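(* Let $\mathscr G$ be an ample groupoid and $\mathcal O$ a $\mathscr G$-sheaf of rings such that the isotropy skew group ring $B_x$ is a left max ring for every $x\in\mathscr G^{(0)}$. Then the (left) primitive ideals of $\Gamma_c(\mathscr G,\mathcal O)$ are exactly the ideals of the form $\mathrm{Ann}(\mathrm{Ind}_x(M))$, where $x\in\mathscr G^{(0)}$ and $M$ is a simple left $B_x$-module.
   Context: "Compact" includes Hausdorff. A groupoid $\mathscr G$ (identified with its set of arrows) has unit space $\mathscr G^{(0)}$, $\boldsymbol d(\gamma)=\gamma^{-1}\gamma$, $\boldsymbol r(\gamma)=\gamma\gamma^{-1}$. It is ample if it is a topological groupoid such that $\mathscr G^{(0)}$ is locally compact Hausdorff with a basis of compact open sets and $\boldsymbol r$ is a local homeomorphism. A bisection is a subset on which $\boldsymbol d$ and $\boldsymbol r$ are injective. $\mathscr G_x^x=\{g:\boldsymbol d(g)=\boldsymbol r(g)=x\}$. A $\mathscr G$-sheaf $(E,p,\alpha)$ is a space $E$, a local homeomorphism $p:E\to\mathscr G^{(0)}$ and a continuous map $\alpha:\mathscr G\times_{\boldsymbol d,p}E\to E$, $(\gamma,e)\mapsto\alpha_\gamma(e)$, with $\alpha_{p(e)}(e)=e$, $p(\alpha_\gamma(e))=\boldsymbol r(\gamma)$, and $\alpha_\beta(\alpha_\gamma(e))=\alpha_{\beta\gamma}(e)$ whenever defined. The stalk at $x$ is $p^{-1}(x)$. A $\mathscr G$-sheaf of rings $\mathcal O=(E,p,\alpha)$ is a $\mathscr G$-sheaf with a unital ring structure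 on each stalk $\mathcal O_x$ such that fiberwise addition and multiplication $E\times_{p,p}E\to E$ and the unit section $x\mapsto 1_x$ are continuous, and each $\alpha_\gamma:\mathcal O_{\boldsymbol d(\gamma)}\to\mathcal O_{\boldsymbol r(\gamma)}$ is a (unital) ring homomorphism. $\Gamma_c(\mathscr G,\mathcal O)$ is the additive group generated by all maps $f:\mathscr G\to E$ with $p\circ f=\boldsymbol r$ for which there is a compact open bisection $U$ with $f|_U$ continuous and $f=0$ off $U$. It is a ring (with local units, not necessarily unital) under pointwise addition and convolution $(f*g)(\gamma)=\sum_{\beta\rho=\gamma}f(\beta)\alpha_\beta(g(\rho))$. $B_x=\mathcal O_x\rtimes\mathscr G_x^x$ is the isotropy skew group ring at $x$, with product $(b\delta)(c\eta)=b\alpha_\delta(c)\,\delta\eta$ for $b,c\in\mathcal O_x$, $\delta,\eta\in\mathscr G_x^x$. Let $\mathcal L_x=\bigoplus_{\boldsymbol d(\gamma)=x}\mathcal O_{\boldsymbol r(\gamma)}$, writing $a1_\gamma$ for the element with entry $a$ at coordinate $\gamma$ and $0$ elsewhere. It is a $\Gamma_c(\mathscr G,\mathcal O)$-$B_x$-bimodule via $a1_\gamma\cdot b\delta=a\alpha_\gamma(b)1_{\gamma\delta}$ and $f\cdot a1_\gamma=\sum_{\boldsymbol d(\beta)=\boldsymbol r(\gamma)}f(\beta)\alpha_\beta(a)1_{\beta\gamma}$. For a left $B_x$-module $M$, $\mathrm{Ind}_x(M)=\mathcal L_x\otimes_{B_x}M$, a left $\Gamma_c(\mathscr G,\mathcal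 O)$-module. An ideal of a ring $R$ is (left) primitive if it is the annihilator of a simple left $R$-module; a simple left $R$-module is a module $N$ with $RN\neq 0$ whose only submodules are $0$ and $N$. A unital ring $S$ is a left max ring if every non-zero left $S$-module has a maximal (proper) submodule. *)

theory Defs
  imports
    "HOL-Analysis.Abstract_Topological_Spaces"
    "HOL-Analysis.Product_Topology"
    "HOL-Algebra.Module"
    "HOL-Algebra.Product_Groups"
    "HOL-Algebra.Free_Abelian_Groups"
begin

section \<open>Ample groupoids\<close>

text \<open>
  The set of arrows is \<^term>\<open>topspace\<close> of the topology \<open>gtop\<close>; no global Hausdorff assumption is
  made. The values of \<open>gmult\<close> on non-composable pairs are irrelevant.
\<close>

record 'g groupoid_data =
  gtop :: "'g topology"
  gmult :: "'g \<Rightarrow> 'g \<Rightarrow> 'g"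
  ginv :: "'g \<Rightarrow> 'g"

abbreviation arrows :: "'g groupoid_data \<Rightarrow> 'g set" where
  "arrows G \<equiv> topspace (gtop G)"

definition src :: "'g groupoid_data \<Rightarrow> 'g \<Rightarrow> 'g" where
  "src G \<gamma> = gmult G (ginv G \<gamma>) \<gamma>"

definition tgt :: "'g groupoid_data \<Rightarrow> 'g \<Rightarrow> 'g" where
  "tgt G \<gamma> = gmult G \<gamma> (ginv G \<gamma>)"

definition units :: "'g groupoid_data \<Rightarrow> 'g set" where
  "units G = src G ` arrows G"

definition isotropy :: "'g groupoid_data \<Rightarrow> 'g \<Rightarrow> 'g set" where
  "isotropy G x = {\<gamma> \<in> arrows G. src G \<gamma> = x \<and> tgt G \<gamma> = x}"

definition src_fibre :: "'g groupoid_data \<Rightarrow> 'g \<Rightarrow> 'g set" where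
  "src_fibre G x = {\<gamma> \<in> arrows G. src G \<gamma> = x}"

locale groupoid =
  fixes G :: "'g groupoid_data"
  assumes inv_closed: "\<gamma> \<in> arrows G \<Longrightarrow> ginv G \<gamma> \<in> arrows G"
    and inv_inv: "\<gamma> \<in> arrows G \<Longrightarrow> ginv G (ginv G \<gamma>) = \<gamma>"
    and mult_closed:
      "\<lbrakk>\<beta> \<in> arrows G; \<gamma> \<in> arrows G; src G \<beta> = tgt G \<gamma>\<rbrakk> \<Longrightarrow> gmult G \<beta> \<gamma> \<in> arrows G"
    and src_mult:
      "\<lbrakk>\<beta> \<in> arrows G; \<gamma> \<in> arrows G; src G \<beta> = tgt G \<gamma>\<rbrakk> \<Longrightarrow> src G (gmult G \<beta> \<gamma>) = src G \<gamma>"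
    and tgt_mult:
      "\<lbrakk>\<beta> \<in> arrows G; \<gamma> \<in> arrows G; src G \<beta> = tgt G \<gamma>\<rbrakk> \<Longrightarrow> tgt G (gmult G \<beta> \<gamma>) = tgt G \<beta>"
    and mult_assoc:
      "\<lbrakk>\<alpha> \<in> arrows G; \<beta> \<in> arrows G; \<gamma> \<in> arrows G; src G \<alpha> = tgt G \<beta>; src G \<beta> = tgt G \<gamma>\<rbrakk>
        \<Longrightarrow> gmult G (gmult G \<alpha> \<beta>) \<gamma> = gmult G \<alpha> (gmult G \<beta> \<gamma>)"
    and mult_src: "\<gamma> \<in> arrows G \<Longrightarrow> gmult G \<gamma> (src G \<gamma>) = \<gamma>"
    and tgt_mult_self: "\<gamma> \<in> arrows G \<Longrightarrow> gmult G (tgt G \<gamma>) \<gamma> = \<gamma>"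

definition unit_space :: "'g groupoid_data \<Rightarrow> 'g topology" where
  "unit_space G = subtopology (gtop G) (units G)"

locale topological_groupoid = groupoid +
  assumes continuous_mult:
      "continuous_map
        (subtopology (prod_topology (gtop G) (gtop G)) {(\<beta>, \<gamma>). src G \<beta> = tgt G \<gamma>})
        (gtop G) (\<lambda>(\<beta>, \<gamma>). gmult G \<beta> \<gamma>)"
    and continuous_inv: "continuous_map (gtop G) (gtop G) (ginv G)"

definition local_homeomorphism :: "'a topology \<Rightarrow> 'b topology \<Rightarrow> ('a \<Rightarrow> 'b) \<Rightarrow> bool" where
  "local_homeomorphism X Y f \<longleftrightarrow>
     f \<in> topspace X \<rightarrow> topspace Y \<and>
     (\<forall>x \<in> topspace X. \<exists>U. openin X U \<and> x \<in> U \<and> openin Y (f ` U) \<and>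
        homeomorphic_map (subtopology X U) (subtopology Y (f ` U)) f)"

locale ample_groupoid = topological_groupoid +
  assumes unit_space_locally_compact: "locally_compact_space (unit_space G)"
    and unit_space_Hausdorff: "Hausdorff_space (unit_space G)"
    and unit_space_compact_open_basis:
      "openin (unit_space G) =
        (arbitrary union_of (\<lambda>K. compactin (unit_space G) K \<and> openin (unit_space G) K))"
    and tgt_local_homeomorphism: "local_homeomorphism (gtop G) (unit_space G) (tgt G)"

definition compact_open_bisection :: "'g groupoid_data \<Rightarrow> 'g set \<Rightarrow> bool" where
  "compact_open_bisection G U \<longleftrightarrow>
     openin (gtop G) U \<and> compactin (gtop G) U \<and> Hausdorff_space (subtopology (gtop G) U) \<and>
     inj_on (src G) U \<and> inj_on (tgt G) U"


section \<open>Sheaves of rings on a groupoid\<close>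

record ('g, 'e) ring_sheaf_data =
  etop :: "'e topology"
  proj :: "'e \<Rightarrow> 'g"
  act :: "'g \<Rightarrow> 'e \<Rightarrow> 'e"
  stalk :: "'g \<Rightarrow> 'e ring"

locale groupoid_sheaf_of_rings =
  fixes G :: "'g groupoid_data" and S :: "('g, 'e) ring_sheaf_data"
  assumes proj_local_homeomorphism: "local_homeomorphism (etop S) (unit_space G) (proj S)"
    and continuous_act:
      "continuous_map
        (subtopology (prod_topology (gtop G) (etop S)) {(\<gamma>, e). src G \<gamma> = proj S e})
        (etop S) (\<lambda>(\<gamma>, e). act S \<gamma> e)"
    and act_unit: "e \<in> topspace (etop S) \<Longrightarrow> act S (proj S e) e = e"
    and proj_act:
      "\<lbrakk>\<gamma> \<in> arrows G; e \<in> topspace (etop S); src G \<gamma> = proj S e\<rbrakk>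
        \<Longrightarrow> proj S (act S \<gamma> e) = tgt G \<gamma>"
    and act_act:
      "\<lbrakk>\<beta> \<in> arrows G; \<gamma> \<in> arrows G; src G \<beta> = tgt G \<gamma>; e \<in> topspace (etop S); src G \<gamma> = proj S e\<rbrakk>
        \<Longrightarrow> act S \<beta> (act S \<gamma> e) = act S (gmult G \<beta> \<gamma>) e"
    and carrier_stalk:
      "x \<in> units G \<Longrightarrow> carrier (stalk S x) = {e \<in> topspace (etop S). proj S e = x}"
    and ring_stalk: "x \<in> units G \<Longrightarrow> ring (stalk S x)"
    and continuous_add:
      "continuous_map
        (subtopology (prod_topology (etop S) (etop S)) {(a, b). proj S a = proj S b})
        (etop S) (\<lambda>(a, b). a \<oplus>\<^bsub>stalk S (proj S a)\<^esub> b)"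
    and continuous_stalk_mult:
      "continuous_map
        (subtopology (prod_topology (etop S) (etop S)) {(a, b). proj S a = proj S b})
        (etop S) (\<lambda>(a, b). a \<otimes>\<^bsub>stalk S (proj S a)\<^esub> b)"
    and continuous_one: "continuous_map (unit_space G) (etop S) (\<lambda>x. \<one>\<^bsub>stalk S x\<^esub>)"
    and act_ring_hom:
      "\<gamma> \<in> arrows G \<Longrightarrow> act S \<gamma> \<in> ring_hom (stalk S (src G \<gamma>)) (stalk S (tgt G \<gamma>))"


section \<open>The convolution ring, the isotropy skew group rings and the bimodules\<close>

text \<open>
  All products and actions are instances of one convolution. For \<open>u\<close> defined on \<open>I\<close> and \<open>v\<close> on \<open>J\<close>,
  its value at \<open>\<xi> \<in> K\<close> is the sum, in the stalk at \<open>tgt G \<xi>\<close>, of the terms \<open>u \<beta> \<cdot> \<alpha>\<^sub>\<beta>(v \<gamma>)\<close> over all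
  \<open>\<beta> \<in> I\<close>, \<open>\<gamma> \<in> J\<close> with \<open>\<beta>\<gamma> = \<xi>\<close>. The index set may be infinite, but in all uses below only finitely
  many terms are non-zero, and \<^const>\<open>gfinprod\<close> sums over these (\<^const>\<open>finsum\<close> would return zero).
\<close>

definition conv ::
    "'g groupoid_data \<Rightarrow> ('g, 'e) ring_sheaf_data \<Rightarrow> 'g set \<Rightarrow> 'g set \<Rightarrow> 'g set
      \<Rightarrow> ('g \<Rightarrow> 'e) \<Rightarrow> ('g \<Rightarrow> 'e) \<Rightarrow> ('g \<Rightarrow> 'e)" where
  "conv G S I J K u v =
     (\<lambda>\<xi> \<in> K. gfinprod (add_monoid (stalk S (tgt G \<xi>)))
        (\<lambda>(\<beta>, \<gamma>). u \<beta> \<otimes>\<^bsub>stalk S (tgt G \<xi>)\<^esub> act S \<beta> (v \<gamma>))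
        {(\<beta>, \<gamma>) \<in> I \<times> J. src G \<beta> = tgt G \<gamma> \<and> gmult G \<beta> \<gamma> = \<xi>})"

definition section_group ::
    "'g groupoid_data \<Rightarrow> ('g, 'e) ring_sheaf_data \<Rightarrow> ('g \<Rightarrow> 'e) monoid" where
  "section_group G S = product_group (arrows G) (\<lambda>\<gamma>. add_monoid (stalk S (tgt G \<gamma>)))"

definition basic_sections ::
    "'g groupoid_data \<Rightarrow> ('g, 'e) ring_sheaf_data \<Rightarrow> ('g \<Rightarrow> 'e) set" where
  "basic_sections G S =
     {f \<in> carrier (section_group G S).
        \<exists>U. compact_open_bisection G U \<and>
            continuous_map (subtopology (gtop G) U) (etop S) f \<and>
            (\<forall>\<gamma> \<in> arrows G - U. f \<gamma> = \<zero>\<^bsub>stalk S (tgt G \<gamma>)\<^esub>)}"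

text \<open>\<open>Gamma_c\<close> need not have a unit; the field \<^const>\<open>one\<close> of the record is a dummy.\<close>

definition Gamma_c ::
    "'g groupoid_data \<Rightarrow> ('g, 'e) ring_sheaf_data \<Rightarrow> ('g \<Rightarrow> 'e) ring" where
  "Gamma_c G S =
     \<lparr>carrier = generate (section_group G S) (basic_sections G S),
      monoid.mult = conv G S (arrows G) (arrows G) (arrows G),
      one = undefined,
      ring.zero = \<one>\<^bsub>section_group G S\<^esub>,
      ring.add = monoid.mult (section_group G S)\<rparr>"

text \<open>
  An element \<open>\<Sum> b\<^sub>\<delta> \<delta>\<close> of the isotropy skew group ring is the finitely supported function
  \<open>\<delta> \<mapsto> b\<^sub>\<delta>\<close>, and an element \<open>\<Sum> a\<^sub>\<gamma> 1\<^sub>\<gamma>\<close> of the bimodule at \<open>x\<close> is the finitely supported function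
  \<open>\<gamma> \<mapsto> a\<^sub>\<gamma>\<close>. The convolutions below are the biadditive extensions of
  \<open>(b\<delta>)(c\<eta>) = b \<alpha>\<^sub>\<delta>(c) \<delta>\<eta>\<close>, \<open>a1\<^sub>\<gamma> \<cdot> b\<delta> = a \<alpha>\<^sub>\<gamma>(b) 1\<^sub>\<gamma>\<^sub>\<delta>\<close> and
  \<open>f \<cdot> a1\<^sub>\<gamma> = \<Sum> f(\<beta>) \<alpha>\<^sub>\<beta>(a) 1\<^sub>\<beta>\<^sub>\<gamma>\<close>.
\<close>

definition isotropy_ring ::
    "'g groupoid_data \<Rightarrow> ('g, 'e) ring_sheaf_data \<Rightarrow> 'g \<Rightarrow> ('g \<Rightarrow> 'e) ring" where
  "isotropy_ring G S x =
     (let A = sum_group (isotropy G x) (\<lambda>_. add_monoid (stalk S x)) in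
     \<lparr>carrier = carrier A,
      monoid.mult = conv G S (isotropy G x) (isotropy G x) (isotropy G x),
      one = (\<lambda>\<delta> \<in> isotropy G x. if \<delta> = x then \<one>\<^bsub>stalk S x\<^esub> else \<zero>\<^bsub>stalk S x\<^esub>),
      ring.zero = \<one>\<^bsub>A\<^esub>,
      ring.add = monoid.mult A\<rparr>)"

definition bimodule_group ::
    "'g groupoid_data \<Rightarrow> ('g, 'e) ring_sheaf_data \<Rightarrow> 'g \<Rightarrow> ('g \<Rightarrow> 'e) monoid" where
  "bimodule_group G S x = sum_group (src_fibre G x) (\<lambda>\<gamma>. add_monoid (stalk S (tgt G \<gamma>)))"

definition bimodule_left ::
    "'g groupoid_data \<Rightarrow> ('g, 'e) ring_sheaf_data \<Rightarrow> 'g \<Rightarrow> ('g \<Rightarrow> 'e) \<Rightarrow> ('g \<Rightarrow> 'e) \<Rightarrow> ('g \<Rightarrow> 'e)" where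
  "bimodule_left G S x = conv G S (arrows G) (src_fibre G x) (src_fibre G x)"

definition bimodule_right ::
    "'g groupoid_data \<Rightarrow> ('g, 'e) ring_sheaf_data \<Rightarrow> 'g \<Rightarrow> ('g \<Rightarrow> 'e) \<Rightarrow> ('g \<Rightarrow> 'e) \<Rightarrow> ('g \<Rightarrow> 'e)" where
  "bimodule_right G S x = conv G S (src_fibre G x) (isotropy G x) (src_fibre G x)"


section \<open>Left modules over possibly non-unital, non-commutative rings\<close>

text \<open>
  The library locale \<^locale>\<open>module\<close> assumes a commutative unital base ring. Its record type and the
  predicate \<^const>\<open>submodule\<close> do not, and are reused; the fields \<^const>\<open>monoid.mult\<close> and \<^const>\<open>one\<close>
  of a module record carry no meaning.
\<close>

locale left_module = M?: abelian_group M
  for R :: "('r, 'c) ring_scheme" (structure) and M :: "('r, 'm, 'd) module_scheme" (structure) +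
  assumes lsmult_closed:
      "\<lbrakk>a \<in> carrier R; x \<in> carrier M\<rbrakk> \<Longrightarrow> a \<odot>\<^bsub>M\<^esub> x \<in> carrier M"
    and lsmult_l_distr:
      "\<lbrakk>a \<in> carrier R; b \<in> carrier R; x \<in> carrier M\<rbrakk>
        \<Longrightarrow> (a \<oplus>\<^bsub>R\<^esub> b) \<odot>\<^bsub>M\<^esub> x = a \<odot>\<^bsub>M\<^esub> x \<oplus>\<^bsub>M\<^esub> b \<odot>\<^bsub>M\<^esub> x"
    and lsmult_r_distr:
      "\<lbrakk>a \<in> carrier R; x \<in> carrier M; y \<in> carrier M\<rbrakk>
        \<Longrightarrow> a \<odot>\<^bsub>M\<^esub> (x \<oplus>\<^bsub>M\<^esub> y) = a \<odot>\<^bsub>M\<^esub> x \<oplus>\<^bsub>M\<^esub> a \<odot>\<^bsub>M\<^esub> y"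
    and lsmult_assoc:
      "\<lbrakk>a \<in> carrier R; b \<in> carrier R; x \<in> carrier M\<rbrakk>
        \<Longrightarrow> (a \<otimes>\<^bsub>R\<^esub> b) \<odot>\<^bsub>M\<^esub> x = a \<odot>\<^bsub>M\<^esub> (b \<odot>\<^bsub>M\<^esub> x)"

locale unital_left_module = left_module +
  assumes lsmult_one: "x \<in> carrier M \<Longrightarrow> \<one>\<^bsub>R\<^esub> \<odot>\<^bsub>M\<^esub> x = x"

definition annihilator :: "('r, 'c) ring_scheme \<Rightarrow> ('r, 'm, 'd) module_scheme \<Rightarrow> 'r set" where
  "annihilator R M = {a \<in> carrier R. \<forall>m \<in> carrier M. a \<odot>\<^bsub>M\<^esub> m = \<zero>\<^bsub>M\<^esub>}"

text \<open>If \<open>R\<close> is unital, such a module is automatically unital, because \<open>R M \<noteq> 0\<close>.\<close>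

definition simple_left_module ::
    "('r, 'c) ring_scheme \<Rightarrow> ('r, 'm, 'd) module_scheme \<Rightarrow> bool" where
  "simple_left_module R M \<longleftrightarrow>
     left_module R M \<and>
     (\<exists>a \<in> carrier R. \<exists>m \<in> carrier M. a \<odot>\<^bsub>M\<^esub> m \<noteq> \<zero>\<^bsub>M\<^esub>) \<and>
     (\<forall>H. submodule H R M \<longrightarrow> H = {\<zero>\<^bsub>M\<^esub>} \<or> H = carrier M)"

definition maximal_submodule ::
    "'m set \<Rightarrow> ('r, 'c) ring_scheme \<Rightarrow> ('r, 'm, 'd) module_scheme \<Rightarrow> bool" where
  "maximal_submodule H R M \<longleftrightarrow>
     submodule H R M \<and> H \<noteq> carrier M \<and>
     (\<forall>K. submodule K R M \<and> H \<subseteq> K \<longrightarrow> K = H \<or> K = carrier M)"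

text \<open>
  A definition in HOL cannot quantify over modules in all types. Modules over a ring with elements
  in \<open>'r\<close> therefore have their elements in \<open>'r + 'u\<close>, where the type \<open>'u\<close> is an arbitrary parameter
  (so that modules of any prescribed size are covered) and the summand \<open>'r\<close> makes room
  for all cyclic, hence all simple, modules: see \<open>primitive_ideal_annihilator\<close> below.
\<close>

definition left_max_ring :: "'u itself \<Rightarrow> ('r, 'c) ring_scheme \<Rightarrow> bool" where
  "left_max_ring (_ :: 'u itself) R \<longleftrightarrow>
     (\<forall>M :: ('r, 'r + 'u) module.
        unital_left_module R M \<and> carrier M \<noteq> {\<zero>\<^bsub>M\<^esub>} \<longrightarrow> (\<exists>H. maximal_submodule H R M))"

definition primitive_ideal :: "'u itself \<Rightarrow> ('r, 'c) ring_scheme \<Rightarrow> 'r set \<Rightarrow> bool" where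
  "primitive_ideal (_ :: 'u itself) R I \<longleftrightarrow>
     (\<exists>N :: ('r, 'r + 'u) module. simple_left_module R N \<and> I = annihilator R N)"


section \<open>Induced modules\<close>

text \<open>
  The tensor product of a right module \<open>L\<close>, with action \<open>ract\<close>, and a left module \<open>M\<close> over \<open>B\<close>: the
  free abelian group on pairs modulo biadditivity and balancedness.
\<close>

definition tensor_relations ::
    "('l, 'c) monoid_scheme \<Rightarrow> ('l \<Rightarrow> 'b \<Rightarrow> 'l) \<Rightarrow> ('b, 'd) ring_scheme \<Rightarrow> ('b, 'm, 'f) module_scheme
      \<Rightarrow> (('l \<times> 'm) \<Rightarrow>\<^sub>0 int) set" where
  "tensor_relations L ract B M =
     {frag_of (k \<otimes>\<^bsub>L\<^esub> l, m) - frag_of (k, m) - frag_of (l, m) | k l m.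
        k \<in> carrier L \<and> l \<in> carrier L \<and> m \<in> carrier M} \<union>
     {frag_of (l, m \<oplus>\<^bsub>M\<^esub> n) - frag_of (l, m) - frag_of (l, n) | l m n.
        l \<in> carrier L \<and> m \<in> carrier M \<and> n \<in> carrier M} \<union>
     {frag_of (ract l b, m) - frag_of (l, b \<odot>\<^bsub>M\<^esub> m) | l b m.
        l \<in> carrier L \<and> b \<in> carrier B \<and> m \<in> carrier M}"

definition tensor_kernel ::
    "('l, 'c) monoid_scheme \<Rightarrow> ('l \<Rightarrow> 'b \<Rightarrow> 'l) \<Rightarrow> ('b, 'd) ring_scheme \<Rightarrow> ('b, 'm, 'f) module_scheme
      \<Rightarrow> (('l \<times> 'm) \<Rightarrow>\<^sub>0 int) set" where
  "tensor_kernel L ract B M =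
     generate (free_Abelian_group (carrier L \<times> carrier M)) (tensor_relations L ract B M)"

definition tensor_group ::
    "('l, 'c) monoid_scheme \<Rightarrow> ('l \<Rightarrow> 'b \<Rightarrow> 'l) \<Rightarrow> ('b, 'd) ring_scheme \<Rightarrow> ('b, 'm, 'f) module_scheme
      \<Rightarrow> (('l \<times> 'm) \<Rightarrow>\<^sub>0 int) set monoid" where
  "tensor_group L ract B M =
     free_Abelian_group (carrier L \<times> carrier M) Mod tensor_kernel L ract B M"

text \<open>
  An element \<open>a\<close> acts on a coset \<open>C\<close> through \<open>l \<otimes> m \<mapsto> (a \<cdot> l) \<otimes> m\<close>: the image of \<open>C\<close> under the induced
  endomorphism of the free abelian group is enlarged to a full coset by adding the kernel.
\<close>

definition tensor_module ::
    "('l, 'c) monoid_scheme \<Rightarrow> ('a \<Rightarrow> 'l \<Rightarrow> 'l) \<Rightarrow> ('l \<Rightarrow> 'b \<Rightarrow> 'l) \<Rightarrow> ('b, 'd) ring_scheme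
      \<Rightarrow> ('b, 'm, 'f) module_scheme \<Rightarrow> ('a, (('l \<times> 'm) \<Rightarrow>\<^sub>0 int) set) module" where
  "tensor_module L lact ract B M =
     (let T = tensor_group L ract B M in
     \<lparr>carrier = carrier T,
      monoid.mult = undefined,
      one = undefined,
      ring.zero = \<one>\<^bsub>T\<^esub>,
      ring.add = monoid.mult T,
      smult = (\<lambda>a C. tensor_kernel L ract B M
        <#>\<^bsub>free_Abelian_group (carrier L \<times> carrier M)\<^esub>
        (frag_extend (\<lambda>(l, m). frag_of (lact a l, m)) ` C))\<rparr>)"

definition Ind ::
    "'g groupoid_data \<Rightarrow> ('g, 'e) ring_sheaf_data \<Rightarrow> 'g \<Rightarrow> ('g \<Rightarrow> 'e, 'm) module
      \<Rightarrow> ('g \<Rightarrow> 'e, ((('g \<Rightarrow> 'e) \<times> 'm) \<Rightarrow>\<^sub>0 int) set) module" where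
  "Ind G S x M =
     tensor_module (bimodule_group G S x) (bimodule_left G S x) (bimodule_right G S x)
       (isotropy_ring G S x) M"


section \<open>Primitivity does not depend on the type of the module\<close>

text \<open>
  If an additive group \<open>R\<close> closed under multiplication has a simple module in an arbitrary type
  \<open>'n\<close>, its annihilator is a primitive ideal in the above sense, for every \<open>'u\<close>.
\<close>

lemma simple_left_module_inj:
  fixes R :: "('r, 'c) ring_scheme" and N :: "('r, 'n, 'd) module_scheme"
  assumes R: "abelian_group R"
    and mult: "\<And>a b. \<lbrakk>a \<in> carrier R; b \<in> carrier R\<rbrakk> \<Longrightarrow> a \<otimes>\<^bsub>R\<^esub> b \<in> carrier R"
    and N: "simple_left_module R N"
  obtains h :: "'n \<Rightarrow> 'r" where "inj_on h (carrier N)"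
proof -
  interpret R: abelian_group R by (rule R)
  interpret left_module R N using N by (simp add: simple_left_module_def)
  have r0: "a \<odot>\<^bsub>N\<^esub> \<zero>\<^bsub>N\<^esub> = \<zero>\<^bsub>N\<^esub>" if "a \<in> carrier R" for a
    using lsmult_r_distr[OF that zero_closed zero_closed] lsmult_closed[OF that zero_closed]
    by simp
  have l0: "\<zero>\<^bsub>R\<^esub> \<odot>\<^bsub>N\<^esub> x = \<zero>\<^bsub>N\<^esub>" if "x \<in> carrier N" for x
    using lsmult_l_distr[OF R.zero_closed R.zero_closed that] lsmult_closed[OF R.zero_closed that]
    by simp
  have lneg: "(\<ominus>\<^bsub>R\<^esub> a) \<odot>\<^bsub>N\<^esub> x = \<ominus>\<^bsub>N\<^esub> (a \<odot>\<^bsub>N\<^esub> x)" if "a \<in> carrier R" "x \<in> carrier N" for a x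
    using lsmult_l_distr[OF R.a_inv_closed[OF that(1)] that] that
    by (simp add: R.l_neg l0 lsmult_closed minus_equality)
  obtain a n where an: "a \<in> carrier R" "n \<in> carrier N" "a \<odot>\<^bsub>N\<^esub> n \<noteq> \<zero>\<^bsub>N\<^esub>"
    using N by (auto simp: simple_left_module_def)
  let ?H = "(\<lambda>b. b \<odot>\<^bsub>N\<^esub> n) ` carrier R"
  have "submodule ?H R N"
  proof (intro submodule.intro subgroup.intro submodule_axioms.intro)
    show "?H \<subseteq> carrier (add_monoid N)"
      using an lsmult_closed by auto
    show "x \<otimes>\<^bsub>add_monoid N\<^esub> y \<in> ?H" if "x \<in> ?H" "y \<in> ?H" for x y
      using that an by (auto simp: lsmult_l_distr[symmetric])
    show "\<one>\<^bsub>add_monoid N\<^esub> \<in> ?H"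
      using l0[OF an(2)] R.zero_closed by (force intro: rev_image_eqI)
    show "inv\<^bsub>add_monoid N\<^esub> x \<in> ?H" if x: "x \<in> ?H" for x
    proof -
      obtain b where b: "b \<in> carrier R" "x = b \<odot>\<^bsub>N\<^esub> n" using x by blast
      then have "(\<ominus>\<^bsub>R\<^esub> b) \<odot>\<^bsub>N\<^esub> n \<in> ?H" using R.a_inv_closed by blast
      then show ?thesis using lneg[OF b(1) an(2)] b(2) by (simp add: a_inv_def)
    qed
    show "b \<odot>\<^bsub>N\<^esub> x \<in> ?H" if "b \<in> carrier R" "x \<in> ?H" for b x
      using that an mult by (auto simp: lsmult_assoc[symmetric])
  qed
  moreover have "?H \<noteq> {\<zero>\<^bsub>N\<^esub>}" using an by blast
  ultimately have "?H = carrier N" using N by (auto simp: simple_left_module_def)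
  then have "inj_on (inv_into (carrier R) (\<lambda>b. b \<odot>\<^bsub>N\<^esub> n)) (carrier N)"
    by (metis inj_on_inv_into order_refl)
  then show thesis using that by blast
qed

lemma primitive_ideal_annihilator:
  fixes R :: "('r, 'c) ring_scheme" and N :: "('r, 'n, 'd) module_scheme"
  assumes R: "abelian_group R"
    and mult: "\<And>a b. \<lbrakk>a \<in> carrier R; b \<in> carrier R\<rbrakk> \<Longrightarrow> a \<otimes>\<^bsub>R\<^esub> b \<in> carrier R"
    and N: "simple_left_module R N"
  shows "primitive_ideal TYPE('u) R (annihilator R N)"
proof -
  interpret left_module R N using N by (simp add: simple_left_module_def)
  obtain h :: "'n \<Rightarrow> 'r" where h: "inj_on h (carrier N)"
    using simple_left_module_inj[OF assms] by blast
  define f :: "'n \<Rightarrow> 'r + 'u" where "f = Inl \<circ> h"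
  define g where "g = inv_into (carrier N) f"
  have f: "inj_on f (carrier N)" using h by (auto simp: f_def inj_on_def)
  have gf: "g (f x) = x" if "x \<in> carrier N" for x
    using f that by (simp add: g_def)
  define P :: "('r, 'r + 'u) module" where
    "P = \<lparr>carrier = f ` carrier N, monoid.mult = undefined, one = undefined, ring.zero = f \<zero>\<^bsub>N\<^esub>,
          ring.add = (\<lambda>x y. f (g x \<oplus>\<^bsub>N\<^esub> g y)), smult = (\<lambda>a x. f (a \<odot>\<^bsub>N\<^esub> g x))\<rparr>"
  have P: "carrier P = f ` carrier N" "\<zero>\<^bsub>P\<^esub> = f \<zero>\<^bsub>N\<^esub>"
    "\<And>x y. x \<oplus>\<^bsub>P\<^esub> y = f (g x \<oplus>\<^bsub>N\<^esub> g y)" "\<And>a x. a \<odot>\<^bsub>P\<^esub> x = f (a \<odot>\<^bsub>N\<^esub> g x)"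
    by (simp_all add: P_def)
  interpret P: abelian_group P
  proof (rule abelian_groupI)
    fix x assume "x \<in> carrier P"
    then obtain n where "n \<in> carrier N" "x = f n" by (auto simp: P)
    then show "\<exists>y\<in>carrier P. y \<oplus>\<^bsub>P\<^esub> x = \<zero>\<^bsub>P\<^esub>"
      by (intro bexI[of _ "f (\<ominus>\<^bsub>N\<^esub> n)"]) (auto simp: P gf l_neg)
  qed (auto simp: P gf a_ac)
  have PL: "left_module R P"
    by unfold_locales (auto simp: P gf lsmult_closed lsmult_l_distr lsmult_r_distr lsmult_assoc)
  have zero: "f x = f \<zero>\<^bsub>N\<^esub> \<longleftrightarrow> x = \<zero>\<^bsub>N\<^esub>" if "x \<in> carrier N" for x
    using f that by (auto dest: inj_onD)
  have neg: "\<ominus>\<^bsub>P\<^esub> f n = f (\<ominus>\<^bsub>N\<^esub> n)" if "n \<in> carrier N" for n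
    using that by (intro P.minus_equality) (auto simp: P gf l_neg)
  have sub: "submodule (g ` K) R N \<and> K = f ` g ` K" if "submodule K R P" for K
  proof -
    interpret K: submodule K R P by (rule that)
    have KP: "K \<subseteq> f ` carrier N" using K.subset by (simp add: P)
    then have fg: "f (g x) = x" if "x \<in> K" for x using that by (auto simp: gf)
    have gN: "g x \<in> carrier N" if "x \<in> K" for x using KP that by (auto simp: gf)
    have "submodule (g ` K) R N"
    proof (intro submodule.intro subgroup.intro submodule_axioms.intro)
      show "g ` K \<subseteq> carrier (add_monoid N)" using gN by auto
      show "x \<otimes>\<^bsub>add_monoid N\<^esub> y \<in> g ` K" if xy: "x \<in> g ` K" "y \<in> g ` K" for x y
      proof -
        obtain u v where uv: "u \<in> K" "v \<in> K" "x = g u" "y = g v" using xy by auto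
        then have "g (u \<oplus>\<^bsub>P\<^esub> v) \<in> g ` K" using K.m_closed[of u v] by simp
        then show ?thesis using uv gN by (simp add: P gf)
      qed
      have "\<zero>\<^bsub>P\<^esub> \<in> K" using K.one_closed by simp
      then have "g \<zero>\<^bsub>P\<^esub> \<in> g ` K" by blast
      then show "\<one>\<^bsub>add_monoid N\<^esub> \<in> g ` K" by (simp add: P gf)
      show "inv\<^bsub>add_monoid N\<^esub> x \<in> g ` K" if x: "x \<in> g ` K" for x
      proof -
        obtain u where u: "u \<in> K" "x = g u" using x by auto
        then have "g (\<ominus>\<^bsub>P\<^esub> u) \<in> g ` K" using K.m_inv_closed[of u] by (simp add: a_inv_def)
        moreover have "\<ominus>\<^bsub>P\<^esub> u = f (\<ominus>\<^bsub>N\<^esub> x)" using neg[OF gN[OF u(1)]] fg[OF u(1)] u(2) by simp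
        ultimately show ?thesis using gN u by (simp add: gf a_inv_def[symmetric])
      qed
      show "b \<odot>\<^bsub>N\<^esub> x \<in> g ` K" if bx: "b \<in> carrier R" "x \<in> g ` K" for b x
      proof -
        obtain u where u: "u \<in> K" "x = g u" using bx by auto
        then have "g (b \<odot>\<^bsub>P\<^esub> u) \<in> g ` K" using K.smult_closed[of b u] bx by simp
        then show ?thesis using u gN bx by (simp add: P gf lsmult_closed)
      qed
    qed
    moreover have "K = f ` g ` K" using fg by (force simp: image_iff)
    ultimately show ?thesis by blast
  qed
  have "simple_left_module R P"
    unfolding simple_left_module_def
  proof (intro conjI allI impI PL)
    show "\<exists>a\<in>carrier R. \<exists>m\<in>carrier P. a \<odot>\<^bsub>P\<^esub> m \<noteq> \<zero>\<^bsub>P\<^esub>"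
      using N by (fastforce simp: simple_left_module_def P gf zero lsmult_closed)
    show "K = {\<zero>\<^bsub>P\<^esub>} \<or> K = carrier P" if K: "submodule K R P" for K
    proof -
      have "g ` K = {\<zero>\<^bsub>N\<^esub>} \<or> g ` K = carrier N"
        using N sub[OF K] by (simp add: simple_left_module_def)
      then show ?thesis using sub[OF K] by (metis P(1,2) image_empty image_insert)
    qed
  qed
  moreover have "annihilator R N = annihilator R P"
    by (auto simp: annihilator_def P gf zero lsmult_closed)
  ultimately show ?thesis unfolding primitive_ideal_def by blast
qed

end

theory Submission
  imports Defs
begin

text \<open>
  Write \<open>\<Gamma>\<close> for the convolution ring. It is a subring of the unital ring \<open>F\<close> of row-finite sections on
  the arrows (finitely many non-zero values on each target fibre). For a unit \<open>x\<close> with unit section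
  \<open>e \<in> F\<close>, the isotropy ring is the corner \<open>e F e\<close>, the bimodule is \<open>\<Gamma> e\<close>, and \<open>e \<Gamma> = e F\<close>. It follows
  that \<open>f \<in> \<Gamma>\<close> annihilates \<open>Ind\<^sub>x(M)\<close> if and only if \<open>(e g f h e) M = 0\<close> for all \<open>g, h \<in> \<Gamma>\<close>.

  If \<open>M\<close> is simple and \<open>0 \<noteq> m \<in> M\<close>, this is the annihilator of the simple \<open>\<Gamma>\<close>-module
  \<open>\<Gamma> / {f. \<forall>g \<in> \<Gamma>. (e g f e) m = 0}\<close>.

  Conversely let \<open>N\<close> be a simple \<open>\<Gamma>\<close>-module and put \<open>J = {f \<in> \<Gamma>. e f = 0}\<close>. The stalk \<open>N / J N\<close> is a
  module over \<open>e F e\<close>, and it is non-zero for some \<open>x\<close>: an element of \<open>J\<close> vanishes on all arrows with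
  target near \<open>x\<close>, so compactness applies. Let \<open>M\<close> be the quotient of the stalk by a maximal submodule.
  Then \<open>Ann(N)\<close> annihilates \<open>Ind\<^sub>x(M)\<close>, and \<open>Ann(Ind\<^sub>x(M)) N\<close> is a submodule of \<open>N\<close> contained in the
  kernel of \<open>N \<rightarrow> M\<close>, hence zero.
\<close>

section \<open>Modules and tensor products\<close>

text \<open>Unless \<open>x\<close> is isolated, the unit section \<open>e\<close> is in general
  discontinuous, so it lies outside \<Gamma> and cannot act on a \<Gamma>-module. This shapes the
  proof. A single row or column of an element of \<Gamma> is finite, so on it \<open>e\<close> can
  be replaced by the indicator section of a compact open set of units that contains \<open>x\<close>
  and misses the finitely many other units involved. Where one would want \<open>e N\<close>, the
  quotient \<open>N / J N\<close> is taken, with the corner acting through elements of \<Gamma> that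
  have the right row at \<open>x\<close>. Simplicity of \<open>N\<close> is not shown to pass to
  this quotient, so a simple quotient of it has to come from the left max condition. That
  \<open>Ann(Ind) N\<close> falls into the kernel of \<open>N -> M\<close> rests on transport: the
  row \<open>e f\<close> has finitely many sources \<open>y\<close>, each joined to \<open>x\<close>
  by an arrow, so the indicator of \<open>y\<close> factors through \<open>e\<close>, and
  \<open>e f\<close> becomes a finite sum of terms \<open>e f v e w\<close> with
  \<open>e f v e\<close> in the corner. Quotients of \<open>N\<close> are represented inside the
  type of \<open>N\<close>, because the hypothesis on the isotropy rings speaks only about modules
  with elements in that type.\<close>

lemma (in abelian_group) add_subgroupI:
  assumes "K \<subseteq> carrier G" "\<zero> \<in> K"
    and "\<And>x y. \<lbrakk>x \<in> K; y \<in> K\<rbrakk> \<Longrightarrow> x \<oplus> y \<in> K" "\<And>x. x \<in> K \<Longrightarrow> \<ominus> x \<in> K"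
  shows "subgroup K (add_monoid G)"
  using assms by (intro subgroup.intro) (auto simp: a_inv_def)

lemma (in abelian_group) add_subgroupD:
  assumes "subgroup K (add_monoid G)"
  shows "K \<subseteq> carrier G" "\<zero> \<in> K"
    and "\<And>x y. \<lbrakk>x \<in> K; y \<in> K\<rbrakk> \<Longrightarrow> x \<oplus> y \<in> K" "\<And>x. x \<in> K \<Longrightarrow> \<ominus> x \<in> K"
    and "\<And>x y. \<lbrakk>x \<in> K; y \<in> K\<rbrakk> \<Longrightarrow> x \<ominus> y \<in> K"
proof -
  interpret subgroup K "add_monoid G" by (rule assms)
  show 1: "K \<subseteq> carrier G" "\<zero> \<in> K" using subset one_closed by auto
  show 2: "x \<oplus> y \<in> K" if "x \<in> K" "y \<in> K" for x y using m_closed[OF that] by simp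
  show 3: "\<ominus> x \<in> K" if "x \<in> K" for x using m_inv_closed[OF that] by (simp add: a_inv_def)
  show "x \<ominus> y \<in> K" if "x \<in> K" "y \<in> K" for x y using that 2 3 by (simp add: a_minus_def)
qed

lemma (in abelian_group) diff_add_cancel: "\<lbrakk>x \<in> carrier G; y \<in> carrier G\<rbrakk> \<Longrightarrow> (x \<ominus> y) \<oplus> y = x"
  by (simp add: a_minus_def a_assoc l_neg)

lemma (in abelian_group) diff_eq_zero_iff:
  "\<lbrakk>x \<in> carrier G; y \<in> carrier G\<rbrakk> \<Longrightarrow> x \<ominus> y = \<zero> \<longleftrightarrow> x = y"
  by (metis diff_add_cancel l_zero r_neg a_minus_def)

lemma (in abelian_group) add_idem_zero: "\<lbrakk>x \<in> carrier G; x \<oplus> x = x\<rbrakk> \<Longrightarrow> x = \<zero>"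
  by (metis l_zero add.right_cancel zero_closed)

lemma (in abelian_group) a_inv_zero [simp]: "\<ominus> \<zero> = \<zero>"
  by (rule minus_equality) auto

lemma submoduleI':
  assumes "abelian_group M" "K \<subseteq> carrier M" "\<zero>\<^bsub>M\<^esub> \<in> K"
    and "\<And>x y. \<lbrakk>x \<in> K; y \<in> K\<rbrakk> \<Longrightarrow> x \<oplus>\<^bsub>M\<^esub> y \<in> K" "\<And>x. x \<in> K \<Longrightarrow> \<ominus>\<^bsub>M\<^esub> x \<in> K"
    and "\<And>a x. \<lbrakk>a \<in> carrier R; x \<in> K\<rbrakk> \<Longrightarrow> a \<odot>\<^bsub>M\<^esub> x \<in> K"
  shows "submodule K R M"
  using assms abelian_group.add_subgroupI[OF assms(1-5)]
  by (intro submodule.intro submodule_axioms.intro) auto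

text \<open>Scalar multiplication in \<open>tensor_module\<close> adds the kernel to the image of a
  coset. This is how an image inside the kernel is recognised as the zero coset.\<close>

lemma set_mult_subgroup_absorb:
  assumes "group A" "subgroup K A" "X \<subseteq> K" "X \<noteq> {}"
  shows "K <#>\<^bsub>A\<^esub> X = K"
proof -
  interpret group A by fact
  interpret subgroup K A by fact
  obtain x where x: "x \<in> X" using assms by blast
  have "k \<in> K <#>\<^bsub>A\<^esub> X" if "k \<in> K" for k
  proof -
    have "k = (k \<otimes>\<^bsub>A\<^esub> inv\<^bsub>A\<^esub> x) \<otimes>\<^bsub>A\<^esub> x" using that x assms(3) by (simp add: m_assoc subset_iff)
    moreover have "k \<otimes>\<^bsub>A\<^esub> inv\<^bsub>A\<^esub> x \<in> K" using that x assms(3) by auto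
    ultimately show ?thesis using x unfolding set_mult_def by blast
  qed
  then show ?thesis using assms(3) by (auto simp: set_mult_def)
qed

text \<open>Pure tensors generate, and the map induced on the free abelian group is additive, so it
  is enough to look at generators. Conversely, the coset of a pure tensor contains the generator
  itself, whose image must then lie in the kernel.\<close>

lemma annihilator_tensor_module:
  fixes L :: "('l, 'c) monoid_scheme" and M :: "('b, 'm, 'f) module_scheme"
  assumes sub: "tensor_relations L ract B M \<subseteq> carrier (free_Abelian_group (carrier L \<times> carrier M))"
  shows "annihilator R (tensor_module L lact ract B M) =
    {a \<in> carrier R. \<forall>l \<in> carrier L. \<forall>m \<in> carrier M. frag_of (lact a l, m) \<in> tensor_kernel L ract B M}"
proof -
  let ?A = "free_Abelian_group (carrier L \<times> carrier M)"
  let ?K = "tensor_kernel L ract B M"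
  let ?\<phi> = "\<lambda>a. frag_extend (\<lambda>(l, m). frag_of (lact a l, m))"
  interpret A: comm_group ?A by (rule abelian_free_Abelian_group)
  have K: "subgroup ?K ?A"
    unfolding tensor_kernel_def by (rule A.generate_is_subgroup[OF sub])
  interpret K: subgroup ?K ?A by (rule K)
  have ann: "annihilator R (tensor_module L lact ract B M) =
     {a \<in> carrier R. \<forall>C \<in> rcosets\<^bsub>?A\<^esub> ?K. ?K <#>\<^bsub>?A\<^esub> (?\<phi> a ` C) = ?K}"
    by (simp add: annihilator_def tensor_module_def Let_def tensor_group_def FactGroup_def)
  have 1: "frag_of (lact a l, m) \<in> ?K"
    if "\<forall>C \<in> rcosets\<^bsub>?A\<^esub> ?K. ?K <#>\<^bsub>?A\<^esub> (?\<phi> a ` C) = ?K" and lm: "l \<in> carrier L" "m \<in> carrier M" for a l m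
  proof -
    let ?c = "frag_of (l, m)"
    have cA: "?c \<in> carrier ?A" using lm by simp
    have "?K #>\<^bsub>?A\<^esub> ?c \<in> rcosets\<^bsub>?A\<^esub> ?K" by (rule A.rcosetsI[OF K.subset cA])
    then have "?K <#>\<^bsub>?A\<^esub> (?\<phi> a ` (?K #>\<^bsub>?A\<^esub> ?c)) = ?K" using that by blast
    moreover have "?c \<in> ?K #>\<^bsub>?A\<^esub> ?c" by (rule A.rcos_self[OF cA K])
    then have "?\<phi> a ?c \<in> ?\<phi> a ` (?K #>\<^bsub>?A\<^esub> ?c)" by blast
    moreover have "0 \<in> ?K" using K.one_closed by simp
    ultimately have "0 \<otimes>\<^bsub>?A\<^esub> ?\<phi> a ?c \<in> ?K" unfolding set_mult_def by blast
    then show ?thesis by simp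
  qed
  have 2: "?K <#>\<^bsub>?A\<^esub> (?\<phi> a ` C) = ?K"
    if h: "\<forall>l \<in> carrier L. \<forall>m \<in> carrier M. frag_of (lact a l, m) \<in> ?K" and C: "C \<in> rcosets\<^bsub>?A\<^esub> ?K" for a C
  proof (rule set_mult_subgroup_absorb[OF A.is_group K])
    have \<phi>: "?\<phi> a c \<in> ?K" if "Poly_Mapping.keys c \<subseteq> carrier L \<times> carrier M" for c
    proof (rule free_Abelian_group_induct[OF that])
      show "?\<phi> a 0 \<in> ?K" using K.one_closed by simp
    next
      fix x y
      assume 2: "Poly_Mapping.keys x \<subseteq> carrier L \<times> carrier M" "Poly_Mapping.keys y \<subseteq> carrier L \<times> carrier M"
        "?\<phi> a x \<in> ?K" "?\<phi> a y \<in> ?K"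
      then have "?\<phi> a x \<otimes>\<^bsub>?A\<^esub> inv\<^bsub>?A\<^esub> (?\<phi> a y) \<in> ?K" by blast
      moreover have "inv\<^bsub>?A\<^esub> (?\<phi> a y) = - ?\<phi> a y"
        using subsetD[OF K.subset 2(4)] by (intro inv_free_Abelian_group) simp
      ultimately show "?\<phi> a (x - y) \<in> ?K" by (simp add: frag_extend_diff)
    next
      show "?\<phi> a (frag_of p) \<in> ?K" if "p \<in> carrier L \<times> carrier M" for p
        using that h by auto
    qed
    obtain c where c: "c \<in> carrier ?A" "C = ?K #>\<^bsub>?A\<^esub> c" using C by (auto simp: RCOSETS_def)
    have "C \<subseteq> carrier ?A" using A.r_coset_subset_G[OF K.subset c(1)] c(2) by simp
    then show "?\<phi> a ` C \<subseteq> ?K" using \<phi> by auto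
    show "?\<phi> a ` C \<noteq> {}" using A.rcos_self[OF c(1) K] c(2) by auto
  qed
  show ?thesis unfolding ann using 1 2 by blast
qed

section \<open>Rings with a corner\<close>

text \<open>
  The ring \<open>F\<close> will be the ring of row-finite sections on the arrows and \<open>e\<close> the unit section of
  a single unit \<open>x\<close>. The (non-unital) subring \<open>R\<close> of \<open>F\<close> realises every row of \<open>F\<close>, the isotropy
  ring is the corner \<open>e F e\<close>, and the bimodule is \<open>R e\<close>.
\<close>

locale corner = F?: ring F for F :: "('r, 'c) ring_scheme" (structure) +
  fixes R B :: "'r ring" and L :: "'r monoid" and e :: 'r and \<iota> \<kappa> :: "'r \<Rightarrow> 'r"
    and lact ract :: "'r \<Rightarrow> 'r \<Rightarrow> 'r"
  assumes R_subgroup: "subgroup (carrier R) (add_monoid F)"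
    and R_add [simp]: "a \<oplus>\<^bsub>R\<^esub> b = a \<oplus> b"
    and R_mult [simp]: "a \<otimes>\<^bsub>R\<^esub> b = a \<otimes> b"
    and R_zero [simp]: "\<zero>\<^bsub>R\<^esub> = \<zero>"
    and R_m_closed: "\<lbrakk>a \<in> carrier R; b \<in> carrier R\<rbrakk> \<Longrightarrow> a \<otimes> b \<in> carrier R"
    and e_closed [simp]: "e \<in> carrier F"
    and e_idem [simp]: "e \<otimes> e = e"
    and row: "f \<in> carrier F \<Longrightarrow> \<exists>r \<in> carrier R. e \<otimes> r = e \<otimes> f"
    and column: "f \<in> carrier F \<Longrightarrow> \<exists>r \<in> carrier R. r \<otimes> e = e \<otimes> f \<otimes> e"
    \<comment> \<open>Both cut axioms imitate multiplication by \<open>e\<close>, which need not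
      belong to \<open>R\<close>, on one finite row or column.\<close>
    and right_cut: "r \<in> carrier R \<Longrightarrow> \<exists>s \<in> carrier R. e \<otimes> r \<otimes> s = e \<otimes> r \<otimes> e"
    and left_cut: "r \<in> carrier R \<Longrightarrow> \<exists>s \<in> carrier R. s \<otimes> r \<otimes> e = e \<otimes> r \<otimes> e"
    \<comment> \<open>The units met by the row \<open>e r\<close> are joined to \<open>x\<close> by
      arrows, so their indicators factor through \<open>e\<close>. The two factor axioms record the
      outcome without mentioning arrows.\<close>
    and row_factor: "r \<in> carrier R \<Longrightarrow>
      e \<otimes> r \<in> generate (add_monoid F) {e \<otimes> r \<otimes> v \<otimes> e \<otimes> w | v w. v \<in> carrier R \<and> w \<in> carrier R}"
    and column_factor: "r \<in> carrier R \<Longrightarrow>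
      r \<otimes> e \<in> generate (add_monoid F) {w \<otimes> e \<otimes> v \<otimes> r \<otimes> e | v w. v \<in> carrier R \<and> w \<in> carrier R}"
    and iota_bij: "bij_betw \<iota> (carrier B) {e \<otimes> f \<otimes> e | f. f \<in> carrier F}"
    and B_add: "\<lbrakk>a \<in> carrier B; b \<in> carrier B\<rbrakk> \<Longrightarrow> a \<oplus>\<^bsub>B\<^esub> b \<in> carrier B \<and> \<iota> (a \<oplus>\<^bsub>B\<^esub> b) = \<iota> a \<oplus> \<iota> b"
    and B_mult: "\<lbrakk>a \<in> carrier B; b \<in> carrier B\<rbrakk> \<Longrightarrow> a \<otimes>\<^bsub>B\<^esub> b \<in> carrier B \<and> \<iota> (a \<otimes>\<^bsub>B\<^esub> b) = \<iota> a \<otimes> \<iota> b"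
    and B_one: "\<one>\<^bsub>B\<^esub> \<in> carrier B \<and> \<iota> \<one>\<^bsub>B\<^esub> = e"
    and kappa_bij: "bij_betw \<kappa> (carrier L) {r \<otimes> e | r. r \<in> carrier R}"
    and L_mult: "\<lbrakk>k \<in> carrier L; l \<in> carrier L\<rbrakk> \<Longrightarrow> k \<otimes>\<^bsub>L\<^esub> l \<in> carrier L \<and> \<kappa> (k \<otimes>\<^bsub>L\<^esub> l) = \<kappa> k \<oplus> \<kappa> l"
    and L_lact: "\<lbrakk>r \<in> carrier R; l \<in> carrier L\<rbrakk> \<Longrightarrow> lact r l \<in> carrier L \<and> \<kappa> (lact r l) = r \<otimes> \<kappa> l"
    and L_ract: "\<lbrakk>l \<in> carrier L; b \<in> carrier B\<rbrakk> \<Longrightarrow> ract l b \<in> carrier L \<and> \<kappa> (ract l b) = \<kappa> l \<otimes> \<iota> b"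
begin

lemmas R_sub = F.add_subgroupD[OF R_subgroup]

lemma R_F [simp]: "r \<in> carrier R \<Longrightarrow> r \<in> carrier F"
  using R_sub(1) by blast

lemma e_e [simp]: "f \<in> carrier F \<Longrightarrow> e \<otimes> (e \<otimes> f) = e \<otimes> f"
  by (simp flip: m_assoc)

lemma R_abelian: "abelian_group R"
proof (rule abelian_groupI)
  show "\<exists>y\<in>carrier R. y \<oplus>\<^bsub>R\<^esub> x = \<zero>\<^bsub>R\<^esub>" if "x \<in> carrier R" for x
    using that R_sub(4)[OF that] by (auto intro!: bexI[of _ "\<ominus> x"] simp: l_neg)
qed (auto simp: R_sub a_ac)

text \<open>Defined on all of \<open>F\<close> through the compression \<open>e f e\<close>, so that
  actions of the corner can be computed with arbitrary products in \<open>F\<close>.\<close>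

definition to_B :: "'r \<Rightarrow> 'r" where
  "to_B f = inv_into (carrier B) \<iota> (e \<otimes> f \<otimes> e)"

lemma iota_image: "\<iota> ` carrier B = {e \<otimes> f \<otimes> e | f. f \<in> carrier F}"
  using iota_bij by (simp add: bij_betw_def)

lemma corner_in_image: "f \<in> carrier F \<Longrightarrow> e \<otimes> f \<otimes> e \<in> \<iota> ` carrier B"
  unfolding iota_image by blast

lemma to_B_closed [simp]: "f \<in> carrier F \<Longrightarrow> to_B f \<in> carrier B"
  unfolding to_B_def by (rule inv_into_into[OF corner_in_image])

lemma iota_to_B [simp]: "f \<in> carrier F \<Longrightarrow> \<iota> (to_B f) = e \<otimes> f \<otimes> e"
  unfolding to_B_def by (rule f_inv_into_f[OF corner_in_image])

lemma iota_corner_obtain: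
  assumes "b \<in> carrier B" obtains f where "f \<in> carrier F" "\<iota> b = e \<otimes> f \<otimes> e"
  using iota_image assms by blast

lemma iota_closed: "b \<in> carrier B \<Longrightarrow> \<iota> b \<in> carrier F"
  by (erule iota_corner_obtain) simp

lemma iota_corner: "b \<in> carrier B \<Longrightarrow> e \<otimes> \<iota> b \<otimes> e = \<iota> b"
  by (erule iota_corner_obtain) (simp add: m_assoc)

lemma iota_inj: "\<lbrakk>a \<in> carrier B; b \<in> carrier B; \<iota> a = \<iota> b\<rbrakk> \<Longrightarrow> a = b"
  using iota_bij by (auto simp: bij_betw_def dest: inj_onD)

lemma to_B_iota: "b \<in> carrier B \<Longrightarrow> to_B (\<iota> b) = b"
  by (rule iota_inj) (auto simp: iota_closed iota_corner)

lemma to_B_cong: "e \<otimes> f \<otimes> e = e \<otimes> g \<otimes> e \<Longrightarrow> to_B f = to_B g"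
  by (simp add: to_B_def)

lemma to_B_add: "\<lbrakk>f \<in> carrier F; g \<in> carrier F\<rbrakk> \<Longrightarrow> to_B (f \<oplus> g) = to_B f \<oplus>\<^bsub>B\<^esub> to_B g"
  by (rule iota_inj) (auto simp: B_add l_distr r_distr)

text \<open>Compression is not multiplicative: the product of \<open>e f e\<close> and
  \<open>e g e\<close> keeps an \<open>e\<close> in the middle, which later computations have to
  produce or absorb.\<close>

lemma to_B_mult: "\<lbrakk>f \<in> carrier F; g \<in> carrier F\<rbrakk> \<Longrightarrow> to_B f \<otimes>\<^bsub>B\<^esub> to_B g = to_B (f \<otimes> e \<otimes> g)"
  by (rule iota_inj) (auto simp: B_mult m_assoc)

lemma to_B_one: "to_B e = \<one>\<^bsub>B\<^esub>"
  by (rule iota_inj) (auto simp: B_one)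

lemma obtain_row:
  assumes "f \<in> carrier F" obtains r where "r \<in> carrier R" "e \<otimes> r = e \<otimes> f"
  using row[OF assms] by blast

text \<open>A stand-in for \<open>e\<close> on the left: \<open>r\<close> lies in \<open>R\<close>,
  while \<open>e\<close> in general does not.\<close>

lemma obtain_unit_row: obtains r where "r \<in> carrier R" "e \<otimes> r = e"
  using obtain_row[of e] by auto

text \<open>For modules \<open>M\<close> over the corner, \<open>corner_ann M\<close> is the annihilator of \<open>Re \<otimes> M\<close>.\<close>

definition corner_ann :: "('r, 'm, 'd) module_scheme \<Rightarrow> 'r set" where
  "corner_ann M = {f \<in> carrier R. \<forall>g \<in> carrier R. \<forall>h \<in> carrier R. \<forall>m \<in> carrier M.
     to_B (g \<otimes> f \<otimes> h) \<odot>\<^bsub>M\<^esub> m = \<zero>\<^bsub>M\<^esub>}"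

end

section \<open>Modules over the corner and their induced modules\<close>

locale corner_module = corner F R B L e \<iota> \<kappa> lact ract + M: left_module B M
  for F :: "('r, 'c) ring_scheme" (structure) and R B :: "'r ring" and L :: "'r monoid"
    and e :: 'r and \<iota> \<kappa> :: "'r \<Rightarrow> 'r" and lact ract :: "'r \<Rightarrow> 'r \<Rightarrow> 'r"
    and M :: "('r, 'm, 'd) module_scheme"
begin

lemma act_closed [simp]: "\<lbrakk>f \<in> carrier F; m \<in> carrier M\<rbrakk> \<Longrightarrow> to_B f \<odot>\<^bsub>M\<^esub> m \<in> carrier M"
  by (simp add: M.lsmult_closed)

lemma act_add: "\<lbrakk>f \<in> carrier F; g \<in> carrier F; m \<in> carrier M\<rbrakk>
    \<Longrightarrow> to_B (f \<oplus> g) \<odot>\<^bsub>M\<^esub> m = to_B f \<odot>\<^bsub>M\<^esub> m \<oplus>\<^bsub>M\<^esub> to_B g \<odot>\<^bsub>M\<^esub> m"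
  by (simp add: to_B_add M.lsmult_l_distr)

lemma act_add_right: "\<lbrakk>f \<in> carrier F; m \<in> carrier M; n \<in> carrier M\<rbrakk>
    \<Longrightarrow> to_B f \<odot>\<^bsub>M\<^esub> (m \<oplus>\<^bsub>M\<^esub> n) = to_B f \<odot>\<^bsub>M\<^esub> m \<oplus>\<^bsub>M\<^esub> to_B f \<odot>\<^bsub>M\<^esub> n"
  by (simp add: M.lsmult_r_distr)

lemma act_zero [simp]: "m \<in> carrier M \<Longrightarrow> to_B \<zero> \<odot>\<^bsub>M\<^esub> m = \<zero>\<^bsub>M\<^esub>"
  by (rule M.add_idem_zero) (simp_all flip: act_add)

lemma act_zero_right [simp]: "f \<in> carrier F \<Longrightarrow> to_B f \<odot>\<^bsub>M\<^esub> \<zero>\<^bsub>M\<^esub> = \<zero>\<^bsub>M\<^esub>"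
  by (rule M.add_idem_zero) (simp_all flip: act_add_right)

lemma act_neg: "\<lbrakk>f \<in> carrier F; m \<in> carrier M\<rbrakk> \<Longrightarrow> to_B (\<ominus> f) \<odot>\<^bsub>M\<^esub> m = \<ominus>\<^bsub>M\<^esub> (to_B f \<odot>\<^bsub>M\<^esub> m)"
  using act_add[of "\<ominus> f" f m] by (intro M.minus_equality[symmetric]) (auto simp: l_neg)

lemma act_neg_right: "\<lbrakk>f \<in> carrier F; m \<in> carrier M\<rbrakk> \<Longrightarrow> to_B f \<odot>\<^bsub>M\<^esub> (\<ominus>\<^bsub>M\<^esub> m) = \<ominus>\<^bsub>M\<^esub> (to_B f \<odot>\<^bsub>M\<^esub> m)"
  using act_add_right[of f "\<ominus>\<^bsub>M\<^esub> m" m] by (intro M.minus_equality[symmetric]) (auto simp: M.l_neg)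

lemma act_act: "\<lbrakk>f \<in> carrier F; g \<in> carrier F; m \<in> carrier M\<rbrakk>
    \<Longrightarrow> to_B f \<odot>\<^bsub>M\<^esub> (to_B g \<odot>\<^bsub>M\<^esub> m) = to_B (f \<otimes> e \<otimes> g) \<odot>\<^bsub>M\<^esub> m"
  by (simp add: M.lsmult_assoc[symmetric] to_B_mult)

text \<open>The elements killed by the whole corner form a submodule, which is proper because some
  product is non-zero, and hence is zero. It contains every \<open>e m - m\<close>, because
  compression does not see an additional right factor \<open>e\<close>.\<close>

lemma unital_of_simple:
  assumes "simple_left_module B M"
  shows "unital_left_module B M"
proof -
  define H where "H = {m \<in> carrier M. \<forall>f \<in> carrier F. to_B f \<odot>\<^bsub>M\<^esub> m = \<zero>\<^bsub>M\<^esub>}"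
  have "submodule H B M"
  proof (rule submoduleI')
    show "b \<odot>\<^bsub>M\<^esub> m \<in> H" if "b \<in> carrier B" "m \<in> H" for b m
    proof -
      have "to_B (\<iota> b) \<odot>\<^bsub>M\<^esub> m = \<zero>\<^bsub>M\<^esub>" using that by (auto simp: H_def iota_closed)
      then show ?thesis using that by (simp add: to_B_iota H_def)
    qed
  qed (auto simp: H_def act_add_right act_neg_right M.abelian_group_axioms)
  moreover have "H \<noteq> carrier M"
  proof
    assume H: "H = carrier M"
    obtain b m where bm: "b \<in> carrier B" "m \<in> carrier M" "b \<odot>\<^bsub>M\<^esub> m \<noteq> \<zero>\<^bsub>M\<^esub>"
      using assms by (auto simp: simple_left_module_def)
    then have "to_B (\<iota> b) \<odot>\<^bsub>M\<^esub> m = \<zero>\<^bsub>M\<^esub>" using H iota_closed[of b] unfolding H_def by blast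
    then show False using bm by (simp add: to_B_iota)
  qed
  ultimately have H: "H = {\<zero>\<^bsub>M\<^esub>}" using assms by (auto simp: simple_left_module_def)
  have "to_B e \<odot>\<^bsub>M\<^esub> m = m" if m: "m \<in> carrier M" for m
  proof -
    have "to_B f \<odot>\<^bsub>M\<^esub> (to_B e \<odot>\<^bsub>M\<^esub> m \<ominus>\<^bsub>M\<^esub> m) = \<zero>\<^bsub>M\<^esub>" if f: "f \<in> carrier F" for f
    proof -
      have "to_B (f \<otimes> e \<otimes> e) = to_B f" using f by (intro to_B_cong) (simp add: m_assoc)
      then show ?thesis using f m by (simp add: a_minus_def act_add_right act_neg_right act_act M.r_neg)
    qed
    then have "to_B e \<odot>\<^bsub>M\<^esub> m \<ominus>\<^bsub>M\<^esub> m \<in> H" using m by (simp add: H_def)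
    then show ?thesis using H m by (simp add: M.diff_eq_zero_iff)
  qed
  then show ?thesis
    by (intro unital_left_module.intro unital_left_module_axioms.intro M.left_module_axioms)
      (simp add: to_B_one)
qed

end

locale corner_unital_module = corner_module F R B L e \<iota> \<kappa> lact ract M + M: unital_left_module B M
  for F :: "('r, 'c) ring_scheme" (structure) and R B :: "'r ring" and L :: "'r monoid"
    and e :: 'r and \<iota> \<kappa> :: "'r \<Rightarrow> 'r" and lact ract :: "'r \<Rightarrow> 'r \<Rightarrow> 'r"
    and M :: "('r, 'm, 'd) module_scheme"
begin

lemma act_e [simp]: "m \<in> carrier M \<Longrightarrow> to_B e \<odot>\<^bsub>M\<^esub> m = m"
  by (simp add: to_B_one M.lsmult_one)

lemma kappa_image: "\<kappa> ` carrier L = {r \<otimes> e | r. r \<in> carrier R}"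
  using kappa_bij by (simp add: bij_betw_def)

lemma kappa_e:
  assumes "l \<in> carrier L" shows "\<exists>r \<in> carrier R. \<kappa> l = r \<otimes> e"
proof -
  have "\<kappa> l \<in> {r \<otimes> e | r. r \<in> carrier R}"
    using imageI[OF assms, of \<kappa>] unfolding kappa_image .
  then show ?thesis by auto
qed

lemma kappa_closed: "l \<in> carrier L \<Longrightarrow> \<kappa> l \<in> carrier F"
  by (drule kappa_e) auto

lemma kappa_inj: "\<lbrakk>k \<in> carrier L; l \<in> carrier L; \<kappa> k = \<kappa> l\<rbrakk> \<Longrightarrow> k = l"
  using kappa_bij unfolding bij_betw_def by (meson inj_onD)

lemma kappa_surj:
  assumes "r \<in> carrier R" shows "\<exists>l \<in> carrier L. \<kappa> l = r \<otimes> e"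
proof -
  have "r \<otimes> e \<in> \<kappa> ` carrier L" unfolding kappa_image using assms by blast
  then show ?thesis by auto
qed

lemma tensor_relations_closed:
  "tensor_relations L ract B M \<subseteq> carrier (free_Abelian_group (carrier L \<times> carrier M))"
proof -
  let ?A = "free_Abelian_group (carrier L \<times> carrier M)"
  have d: "x - y \<in> carrier ?A" if "x \<in> carrier ?A" "y \<in> carrier ?A" for x y
    using that keys_diff[of x y] unfolding carrier_free_Abelian_group_iff by blast
  have o: "frag_of (l, m) \<in> carrier ?A" if "l \<in> carrier L" "m \<in> carrier M" for l m
    using that by simp
  have 1: "frag_of (k \<otimes>\<^bsub>L\<^esub> l, m) - frag_of (k, m) - frag_of (l, m) \<in> carrier ?A"
    if "k \<in> carrier L" "l \<in> carrier L" "m \<in> carrier M" for k l m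
    using that by (intro d o) (auto simp: L_mult)
  have 2: "frag_of (l, m \<oplus>\<^bsub>M\<^esub> n) - frag_of (l, m) - frag_of (l, n) \<in> carrier ?A"
    if "l \<in> carrier L" "m \<in> carrier M" "n \<in> carrier M" for l m n
    using that by (intro d o) auto
  have 3: "frag_of (ract l b, m) - frag_of (l, b \<odot>\<^bsub>M\<^esub> m) \<in> carrier ?A"
    if "l \<in> carrier L" "b \<in> carrier B" "m \<in> carrier M" for l b m
    using that by (intro d o) (auto simp: L_ract M.lsmult_closed)
  show ?thesis
    unfolding tensor_relations_def
    by (intro Un_least subsetI; elim CollectE exE conjE; erule ssubst; rule 1 2 3; assumption)
qed

lemma tensor_kernel_subgroup:
  "subgroup (tensor_kernel L ract B M) (free_Abelian_group (carrier L \<times> carrier M))"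
  unfolding tensor_kernel_def
  by (rule group.generate_is_subgroup[OF group_free_Abelian_group tensor_relations_closed])

text \<open>For fixed \<open>g\<close>, sending \<open>(l, m)\<close> to
  \<open>(e g \<kappa>(l) e) m\<close> is biadditive and balanced, so it extends to the free abelian
  group and kills all tensor relations, hence the kernel.\<close>

lemma tensor_kernelD:
  assumes t: "frag_of (l, m) \<in> tensor_kernel L ract B M" and lm: "l \<in> carrier L" "m \<in> carrier M"
    and g: "g \<in> carrier F"
  shows "to_B (g \<otimes> \<kappa> l) \<odot>\<^bsub>M\<^esub> m = \<zero>\<^bsub>M\<^esub>"
proof -
  let ?A = "free_Abelian_group (carrier L \<times> carrier M)"
  let ?f = "\<lambda>(l, m). to_B (g \<otimes> \<kappa> l) \<odot>\<^bsub>M\<^esub> m"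
  interpret A: comm_group ?A by (rule abelian_free_Abelian_group)
  have "?f ` (carrier L \<times> carrier M) \<subseteq> carrier (add_monoid M)" using g by (auto simp: kappa_closed)
  then obtain \<psi> where \<psi>: "\<psi> \<in> hom ?A (add_monoid M)"
    and \<psi>of: "\<And>p. p \<in> carrier L \<times> carrier M \<Longrightarrow> \<psi> (frag_of p) = ?f p"
    using comm_group.free_Abelian_group_universal[OF M.a_comm_group, of ?f "carrier L \<times> carrier M"] by blast
  interpret \<psi>: group_hom ?A "add_monoid M" \<psi> by unfold_locales (rule \<psi>)
  have diff: "\<psi> (x - y) = \<psi> x \<ominus>\<^bsub>M\<^esub> \<psi> y" if "x \<in> carrier ?A" "y \<in> carrier ?A" for x y
  proof -
    have "\<psi> (x \<otimes>\<^bsub>?A\<^esub> inv\<^bsub>?A\<^esub> y) = \<psi> x \<otimes>\<^bsub>add_monoid M\<^esub> inv\<^bsub>add_monoid M\<^esub> \<psi> y"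
      using that by (simp only: \<psi>.hom_mult \<psi>.hom_inv A.inv_closed)
    moreover have "x \<otimes>\<^bsub>?A\<^esub> inv\<^bsub>?A\<^esub> y = x - y" using that by simp
    ultimately show ?thesis by (simp add: a_minus_def a_inv_def)
  qed
  have cancel: "(u \<oplus>\<^bsub>M\<^esub> v) \<ominus>\<^bsub>M\<^esub> u \<ominus>\<^bsub>M\<^esub> v = \<zero>\<^bsub>M\<^esub>" if "u \<in> carrier M" "v \<in> carrier M" for u v
  proof -
    have "(u \<oplus>\<^bsub>M\<^esub> v) \<ominus>\<^bsub>M\<^esub> u \<ominus>\<^bsub>M\<^esub> v = (u \<oplus>\<^bsub>M\<^esub> v) \<ominus>\<^bsub>M\<^esub> (u \<oplus>\<^bsub>M\<^esub> v)"
      using that by (simp add: a_minus_def M.minus_add M.a_assoc)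
    then show ?thesis using that by (simp add: a_minus_def M.r_neg)
  qed
  have of: "frag_of p \<in> carrier ?A \<longleftrightarrow> p \<in> carrier L \<times> carrier M" for p by simp
  have dA: "x - y \<in> carrier ?A" if "x \<in> carrier ?A" "y \<in> carrier ?A" for x y
    using that keys_diff[of x y] unfolding carrier_free_Abelian_group_iff by blast
  have "tensor_relations L ract B M \<subseteq> {c \<in> carrier ?A. \<psi> c = \<zero>\<^bsub>M\<^esub>}"
  proof -
    have r1: "\<psi> (frag_of (k \<otimes>\<^bsub>L\<^esub> l, m) - frag_of (k, m) - frag_of (l, m)) = \<zero>\<^bsub>M\<^esub>"
      if "k \<in> carrier L" "l \<in> carrier L" "m \<in> carrier M" for k l m
    proof -
      have "\<psi> (frag_of (k \<otimes>\<^bsub>L\<^esub> l, m) - frag_of (k, m) - frag_of (l, m)) =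
        ?f (k \<otimes>\<^bsub>L\<^esub> l, m) \<ominus>\<^bsub>M\<^esub> ?f (k, m) \<ominus>\<^bsub>M\<^esub> ?f (l, m)"
        using that by (simp add: diff dA of \<psi>of L_mult del: carrier_free_Abelian_group_iff)
      also have "\<dots> = \<zero>\<^bsub>M\<^esub>"
        using that g
        by (simp add: L_mult kappa_closed r_distr act_add cancel)
      finally show ?thesis .
    qed
    have r2: "\<psi> (frag_of (l, m \<oplus>\<^bsub>M\<^esub> n) - frag_of (l, m) - frag_of (l, n)) = \<zero>\<^bsub>M\<^esub>"
      if "l \<in> carrier L" "m \<in> carrier M" "n \<in> carrier M" for l m n
    proof -
      have "\<psi> (frag_of (l, m \<oplus>\<^bsub>M\<^esub> n) - frag_of (l, m) - frag_of (l, n)) =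
        ?f (l, m \<oplus>\<^bsub>M\<^esub> n) \<ominus>\<^bsub>M\<^esub> ?f (l, m) \<ominus>\<^bsub>M\<^esub> ?f (l, n)"
        using that by (simp add: diff dA of \<psi>of del: carrier_free_Abelian_group_iff)
      also have "\<dots> = \<zero>\<^bsub>M\<^esub>"
        using that g
        by (simp add: kappa_closed act_add_right cancel)
      finally show ?thesis .
    qed
    have r3: "\<psi> (frag_of (ract l b, m) - frag_of (l, b \<odot>\<^bsub>M\<^esub> m)) = \<zero>\<^bsub>M\<^esub>"
      if lbm: "l \<in> carrier L" "b \<in> carrier B" "m \<in> carrier M" for l b m
    proof -
      \<comment> \<open>Elements in the image of \<kappa> end in \<open>e\<close>, which absorbs the
        middle \<open>e\<close> produced by \<open>act_act\<close>; this gives balancedness.\<close>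
      obtain r where r: "r \<in> carrier R" "\<kappa> l = r \<otimes> e" using kappa_e[OF lbm(1)] by blast
      have "to_B (g \<otimes> \<kappa> l) \<odot>\<^bsub>M\<^esub> (to_B (\<iota> b) \<odot>\<^bsub>M\<^esub> m) = to_B (g \<otimes> \<kappa> l \<otimes> e \<otimes> \<iota> b) \<odot>\<^bsub>M\<^esub> m"
        using lbm g by (simp add: act_act kappa_closed iota_closed)
      also have "g \<otimes> \<kappa> l \<otimes> e \<otimes> \<iota> b = g \<otimes> (\<kappa> l \<otimes> \<iota> b)"
        using r g lbm by (simp add: m_assoc iota_closed)
      finally have "?f (ract l b, m) = ?f (l, b \<odot>\<^bsub>M\<^esub> m)"
        using lbm by (simp add: L_ract to_B_iota)
      then show ?thesis using lbm g
        by (simp add: diff dA of \<psi>of L_ract M.lsmult_closed M.r_neg a_minus_def kappa_closed iota_closed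
            del: carrier_free_Abelian_group_iff)
    qed
    have "tensor_relations L ract B M \<subseteq> {c. \<psi> c = \<zero>\<^bsub>M\<^esub>}"
      unfolding tensor_relations_def
      by (intro Un_least subsetI CollectI; elim CollectE exE conjE; erule ssubst; rule r1 r2 r3; assumption)
    then show ?thesis using tensor_relations_closed by blast
  qed
  moreover have "subgroup {c \<in> carrier ?A. \<psi> c = \<zero>\<^bsub>M\<^esub>} ?A"
    using \<psi>.subgroup_kernel by (simp add: kernel_def)
  ultimately have "tensor_kernel L ract B M \<subseteq> {c \<in> carrier ?A. \<psi> c = \<zero>\<^bsub>M\<^esub>}"
    unfolding tensor_kernel_def by (rule A.generate_subgroup_incl)
  then show ?thesis using t lm by (auto simp: \<psi>of)
qed

text \<open>If \<open>f\<close> kills all tensors, apply \<open>tensor_kernelD\<close> to the image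
  under \<open>f\<close> of the tensor of \<open>h e\<close> and \<open>m\<close>. Conversely,
  \<open>column_factor\<close> writes \<open>f r e\<close> as a sum of terms
  \<open>w e v f r e\<close>. Each splits as \<open>w e\<close> times the corner element
  \<open>e v f r e\<close>, which moves across the tensor sign and kills \<open>m\<close>.\<close>

lemma annihilator_tensor:
  "annihilator R (tensor_module L lact ract B M) = corner_ann M"
proof -
  let ?A = "free_Abelian_group (carrier L \<times> carrier M)"
  let ?K = "tensor_kernel L ract B M"
  interpret K: subgroup ?K ?A by (rule tensor_kernel_subgroup)
  have rel: "r \<in> ?K" if "r \<in> tensor_relations L ract B M" for r
    unfolding tensor_kernel_def using that by (rule generate.incl)
  have Kadd: "x + y \<in> ?K" if "x \<in> ?K" "y \<in> ?K" for x y using K.m_closed[OF that] by simp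
  have Kneg: "- x \<in> ?K" if "x \<in> ?K" for x
    using K.m_inv_closed[OF that] subsetD[OF K.subset that] by simp
  have Kdiff: "x - y \<in> ?K" if "x \<in> ?K" "y \<in> ?K" for x y using Kadd[OF that(1) Kneg[OF that(2)]] by simp
  have 1: "f \<in> corner_ann M"
    if f: "f \<in> carrier R" "\<forall>l \<in> carrier L. \<forall>m \<in> carrier M. frag_of (lact f l, m) \<in> ?K" for f
    unfolding corner_ann_def
  proof (intro CollectI conjI ballI f)
    fix g h m assume gh: "g \<in> carrier R" "h \<in> carrier R" and m: "m \<in> carrier M"
    obtain l where l: "l \<in> carrier L" "\<kappa> l = h \<otimes> e" using kappa_surj[OF gh(2)] by blast
    then have "to_B (g \<otimes> \<kappa> (lact f l)) \<odot>\<^bsub>M\<^esub> m = \<zero>\<^bsub>M\<^esub>"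
      using f gh m by (intro tensor_kernelD) (auto simp: L_lact)
    moreover have "to_B (g \<otimes> (f \<otimes> (h \<otimes> e))) = to_B (g \<otimes> f \<otimes> h)"
      using f gh by (intro to_B_cong) (simp add: m_assoc)
    ultimately show "to_B (g \<otimes> f \<otimes> h) \<odot>\<^bsub>M\<^esub> m = \<zero>\<^bsub>M\<^esub>" using f l by (simp add: L_lact)
  qed
  have 2: "frag_of (lact f l, m) \<in> ?K"
    if f: "f \<in> corner_ann M" and l: "l \<in> carrier L" and m: "m \<in> carrier M" for f l m
  proof -
    have fR: "f \<in> carrier R" using f by (simp add: corner_ann_def)
    obtain r where r: "r \<in> carrier R" "\<kappa> l = r \<otimes> e" using kappa_e[OF l] by blast
    have fr: "f \<otimes> r \<in> carrier R" using fR r by (simp add: R_m_closed)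
    \<comment> \<open>The elements of \<open>F\<close> whose tensor with the fixed \<open>m\<close>
      vanishes. Once this is an additive subgroup, only the terms given by
      \<open>column_factor\<close> have to be checked.\<close>
    define Q where "Q = {h \<in> carrier F. \<exists>k \<in> carrier L. \<kappa> k = h \<and> frag_of (k, m) \<in> ?K}"
    obtain z where z: "z \<in> carrier L" "\<kappa> z = \<zero> \<otimes> e" using kappa_surj R_sub(2) by blast
    have zz: "z \<otimes>\<^bsub>L\<^esub> z = z" by (rule kappa_inj) (use z in \<open>auto simp: L_mult\<close>)
    have zK: "frag_of (z, m) \<in> ?K"
    proof -
      \<comment> \<open>As \<open>z + z = z\<close>, this relation is the negative of the generator
        \<open>(z, m)\<close>.\<close>
      have "frag_of (z \<otimes>\<^bsub>L\<^esub> z, m) - frag_of (z, m) - frag_of (z, m) \<in> ?K"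
        by (rule rel) (use z m in \<open>unfold tensor_relations_def, blast\<close>)
      then show ?thesis using Kneg zz by fastforce
    qed
    have addK: "frag_of (k \<otimes>\<^bsub>L\<^esub> k', m) - frag_of (k, m) - frag_of (k', m) \<in> ?K"
      if "k \<in> carrier L" "k' \<in> carrier L" for k k'
      by (rule rel) (use that m in \<open>unfold tensor_relations_def, blast\<close>)
    have Q: "subgroup Q (add_monoid F)"
    proof (rule F.add_subgroupI)
      show "\<zero> \<in> Q" using z zK by (auto simp: Q_def)
      show "x \<oplus> y \<in> Q" if xy: "x \<in> Q" "y \<in> Q" for x y
      proof -
        obtain k k' where k: "k \<in> carrier L" "k' \<in> carrier L" "\<kappa> k = x" "\<kappa> k' = y"
          "frag_of (k, m) \<in> ?K" "frag_of (k', m) \<in> ?K" using xy unfolding Q_def by blast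
        have "(frag_of (k \<otimes>\<^bsub>L\<^esub> k', m) - frag_of (k, m) - frag_of (k', m)) + (frag_of (k, m) + frag_of (k', m)) \<in> ?K"
          using k by (intro Kadd addK)
        then have "frag_of (k \<otimes>\<^bsub>L\<^esub> k', m) \<in> ?K" by (simp add: algebra_simps)
        then show ?thesis using k xy kappa_closed by (auto simp: Q_def L_mult intro!: bexI[of _ "k \<otimes>\<^bsub>L\<^esub> k'"])
      qed
      show "\<ominus> x \<in> Q" if x: "x \<in> Q" for x
      proof -
        obtain k where k: "k \<in> carrier L" "\<kappa> k = x" "frag_of (k, m) \<in> ?K" using x unfolding Q_def by blast
        obtain s where s: "s \<in> carrier R" "\<kappa> k = s \<otimes> e" using kappa_e k by blast
        obtain k' where k': "k' \<in> carrier L" "\<kappa> k' = (\<ominus> s) \<otimes> e" using kappa_surj R_sub(4) s by blast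
        have kk': "k \<otimes>\<^bsub>L\<^esub> k' = z" by (rule kappa_inj) (use k k' z s in \<open>auto simp: L_mult l_minus r_neg\<close>)
        have "frag_of (z, m) - frag_of (k, m) - (frag_of (k \<otimes>\<^bsub>L\<^esub> k', m) - frag_of (k, m) - frag_of (k', m)) \<in> ?K"
          using k k' by (intro Kdiff addK zK)
        then have "frag_of (k', m) \<in> ?K" using kk' by (simp add: algebra_simps)
        then show ?thesis using k' k s by (auto simp: Q_def l_minus intro!: bexI[of _ k'])
      qed
    qed (auto simp: Q_def)
    have "{w \<otimes> e \<otimes> v \<otimes> (f \<otimes> r) \<otimes> e | v w. v \<in> carrier R \<and> w \<in> carrier R} \<subseteq> Q"
    proof clarify
      fix v w assume vw: "v \<in> carrier R" "w \<in> carrier R"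
      obtain k where k: "k \<in> carrier L" "\<kappa> k = w \<otimes> e" using kappa_surj vw by blast
      define b where "b = to_B (v \<otimes> f \<otimes> r)"
      have b: "b \<in> carrier B" "\<iota> b = e \<otimes> (v \<otimes> f \<otimes> r) \<otimes> e" using vw fR r by (auto simp: b_def)
      have bm: "b \<odot>\<^bsub>M\<^esub> m = \<zero>\<^bsub>M\<^esub>" using f vw r m by (simp add: b_def corner_ann_def)
      have 0: "frag_of (k, \<zero>\<^bsub>M\<^esub>) \<in> ?K"
      proof -
        have "frag_of (k, \<zero>\<^bsub>M\<^esub> \<oplus>\<^bsub>M\<^esub> \<zero>\<^bsub>M\<^esub>) - frag_of (k, \<zero>\<^bsub>M\<^esub>) - frag_of (k, \<zero>\<^bsub>M\<^esub>) \<in> ?K"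
          by (rule rel) (use k M.zero_closed in \<open>unfold tensor_relations_def, blast\<close>)
        then show ?thesis using Kneg by fastforce
      qed
      \<comment> \<open>Balancedness moves the corner element \<open>b\<close> to \<open>m\<close>,
        where it gives zero.\<close>
      have "frag_of (ract k b, m) - frag_of (k, b \<odot>\<^bsub>M\<^esub> m) \<in> ?K"
        by (rule rel) (use k b m in \<open>unfold tensor_relations_def, blast\<close>)
      from Kadd[OF this] 0 bm have "frag_of (ract k b, m) \<in> ?K" by fastforce
      moreover have "\<kappa> (ract k b) = w \<otimes> e \<otimes> v \<otimes> (f \<otimes> r) \<otimes> e"
        using k b vw fR r by (simp add: L_ract m_assoc)
      ultimately show "w \<otimes> e \<otimes> v \<otimes> (f \<otimes> r) \<otimes> e \<in> Q"
        using k b vw fR r by (auto simp: Q_def L_ract intro!: bexI[of _ "ract k b"])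
    qed
    then have "f \<otimes> r \<otimes> e \<in> Q"
      using column_factor[OF fr] group.generate_subgroup_incl[OF F.a_group _ Q] by blast
    then obtain k where k: "k \<in> carrier L" "\<kappa> k = f \<otimes> r \<otimes> e" "frag_of (k, m) \<in> ?K" by (auto simp: Q_def)
    have "k = lact f l" by (rule kappa_inj) (use k l r fR in \<open>auto simp: L_lact m_assoc\<close>)
    then show ?thesis using k by simp
  qed
  show ?thesis
    unfolding annihilator_tensor_module[OF tensor_relations_closed]
    using 1 2 by (auto simp: corner_ann_def)
qed

text \<open>Unitality puts \<open>m0\<close> into its own orbit, which is therefore a non-zero
  submodule.\<close>

lemma simple_cyclic:
  assumes M: "simple_left_module B M" and m0: "m0 \<in> carrier M" "m0 \<noteq> \<zero>\<^bsub>M\<^esub>" and m: "m \<in> carrier M"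
  shows "\<exists>f \<in> carrier F. to_B f \<odot>\<^bsub>M\<^esub> m0 = m"
proof -
  let ?H = "(\<lambda>f. to_B f \<odot>\<^bsub>M\<^esub> m0) ` carrier F"
  have "submodule ?H B M"
  proof (rule submoduleI')
    show "\<zero>\<^bsub>M\<^esub> \<in> ?H" using m0 by (intro image_eqI[of _ _ \<zero>]) auto
    show "x \<oplus>\<^bsub>M\<^esub> y \<in> ?H" if "x \<in> ?H" "y \<in> ?H" for x y
      using that m0 by (auto simp flip: act_add)
    show "\<ominus>\<^bsub>M\<^esub> x \<in> ?H" if "x \<in> ?H" for x
      using that m0 by (auto simp flip: act_neg)
    show "b \<odot>\<^bsub>M\<^esub> x \<in> ?H" if "b \<in> carrier B" "x \<in> ?H" for b x
    proof -
      obtain f where f: "f \<in> carrier F" "x = to_B f \<odot>\<^bsub>M\<^esub> m0" using \<open>x \<in> ?H\<close> by blast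
      have "to_B (\<iota> b) \<odot>\<^bsub>M\<^esub> x = to_B (\<iota> b \<otimes> e \<otimes> f) \<odot>\<^bsub>M\<^esub> m0"
        using f m0 that(1) by (simp add: act_act iota_closed)
      then show ?thesis using that(1) f by (auto simp: to_B_iota iota_closed)
    qed
  qed (use m0 M.abelian_group_axioms in auto)
  moreover have "?H \<noteq> {\<zero>\<^bsub>M\<^esub>}" using m0 act_e[of m0] e_closed by (metis image_eqI singletonD)
  ultimately have "?H = carrier M" using M by (auto simp: simple_left_module_def)
  then have "m \<in> ?H" using m by simp
  then show ?thesis by auto
qed

text \<open>
  The simple module is \<open>R/\<nn>\<close> with \<open>\<nn> = {f. \<forall>g \<in> R. (e g f e) m0 = 0}\<close>, realised through the
  functions \<open>g \<mapsto> (e g f e) m0\<close>.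
\<close>

lemma corner_ann_simple:
  assumes simple: "simple_left_module B M"
  shows "\<exists>N :: ('r, 'r \<Rightarrow> 'm) module. simple_left_module R N \<and> annihilator R N = corner_ann M"
proof -
  obtain b0 m' where "b0 \<in> carrier B" "m' \<in> carrier M" "b0 \<odot>\<^bsub>M\<^esub> m' \<noteq> \<zero>\<^bsub>M\<^esub>"
    using simple unfolding simple_left_module_def by blast
  then obtain m0 where m0: "m0 \<in> carrier M" "m0 \<noteq> \<zero>\<^bsub>M\<^esub>"
    using M.lsmult_closed by blast
  define \<theta> where "\<theta> = (\<lambda>f. \<lambda>g \<in> carrier R. to_B (g \<otimes> f) \<odot>\<^bsub>M\<^esub> m0)"
  \<comment> \<open>A scalar \<open>s\<close> acts by shifting the argument: evaluating the function
    of \<open>f\<close> at \<open>g s\<close> is evaluating the function of \<open>s f\<close> at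
    \<open>g\<close>.\<close>
  define N :: "('r, 'r \<Rightarrow> 'm) module" where
    "N = \<lparr>carrier = \<theta> ` carrier R, monoid.mult = undefined, one = undefined, ring.zero = \<theta> \<zero>,
          ring.add = (\<lambda>u v. \<lambda>g \<in> carrier R. u g \<oplus>\<^bsub>M\<^esub> v g), smult = (\<lambda>s u. \<lambda>g \<in> carrier R. u (g \<otimes> s))\<rparr>"
  have N: "carrier N = \<theta> ` carrier R" "\<zero>\<^bsub>N\<^esub> = \<theta> \<zero>"
    by (simp_all add: N_def)
  have N_add: "\<theta> f \<oplus>\<^bsub>N\<^esub> \<theta> f' = \<theta> (f \<oplus> f')" if "f \<in> carrier R" "f' \<in> carrier R" for f f'
    using that m0 by (auto simp: N_def \<theta>_def r_distr act_add)
  have N_smult: "s \<odot>\<^bsub>N\<^esub> \<theta> f = \<theta> (s \<otimes> f)" if "s \<in> carrier R" "f \<in> carrier R" for s f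
    using that m0 by (auto simp: N_def \<theta>_def R_m_closed m_assoc)
  have \<theta>_eq: "\<theta> f = \<theta> f' \<longleftrightarrow> (\<forall>g \<in> carrier R. to_B (g \<otimes> f) \<odot>\<^bsub>M\<^esub> m0 = to_B (g \<otimes> f') \<odot>\<^bsub>M\<^esub> m0)" for f f'
    by (auto simp: \<theta>_def fun_eq_iff restrict_def)
  have \<theta>_obtain: "\<exists>f \<in> carrier R. x = \<theta> f" if "x \<in> carrier N" for x
    using that by (auto simp: N)
  have \<theta>_N [simp]: "\<theta> f \<in> carrier N" if "f \<in> carrier R" for f
    using that by (simp add: N)
  interpret N: abelian_group N
  proof (rule abelian_groupI)
    fix x y assume "x \<in> carrier N" "y \<in> carrier N"
    then obtain f g where fg: "f \<in> carrier R" "x = \<theta> f" "g \<in> carrier R" "y = \<theta> g"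
      using \<theta>_obtain[of x] \<theta>_obtain[of y] by blast
    show "x \<oplus>\<^bsub>N\<^esub> y \<in> carrier N" using fg by (simp add: N_add R_sub)
    show "x \<oplus>\<^bsub>N\<^esub> y = y \<oplus>\<^bsub>N\<^esub> x" using fg by (simp add: N_add a_comm)
    show "\<zero>\<^bsub>N\<^esub> \<oplus>\<^bsub>N\<^esub> x = x" using fg by (simp add: N(2) N_add R_sub)
    have "\<theta> (\<ominus> f) \<oplus>\<^bsub>N\<^esub> x = \<zero>\<^bsub>N\<^esub>" using fg by (simp add: N(2) N_add R_sub l_neg)
    then show "\<exists>y\<in>carrier N. y \<oplus>\<^bsub>N\<^esub> x = \<zero>\<^bsub>N\<^esub>" using \<theta>_N[OF R_sub(4)[OF fg(1)]] by blast
    fix z assume "z \<in> carrier N"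
    then obtain h where "h \<in> carrier R" "z = \<theta> h" using \<theta>_obtain by blast
    then show "x \<oplus>\<^bsub>N\<^esub> y \<oplus>\<^bsub>N\<^esub> z = x \<oplus>\<^bsub>N\<^esub> (y \<oplus>\<^bsub>N\<^esub> z)"
      using fg by (simp add: N_add R_sub a_assoc)
  qed (simp add: N R_sub)
  have NL: "left_module R N"
  proof (intro left_module.intro left_module_axioms.intro N.abelian_group_axioms)
    fix a x assume a: "a \<in> carrier R" and "x \<in> carrier N"
    then obtain f where f: "f \<in> carrier R" "x = \<theta> f" using \<theta>_obtain by blast
    show "a \<odot>\<^bsub>N\<^esub> x \<in> carrier N" using a f by (simp add: N_smult R_m_closed)
    show "(a \<oplus>\<^bsub>R\<^esub> b) \<odot>\<^bsub>N\<^esub> x = a \<odot>\<^bsub>N\<^esub> x \<oplus>\<^bsub>N\<^esub> b \<odot>\<^bsub>N\<^esub> x" if "b \<in> carrier R" for b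
      using a f that by (simp add: N_smult N_add R_m_closed R_sub l_distr)
    show "(a \<otimes>\<^bsub>R\<^esub> b) \<odot>\<^bsub>N\<^esub> x = a \<odot>\<^bsub>N\<^esub> (b \<odot>\<^bsub>N\<^esub> x)" if "b \<in> carrier R" for b
      using a f that by (simp add: N_smult R_m_closed m_assoc)
    fix y assume "y \<in> carrier N"
    then obtain g where g: "g \<in> carrier R" "y = \<theta> g" using \<theta>_obtain by blast
    show "a \<odot>\<^bsub>N\<^esub> (x \<oplus>\<^bsub>N\<^esub> y) = a \<odot>\<^bsub>N\<^esub> x \<oplus>\<^bsub>N\<^esub> a \<odot>\<^bsub>N\<^esub> y"
      using a f g by (simp add: N_smult N_add R_m_closed R_sub r_distr)
  qed
  \<comment> \<open>Every non-zero element generates. Pick \<open>g\<close> with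
    \<open>m1 = (e g f e) m0\<close> non-zero, and \<open>f1\<close> returning \<open>m1\<close> to
    \<open>m0\<close>. The elements \<open>a\<close> and \<open>s0\<close> of \<open>R\<close>
    realise \<open>e f1 e\<close> and the left cut, so that \<open>s f e = h e f1 e g f e\<close>;
    then \<open>k s f\<close> and \<open>k h\<close> act alike on \<open>m0\<close>.\<close>
  have gen: "\<exists>s \<in> carrier R. s \<odot>\<^bsub>N\<^esub> \<theta> f = \<theta> h"
    if f: "f \<in> carrier R" "\<theta> f \<noteq> \<zero>\<^bsub>N\<^esub>" and h: "h \<in> carrier R" for f h
  proof -
    obtain g where g: "g \<in> carrier R" "to_B (g \<otimes> f) \<odot>\<^bsub>M\<^esub> m0 \<noteq> \<zero>\<^bsub>M\<^esub>"
      using f m0 by (auto simp: N \<theta>_eq)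
    define m1 where "m1 = to_B (g \<otimes> f) \<odot>\<^bsub>M\<^esub> m0"
    obtain f1 where f1: "f1 \<in> carrier F" "to_B f1 \<odot>\<^bsub>M\<^esub> m1 = m0"
      using simple_cyclic[OF simple, of m1 m0] g f m0 by (auto simp: m1_def)
    obtain a where a: "a \<in> carrier R" "a \<otimes> e = e \<otimes> f1 \<otimes> e" using column[OF f1(1)] by blast
    obtain s0 where s0: "s0 \<in> carrier R" "s0 \<otimes> (g \<otimes> f) \<otimes> e = e \<otimes> (g \<otimes> f) \<otimes> e"
      using left_cut[of "g \<otimes> f"] g f by (auto simp: R_m_closed)
    define s where "s = h \<otimes> a \<otimes> s0 \<otimes> g"
    have s: "s \<in> carrier R" using h a s0 g by (simp add: s_def R_m_closed)
    have "s \<otimes> f \<otimes> e = h \<otimes> a \<otimes> (s0 \<otimes> (g \<otimes> f) \<otimes> e)"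
      using h a(1) s0(1) g f by (simp add: s_def m_assoc)
    also have "\<dots> = h \<otimes> (a \<otimes> e) \<otimes> (g \<otimes> f \<otimes> e)"
      unfolding s0 using h a(1) g f by (simp add: m_assoc)
    finally have sfe: "s \<otimes> f \<otimes> e = h \<otimes> e \<otimes> f1 \<otimes> e \<otimes> (g \<otimes> f) \<otimes> e"
      unfolding a(2) using h f1 g f by (simp add: m_assoc)
    have "to_B (k \<otimes> (s \<otimes> f)) \<odot>\<^bsub>M\<^esub> m0 = to_B (k \<otimes> h) \<odot>\<^bsub>M\<^esub> m0" if k: "k \<in> carrier R" for k
    proof -
      have "to_B (k \<otimes> h) \<odot>\<^bsub>M\<^esub> (to_B f1 \<odot>\<^bsub>M\<^esub> m1) = to_B (k \<otimes> h \<otimes> e \<otimes> f1 \<otimes> e \<otimes> (g \<otimes> f)) \<odot>\<^bsub>M\<^esub> m0"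
        using k h f1(1) g(1) f(1) m0(1) by (simp add: m1_def act_act m_assoc)
      also have "to_B (k \<otimes> h \<otimes> e \<otimes> f1 \<otimes> e \<otimes> (g \<otimes> f)) = to_B (k \<otimes> (s \<otimes> f))"
      proof (rule to_B_cong)
        have "e \<otimes> (k \<otimes> (s \<otimes> f)) \<otimes> e = e \<otimes> k \<otimes> (s \<otimes> f \<otimes> e)"
          using k s f by (simp add: m_assoc)
        then show "e \<otimes> (k \<otimes> h \<otimes> e \<otimes> f1 \<otimes> e \<otimes> (g \<otimes> f)) \<otimes> e = e \<otimes> (k \<otimes> (s \<otimes> f)) \<otimes> e"
          unfolding sfe using k h f1 g f by (simp add: m_assoc)
      qed
      finally show ?thesis using f1 by simp
    qed
    then have "s \<odot>\<^bsub>N\<^esub> \<theta> f = \<theta> h" using s f by (simp add: N_smult \<theta>_eq)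
    then show ?thesis using s by blast
  qed
  have "simple_left_module R N"
    unfolding simple_left_module_def
  proof (intro conjI allI impI NL)
    \<comment> \<open>With \<open>e r = e\<close> and \<open>r' e = e\<close> the compression of
      \<open>r r'\<close> is the unit, which does not kill \<open>m0\<close>. So
      \<open>\<theta> r'\<close> is non-zero, and by \<open>gen\<close> some scalar fixes
      it.\<close>
    obtain r where r: "r \<in> carrier R" "e \<otimes> r = e" using obtain_unit_row by blast
    obtain r' where r': "r' \<in> carrier R" "r' \<otimes> e = e" using column[of e] by auto
    have "e \<otimes> (r \<otimes> r') \<otimes> e = (e \<otimes> r) \<otimes> (r' \<otimes> e)" using r(1) r'(1) by (simp add: m_assoc)
    then have "to_B (r \<otimes> r') = to_B e" using r r' by (intro to_B_cong) simp
    then have "to_B (r \<otimes> r') \<odot>\<^bsub>M\<^esub> m0 \<noteq> to_B (r \<otimes> \<zero>) \<odot>\<^bsub>M\<^esub> m0" using r(1) m0 by simp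
    then have "\<theta> r' \<noteq> \<zero>\<^bsub>N\<^esub>" unfolding N \<theta>_eq using r(1) by blast
    then show "\<exists>a\<in>carrier R. \<exists>m\<in>carrier N. a \<odot>\<^bsub>N\<^esub> m \<noteq> \<zero>\<^bsub>N\<^esub>"
      using gen[OF r'(1) _ r'(1)] \<theta>_N[OF r'(1)] by metis
    show "H = {\<zero>\<^bsub>N\<^esub>} \<or> H = carrier N" if H: "submodule H R N" for H
    proof (rule disjCI)
      interpret H: submodule H R N by (rule H)
      assume "H \<noteq> carrier N"
      have HN: "H \<subseteq> carrier N" using H.subset by simp
      have "u = \<zero>\<^bsub>N\<^esub>" if "u \<in> H" for u
      proof (rule ccontr)
        assume u: "u \<noteq> \<zero>\<^bsub>N\<^esub>"
        obtain f where f: "f \<in> carrier R" "u = \<theta> f" using \<open>u \<in> H\<close> HN N(1) by blast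
        have "\<theta> h \<in> H" if h: "h \<in> carrier R" for h
        proof -
          have "\<theta> f \<noteq> \<zero>\<^bsub>N\<^esub>" using u f by simp
          then obtain s where s: "s \<in> carrier R" "s \<odot>\<^bsub>N\<^esub> \<theta> f = \<theta> h" using gen[OF f(1) _ h] by blast
          have "s \<odot>\<^bsub>N\<^esub> u \<in> H" using s(1) \<open>u \<in> H\<close> by (rule H.smult_closed)
          then show ?thesis using s(2) f(2) by simp
        qed
        then have "carrier N \<subseteq> H" unfolding N(1) by blast
        then show False using HN \<open>H \<noteq> carrier N\<close> by blast
      qed
      moreover have "\<zero>\<^bsub>N\<^esub> \<in> H" using H.one_closed by simp
      ultimately show "H = {\<zero>\<^bsub>N\<^esub>}" by blast
    qed
  qed
  moreover have "annihilator R N = corner_ann M"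
  proof -
    have "to_B (g \<otimes> f \<otimes> h) \<odot>\<^bsub>M\<^esub> m = \<zero>\<^bsub>M\<^esub>"
      if f: "f \<in> carrier R" and z: "\<forall>h \<in> carrier R. \<forall>g \<in> carrier R. to_B (g \<otimes> (f \<otimes> h)) \<odot>\<^bsub>M\<^esub> m0 = \<zero>\<^bsub>M\<^esub>"
        and gh: "g \<in> carrier R" "h \<in> carrier R" and m: "m \<in> carrier M" for f g h m
    proof -
      \<comment> \<open>By cyclicity \<open>m = (e f1 e) m0\<close>. An \<open>a\<close> in
        \<open>R\<close> with \<open>a e = e f1 e\<close> absorbs \<open>f1\<close> into the right
        factor, so vanishing at \<open>m0\<close> spreads to every \<open>m\<close>.\<close>
      obtain f1 where f1: "f1 \<in> carrier F" "to_B f1 \<odot>\<^bsub>M\<^esub> m0 = m"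
        using simple_cyclic[OF simple m0 m] by blast
      obtain a where a: "a \<in> carrier R" "a \<otimes> e = e \<otimes> f1 \<otimes> e" using column[OF f1(1)] by blast
      have "to_B (g \<otimes> f \<otimes> h) \<odot>\<^bsub>M\<^esub> m = to_B (g \<otimes> f \<otimes> h \<otimes> e \<otimes> f1) \<odot>\<^bsub>M\<^esub> m0"
        using f gh f1 m0 by (auto simp: act_act)
      also have "to_B (g \<otimes> f \<otimes> h \<otimes> e \<otimes> f1) = to_B (g \<otimes> (f \<otimes> (h \<otimes> a)))"
      proof (rule to_B_cong)
        have "e \<otimes> (g \<otimes> (f \<otimes> (h \<otimes> a))) \<otimes> e = e \<otimes> g \<otimes> f \<otimes> h \<otimes> (a \<otimes> e)"
          using f gh a(1) by (simp add: m_assoc)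
        then show "e \<otimes> (g \<otimes> f \<otimes> h \<otimes> e \<otimes> f1) \<otimes> e = e \<otimes> (g \<otimes> (f \<otimes> (h \<otimes> a))) \<otimes> e"
          unfolding a(2) using f gh f1 by (simp add: m_assoc)
      qed
      finally show ?thesis using z gh a by (simp add: R_m_closed)
    qed
    moreover have "to_B (g \<otimes> (f \<otimes> h)) \<odot>\<^bsub>M\<^esub> m0 = \<zero>\<^bsub>M\<^esub>"
      if f: "f \<in> corner_ann M" and gh: "g \<in> carrier R" "h \<in> carrier R" for f g h
    proof -
      have "f \<in> carrier R" "to_B (g \<otimes> f \<otimes> h) \<odot>\<^bsub>M\<^esub> m0 = \<zero>\<^bsub>M\<^esub>"
        using f gh m0(1) unfolding corner_ann_def by blast+
      then show ?thesis using gh by (simp add: m_assoc)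
    qed
    moreover have "f \<odot>\<^bsub>N\<^esub> \<theta> h = \<zero>\<^bsub>N\<^esub> \<longleftrightarrow> (\<forall>g \<in> carrier R. to_B (g \<otimes> (f \<otimes> h)) \<odot>\<^bsub>M\<^esub> m0 = \<zero>\<^bsub>M\<^esub>)"
      if "f \<in> carrier R" "h \<in> carrier R" for f h
      using that m0(1) by (simp add: N(2) N_smult \<theta>_eq)
    then have "f \<in> annihilator R N \<longleftrightarrow> f \<in> carrier R \<and> (\<forall>h \<in> carrier R. \<forall>g \<in> carrier R.
        to_B (g \<otimes> (f \<otimes> h)) \<odot>\<^bsub>M\<^esub> m0 = \<zero>\<^bsub>M\<^esub>)" for f
      by (auto simp: annihilator_def N(1))
    ultimately have "f \<in> annihilator R N \<longleftrightarrow> f \<in> corner_ann M" for f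
      by (auto simp: corner_ann_def)
    then show ?thesis by blast
  qed
  ultimately show ?thesis by blast
qed

end

section \<open>From modules over the ring to modules over the corner\<close>

locale corner_ring_module = corner F R B L e \<iota> \<kappa> lact ract + N: left_module R N
  for F :: "('r, 'c) ring_scheme" (structure) and R B :: "'r ring" and L :: "'r monoid"
    and e :: 'r and \<iota> \<kappa> :: "'r \<Rightarrow> 'r" and lact ract :: "'r \<Rightarrow> 'r \<Rightarrow> 'r"
    and N :: "('r, 'm, 'd) module_scheme" +
  \<comment> \<open>That is, \<open>R N = N\<close>. As \<open>R\<close> may lack a unit, this is
    what makes the unit of \<open>B\<close> act as the identity on the quotients.\<close>
  assumes generated: "generate (add_monoid N) {r \<odot>\<^bsub>N\<^esub> n | r n. r \<in> carrier R \<and> n \<in> carrier N} = carrier N"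
begin

lemma r_add: "\<lbrakk>a \<in> carrier R; b \<in> carrier R; n \<in> carrier N\<rbrakk>
    \<Longrightarrow> (a \<oplus> b) \<odot>\<^bsub>N\<^esub> n = a \<odot>\<^bsub>N\<^esub> n \<oplus>\<^bsub>N\<^esub> b \<odot>\<^bsub>N\<^esub> n"
  using N.lsmult_l_distr[of a b n] by simp

lemma r_mult: "\<lbrakk>a \<in> carrier R; b \<in> carrier R; n \<in> carrier N\<rbrakk>
    \<Longrightarrow> (a \<otimes> b) \<odot>\<^bsub>N\<^esub> n = a \<odot>\<^bsub>N\<^esub> (b \<odot>\<^bsub>N\<^esub> n)"
  using N.lsmult_assoc[of a b n] by simp

lemma r_zero: "n \<in> carrier N \<Longrightarrow> \<zero> \<odot>\<^bsub>N\<^esub> n = \<zero>\<^bsub>N\<^esub>"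
  by (rule N.add_idem_zero) (simp_all add: N.lsmult_closed R_sub flip: r_add)

lemma r_zero_right: "a \<in> carrier R \<Longrightarrow> a \<odot>\<^bsub>N\<^esub> \<zero>\<^bsub>N\<^esub> = \<zero>\<^bsub>N\<^esub>"
  by (rule N.add_idem_zero) (simp_all add: N.lsmult_closed flip: N.lsmult_r_distr)

lemma r_neg': "\<lbrakk>a \<in> carrier R; n \<in> carrier N\<rbrakk> \<Longrightarrow> (\<ominus> a) \<odot>\<^bsub>N\<^esub> n = \<ominus>\<^bsub>N\<^esub> (a \<odot>\<^bsub>N\<^esub> n)"
  using r_add[of "\<ominus> a" a n]
  by (intro N.minus_equality[symmetric]) (auto simp: N.lsmult_closed R_sub l_neg r_zero)

lemma r_neg_right: "\<lbrakk>a \<in> carrier R; n \<in> carrier N\<rbrakk> \<Longrightarrow> a \<odot>\<^bsub>N\<^esub> (\<ominus>\<^bsub>N\<^esub> n) = \<ominus>\<^bsub>N\<^esub> (a \<odot>\<^bsub>N\<^esub> n)"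
  using N.lsmult_r_distr[of a "\<ominus>\<^bsub>N\<^esub> n" n]
  by (intro N.minus_equality[symmetric]) (auto simp: N.lsmult_closed N.l_neg r_zero_right)

lemma r_diff: "\<lbrakk>a \<in> carrier R; b \<in> carrier R; n \<in> carrier N\<rbrakk>
    \<Longrightarrow> (a \<ominus> b) \<odot>\<^bsub>N\<^esub> n = a \<odot>\<^bsub>N\<^esub> n \<ominus>\<^bsub>N\<^esub> b \<odot>\<^bsub>N\<^esub> n"
  by (simp add: a_minus_def r_add r_neg' R_sub)

lemma r_diff_right: "\<lbrakk>a \<in> carrier R; m \<in> carrier N; n \<in> carrier N\<rbrakk>
    \<Longrightarrow> a \<odot>\<^bsub>N\<^esub> (m \<ominus>\<^bsub>N\<^esub> n) = a \<odot>\<^bsub>N\<^esub> m \<ominus>\<^bsub>N\<^esub> a \<odot>\<^bsub>N\<^esub> n"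
  by (simp add: a_minus_def N.lsmult_r_distr r_neg_right)

text \<open>
  Stable subgroups \<open>K\<close> are those for which \<open>(e a e) \<cdot> [n] = [a n]\<close>, for \<open>a \<in> R\<close> with \<open>e a = e a e\<close>,
  is a well-defined action of the corner on \<open>N / K\<close>. The quotient is carried by chosen representatives,
  so that it stays inside the type of \<open>N\<close>.
\<close>

definition stable :: "'m set \<Rightarrow> bool" where
  "stable K \<longleftrightarrow> subgroup K (add_monoid N) \<and>
     (\<forall>f \<in> carrier R. \<forall>n \<in> carrier N. e \<otimes> f = \<zero> \<longrightarrow> f \<odot>\<^bsub>N\<^esub> n \<in> K) \<and>
     (\<forall>a \<in> carrier R. \<forall>n \<in> K. e \<otimes> a = e \<otimes> a \<otimes> e \<longrightarrow> a \<odot>\<^bsub>N\<^esub> n \<in> K)"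

definition rep :: "'m set \<Rightarrow> 'm \<Rightarrow> 'm" where
  "rep K n = (SOME n'. n' \<in> carrier N \<and> n' \<ominus>\<^bsub>N\<^esub> n \<in> K)"

text \<open>A representative in \<open>R\<close> of the corner element, available by
  \<open>row\<close>. As the corner element ends in \<open>e\<close>, the third condition of
  \<open>stable\<close> applies to it.\<close>

definition lift :: "'r \<Rightarrow> 'r" where
  "lift b = (SOME a. a \<in> carrier R \<and> e \<otimes> a = \<iota> b)"

definition quot :: "'m set \<Rightarrow> ('r, 'm) module" where
  "quot K = \<lparr>carrier = rep K ` carrier N, monoid.mult = undefined, one = undefined,
     ring.zero = rep K \<zero>\<^bsub>N\<^esub>, ring.add = (\<lambda>u v. rep K (u \<oplus>\<^bsub>N\<^esub> v)),
     smult = (\<lambda>b u. rep K (lift b \<odot>\<^bsub>N\<^esub> u))\<rparr>"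

lemma lift:
  assumes "b \<in> carrier B" shows "lift b \<in> carrier R" "e \<otimes> lift b = \<iota> b"
proof -
  obtain f where f: "f \<in> carrier F" "\<iota> b = e \<otimes> f \<otimes> e" using iota_corner_obtain[OF assms] by blast
  then have "\<exists>a. a \<in> carrier R \<and> e \<otimes> a = \<iota> b"
    using row[of "f \<otimes> e"] by (auto simp: m_assoc)
  then have "lift b \<in> carrier R \<and> e \<otimes> lift b = \<iota> b" unfolding lift_def by (rule someI_ex)
  then show "lift b \<in> carrier R" "e \<otimes> lift b = \<iota> b" by auto
qed

lemma lift_e:
  assumes b: "b \<in> carrier B" shows "e \<otimes> lift b = e \<otimes> lift b \<otimes> e"
proof -
  obtain f where "f \<in> carrier F" "\<iota> b = e \<otimes> f \<otimes> e" using iota_corner_obtain[OF b] by blast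
  then show ?thesis unfolding lift(2)[OF b] by (simp add: m_assoc)
qed

context
  fixes K assumes K: "stable K"
begin

lemma stableD:
  shows "subgroup K (add_monoid N)"
    and "\<And>f n. \<lbrakk>f \<in> carrier R; n \<in> carrier N; e \<otimes> f = \<zero>\<rbrakk> \<Longrightarrow> f \<odot>\<^bsub>N\<^esub> n \<in> K"
    and "\<And>a n. \<lbrakk>a \<in> carrier R; n \<in> K; e \<otimes> a = e \<otimes> a \<otimes> e\<rbrakk> \<Longrightarrow> a \<odot>\<^bsub>N\<^esub> n \<in> K"
  using K by (auto simp: stable_def)

lemmas K_sub = N.add_subgroupD[OF stableD(1)]

lemma K_N: "n \<in> K \<Longrightarrow> n \<in> carrier N"
  using K_sub(1) by blast

lemma rep:
  assumes "n \<in> carrier N" shows "rep K n \<in> carrier N" "rep K n \<ominus>\<^bsub>N\<^esub> n \<in> K"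
proof -
  have "n \<in> carrier N \<and> n \<ominus>\<^bsub>N\<^esub> n \<in> K"
    using assms K_sub(2) by (simp add: a_minus_def N.r_neg)
  then have "rep K n \<in> carrier N \<and> rep K n \<ominus>\<^bsub>N\<^esub> n \<in> K" unfolding rep_def by (rule someI)
  then show "rep K n \<in> carrier N" "rep K n \<ominus>\<^bsub>N\<^esub> n \<in> K" by auto
qed

lemma diff_trans: "\<lbrakk>l \<in> carrier N; m \<in> carrier N; n \<in> carrier N; l \<ominus>\<^bsub>N\<^esub> m \<in> K; m \<ominus>\<^bsub>N\<^esub> n \<in> K\<rbrakk>
    \<Longrightarrow> l \<ominus>\<^bsub>N\<^esub> n \<in> K"
proof -
  assume a: "l \<in> carrier N" "m \<in> carrier N" "n \<in> carrier N" "l \<ominus>\<^bsub>N\<^esub> m \<in> K" "m \<ominus>\<^bsub>N\<^esub> n \<in> K"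
  have "(l \<ominus>\<^bsub>N\<^esub> m) \<oplus>\<^bsub>N\<^esub> (m \<ominus>\<^bsub>N\<^esub> n) = l \<ominus>\<^bsub>N\<^esub> n"
    using a(1-3) by (simp add: a_minus_def N.a_assoc N.r_neg1)
  then show ?thesis using K_sub(3)[OF a(4,5)] by simp
qed

lemma diff_sym: "\<lbrakk>m \<in> carrier N; n \<in> carrier N; m \<ominus>\<^bsub>N\<^esub> n \<in> K\<rbrakk> \<Longrightarrow> n \<ominus>\<^bsub>N\<^esub> m \<in> K"
proof -
  assume a: "m \<in> carrier N" "n \<in> carrier N" "m \<ominus>\<^bsub>N\<^esub> n \<in> K"
  have "\<ominus>\<^bsub>N\<^esub> (m \<ominus>\<^bsub>N\<^esub> n) = n \<ominus>\<^bsub>N\<^esub> m"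
    using a(1-2) by (simp add: a_minus_def N.minus_add N.a_comm)
  then show ?thesis using K_sub(4)[OF a(3)] by simp
qed

lemma rep_eq:
  assumes "m \<in> carrier N" "n \<in> carrier N"
  shows "rep K m = rep K n \<longleftrightarrow> m \<ominus>\<^bsub>N\<^esub> n \<in> K"
proof
  assume "rep K m = rep K n"
  then have "m \<ominus>\<^bsub>N\<^esub> rep K n \<in> K" using diff_sym[OF rep(1)[OF assms(1)] assms(1)] rep(2)[OF assms(1)] by simp
  then show "m \<ominus>\<^bsub>N\<^esub> n \<in> K"
    using diff_trans[of m "rep K n" n] rep[OF assms(2)] assms by blast
next
  assume d: "m \<ominus>\<^bsub>N\<^esub> n \<in> K"
  have "(n' \<in> carrier N \<and> n' \<ominus>\<^bsub>N\<^esub> m \<in> K) \<longleftrightarrow> (n' \<in> carrier N \<and> n' \<ominus>\<^bsub>N\<^esub> n \<in> K)" for n'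
    using diff_trans[of n' m n] diff_trans[of n' n m] diff_sym[OF assms d] d assms by blast
  then show "rep K m = rep K n" by (simp add: rep_def)
qed

lemma rep_zero_iff: "n \<in> carrier N \<Longrightarrow> rep K n = rep K \<zero>\<^bsub>N\<^esub> \<longleftrightarrow> n \<in> K"
  by (simp add: rep_eq a_minus_def)

lemma rep_add:
  assumes "m \<in> carrier N" "n \<in> carrier N"
  shows "rep K (rep K m \<oplus>\<^bsub>N\<^esub> rep K n) = rep K (m \<oplus>\<^bsub>N\<^esub> n)"
proof -
  have "(rep K m \<oplus>\<^bsub>N\<^esub> rep K n) \<ominus>\<^bsub>N\<^esub> (m \<oplus>\<^bsub>N\<^esub> n) = (rep K m \<ominus>\<^bsub>N\<^esub> m) \<oplus>\<^bsub>N\<^esub> (rep K n \<ominus>\<^bsub>N\<^esub> n)"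
    using assms rep(1) by (simp add: a_minus_def N.minus_add N.a_ac)
  then show ?thesis using assms rep K_sub(3) by (simp add: rep_eq)
qed

text \<open>Changing the representative of the class of \<open>n\<close> costs an element of
  \<open>K\<close> by the third condition of \<open>stable\<close>. Changing the lift of
  \<open>b\<close> costs one by the second, since two lifts differ by some \<open>f\<close> with
  \<open>e f = 0\<close>.\<close>

lemma rep_smult:
  assumes b: "b \<in> carrier B" and a: "a \<in> carrier R" "e \<otimes> a = \<iota> b" and n: "n \<in> carrier N"
  shows "rep K (lift b \<odot>\<^bsub>N\<^esub> rep K n) = rep K (a \<odot>\<^bsub>N\<^esub> n)"
proof -
  note l = lift[OF b]
  have "lift b \<odot>\<^bsub>N\<^esub> (rep K n \<ominus>\<^bsub>N\<^esub> n) \<in> K"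
    using l(1) rep(2)[OF n] lift_e[OF b] by (rule stableD)
  then have 1: "lift b \<odot>\<^bsub>N\<^esub> rep K n \<ominus>\<^bsub>N\<^esub> lift b \<odot>\<^bsub>N\<^esub> n \<in> K"
    using l n rep(1)[OF n] by (simp add: r_diff_right)
  have "e \<otimes> (lift b \<ominus> a) = \<zero>"
    using l a b by (simp add: a_minus_def r_distr r_minus r_neg iota_closed)
  then have "(lift b \<ominus> a) \<odot>\<^bsub>N\<^esub> n \<in> K"
    using l a n R_sub(5) by (intro stableD) auto
  then have 2: "lift b \<odot>\<^bsub>N\<^esub> n \<ominus>\<^bsub>N\<^esub> a \<odot>\<^bsub>N\<^esub> n \<in> K"
    using l a n by (simp add: r_diff)
  show ?thesis
    using diff_trans[OF _ _ _ 1 2] l a n rep(1)[OF n] by (simp add: rep_eq N.lsmult_closed)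
qed

lemma quot_simps: "carrier (quot K) = rep K ` carrier N" "\<zero>\<^bsub>quot K\<^esub> = rep K \<zero>\<^bsub>N\<^esub>"
  "\<And>m n. \<lbrakk>m \<in> carrier N; n \<in> carrier N\<rbrakk> \<Longrightarrow> rep K m \<oplus>\<^bsub>quot K\<^esub> rep K n = rep K (m \<oplus>\<^bsub>N\<^esub> n)"
  "\<And>a b n. \<lbrakk>b \<in> carrier B; a \<in> carrier R; e \<otimes> a = \<iota> b; n \<in> carrier N\<rbrakk>
    \<Longrightarrow> b \<odot>\<^bsub>quot K\<^esub> rep K n = rep K (a \<odot>\<^bsub>N\<^esub> n)"
  by (simp_all add: quot_def rep_add rep_smult)

lemma quot_lift: "\<lbrakk>b \<in> carrier B; n \<in> carrier N\<rbrakk> \<Longrightarrow> b \<odot>\<^bsub>quot K\<^esub> rep K n = rep K (lift b \<odot>\<^bsub>N\<^esub> n)"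
  by (rule quot_simps) (simp_all add: lift)

lemma quot_abelian: "abelian_group (quot K)"
proof (rule abelian_groupI)
  show "\<exists>y\<in>carrier (quot K). y \<oplus>\<^bsub>quot K\<^esub> x = \<zero>\<^bsub>quot K\<^esub>" if x: "x \<in> carrier (quot K)" for x
  proof -
    obtain n where "n \<in> carrier N" "x = rep K n" using x by (auto simp: quot_simps)
    then show ?thesis
      by (intro bexI[of _ "rep K (\<ominus>\<^bsub>N\<^esub> n)"]) (auto simp: quot_simps N.l_neg)
  qed
qed (auto simp: quot_simps N.a_ac)

lemma quot_neg: "n \<in> carrier N \<Longrightarrow> \<ominus>\<^bsub>quot K\<^esub> rep K n = rep K (\<ominus>\<^bsub>N\<^esub> n)"
  using quot_abelian by (intro abelian_group.minus_equality) (auto simp: quot_simps N.l_neg)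

lemma quot_module: "unital_left_module B (quot K)"
proof -
  have "left_module B (quot K)"
  proof (intro left_module.intro left_module_axioms.intro quot_abelian)
    fix a b x y assume ab: "a \<in> carrier B" "b \<in> carrier B"
    show "a \<odot>\<^bsub>quot K\<^esub> x \<in> carrier (quot K)" if "x \<in> carrier (quot K)"
      using that ab by (auto simp: quot_simps(1) quot_lift lift N.lsmult_closed)
    show "(a \<oplus>\<^bsub>B\<^esub> b) \<odot>\<^bsub>quot K\<^esub> x = a \<odot>\<^bsub>quot K\<^esub> x \<oplus>\<^bsub>quot K\<^esub> b \<odot>\<^bsub>quot K\<^esub> x" if x: "x \<in> carrier (quot K)"
    proof -
      obtain n where n: "n \<in> carrier N" "x = rep K n" using x by (auto simp: quot_simps)
      have "(a \<oplus>\<^bsub>B\<^esub> b) \<odot>\<^bsub>quot K\<^esub> x = rep K ((lift a \<oplus> lift b) \<odot>\<^bsub>N\<^esub> n)"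
        unfolding n by (rule quot_simps) (use ab n in \<open>auto simp: B_add lift R_sub r_distr\<close>)
      then show ?thesis using ab n by (simp add: quot_lift quot_simps lift N.lsmult_closed r_add)
    qed
    show "a \<odot>\<^bsub>quot K\<^esub> (x \<oplus>\<^bsub>quot K\<^esub> y) = a \<odot>\<^bsub>quot K\<^esub> x \<oplus>\<^bsub>quot K\<^esub> a \<odot>\<^bsub>quot K\<^esub> y"
      if "x \<in> carrier (quot K)" "y \<in> carrier (quot K)"
      using that ab by (auto simp: quot_simps(1-3) quot_lift lift N.lsmult_closed N.lsmult_r_distr)
    show "(a \<otimes>\<^bsub>B\<^esub> b) \<odot>\<^bsub>quot K\<^esub> x = a \<odot>\<^bsub>quot K\<^esub> (b \<odot>\<^bsub>quot K\<^esub> x)" if x: "x \<in> carrier (quot K)"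
    proof -
      obtain n where n: "n \<in> carrier N" "x = rep K n" using x by (auto simp: quot_simps)
      \<comment> \<open>A lift \<open>a\<close> satisfies \<open>e a = e a e\<close>, so the product
        of two lifts is a lift of the product.\<close>
      have "e \<otimes> (lift a \<otimes> lift b) = (e \<otimes> lift a \<otimes> e) \<otimes> lift b"
        using lift(1)[OF ab(1)] lift(1)[OF ab(2)] unfolding lift_e[OF ab(1), symmetric] by (simp add: m_assoc)
      also have "\<dots> = (e \<otimes> lift a) \<otimes> (e \<otimes> lift b)"
        using lift(1)[OF ab(1)] lift(1)[OF ab(2)] by (simp add: m_assoc)
      finally have *: "e \<otimes> (lift a \<otimes> lift b) = \<iota> a \<otimes> \<iota> b"
        using lift(2)[OF ab(1)] lift(2)[OF ab(2)] by simp
      have "(a \<otimes>\<^bsub>B\<^esub> b) \<odot>\<^bsub>quot K\<^esub> x = rep K ((lift a \<otimes> lift b) \<odot>\<^bsub>N\<^esub> n)"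
        unfolding n by (rule quot_simps) (use ab n * in \<open>auto simp: B_mult lift R_m_closed\<close>)
      then show ?thesis using ab n by (simp add: quot_lift lift N.lsmult_closed r_mult)
    qed
  qed
  moreover have "\<one>\<^bsub>B\<^esub> \<odot>\<^bsub>quot K\<^esub> x = x" if x: "x \<in> carrier (quot K)" for x
  proof -
    obtain n where n: "n \<in> carrier N" "x = rep K n" using x by (auto simp: quot_simps)
    obtain a where a: "a \<in> carrier R" "e \<otimes> a = e" using obtain_unit_row by blast
    \<comment> \<open>Unitality modulo \<open>K\<close>: for \<open>r\<close> in \<open>R\<close>
      the difference \<open>a r - r\<close> is killed by \<open>e\<close> on the left, so
      \<open>H\<close> contains all \<open>r n\<close>. As \<open>H\<close> is a subgroup,
      \<open>generated\<close> gives everything.\<close>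
    define H where "H = {n \<in> carrier N. a \<odot>\<^bsub>N\<^esub> n \<ominus>\<^bsub>N\<^esub> n \<in> K}"
    have "subgroup H (add_monoid N)"
    proof (rule N.add_subgroupI)
      show "x \<oplus>\<^bsub>N\<^esub> y \<in> H" if "x \<in> H" "y \<in> H" for x y
      proof -
        have "(a \<odot>\<^bsub>N\<^esub> x \<ominus>\<^bsub>N\<^esub> x) \<oplus>\<^bsub>N\<^esub> (a \<odot>\<^bsub>N\<^esub> y \<ominus>\<^bsub>N\<^esub> y) = a \<odot>\<^bsub>N\<^esub> (x \<oplus>\<^bsub>N\<^esub> y) \<ominus>\<^bsub>N\<^esub> (x \<oplus>\<^bsub>N\<^esub> y)"
          using that a by (simp add: H_def a_minus_def N.minus_add N.a_ac N.lsmult_closed N.lsmult_r_distr)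
        then show ?thesis using that K_sub(3)[of "a \<odot>\<^bsub>N\<^esub> x \<ominus>\<^bsub>N\<^esub> x" "a \<odot>\<^bsub>N\<^esub> y \<ominus>\<^bsub>N\<^esub> y"] by (simp add: H_def)
      qed
      show "\<ominus>\<^bsub>N\<^esub> x \<in> H" if "x \<in> H" for x
      proof -
        have "\<ominus>\<^bsub>N\<^esub> (a \<odot>\<^bsub>N\<^esub> x \<ominus>\<^bsub>N\<^esub> x) = a \<odot>\<^bsub>N\<^esub> (\<ominus>\<^bsub>N\<^esub> x) \<ominus>\<^bsub>N\<^esub> (\<ominus>\<^bsub>N\<^esub> x)"
          using that a by (simp add: H_def a_minus_def N.minus_add N.lsmult_closed r_neg_right)
        then show ?thesis using that K_sub(4)[of "a \<odot>\<^bsub>N\<^esub> x \<ominus>\<^bsub>N\<^esub> x"] by (simp add: H_def)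
      qed
    qed (use a K_sub(2) in \<open>auto simp: H_def r_zero_right a_minus_def\<close>)
    moreover have "{r \<odot>\<^bsub>N\<^esub> n | r n. r \<in> carrier R \<and> n \<in> carrier N} \<subseteq> H"
    proof clarify
      fix r n assume rn: "r \<in> carrier R" "n \<in> carrier N"
      have "e \<otimes> (a \<otimes> r \<ominus> r) = e \<otimes> a \<otimes> r \<ominus> e \<otimes> r"
        using rn a(1) by (simp add: a_minus_def r_distr r_minus m_assoc)
      then have "e \<otimes> (a \<otimes> r \<ominus> r) = \<zero>" using a rn by (simp add: a_minus_def r_neg)
      then have "(a \<otimes> r \<ominus> r) \<odot>\<^bsub>N\<^esub> n \<in> K" using a rn by (intro stableD) (auto simp: R_sub R_m_closed)
      then show "r \<odot>\<^bsub>N\<^esub> n \<in> H" using a rn by (simp add: H_def r_diff r_mult R_m_closed N.lsmult_closed)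
    qed
    ultimately have "generate (add_monoid N) {r \<odot>\<^bsub>N\<^esub> n | r n. r \<in> carrier R \<and> n \<in> carrier N} \<subseteq> H"
      by (intro group.generate_subgroup_incl[OF N.a_group])
    then have "carrier N \<subseteq> H" unfolding generated .
    then have "a \<odot>\<^bsub>N\<^esub> n \<ominus>\<^bsub>N\<^esub> n \<in> K" using n by (auto simp: H_def)
    then have "rep K (a \<odot>\<^bsub>N\<^esub> n) = rep K n" using a n by (simp add: rep_eq N.lsmult_closed)
    moreover have "\<one>\<^bsub>B\<^esub> \<odot>\<^bsub>quot K\<^esub> rep K n = rep K (a \<odot>\<^bsub>N\<^esub> n)"
      using a n B_one by (intro quot_simps) auto
    ultimately show ?thesis using n by simp
  qed
  ultimately show ?thesis
    by (simp add: unital_left_module_def unital_left_module_axioms_def)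
qed

text \<open>Preimages in \<open>N\<close> replace submodules of the quotient by stable subgroups
  above \<open>K\<close>. An \<open>a\<close> with \<open>e a = e a e\<close> is a lift of its own
  compression, so closure under \<open>B\<close> yields the third condition.\<close>

lemma stable_of_submodule:
  assumes H: "submodule H B (quot K)"
  defines "P \<equiv> {n \<in> carrier N. rep K n \<in> H}"
  shows "stable P" "K \<subseteq> P" "H = rep K ` P"
proof -
  interpret H: submodule H B "quot K" by (rule H)
  have HQ: "H \<subseteq> rep K ` carrier N" using H.subset by (simp add: quot_simps)
  have zero: "rep K \<zero>\<^bsub>N\<^esub> \<in> H" using H.one_closed by (simp add: quot_simps)
  show KP: "K \<subseteq> P"
  proof
    fix n assume "n \<in> K"
    then have "n \<in> carrier N" "rep K n = rep K \<zero>\<^bsub>N\<^esub>" using K_N rep_zero_iff by auto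
    then show "n \<in> P" using zero by (simp add: P_def)
  qed
  have "subgroup P (add_monoid N)"
  proof (rule N.add_subgroupI)
    show "x \<oplus>\<^bsub>N\<^esub> y \<in> P" if "x \<in> P" "y \<in> P" for x y
      using that H.m_closed[of "rep K x" "rep K y"] by (simp add: P_def quot_simps)
    show "\<ominus>\<^bsub>N\<^esub> x \<in> P" if "x \<in> P" for x
      using that H.m_inv_closed[of "rep K x"] by (simp add: P_def quot_neg flip: a_inv_def)
  qed (use zero in \<open>auto simp: P_def\<close>)
  moreover have "a \<odot>\<^bsub>N\<^esub> n \<in> P" if a: "a \<in> carrier R" "e \<otimes> a = e \<otimes> a \<otimes> e" and n: "n \<in> P" for a n
  proof -
    have "to_B a \<odot>\<^bsub>quot K\<^esub> rep K n = rep K (a \<odot>\<^bsub>N\<^esub> n)"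
      using a n by (intro quot_simps) (auto simp: P_def)
    then show ?thesis using a n H.smult_closed[of "to_B a" "rep K n"] by (simp add: P_def N.lsmult_closed)
  qed
  ultimately show "stable P" using KP stableD(2) by (auto simp: stable_def)
  show "H = rep K ` P" using HQ by (auto simp: P_def)
qed

text \<open>The inverse of the previous passage: because \<open>P\<close> contains \<open>K\<close>,
  membership in \<open>P\<close> depends only on the class modulo \<open>K\<close>.\<close>

lemma submodule_of_stable:
  assumes P: "stable P" "K \<subseteq> P"
  shows "submodule (rep K ` P) B (quot K)" "{n \<in> carrier N. rep K n \<in> rep K ` P} = P"
proof -
  have Ps: "subgroup P (add_monoid N)"
    and Pa: "\<And>a n. \<lbrakk>a \<in> carrier R; n \<in> P; e \<otimes> a = e \<otimes> a \<otimes> e\<rbrakk> \<Longrightarrow> a \<odot>\<^bsub>N\<^esub> n \<in> P"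
    using P by (auto simp: stable_def)
  note Psub = N.add_subgroupD[OF Ps]
  have PN: "n \<in> carrier N" if "n \<in> P" for n using Psub(1) that by blast
  show "submodule (rep K ` P) B (quot K)"
  proof (rule submoduleI'[OF quot_abelian])
    show "b \<odot>\<^bsub>quot K\<^esub> x \<in> rep K ` P" if bx: "b \<in> carrier B" "x \<in> rep K ` P" for b x
    proof -
      obtain n where n: "n \<in> P" "x = rep K n" using bx by blast
      have "lift b \<odot>\<^bsub>N\<^esub> n \<in> P" using lift[OF bx(1)] lift_e[OF bx(1)] n by (intro Pa)
      then show ?thesis using n bx PN by (simp add: quot_lift)
    qed
  qed (use Psub PN in \<open>auto simp: quot_simps quot_neg\<close>)
  show "{n \<in> carrier N. rep K n \<in> rep K ` P} = P"
  proof (intro equalityI subsetI)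
    fix n assume "n \<in> {n \<in> carrier N. rep K n \<in> rep K ` P}"
    then obtain p where p: "n \<in> carrier N" "p \<in> P" "rep K n = rep K p" by blast
    then have "n \<ominus>\<^bsub>N\<^esub> p \<in> P" using PN P by (auto simp: rep_eq)
    then have "(n \<ominus>\<^bsub>N\<^esub> p) \<oplus>\<^bsub>N\<^esub> p \<in> P" using p Psub by blast
    then show "n \<in> P" using p PN by (simp add: N.diff_add_cancel)
  qed (use PN in auto)
qed

end

text \<open>The smallest stable subgroup; \<open>N\<close> modulo it plays the role of the stalk of \<open>N\<close>.\<close>

definition germ_kernel :: "'m set" where
  "germ_kernel = generate (add_monoid N) {f \<odot>\<^bsub>N\<^esub> n | f n. f \<in> carrier R \<and> n \<in> carrier N \<and> e \<otimes> f = \<zero>}"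

text \<open>If \<open>e a = e a e\<close> and \<open>e f = 0\<close>, then
  \<open>e a f = e a e f = 0\<close>, so \<open>a\<close> maps generators to generators.\<close>

lemma stable_germ_kernel: "stable germ_kernel"
proof -
  let ?S = "{f \<odot>\<^bsub>N\<^esub> n | f n. f \<in> carrier R \<and> n \<in> carrier N \<and> e \<otimes> f = \<zero>}"
  have S: "?S \<subseteq> carrier (add_monoid N)" by (auto simp: N.lsmult_closed)
  have sub: "subgroup germ_kernel (add_monoid N)"
    unfolding germ_kernel_def by (rule group.generate_is_subgroup[OF N.a_group S])
  have incl: "f \<odot>\<^bsub>N\<^esub> n \<in> germ_kernel" if "f \<in> carrier R" "n \<in> carrier N" "e \<otimes> f = \<zero>" for f n
    unfolding germ_kernel_def by (rule generate.incl) (use that in blast)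
  note Ksub = N.add_subgroupD[OF sub]
  have "a \<odot>\<^bsub>N\<^esub> n \<in> germ_kernel"
    if a: "a \<in> carrier R" "e \<otimes> a = e \<otimes> a \<otimes> e" and n: "n \<in> germ_kernel" for a n
  proof -
    let ?H = "{n \<in> carrier N. a \<odot>\<^bsub>N\<^esub> n \<in> germ_kernel}"
    have "subgroup ?H (add_monoid N)"
      by (rule N.add_subgroupI) (use a Ksub in \<open>auto simp: r_zero_right r_neg_right N.lsmult_r_distr\<close>)
    moreover have "?S \<subseteq> ?H"
    proof clarify
      fix f n assume fn: "f \<in> carrier R" "n \<in> carrier N" "e \<otimes> f = \<zero>"
      have "e \<otimes> (a \<otimes> f) = e \<otimes> a \<otimes> e \<otimes> f" using a fn by (metis R_F e_closed m_assoc)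
      also have "\<dots> = \<zero>" using a(1) fn by (simp add: m_assoc)
      finally have "(a \<otimes> f) \<odot>\<^bsub>N\<^esub> n \<in> germ_kernel" using a fn by (intro incl) (auto simp: R_m_closed)
      then show "f \<odot>\<^bsub>N\<^esub> n \<in> carrier N \<and> a \<odot>\<^bsub>N\<^esub> (f \<odot>\<^bsub>N\<^esub> n) \<in> germ_kernel"
        using a fn by (simp add: r_mult N.lsmult_closed)
    qed
    ultimately have "germ_kernel \<subseteq> ?H"
      unfolding germ_kernel_def by (intro group.generate_subgroup_incl[OF N.a_group])
    then show ?thesis using n by blast
  qed
  then show ?thesis using sub incl by (auto simp: stable_def)
qed

text \<open>Simplicity enters in the second inclusion. There \<open>corner_ann\<close> is a left
  ideal, so its product with \<open>N\<close> is a submodule, and rewriting the row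
  \<open>e f\<close> with \<open>row_factor\<close> shows that this product lies in the proper
  subgroup \<open>P\<close>.\<close>

lemma annihilator_eq_corner_ann:
  assumes simple: "simple_left_module R N" and P: "stable P" "P \<noteq> carrier N"
  shows "annihilator R N = corner_ann (quot P)"
proof (intro equalityI subsetI)
  fix f assume f: "f \<in> annihilator R N"
  then have fR: "f \<in> carrier R" by (simp add: annihilator_def)
  have "to_B (g \<otimes> f \<otimes> h) \<odot>\<^bsub>quot P\<^esub> x = \<zero>\<^bsub>quot P\<^esub>"
    if gh: "g \<in> carrier R" "h \<in> carrier R" and x: "x \<in> carrier (quot P)" for g h x
  proof -
    obtain n where n: "n \<in> carrier N" "x = rep P n" using x by (auto simp: quot_simps[OF P(1)])
    have gfh: "g \<otimes> f \<otimes> h \<in> carrier R" using gh fR by (simp add: R_m_closed)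
    \<comment> \<open>A corner element acts on the quotient through an element of \<open>R\<close>
      with the same row; for the compression of \<open>g f h\<close> this is
      \<open>g f h s\<close>.\<close>
    obtain s where s: "s \<in> carrier R" "e \<otimes> (g \<otimes> f \<otimes> h) \<otimes> s = e \<otimes> (g \<otimes> f \<otimes> h) \<otimes> e"
      using right_cut[OF gfh] by blast
    have "to_B (g \<otimes> f \<otimes> h) \<odot>\<^bsub>quot P\<^esub> rep P n = rep P ((g \<otimes> f \<otimes> h \<otimes> s) \<odot>\<^bsub>N\<^esub> n)"
    proof (rule quot_simps(4)[OF P(1)])
      have "e \<otimes> (g \<otimes> f \<otimes> h \<otimes> s) = e \<otimes> (g \<otimes> f \<otimes> h) \<otimes> s"
        using s(1) gfh by (simp only: m_assoc R_F e_closed)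
      then show "e \<otimes> (g \<otimes> f \<otimes> h \<otimes> s) = \<iota> (to_B (g \<otimes> f \<otimes> h))"
        using s(2) gfh by simp
    qed (use gfh s n in \<open>auto simp: R_m_closed\<close>)
    also have "(g \<otimes> f \<otimes> h \<otimes> s) \<odot>\<^bsub>N\<^esub> n = g \<odot>\<^bsub>N\<^esub> (f \<odot>\<^bsub>N\<^esub> (h \<odot>\<^bsub>N\<^esub> (s \<odot>\<^bsub>N\<^esub> n)))"
      using gh fR s(1) n(1) by (simp add: r_mult R_m_closed N.lsmult_closed)
    also have "f \<odot>\<^bsub>N\<^esub> (h \<odot>\<^bsub>N\<^esub> (s \<odot>\<^bsub>N\<^esub> n)) = \<zero>\<^bsub>N\<^esub>"
      using f gh s(1) n(1) N.lsmult_closed by (simp add: annihilator_def)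
    finally show ?thesis using n gh by (simp add: quot_simps(2)[OF P(1)] r_zero_right)
  qed
  then show "f \<in> corner_ann (quot P)" using fR by (auto simp: corner_ann_def)
next
  let ?I = "corner_ann (quot P)"
  have IR: "f \<in> carrier R" if "f \<in> ?I" for f using that by (simp add: corner_ann_def)
  note Psub = N.add_subgroupD[OF stableD(1)[OF P(1)]]
  have IP: "f \<odot>\<^bsub>N\<^esub> n \<in> P" if f: "f \<in> ?I" and n: "n \<in> carrier N" for f n
  proof -
    have fR: "f \<in> carrier R" using f by (rule IR)
    \<comment> \<open>\<open>S\<close> collects the rows \<open>e a\<close> of elements
      \<open>a\<close> that send \<open>n\<close> into \<open>P\<close>. Whether \<open>a n\<close>
      lies in \<open>P\<close> depends only on \<open>e a\<close>, so it suffices to place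
      \<open>e f\<close> in \<open>S\<close>.\<close>
    define S where "S = {h \<in> carrier F. \<exists>a \<in> carrier R. e \<otimes> a = h \<and> a \<odot>\<^bsub>N\<^esub> n \<in> P}"
    have "subgroup S (add_monoid F)"
    proof (rule F.add_subgroupI)
      show "\<zero> \<in> S" using n Psub R_sub by (auto simp: S_def r_zero intro!: bexI[of _ \<zero>])
      show "x \<oplus> y \<in> S" if xy: "x \<in> S" "y \<in> S" for x y
      proof -
        obtain a b where ab: "a \<in> carrier R" "b \<in> carrier R" "e \<otimes> a = x" "e \<otimes> b = y"
          "a \<odot>\<^bsub>N\<^esub> n \<in> P" "b \<odot>\<^bsub>N\<^esub> n \<in> P" using xy unfolding S_def by blast
        then have "e \<otimes> (a \<oplus> b) = x \<oplus> y" "(a \<oplus> b) \<odot>\<^bsub>N\<^esub> n \<in> P" "a \<oplus> b \<in> carrier R"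
          using n Psub R_sub by (auto simp: r_distr r_add)
        then show ?thesis using xy by (auto simp: S_def)
      qed
      show "\<ominus> x \<in> S" if x: "x \<in> S" for x
      proof -
        obtain a where a: "a \<in> carrier R" "e \<otimes> a = x" "a \<odot>\<^bsub>N\<^esub> n \<in> P" using x unfolding S_def by blast
        then have "e \<otimes> (\<ominus> a) = \<ominus> x" "(\<ominus> a) \<odot>\<^bsub>N\<^esub> n \<in> P" "\<ominus> a \<in> carrier R"
          using n Psub R_sub by (auto simp: r_minus r_neg')
        then show ?thesis using x by (auto simp: S_def)
      qed
    qed (auto simp: S_def)
    moreover have "{e \<otimes> f \<otimes> v \<otimes> e \<otimes> w | v w. v \<in> carrier R \<and> w \<in> carrier R} \<subseteq> S"
    proof clarify
      fix v w assume vw: "v \<in> carrier R" "w \<in> carrier R"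
      define b where "b = to_B (f \<otimes> v)"
      have b: "b \<in> carrier B" "\<iota> b = e \<otimes> (f \<otimes> v) \<otimes> e" using fR vw by (auto simp: b_def)
      have wn: "w \<odot>\<^bsub>N\<^esub> n \<in> carrier N" using vw n by (simp add: N.lsmult_closed)
      \<comment> \<open>\<open>corner_ann\<close> asks for a left factor from \<open>R\<close>; this
        \<open>g\<close> supplies one without changing the compression.\<close>
      obtain g where g: "g \<in> carrier R" "e \<otimes> g = e" using obtain_unit_row by blast
      have "e \<otimes> (g \<otimes> f \<otimes> v) \<otimes> e = (e \<otimes> g) \<otimes> (f \<otimes> v) \<otimes> e"
        using g(1) fR vw by (simp add: m_assoc)
      then have "to_B (g \<otimes> f \<otimes> v) = b" unfolding b_def g by (rule to_B_cong)
      then have "b \<odot>\<^bsub>quot P\<^esub> rep P (w \<odot>\<^bsub>N\<^esub> n) = \<zero>\<^bsub>quot P\<^esub>"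
        using f g(1) vw wn by (auto simp: corner_ann_def quot_simps(1)[OF P(1)])
      then have "rep P (lift b \<odot>\<^bsub>N\<^esub> (w \<odot>\<^bsub>N\<^esub> n)) = rep P \<zero>\<^bsub>N\<^esub>"
        using b wn by (simp add: quot_lift[OF P(1)] quot_simps(2)[OF P(1)])
      then have "(lift b \<otimes> w) \<odot>\<^bsub>N\<^esub> n \<in> P"
        using lift[OF b(1)] vw n wn by (simp add: r_mult rep_zero_iff[OF P(1)] N.lsmult_closed)
      moreover have "e \<otimes> (lift b \<otimes> w) = e \<otimes> f \<otimes> v \<otimes> e \<otimes> w"
      proof -
        have "e \<otimes> (lift b \<otimes> w) = (e \<otimes> lift b) \<otimes> w" using lift(1)[OF b(1)] vw by (simp add: m_assoc)
        then show ?thesis unfolding lift(2)[OF b(1)] b(2) using fR vw by (simp add: m_assoc)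
      qed
      ultimately show "e \<otimes> f \<otimes> v \<otimes> e \<otimes> w \<in> S"
        using lift(1)[OF b(1)] fR vw by (auto simp: S_def R_m_closed intro!: bexI[of _ "lift b \<otimes> w"])
    qed
    ultimately have "e \<otimes> f \<in> S"
      using row_factor[OF fR] group.generate_subgroup_incl[OF F.a_group, of _ S] by blast
    then obtain a where a: "a \<in> carrier R" "e \<otimes> a = e \<otimes> f" "a \<odot>\<^bsub>N\<^esub> n \<in> P" by (auto simp: S_def)
    have "e \<otimes> (f \<ominus> a) = e \<otimes> f \<ominus> e \<otimes> a" using a(1) fR by (simp add: a_minus_def r_distr r_minus)
    then have "e \<otimes> (f \<ominus> a) = \<zero>" using a fR by (simp add: a_minus_def r_neg)
    then have "(f \<ominus> a) \<odot>\<^bsub>N\<^esub> n \<in> P" using a fR n R_sub by (intro stableD[OF P(1)])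
    then have "(f \<ominus> a) \<odot>\<^bsub>N\<^esub> n \<oplus>\<^bsub>N\<^esub> a \<odot>\<^bsub>N\<^esub> n \<in> P" using a by (intro Psub)
    then show ?thesis using a(1) fR n by (simp add: r_diff N.diff_add_cancel N.lsmult_closed)
  qed
  have I_left: "r \<otimes> f \<in> ?I" if f: "f \<in> ?I" and r: "r \<in> carrier R" for f r
  proof -
    have "g \<otimes> (r \<otimes> f) \<otimes> h = (g \<otimes> r) \<otimes> f \<otimes> h" if "g \<in> carrier R" "h \<in> carrier R" for g h
      using that r IR[OF f] by (simp add: m_assoc)
    then show ?thesis using f r by (simp add: corner_ann_def R_m_closed)
  qed
  fix f assume f: "f \<in> ?I"
  \<comment> \<open>These products generate a submodule inside the proper subgroup \<open>P\<close>,
    which is therefore zero.\<close>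
  let ?S = "{g \<odot>\<^bsub>N\<^esub> n | g n. g \<in> ?I \<and> n \<in> carrier N}"
  let ?H = "generate (add_monoid N) ?S"
  have S: "?S \<subseteq> carrier (add_monoid N)" using IR by (auto simp: N.lsmult_closed)
  have H: "subgroup ?H (add_monoid N)" by (rule group.generate_is_subgroup[OF N.a_group S])
  note Hsub = N.add_subgroupD[OF H]
  have HP: "?H \<subseteq> P"
    by (rule group.generate_subgroup_incl[OF N.a_group _ stableD(1)[OF P(1)]]) (use IP in blast)
  have "r \<odot>\<^bsub>N\<^esub> x \<in> ?H" if r: "r \<in> carrier R" and x: "x \<in> ?H" for r x
  proof -
    let ?T = "{n \<in> carrier N. r \<odot>\<^bsub>N\<^esub> n \<in> ?H}"
    have "subgroup ?T (add_monoid N)"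
      by (rule N.add_subgroupI) (use r Hsub in \<open>auto simp: r_zero_right r_neg_right N.lsmult_r_distr\<close>)
    moreover have "?S \<subseteq> ?T"
    proof clarify
      fix g n assume gn: "g \<in> ?I" "n \<in> carrier N"
      have "(r \<otimes> g) \<odot>\<^bsub>N\<^esub> n \<in> ?H" using I_left[OF gn(1) r] gn(2) by (intro generate.incl) blast
      then show "g \<odot>\<^bsub>N\<^esub> n \<in> carrier N \<and> r \<odot>\<^bsub>N\<^esub> (g \<odot>\<^bsub>N\<^esub> n) \<in> ?H"
        using r gn IR by (simp add: r_mult N.lsmult_closed)
    qed
    ultimately have "?H \<subseteq> ?T" by (intro group.generate_subgroup_incl[OF N.a_group])
    then show ?thesis using x by blast
  qed
  then have "submodule ?H R N" using H by (simp add: submodule_def submodule_axioms_def)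
  moreover have "?H \<noteq> carrier N" using HP P(2) Psub(1) by blast
  ultimately have H0: "?H = {\<zero>\<^bsub>N\<^esub>}" using simple unfolding simple_left_module_def by blast
  have "f \<odot>\<^bsub>N\<^esub> n = \<zero>\<^bsub>N\<^esub>" if n: "n \<in> carrier N" for n
  proof -
    have "f \<odot>\<^bsub>N\<^esub> n \<in> ?H" by (rule generate.incl) (use f n in blast)
    then show ?thesis unfolding H0 by simp
  qed
  then show "f \<in> annihilator R N" using IR[OF f] by (simp add: annihilator_def)
qed

text \<open>The maximal submodule of the stalk is pulled back to a stable subgroup \<open>P\<close>
  of \<open>N\<close>, and \<open>N\<close> modulo \<open>P\<close> is formed directly, not as a
  quotient of a quotient. Maximality becomes simplicity through the correspondence of submodules and
  stable subgroups; unitality provides a non-zero product.\<close>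

lemma maximal_stable:
  assumes H: "maximal_submodule H B (quot germ_kernel)"
  shows "\<exists>P. stable P \<and> P \<noteq> carrier N \<and> simple_left_module B (quot P)"
proof -
  let ?K = "germ_kernel"
  note K = stable_germ_kernel
  have Hs: "submodule H B (quot ?K)" and HQ: "H \<noteq> carrier (quot ?K)"
    and Hm: "\<And>H'. \<lbrakk>submodule H' B (quot ?K); H \<subseteq> H'\<rbrakk> \<Longrightarrow> H' = H \<or> H' = carrier (quot ?K)"
    using H unfolding maximal_submodule_def by blast+
  define P where "P = {n \<in> carrier N. rep ?K n \<in> H}"
  have P: "stable P" "?K \<subseteq> P" "H = rep ?K ` P"
    using stable_of_submodule[OF K Hs] by (simp_all add: P_def)
  have PN: "P \<noteq> carrier N" using HQ P(3) by (auto simp: quot_simps(1)[OF K])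
  have PsubN: "P \<subseteq> carrier N" by (auto simp: P_def)
  interpret Q: unital_left_module B "quot P" by (rule quot_module[OF P(1)])
  have "simple_left_module B (quot P)"
    unfolding simple_left_module_def
  proof (intro conjI allI impI Q.left_module_axioms)
    obtain n where n: "n \<in> carrier N" "n \<notin> P" using PN PsubN by blast
    have "rep P n \<in> carrier (quot P)" using n by (simp add: quot_simps(1)[OF P(1)])
    moreover have "rep P n \<noteq> \<zero>\<^bsub>quot P\<^esub>"
      using n by (simp add: quot_simps(2)[OF P(1)] rep_zero_iff[OF P(1)])
    ultimately show "\<exists>a\<in>carrier B. \<exists>m\<in>carrier (quot P). a \<odot>\<^bsub>quot P\<^esub> m \<noteq> \<zero>\<^bsub>quot P\<^esub>"
      using B_one Q.lsmult_one[of "rep P n"] by metis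
    show "H' = {\<zero>\<^bsub>quot P\<^esub>} \<or> H' = carrier (quot P)" if H': "submodule H' B (quot P)" for H'
    proof -
      define P' where "P' = {n \<in> carrier N. rep P n \<in> H'}"
      have P': "stable P'" "P \<subseteq> P'" "H' = rep P ` P'"
        using stable_of_submodule[OF P(1) H'] by (simp_all add: P'_def)
      have KP': "?K \<subseteq> P'" using P(2) P'(2) by blast
      note s = submodule_of_stable[OF K P'(1) KP']
      have "rep ?K ` P' = H \<or> rep ?K ` P' = carrier (quot ?K)"
        using P(3) P'(2) by (intro Hm s) auto
      then show ?thesis
      proof
        assume "rep ?K ` P' = H"
        then have "P' = P" using s(2) by (simp add: P_def)
        moreover have "rep P ` P = {\<zero>\<^bsub>quot P\<^esub>}"
        proof -
          have "rep P n = \<zero>\<^bsub>quot P\<^esub>" if "n \<in> P" for n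
            using that PsubN rep_zero_iff[OF P(1), of n] by (auto simp: quot_simps(2)[OF P(1)])
          then have "rep P ` P = (\<lambda>_. \<zero>\<^bsub>quot P\<^esub>) ` P" by (rule image_cong[OF refl])
          moreover have "P \<noteq> {}" using N.add_subgroupD(2)[OF stableD(1)[OF P(1)]] by blast
          ultimately show ?thesis by auto
        qed
        ultimately show ?thesis using P'(3) by simp
      next
        assume a: "rep ?K ` P' = carrier (quot ?K)"
        have "{n \<in> carrier N. rep ?K n \<in> rep ?K ` P'} = carrier N"
          unfolding a by (auto simp: quot_simps(1)[OF K])
        then have "P' = carrier N" using s(2) by simp
        then show ?thesis using P'(3) by (simp add: quot_simps(1)[OF P(1)])
      qed
    qed
  qed
  then show ?thesis using P(1) PN by blast
qed

lemma quot_germ_kernel_nonzero: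
  assumes "germ_kernel \<noteq> carrier N"
  shows "carrier (quot germ_kernel) \<noteq> {\<zero>\<^bsub>quot germ_kernel\<^esub>}"
proof -
  note K = stable_germ_kernel
  obtain n where n: "n \<in> carrier N" "n \<notin> germ_kernel"
    using assms N.add_subgroupD(1)[OF stableD(1)[OF K]] by blast
  then have "rep germ_kernel n \<in> carrier (quot germ_kernel)" "rep germ_kernel n \<noteq> \<zero>\<^bsub>quot germ_kernel\<^esub>"
    by (simp_all add: quot_simps(1,2)[OF K] rep_zero_iff[OF K])
  then show ?thesis by blast
qed

end

text \<open>The simple module of \<open>corner_ann_simple\<close> lives in a function type;
  \<open>primitive_ideal_annihilator\<close> transfers its annihilator to the type fixed in
  \<open>primitive_ideal\<close>.\<close>

lemma (in corner) corner_ann_primitive: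
  fixes M :: "('r, 'm, 'd) module_scheme"
  assumes "simple_left_module B M"
  shows "annihilator R (tensor_module L lact ract B M) = corner_ann M"
    and "primitive_ideal TYPE('u) R (corner_ann M)"
proof -
  interpret left_module B M using assms by (simp add: simple_left_module_def)
  interpret corner_module F R B L e \<iota> \<kappa> lact ract M ..
  interpret corner_unital_module F R B L e \<iota> \<kappa> lact ract M
    using unital_of_simple[OF assms] by (intro corner_unital_module.intro corner_module_axioms)
  show "annihilator R (tensor_module L lact ract B M) = corner_ann M" by (rule annihilator_tensor)
  obtain N :: "('r, 'r \<Rightarrow> 'm) module" where N: "simple_left_module R N" "annihilator R N = corner_ann M"
    using corner_ann_simple[OF assms] by blast
  have "primitive_ideal TYPE('u) R (annihilator R N)"
    by (rule primitive_ideal_annihilator[OF R_abelian _ N(1)]) (simp add: R_m_closed)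
  then show "primitive_ideal TYPE('u) R (corner_ann M)" by (simp add: N(2))
qed

lemma (in corner_ring_module) annihilator_induced:
  assumes "simple_left_module R N" "germ_kernel \<noteq> carrier N"
    and max: "\<exists>H. maximal_submodule H B (quot germ_kernel)"
  shows "\<exists>M :: ('r, 'm) module. simple_left_module B M \<and>
    annihilator R N = annihilator R (tensor_module L lact ract B M)"
proof -
  obtain P where P: "stable P" "P \<noteq> carrier N" "simple_left_module B (quot P)"
    using maximal_stable max by blast
  have "annihilator R N = annihilator R (tensor_module L lact ract B (quot P))"
    using annihilator_eq_corner_ann[OF assms(1) P(1,2)] corner_ann_primitive(1)[OF P(3)] by simp
  then show ?thesis using P(3) by blast
qed

section \<open>Row-finite sections\<close>

lemma (in abelian_monoid) finsum_swap:
  assumes "finite A" "finite B" and f: "\<And>i j. \<lbrakk>i \<in> A; j \<in> B\<rbrakk> \<Longrightarrow> f i j \<in> carrier G"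
  shows "(\<Oplus>i \<in> A. \<Oplus>j \<in> B. f i j) = (\<Oplus>j \<in> B. \<Oplus>i \<in> A. f i j)"
  using assms(1) f
proof (induction A)
  case (insert a A)
  then have "(\<Oplus>i \<in> insert a A. \<Oplus>j \<in> B. f i j) = (\<Oplus>j \<in> B. f a j) \<oplus> (\<Oplus>i \<in> A. \<Oplus>j \<in> B. f i j)"
    by (intro finsum_insert) (auto intro!: finsum_closed)
  also have "\<dots> = (\<Oplus>j \<in> B. f a j) \<oplus> (\<Oplus>j \<in> B. \<Oplus>i \<in> A. f i j)" using insert by simp
  also have "\<dots> = (\<Oplus>j \<in> B. f a j \<oplus> (\<Oplus>i \<in> A. f i j))"
    using insert by (intro finsum_addf[symmetric]) (auto intro!: finsum_closed)
  also have "\<dots> = (\<Oplus>j \<in> B. \<Oplus>i \<in> insert a A. f i j)"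
    using insert by (intro finsum_cong' refl) (auto intro!: finsum_closed)
  finally show ?case .
qed (simp add: finsum_zero)

lemma ring_hom_finsum:
  assumes "ring R" "ring R'" "h \<in> ring_hom R R'" "finite A" "f \<in> A \<rightarrow> carrier R"
  shows "h (finsum R f A) = finsum R' (\<lambda>i. h (f i)) A"
  using assms(4,5)
proof (induction A)
  case empty
  interpret R: ring R by fact
  interpret R': ring R' by fact
  show ?case using ring_hom_zero[OF assms(3,1,2)] by simp
next
  case (insert a A)
  interpret R: ring R by fact
  interpret R': ring R' by fact
  have "h (f i) \<in> carrier R'" if "i \<in> insert a A" for i
    using insert.prems that ring_hom_closed[OF assms(3)] by blast
  then show ?case
    using insert by (auto simp: Pi_def R.finsum_insert R'.finsum_insert ring_hom_add[OF assms(3)])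
qed

section \<open>Groupoid calculus\<close>

context groupoid
begin

lemma src_inv: "\<gamma> \<in> arrows G \<Longrightarrow> src G (ginv G \<gamma>) = tgt G \<gamma>"
  by (simp add: src_def tgt_def inv_inv)

lemma tgt_inv: "\<gamma> \<in> arrows G \<Longrightarrow> tgt G (ginv G \<gamma>) = src G \<gamma>"
  by (simp add: src_def tgt_def inv_inv)

lemma src_closed: "\<gamma> \<in> arrows G \<Longrightarrow> src G \<gamma> \<in> arrows G"
  by (metis inv_closed mult_closed src_def src_inv)

lemma tgt_closed: "\<gamma> \<in> arrows G \<Longrightarrow> tgt G \<gamma> \<in> arrows G"
  by (metis inv_closed src_closed src_inv)

lemma src_src: "\<gamma> \<in> arrows G \<Longrightarrow> src G (src G \<gamma>) = src G \<gamma>"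
  by (metis inv_closed src_def src_inv src_mult)

lemma tgt_src: "\<gamma> \<in> arrows G \<Longrightarrow> tgt G (src G \<gamma>) = src G \<gamma>"
  by (metis inv_closed src_def src_inv tgt_inv tgt_mult)

lemma src_tgt: "\<gamma> \<in> arrows G \<Longrightarrow> src G (tgt G \<gamma>) = tgt G \<gamma>"
  by (metis inv_closed src_inv src_src)

lemma tgt_tgt: "\<gamma> \<in> arrows G \<Longrightarrow> tgt G (tgt G \<gamma>) = tgt G \<gamma>"
  by (metis inv_closed src_inv tgt_src)

lemma src_unit: "\<gamma> \<in> arrows G \<Longrightarrow> src G \<gamma> \<in> units G"
  by (simp add: units_def)

lemma tgt_unit: "\<gamma> \<in> arrows G \<Longrightarrow> tgt G \<gamma> \<in> units G"
  by (metis inv_closed src_inv src_unit)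

lemma unit_arrow: "x \<in> units G \<Longrightarrow> x \<in> arrows G"
  by (auto simp: units_def src_closed)

lemma src_of_unit: "x \<in> units G \<Longrightarrow> src G x = x"
  by (auto simp: units_def src_src)

lemma tgt_of_unit: "x \<in> units G \<Longrightarrow> tgt G x = x"
  by (auto simp: units_def tgt_src)

lemma inv_of_unit: "x \<in> units G \<Longrightarrow> ginv G x = x"
  by (metis inv_closed mult_src src_def src_inv src_of_unit tgt_of_unit unit_arrow)

lemma unit_mult: "\<lbrakk>\<gamma> \<in> arrows G; tgt G \<gamma> = x\<rbrakk> \<Longrightarrow> gmult G x \<gamma> = \<gamma>"
  using tgt_mult_self by blast

lemma inv_mult_cancel:
  "\<lbrakk>\<beta> \<in> arrows G; \<gamma> \<in> arrows G; src G \<beta> = tgt G \<gamma>\<rbrakk> \<Longrightarrow> gmult G (ginv G \<beta>) (gmult G \<beta> \<gamma>) = \<gamma>"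
  by (metis inv_closed mult_assoc src_def src_inv unit_mult)

lemma mult_inv_cancel:
  "\<lbrakk>\<beta> \<in> arrows G; \<gamma> \<in> arrows G; tgt G \<beta> = tgt G \<gamma>\<rbrakk> \<Longrightarrow> gmult G \<beta> (gmult G (ginv G \<beta>) \<gamma>) = \<gamma>"
  by (metis inv_closed inv_inv inv_mult_cancel src_inv)

text \<open>Factorisations \<open>\<xi> = \<beta> \<rho>\<close> correspond to the arrows \<beta>
  with the target of \<xi>, the other factor being \<open>ldiv \<beta> \<xi>\<close>. This makes
  convolution a sum over one variable.\<close>

abbreviation ldiv :: "'g \<Rightarrow> 'g \<Rightarrow> 'g" where
  "ldiv \<beta> \<gamma> \<equiv> gmult G (ginv G \<beta>) \<gamma>"

lemma ldiv:
  assumes "\<beta> \<in> arrows G" "\<gamma> \<in> arrows G" "tgt G \<beta> = tgt G \<gamma>"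
  shows "ldiv \<beta> \<gamma> \<in> arrows G" "src G (ldiv \<beta> \<gamma>) = src G \<gamma>" "tgt G (ldiv \<beta> \<gamma>) = src G \<beta>"
    "gmult G \<beta> (ldiv \<beta> \<gamma>) = \<gamma>"
  using assms by (simp_all add: inv_closed mult_closed src_mult tgt_mult src_inv tgt_inv mult_inv_cancel)

lemma ldiv_eq_iff:
  assumes "\<beta> \<in> arrows G" "\<gamma> \<in> arrows G" "tgt G \<beta> = tgt G \<gamma>" "\<rho> \<in> arrows G" "src G \<beta> = tgt G \<rho>"
  shows "ldiv \<beta> \<gamma> = \<rho> \<longleftrightarrow> gmult G \<beta> \<rho> = \<gamma>"
  using assms by (auto simp: ldiv inv_mult_cancel)

lemma ldiv_ldiv:
  assumes "\<beta> \<in> arrows G" "\<rho> \<in> arrows G" "\<gamma> \<in> arrows G" "tgt G \<beta> = tgt G \<gamma>" "tgt G \<rho> = tgt G \<gamma>"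
  shows "ldiv (ldiv \<rho> \<beta>) (ldiv \<rho> \<gamma>) = ldiv \<beta> \<gamma>"
proof -
  have "gmult G (ldiv \<rho> \<beta>) (ldiv \<beta> \<gamma>) = ldiv \<rho> (gmult G \<beta> (ldiv \<beta> \<gamma>))"
    using assms by (intro mult_assoc) (auto simp: ldiv inv_closed src_inv)
  then have "gmult G (ldiv \<rho> \<beta>) (ldiv \<beta> \<gamma>) = ldiv \<rho> \<gamma>" using assms by (simp add: ldiv)
  then show ?thesis using assms by (subst ldiv_eq_iff) (auto simp: ldiv)
qed

end

section \<open>Sections on the arrows and their convolution\<close>

locale sheaf_groupoid = groupoid G + groupoid_sheaf_of_rings G S
  for G :: "'g groupoid_data" and S :: "('g, 'e) ring_sheaf_data"
begin

lemmas stalk_ring = ring_stalk[OF tgt_unit]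

lemma act_closed:
  "\<lbrakk>\<gamma> \<in> arrows G; a \<in> carrier (stalk S (src G \<gamma>))\<rbrakk> \<Longrightarrow> act S \<gamma> a \<in> carrier (stalk S (tgt G \<gamma>))"
  using ring_hom_closed[OF act_ring_hom] by blast

lemma act_zero: "\<gamma> \<in> arrows G \<Longrightarrow> act S \<gamma> \<zero>\<^bsub>stalk S (src G \<gamma>)\<^esub> = \<zero>\<^bsub>stalk S (tgt G \<gamma>)\<^esub>"
  by (rule ring_hom_zero[OF act_ring_hom]) (auto intro: ring_stalk src_unit tgt_unit)

lemma act_one: "\<gamma> \<in> arrows G \<Longrightarrow> act S \<gamma> \<one>\<^bsub>stalk S (src G \<gamma>)\<^esub> = \<one>\<^bsub>stalk S (tgt G \<gamma>)\<^esub>"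
  by (rule ring_hom_one[OF act_ring_hom])

lemma stalk_E: "\<lbrakk>x \<in> units G; a \<in> carrier (stalk S x)\<rbrakk> \<Longrightarrow> a \<in> topspace (etop S) \<and> proj S a = x"
  using carrier_stalk by auto

lemma act_unit': "\<lbrakk>x \<in> units G; a \<in> carrier (stalk S x)\<rbrakk> \<Longrightarrow> act S x a = a"
  using act_unit stalk_E by metis

lemma act_mult:
  "\<lbrakk>\<beta> \<in> arrows G; \<gamma> \<in> arrows G; src G \<beta> = tgt G \<gamma>; a \<in> carrier (stalk S (src G \<gamma>))\<rbrakk>
    \<Longrightarrow> act S \<beta> (act S \<gamma> a) = act S (gmult G \<beta> \<gamma>) a"
  using stalk_E[OF src_unit, of \<gamma> a] by (intro act_act) auto

definition sections :: "('g \<Rightarrow> 'e) set" where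
  "sections = (\<Pi>\<^sub>E \<gamma> \<in> arrows G. carrier (stalk S (tgt G \<gamma>)))"

lemma section_closed: "\<lbrakk>u \<in> sections; \<gamma> \<in> arrows G\<rbrakk> \<Longrightarrow> u \<gamma> \<in> carrier (stalk S (tgt G \<gamma>))"
  by (auto simp: sections_def)

lemma section_closed': "\<lbrakk>u \<in> sections; \<gamma> \<in> arrows G; tgt G \<gamma> = x\<rbrakk> \<Longrightarrow> u \<gamma> \<in> carrier (stalk S x)"
  by (auto simp: sections_def)

lemma sections_eqI:
  "\<lbrakk>u \<in> sections; v \<in> sections; \<And>\<gamma>. \<gamma> \<in> arrows G \<Longrightarrow> u \<gamma> = v \<gamma>\<rbrakk> \<Longrightarrow> u = v"
  unfolding sections_def by (rule PiE_ext)

definition row :: "('g \<Rightarrow> 'e) \<Rightarrow> 'g \<Rightarrow> 'g set" where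
  "row u x = {\<gamma> \<in> arrows G. tgt G \<gamma> = x \<and> u \<gamma> \<noteq> \<zero>\<^bsub>stalk S x\<^esub>}"

text \<open>The convolution at \<xi> sums over arrows with the target of \<xi>, so finite rows of
  the left factor make the sum finite. Continuity and compact support are dropped, which admits the
  indicator of any set of units, in particular of a single one.\<close>

definition row_finite :: "('g \<Rightarrow> 'e) set" where
  "row_finite = {u \<in> sections. \<forall>x \<in> units G. finite (row u x)}"

abbreviation convolution (infixl "\<star>" 70) where
  "u \<star> v \<equiv> conv G S (arrows G) (arrows G) (arrows G) u v"

definition row_ring :: "('g \<Rightarrow> 'e) ring" where
  "row_ring = \<lparr>carrier = row_finite, monoid.mult = conv G S (arrows G) (arrows G) (arrows G),
     one = (\<lambda>\<gamma> \<in> arrows G. if \<gamma> \<in> units G then \<one>\<^bsub>stalk S \<gamma>\<^esub> else \<zero>\<^bsub>stalk S (tgt G \<gamma>)\<^esub>),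
     ring.zero = (\<lambda>\<gamma> \<in> arrows G. \<zero>\<^bsub>stalk S (tgt G \<gamma>)\<^esub>),
     ring.add = (\<lambda>u v. \<lambda>\<gamma> \<in> arrows G. u \<gamma> \<oplus>\<^bsub>stalk S (tgt G \<gamma>)\<^esub> v \<gamma>)\<rparr>"

lemma row_ring_simps:
  "carrier row_ring = row_finite" "u \<otimes>\<^bsub>row_ring\<^esub> v = u \<star> v"
  "\<one>\<^bsub>row_ring\<^esub> = (\<lambda>\<gamma> \<in> arrows G. if \<gamma> \<in> units G then \<one>\<^bsub>stalk S \<gamma>\<^esub> else \<zero>\<^bsub>stalk S (tgt G \<gamma>)\<^esub>)"
  "\<zero>\<^bsub>row_ring\<^esub> = (\<lambda>\<gamma> \<in> arrows G. \<zero>\<^bsub>stalk S (tgt G \<gamma>)\<^esub>)"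
  "u \<oplus>\<^bsub>row_ring\<^esub> v = (\<lambda>\<gamma> \<in> arrows G. u \<gamma> \<oplus>\<^bsub>stalk S (tgt G \<gamma>)\<^esub> v \<gamma>)"
  by (simp_all add: row_ring_def)

lemma row_finite_sections: "u \<in> row_finite \<Longrightarrow> u \<in> sections"
  by (simp add: row_finite_def)

lemma row_finiteI:
  "\<lbrakk>u \<in> sections; \<And>x. x \<in> units G \<Longrightarrow> \<exists>T. finite T \<and> row u x \<subseteq> T\<rbrakk> \<Longrightarrow> u \<in> row_finite"
  unfolding row_finite_def by (blast intro: finite_subset)

lemma finite_row: "\<lbrakk>u \<in> row_finite; x \<in> units G\<rbrakk> \<Longrightarrow> finite (row u x)"
  by (simp add: row_finite_def)

lemma term_closed:
  assumes "\<beta> \<in> arrows G" "\<xi> \<in> arrows G" "tgt G \<beta> = tgt G \<xi>" "u \<beta> \<in> carrier (stalk S (tgt G \<xi>))"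
    "v (ldiv \<beta> \<xi>) \<in> carrier (stalk S (src G \<beta>))"
  shows "u \<beta> \<otimes>\<^bsub>stalk S (tgt G \<xi>)\<^esub> act S \<beta> (v (ldiv \<beta> \<xi>)) \<in> carrier (stalk S (tgt G \<xi>))"
proof -
  interpret R: ring "stalk S (tgt G \<xi>)" using assms by (intro stalk_ring)
  show ?thesis using act_closed[OF assms(1,5)] assms by simp
qed

text \<open>The defining sum runs over a possibly infinite set of pairs. As \<open>gfinprod\<close>
  ignores zero terms, it may be restricted to the pairs \<open>(\<beta>, ldiv \<beta> \<xi>)\<close>
  with \<beta> in a finite \<open>T\<close> that carries all non-zero terms, and then reindexed by
  \<beta>.\<close>

lemma conv_eq:
  assumes \<xi>: "\<xi> \<in> K" "\<xi> \<in> arrows G" and I: "I \<subseteq> arrows G" "J \<subseteq> arrows G"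
    and u: "\<And>\<beta>. \<beta> \<in> I \<Longrightarrow> u \<beta> \<in> carrier (stalk S (tgt G \<beta>))"
    and v: "\<And>\<gamma>. \<gamma> \<in> J \<Longrightarrow> v \<gamma> \<in> carrier (stalk S (tgt G \<gamma>))"
    and T: "finite T" "T \<subseteq> {\<beta> \<in> I. tgt G \<beta> = tgt G \<xi> \<and> ldiv \<beta> \<xi> \<in> J}"
    and z: "\<And>\<beta>. \<lbrakk>\<beta> \<in> I; tgt G \<beta> = tgt G \<xi>; ldiv \<beta> \<xi> \<in> J; \<beta> \<notin> T\<rbrakk> \<Longrightarrow>
      u \<beta> = \<zero>\<^bsub>stalk S (tgt G \<xi>)\<^esub> \<or> v (ldiv \<beta> \<xi>) = \<zero>\<^bsub>stalk S (src G \<beta>)\<^esub>"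
  shows "conv G S I J K u v \<xi> =
    finsum (stalk S (tgt G \<xi>)) (\<lambda>\<beta>. u \<beta> \<otimes>\<^bsub>stalk S (tgt G \<xi>)\<^esub> act S \<beta> (v (ldiv \<beta> \<xi>))) T"
proof -
  let ?O = "stalk S (tgt G \<xi>)"
  interpret R: ring ?O using \<xi> by (intro stalk_ring)
  let ?P = "{(\<beta>, \<gamma>) \<in> I \<times> J. src G \<beta> = tgt G \<gamma> \<and> gmult G \<beta> \<gamma> = \<xi>}"
  let ?f = "\<lambda>(\<beta>, \<gamma>). u \<beta> \<otimes>\<^bsub>?O\<^esub> act S \<beta> (v \<gamma>)"
  let ?h = "\<lambda>\<beta>. (\<beta>, ldiv \<beta> \<xi>)"
  have P: "tgt G \<beta> = tgt G \<xi>" "\<gamma> = ldiv \<beta> \<xi>" if "(\<beta>, \<gamma>) \<in> ?P" for \<beta> \<gamma>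
    using that I by (auto simp: tgt_mult inv_mult_cancel subset_iff)
  have f: "?f p \<in> carrier ?O" if "p \<in> ?P" for p
  proof -
    obtain \<beta> \<gamma> where p: "p = (\<beta>, \<gamma>)" by (cases p)
    then have bg: "\<beta> \<in> I" "\<gamma> \<in> J" "src G \<beta> = tgt G \<gamma>" using that by auto
    have "act S \<beta> (v \<gamma>) \<in> carrier ?O"
      using act_closed[of \<beta> "v \<gamma>"] bg I v[OF bg(2)] P[OF that[unfolded p]] by auto
    moreover have "u \<beta> \<in> carrier ?O" using u[OF bg(1)] P[OF that[unfolded p]] by simp
    ultimately show ?thesis by (simp add: p)
  qed
  have hT: "?h ` T \<subseteq> ?P"
    using T(2) I \<xi> by (auto simp: ldiv subset_iff)
  have fP: "?f \<in> ?P \<rightarrow> carrier ?O" using f by (intro Pi_I)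
  then have fhT: "?f \<in> ?h ` T \<rightarrow> carrier ?O" using hT by (meson Pi_anti_mono subsetD)
  have "conv G S I J K u v \<xi> = gfinprod (add_monoid ?O) ?f ?P"
    using \<xi> by (simp add: conv_def)
  also have "\<dots> = gfinprod (add_monoid ?O) ?f (?h ` T)"
  proof (rule R.add.gfinprod_mono_neutral_cong_right[OF hT])
    fix p assume p: "p \<in> ?P - ?h ` T"
    obtain \<beta> \<gamma> where bg: "p = (\<beta>, \<gamma>)" by (cases p)
    have pP: "(\<beta>, \<gamma>) \<in> ?P" and n: "\<beta> \<notin> T" using p P[of \<beta> \<gamma>] unfolding bg by auto
    then have b: "\<beta> \<in> arrows G" "\<beta> \<in> I" "\<gamma> \<in> J" "src G \<beta> = tgt G \<gamma>" "\<gamma> \<in> arrows G" using I by auto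
    note P = P[OF pP]
    have "u \<beta> = \<zero>\<^bsub>?O\<^esub> \<or> v \<gamma> = \<zero>\<^bsub>stalk S (src G \<beta>)\<^esub>" using z[of \<beta>] n P b by auto
    then show "?f p = \<zero>\<^bsub>?O\<^esub>"
    proof
      assume "u \<beta> = \<zero>\<^bsub>?O\<^esub>"
      then show ?thesis using act_closed[of \<beta> "v \<gamma>"] b v[OF b(3)] P by (simp add: bg)
    next
      assume "v \<gamma> = \<zero>\<^bsub>stalk S (src G \<beta>)\<^esub>"
      then show ?thesis using u[OF b(2)] P act_zero[OF b(1)] by (simp add: bg)
    qed
  qed (use fP in simp_all)
  also have "\<dots> = finsum ?O ?f (?h ` T)"
    using R.add.gfinprod_eq_finprod[OF _ fhT] T(1) by simp
  also have "\<dots> = finsum ?O (\<lambda>\<beta>. ?f (?h \<beta>)) T"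
    by (rule R.finsum_reindex[OF fhT]) (auto simp: inj_on_def)
  finally show ?thesis by simp
qed

lemma conv_value:
  assumes "u \<in> sections" "v \<in> sections" "\<xi> \<in> arrows G"
    and "finite T" "T \<subseteq> {\<beta> \<in> arrows G. tgt G \<beta> = tgt G \<xi>}"
    and "\<And>\<beta>. \<lbrakk>\<beta> \<in> arrows G; tgt G \<beta> = tgt G \<xi>; \<beta> \<notin> T\<rbrakk> \<Longrightarrow>
      u \<beta> = \<zero>\<^bsub>stalk S (tgt G \<xi>)\<^esub> \<or> v (ldiv \<beta> \<xi>) = \<zero>\<^bsub>stalk S (src G \<beta>)\<^esub>"
  shows "(u \<star> v) \<xi> = finsum (stalk S (tgt G \<xi>)) (\<lambda>\<beta>. u \<beta> \<otimes>\<^bsub>stalk S (tgt G \<xi>)\<^esub> act S \<beta> (v (ldiv \<beta> \<xi>))) T"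
  using assms by (intro conv_eq) (auto simp: section_closed ldiv)

lemma conv_row:
  assumes "u \<in> row_finite" "v \<in> sections" "\<xi> \<in> arrows G"
  shows "(u \<star> v) \<xi> = finsum (stalk S (tgt G \<xi>))
    (\<lambda>\<beta>. u \<beta> \<otimes>\<^bsub>stalk S (tgt G \<xi>)\<^esub> act S \<beta> (v (ldiv \<beta> \<xi>))) (row u (tgt G \<xi>))"
  using assms finite_row[OF assms(1) tgt_unit[OF assms(3)]]
  by (intro conv_value) (auto simp: row_finite_def row_def)

lemma term_closed':
  assumes "u \<in> sections" "v \<in> sections" "\<beta> \<in> arrows G" "\<xi> \<in> arrows G" "tgt G \<beta> = tgt G \<xi>"
  shows "u \<beta> \<otimes>\<^bsub>stalk S (tgt G \<xi>)\<^esub> act S \<beta> (v (ldiv \<beta> \<xi>)) \<in> carrier (stalk S (tgt G \<xi>))"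
  using assms section_closed[of v "ldiv \<beta> \<xi>"] section_closed[of u \<beta>] by (intro term_closed) (auto simp: ldiv)

lemma conv_sections:
  assumes "u \<in> row_finite" "v \<in> sections"
  shows "u \<star> v \<in> sections"
proof -
  have "(u \<star> v) \<xi> \<in> carrier (stalk S (tgt G \<xi>))" if \<xi>: "\<xi> \<in> arrows G" for \<xi>
  proof -
    interpret R: ring "stalk S (tgt G \<xi>)" using \<xi> by (intro stalk_ring)
    show ?thesis
      unfolding conv_row[OF assms \<xi>] using assms \<xi>
      by (intro R.finsum_closed) (auto simp: row_def intro!: term_closed' row_finite_sections)
  qed
  moreover have "u \<star> v \<in> extensional (arrows G)" by (simp add: conv_def)
  ultimately show ?thesis by (auto simp: sections_def PiE_def)
qed

lemma conv_nonzero: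
  assumes "u \<in> row_finite" "v \<in> sections" "\<xi> \<in> arrows G" "(u \<star> v) \<xi> \<noteq> \<zero>\<^bsub>stalk S (tgt G \<xi>)\<^esub>"
  shows "\<exists>\<beta> \<in> row u (tgt G \<xi>). ldiv \<beta> \<xi> \<in> row v (src G \<beta>)"
proof (rule ccontr)
  assume n: "\<not> ?thesis"
  interpret R: ring "stalk S (tgt G \<xi>)" using assms by (intro stalk_ring)
  have "u \<beta> \<otimes>\<^bsub>stalk S (tgt G \<xi>)\<^esub> act S \<beta> (v (ldiv \<beta> \<xi>)) = \<zero>\<^bsub>stalk S (tgt G \<xi>)\<^esub>" if "\<beta> \<in> row u (tgt G \<xi>)" for \<beta>
  proof -
    have b: "\<beta> \<in> arrows G" "tgt G \<beta> = tgt G \<xi>" using that by (auto simp: row_def)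
    then have "v (ldiv \<beta> \<xi>) = \<zero>\<^bsub>stalk S (src G \<beta>)\<^esub>"
      using n that assms(3) by (auto simp: row_def ldiv)
    then show ?thesis
      using act_zero[OF b(1)] b section_closed[OF row_finite_sections[OF assms(1)] b(1)] by simp
  qed
  then have "(u \<star> v) \<xi> = \<zero>\<^bsub>stalk S (tgt G \<xi>)\<^esub>"
    unfolding conv_row[OF assms(1-3)] by (intro R.add.finprod_one_eqI) simp
  then show False using assms by simp
qed

lemma row_conv:
  assumes "u \<in> row_finite" "v \<in> sections"
  shows "row (u \<star> v) x \<subseteq> (\<Union>\<beta> \<in> row u x. gmult G \<beta> ` row v (src G \<beta>))"
proof
  fix \<xi> assume "\<xi> \<in> row (u \<star> v) x"
  then have \<xi>: "\<xi> \<in> arrows G" "tgt G \<xi> = x" "(u \<star> v) \<xi> \<noteq> \<zero>\<^bsub>stalk S (tgt G \<xi>)\<^esub>" by (auto simp: row_def)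
  obtain \<beta> where b: "\<beta> \<in> row u x" "ldiv \<beta> \<xi> \<in> row v (src G \<beta>)" using conv_nonzero[OF assms \<xi>(1,3)] \<xi>(2) by blast
  then have "\<xi> = gmult G \<beta> (ldiv \<beta> \<xi>)" using \<xi> by (auto simp: row_def ldiv)
  then show "\<xi> \<in> (\<Union>\<beta> \<in> row u x. gmult G \<beta> ` row v (src G \<beta>))" using b by blast
qed

lemma conv_closed:
  assumes "u \<in> row_finite" "v \<in> row_finite"
  shows "u \<star> v \<in> row_finite"
proof (rule row_finiteI[OF conv_sections])
  show "\<exists>T. finite T \<and> row (u \<star> v) x \<subseteq> T" if "x \<in> units G" for x
    using row_conv[OF assms(1) row_finite_sections[OF assms(2)]] finite_row[OF assms(1) that]
    by (intro exI[of _ "\<Union>\<beta> \<in> row u x. gmult G \<beta> ` row v (src G \<beta>)"])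
      (auto simp: row_def src_unit intro!: finite_row[OF assms(2), unfolded row_def])
qed (use assms row_finite_sections in auto)

lemma conv_assoc:
  assumes u: "u \<in> row_finite" and v: "v \<in> row_finite" and w: "w \<in> row_finite"
  shows "(u \<star> v) \<star> w = u \<star> (v \<star> w)"
proof (rule sections_eqI)
  note us = row_finite_sections[OF u] and vs = row_finite_sections[OF v] and ws = row_finite_sections[OF w]
  show "(u \<star> v) \<star> w \<in> sections" "u \<star> (v \<star> w) \<in> sections"
    by (simp_all add: conv_sections conv_closed u v w row_finite_sections)
  fix \<xi> assume \<xi>: "\<xi> \<in> arrows G"
  let ?x = "tgt G \<xi>"
  let ?O = "stalk S ?x"
  interpret R: ring ?O using \<xi> by (intro stalk_ring)
  define U where "U = row u ?x"
  \<comment> \<open>This contains the row of the product of \<open>u\<close> and \<open>v\<close>,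
    and for each \<rho> also the whole translate of the row of \<open>v\<close> that the other
    bracketing needs. So both double sums can run over \<open>U\<close> and
    \<open>T\<close>.\<close>
  define T where "T = (\<Union>\<rho> \<in> U. gmult G \<rho> ` row v (src G \<rho>))"
  have U: "finite U" "\<And>\<rho>. \<rho> \<in> U \<Longrightarrow> \<rho> \<in> arrows G \<and> tgt G \<rho> = ?x"
    using finite_row[OF u tgt_unit[OF \<xi>]] by (auto simp: U_def row_def)
  have T: "finite T" "\<And>\<beta>. \<beta> \<in> T \<Longrightarrow> \<beta> \<in> arrows G \<and> tgt G \<beta> = ?x"
    using U finite_row[OF v src_unit] by (auto simp: T_def row_def mult_closed tgt_mult)
  have uc: "u \<rho> \<in> carrier ?O" if "\<rho> \<in> U" for \<rho> using section_closed[OF us] U(2)[OF that] by metis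
  have vc: "act S \<rho> (v (ldiv \<rho> \<beta>)) \<in> carrier ?O" if "\<rho> \<in> U" "\<beta> \<in> arrows G" "tgt G \<beta> = ?x" for \<rho> \<beta>
    using act_closed[of \<rho> "v (ldiv \<rho> \<beta>)"] section_closed[OF vs, of "ldiv \<rho> \<beta>"] U(2)[OF that(1)] that
    by (auto simp: ldiv)
  have wc: "act S \<beta> (w (ldiv \<beta> \<xi>)) \<in> carrier ?O" if "\<beta> \<in> arrows G" "tgt G \<beta> = ?x" for \<beta>
    using act_closed[of \<beta> "w (ldiv \<beta> \<xi>)"] section_closed[OF ws, of "ldiv \<beta> \<xi>"] that \<xi>
    by (auto simp: ldiv)
  let ?t = "\<lambda>\<rho> \<beta>. u \<rho> \<otimes>\<^bsub>?O\<^esub> act S \<rho> (v (ldiv \<rho> \<beta>)) \<otimes>\<^bsub>?O\<^esub> act S \<beta> (w (ldiv \<beta> \<xi>))"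
  have tc: "?t \<rho> \<beta> \<in> carrier ?O" if "\<rho> \<in> U" "\<beta> \<in> T" for \<rho> \<beta>
    using that uc vc wc T(2) by auto
  have z: "(u \<star> v) \<beta> = \<zero>\<^bsub>?O\<^esub>" if "\<beta> \<in> arrows G" "tgt G \<beta> = ?x" "\<beta> \<notin> T" for \<beta>
  proof -
    have "\<beta> \<notin> row (u \<star> v) ?x" using row_conv[OF u vs, of ?x] that(3) unfolding T_def U_def by blast
    then show ?thesis using that by (simp add: row_def)
  qed
  have "((u \<star> v) \<star> w) \<xi> = finsum ?O (\<lambda>\<beta>. (u \<star> v) \<beta> \<otimes>\<^bsub>?O\<^esub> act S \<beta> (w (ldiv \<beta> \<xi>))) T"
    by (rule conv_value[OF conv_sections[OF u vs] ws \<xi> T(1)]) (use T(2) z in auto)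
  also have "\<dots> = finsum ?O (\<lambda>\<beta>. finsum ?O (\<lambda>\<rho>. ?t \<rho> \<beta>) U) T"
  proof (rule R.finsum_cong'[OF refl])
    show "(\<lambda>\<beta>. finsum ?O (\<lambda>\<rho>. ?t \<rho> \<beta>) U) \<in> T \<rightarrow> carrier ?O"
      using tc by (auto intro!: R.finsum_closed)
    fix \<beta> assume b: "\<beta> \<in> T"
    have "(u \<star> v) \<beta> = finsum ?O (\<lambda>\<rho>. u \<rho> \<otimes>\<^bsub>?O\<^esub> act S \<rho> (v (ldiv \<rho> \<beta>))) U"
      using conv_row[OF u vs, of \<beta>] T(2)[OF b] by (simp add: U_def)
    then show "(u \<star> v) \<beta> \<otimes>\<^bsub>?O\<^esub> act S \<beta> (w (ldiv \<beta> \<xi>)) = finsum ?O (\<lambda>\<rho>. ?t \<rho> \<beta>) U"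
      using R.finsum_ldistr[OF U(1), of "act S \<beta> (w (ldiv \<beta> \<xi>))" "\<lambda>\<rho>. u \<rho> \<otimes>\<^bsub>?O\<^esub> act S \<rho> (v (ldiv \<rho> \<beta>))"]
        wc T(2)[OF b] uc vc by simp
  qed
  also have "\<dots> = finsum ?O (\<lambda>\<rho>. finsum ?O (\<lambda>\<beta>. ?t \<rho> \<beta>) T) U"
    using tc by (intro R.finsum_swap T U)
  also have "\<dots> = finsum ?O (\<lambda>\<rho>. u \<rho> \<otimes>\<^bsub>?O\<^esub> act S \<rho> ((v \<star> w) (ldiv \<rho> \<xi>))) U"
  proof (rule R.finsum_cong'[OF refl])
    show "(\<lambda>\<rho>. u \<rho> \<otimes>\<^bsub>?O\<^esub> act S \<rho> ((v \<star> w) (ldiv \<rho> \<xi>))) \<in> U \<rightarrow> carrier ?O"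
      using U(2) \<xi> by (auto intro!: term_closed' us conv_sections v ws)
    fix \<rho> assume r: "\<rho> \<in> U"
    note rA = U(2)[OF r]
    have rt: "ldiv \<rho> \<xi> \<in> arrows G" "tgt G (ldiv \<rho> \<xi>) = src G \<rho>" using rA \<xi> by (auto simp: ldiv)
    interpret Q: ring "stalk S (src G \<rho>)" using rA by (intro ring_stalk src_unit) auto
    let ?V = "row v (src G \<rho>)"
    have V: "finite ?V" "\<And>\<kappa>. \<kappa> \<in> ?V \<Longrightarrow> \<kappa> \<in> arrows G \<and> tgt G \<kappa> = src G \<rho>"
      using finite_row[OF v src_unit] rA by (auto simp: row_def)
    have tV: "v \<kappa> \<otimes>\<^bsub>stalk S (src G \<rho>)\<^esub> act S \<kappa> (w (ldiv \<kappa> (ldiv \<rho> \<xi>))) \<in> carrier (stalk S (src G \<rho>))"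
      if "\<kappa> \<in> ?V" for \<kappa>
      using term_closed'[OF vs ws, of \<kappa> "ldiv \<rho> \<xi>"] V(2)[OF that] rt by auto
    have "(v \<star> w) (ldiv \<rho> \<xi>) =
        finsum (stalk S (src G \<rho>)) (\<lambda>\<kappa>. v \<kappa> \<otimes>\<^bsub>stalk S (src G \<rho>)\<^esub> act S \<kappa> (w (ldiv \<kappa> (ldiv \<rho> \<xi>)))) ?V"
      using conv_row[OF v ws rt(1)] rt(2) by simp
    moreover have "(\<lambda>\<kappa>. v \<kappa> \<otimes>\<^bsub>stalk S (src G \<rho>)\<^esub> act S \<kappa> (w (ldiv \<kappa> (ldiv \<rho> \<xi>)))) \<in> ?V \<rightarrow> carrier (stalk S (src G \<rho>))"
      by (intro Pi_I tV)
    from ring_hom_finsum[OF Q.ring_axioms R.ring_axioms _ V(1) this, of "act S \<rho>"]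
    have "act S \<rho> (finsum (stalk S (src G \<rho>)) (\<lambda>\<kappa>. v \<kappa> \<otimes>\<^bsub>stalk S (src G \<rho>)\<^esub> act S \<kappa> (w (ldiv \<kappa> (ldiv \<rho> \<xi>)))) ?V) =
        finsum ?O (\<lambda>\<kappa>. act S \<rho> (v \<kappa> \<otimes>\<^bsub>stalk S (src G \<rho>)\<^esub> act S \<kappa> (w (ldiv \<kappa> (ldiv \<rho> \<xi>))))) ?V"
      using act_ring_hom[of \<rho>] rA by simp
    ultimately have a1: "act S \<rho> ((v \<star> w) (ldiv \<rho> \<xi>)) =
        finsum ?O (\<lambda>\<kappa>. act S \<rho> (v \<kappa> \<otimes>\<^bsub>stalk S (src G \<rho>)\<^esub> act S \<kappa> (w (ldiv \<kappa> (ldiv \<rho> \<xi>))))) ?V"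
      by simp
    \<comment> \<open>Substitution of \<open>\<rho> \<kappa>\<close> for \<beta>: composite arrows
      act as composite maps, and \<open>ldiv \<kappa> (ldiv \<rho> \<xi>)\<close> becomes
      \<open>ldiv \<beta> \<xi>\<close>.\<close>
    have e: "act S \<rho> (v \<kappa> \<otimes>\<^bsub>stalk S (src G \<rho>)\<^esub> act S \<kappa> (w (ldiv \<kappa> (ldiv \<rho> \<xi>)))) =
        act S \<rho> (v (ldiv \<rho> (gmult G \<rho> \<kappa>))) \<otimes>\<^bsub>?O\<^esub> act S (gmult G \<rho> \<kappa>) (w (ldiv (gmult G \<rho> \<kappa>) \<xi>))"
      if k: "\<kappa> \<in> ?V" for \<kappa>
    proof -
      note kA = V(2)[OF k]
      have 1: "ldiv \<rho> (gmult G \<rho> \<kappa>) = \<kappa>" using kA rA by (simp add: inv_mult_cancel)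
      have 2: "ldiv \<kappa> (ldiv \<rho> \<xi>) = ldiv (gmult G \<rho> \<kappa>) \<xi>"
        using ldiv_ldiv[of "gmult G \<rho> \<kappa>" \<rho> \<xi>] kA rA \<xi> 1 by (simp add: mult_closed tgt_mult)
      have 3: "w (ldiv \<kappa> (ldiv \<rho> \<xi>)) \<in> carrier (stalk S (src G \<kappa>))"
        using section_closed[OF ws, of "ldiv \<kappa> (ldiv \<rho> \<xi>)"] kA rt by (simp add: ldiv)
      have 4: "act S \<kappa> (w (ldiv \<kappa> (ldiv \<rho> \<xi>))) \<in> carrier (stalk S (src G \<rho>))"
        using act_closed[OF _ 3] kA by simp
      have 5: "v \<kappa> \<in> carrier (stalk S (src G \<rho>))" using section_closed[OF vs, of \<kappa>] kA by simp
      have "act S \<rho> (v \<kappa> \<otimes>\<^bsub>stalk S (src G \<rho>)\<^esub> act S \<kappa> (w (ldiv \<kappa> (ldiv \<rho> \<xi>)))) =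
          act S \<rho> (v \<kappa>) \<otimes>\<^bsub>?O\<^esub> act S \<rho> (act S \<kappa> (w (ldiv \<kappa> (ldiv \<rho> \<xi>))))"
        using ring_hom_mult[OF act_ring_hom 5 4] rA by simp
      also have "act S \<rho> (act S \<kappa> (w (ldiv \<kappa> (ldiv \<rho> \<xi>)))) = act S (gmult G \<rho> \<kappa>) (w (ldiv \<kappa> (ldiv \<rho> \<xi>)))"
        using rA kA 3 by (intro act_mult) auto
      finally show ?thesis by (simp add: 1 2)
    qed
    have inj: "inj_on (gmult G \<rho>) ?V" using V(2) rA
      by (intro inj_on_inverseI[of _ "ldiv \<rho>"] inv_mult_cancel) auto
    have vwc: "act S \<rho> (v (ldiv \<rho> (gmult G \<rho> \<kappa>))) \<otimes>\<^bsub>?O\<^esub> act S (gmult G \<rho> \<kappa>) (w (ldiv (gmult G \<rho> \<kappa>) \<xi>)) \<in> carrier ?O"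
      if "\<kappa> \<in> ?V" for \<kappa>
      using vc[OF r, of "gmult G \<rho> \<kappa>"] wc[of "gmult G \<rho> \<kappa>"] V(2)[OF that] rA
      by (simp add: mult_closed tgt_mult)
    have "act S \<rho> ((v \<star> w) (ldiv \<rho> \<xi>)) = finsum ?O (\<lambda>\<kappa>. act S \<rho> (v (ldiv \<rho> (gmult G \<rho> \<kappa>))) \<otimes>\<^bsub>?O\<^esub> act S (gmult G \<rho> \<kappa>) (w (ldiv (gmult G \<rho> \<kappa>) \<xi>))) ?V"
      unfolding a1
    proof (rule R.finsum_cong'[OF refl])
      show "(\<lambda>\<kappa>. act S \<rho> (v (ldiv \<rho> (gmult G \<rho> \<kappa>))) \<otimes>\<^bsub>?O\<^esub> act S (gmult G \<rho> \<kappa>) (w (ldiv (gmult G \<rho> \<kappa>) \<xi>))) \<in> ?V \<rightarrow> carrier ?O"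
        by (intro Pi_I vwc)
    qed (fact e)
    also have "\<dots> = finsum ?O (\<lambda>\<beta>. act S \<rho> (v (ldiv \<rho> \<beta>)) \<otimes>\<^bsub>?O\<^esub> act S \<beta> (w (ldiv \<beta> \<xi>))) (gmult G \<rho> ` ?V)"
      by (rule R.finsum_reindex[symmetric, OF _ inj]) (use vwc in auto)
    \<comment> \<open>Enlarging the translate to \<open>T\<close> only adds terms in which
      \<open>v\<close> vanishes.\<close>
    also have "\<dots> = finsum ?O (\<lambda>\<beta>. act S \<rho> (v (ldiv \<rho> \<beta>)) \<otimes>\<^bsub>?O\<^esub> act S \<beta> (w (ldiv \<beta> \<xi>))) T"
    proof (rule R.add.finprod_mono_neutral_cong_left[OF T(1)])
      show "gmult G \<rho> ` ?V \<subseteq> T" using r by (auto simp: T_def)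
      fix \<beta> assume b: "\<beta> \<in> T - gmult G \<rho> ` ?V"
      then have bA: "\<beta> \<in> arrows G" "tgt G \<beta> = ?x" using T(2) by auto
      have "ldiv \<rho> \<beta> \<notin> ?V" using b bA rA by (metis Diff_iff image_eqI ldiv(4))
      then have "v (ldiv \<rho> \<beta>) = \<zero>\<^bsub>stalk S (src G \<rho>)\<^esub>" using bA rA by (auto simp: row_def ldiv)
      then show "act S \<rho> (v (ldiv \<rho> \<beta>)) \<otimes>\<^bsub>?O\<^esub> act S \<beta> (w (ldiv \<beta> \<xi>)) = \<zero>\<^bsub>?O\<^esub>"
        using act_zero[of \<rho>] rA wc[OF bA] by simp
    qed (use vc[OF r] wc T(2) in auto)
    finally have a2: "act S \<rho> ((v \<star> w) (ldiv \<rho> \<xi>)) =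
      finsum ?O (\<lambda>\<beta>. act S \<rho> (v (ldiv \<rho> \<beta>)) \<otimes>\<^bsub>?O\<^esub> act S \<beta> (w (ldiv \<beta> \<xi>))) T" .
    show "finsum ?O (\<lambda>\<beta>. ?t \<rho> \<beta>) T = u \<rho> \<otimes>\<^bsub>?O\<^esub> act S \<rho> ((v \<star> w) (ldiv \<rho> \<xi>))"
    proof -
      have c: "act S \<rho> (v (ldiv \<rho> \<beta>)) \<otimes>\<^bsub>?O\<^esub> act S \<beta> (w (ldiv \<beta> \<xi>)) \<in> carrier ?O" if "\<beta> \<in> T" for \<beta>
        using vc[OF r] wc T(2)[OF that] by simp
      have "finsum ?O (\<lambda>\<beta>. ?t \<rho> \<beta>) T =
          finsum ?O (\<lambda>\<beta>. u \<rho> \<otimes>\<^bsub>?O\<^esub> (act S \<rho> (v (ldiv \<rho> \<beta>)) \<otimes>\<^bsub>?O\<^esub> act S \<beta> (w (ldiv \<beta> \<xi>)))) T"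
        using uc[OF r] vc[OF r] wc T(2) by (intro R.finsum_cong' refl) (auto simp: R.m_assoc)
      also have "\<dots> = u \<rho> \<otimes>\<^bsub>?O\<^esub> finsum ?O (\<lambda>\<beta>. act S \<rho> (v (ldiv \<rho> \<beta>)) \<otimes>\<^bsub>?O\<^esub> act S \<beta> (w (ldiv \<beta> \<xi>))) T"
        by (rule R.finsum_rdistr[symmetric, OF T(1) uc[OF r]]) (use c in auto)
      finally show ?thesis unfolding a2 .
    qed
  qed
  also have "\<dots> = (u \<star> (v \<star> w)) \<xi>"
    unfolding U_def by (rule conv_row[symmetric]) (use u v ws \<xi> in \<open>auto intro: conv_sections\<close>)
  finally show "((u \<star> v) \<star> w) \<xi> = (u \<star> (v \<star> w)) \<xi>" .
qed

lemma restrict_sections: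
  assumes "\<And>\<gamma>. \<gamma> \<in> arrows G \<Longrightarrow> f \<gamma> \<in> carrier (stalk S (tgt G \<gamma>))"
  shows "restrict f (arrows G) \<in> sections"
  using assms by (simp add: sections_def restrict_PiE_iff)

lemma stalk_closed:
  assumes "\<gamma> \<in> arrows G"
  shows "\<zero>\<^bsub>stalk S (tgt G \<gamma>)\<^esub> \<in> carrier (stalk S (tgt G \<gamma>))"
    and "\<one>\<^bsub>stalk S (tgt G \<gamma>)\<^esub> \<in> carrier (stalk S (tgt G \<gamma>))"
    and "\<lbrakk>a \<in> carrier (stalk S (tgt G \<gamma>)); b \<in> carrier (stalk S (tgt G \<gamma>))\<rbrakk>
      \<Longrightarrow> a \<oplus>\<^bsub>stalk S (tgt G \<gamma>)\<^esub> b \<in> carrier (stalk S (tgt G \<gamma>))"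
    and "a \<in> carrier (stalk S (tgt G \<gamma>)) \<Longrightarrow> \<ominus>\<^bsub>stalk S (tgt G \<gamma>)\<^esub> a \<in> carrier (stalk S (tgt G \<gamma>))"
proof -
  interpret R: ring "stalk S (tgt G \<gamma>)" using assms by (rule stalk_ring)
  show "\<zero>\<^bsub>stalk S (tgt G \<gamma>)\<^esub> \<in> carrier (stalk S (tgt G \<gamma>))" "\<one>\<^bsub>stalk S (tgt G \<gamma>)\<^esub> \<in> carrier (stalk S (tgt G \<gamma>))"
    "\<lbrakk>a \<in> carrier (stalk S (tgt G \<gamma>)); b \<in> carrier (stalk S (tgt G \<gamma>))\<rbrakk>
      \<Longrightarrow> a \<oplus>\<^bsub>stalk S (tgt G \<gamma>)\<^esub> b \<in> carrier (stalk S (tgt G \<gamma>))"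
    "a \<in> carrier (stalk S (tgt G \<gamma>)) \<Longrightarrow> \<ominus>\<^bsub>stalk S (tgt G \<gamma>)\<^esub> a \<in> carrier (stalk S (tgt G \<gamma>))"
    by auto
qed

lemma sections_add:
  "\<lbrakk>u \<in> sections; v \<in> sections\<rbrakk> \<Longrightarrow> u \<oplus>\<^bsub>row_ring\<^esub> v \<in> sections"
  unfolding row_ring_simps by (rule restrict_sections) (simp add: stalk_closed section_closed)

lemma row_add:
  assumes "u \<in> sections" "v \<in> sections"
  shows "row (u \<oplus>\<^bsub>row_ring\<^esub> v) x \<subseteq> row u x \<union> row v x"
proof
  fix \<gamma> assume g: "\<gamma> \<in> row (u \<oplus>\<^bsub>row_ring\<^esub> v) x"
  then interpret R: ring "stalk S (tgt G \<gamma>)" by (intro stalk_ring) (auto simp: row_def)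
  show "\<gamma> \<in> row u x \<union> row v x" using g by (auto simp: row_def row_ring_simps)
qed

lemma zero_sections: "\<zero>\<^bsub>row_ring\<^esub> \<in> sections"
  unfolding row_ring_simps by (rule restrict_sections) (rule stalk_closed)

lemma row_ring_abelian: "abelian_group row_ring"
proof (rule abelian_groupI)
  note c = section_closed'[OF row_finite_sections]
  fix u assume u: "u \<in> carrier row_ring"
  then have us: "u \<in> row_finite" by (simp add: row_ring_simps)
  show "u \<oplus>\<^bsub>row_ring\<^esub> v \<in> carrier row_ring" if "v \<in> carrier row_ring" for v
  proof -
    have v: "v \<in> row_finite" using that by (simp add: row_ring_simps)
    have "u \<oplus>\<^bsub>row_ring\<^esub> v \<in> row_finite"
    proof (rule row_finiteI)
      show "u \<oplus>\<^bsub>row_ring\<^esub> v \<in> sections" using us v row_finite_sections by (intro sections_add)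
      show "\<exists>T. finite T \<and> row (u \<oplus>\<^bsub>row_ring\<^esub> v) x \<subseteq> T" if "x \<in> units G" for x
        using row_add[of u v x] us v row_finite_sections finite_row[OF us that] finite_row[OF v that]
        by (meson finite_UnI)
    qed
    then show ?thesis by (simp add: row_ring_simps)
  qed
  show "u \<oplus>\<^bsub>row_ring\<^esub> v \<oplus>\<^bsub>row_ring\<^esub> w = u \<oplus>\<^bsub>row_ring\<^esub> (v \<oplus>\<^bsub>row_ring\<^esub> w)"
    if "v \<in> carrier row_ring" "w \<in> carrier row_ring" for v w
    unfolding row_ring_simps
  proof (rule restrict_ext)
    fix \<gamma> assume g: "\<gamma> \<in> arrows G"
    then interpret R: ring "stalk S (tgt G \<gamma>)" by (intro stalk_ring)
    show "(\<lambda>\<gamma>\<in>arrows G. u \<gamma> \<oplus>\<^bsub>stalk S (tgt G \<gamma>)\<^esub> v \<gamma>) \<gamma> \<oplus>\<^bsub>stalk S (tgt G \<gamma>)\<^esub> w \<gamma> =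
      u \<gamma> \<oplus>\<^bsub>stalk S (tgt G \<gamma>)\<^esub> (\<lambda>\<gamma>\<in>arrows G. v \<gamma> \<oplus>\<^bsub>stalk S (tgt G \<gamma>)\<^esub> w \<gamma>) \<gamma>"
      using g that us c[of _ \<gamma>] by (simp add: row_ring_simps R.a_assoc)
  qed
  show "u \<oplus>\<^bsub>row_ring\<^esub> v = v \<oplus>\<^bsub>row_ring\<^esub> u" if "v \<in> carrier row_ring" for v
    unfolding row_ring_simps
  proof (rule restrict_ext)
    fix \<gamma> assume g: "\<gamma> \<in> arrows G"
    then interpret R: ring "stalk S (tgt G \<gamma>)" by (intro stalk_ring)
    show "u \<gamma> \<oplus>\<^bsub>stalk S (tgt G \<gamma>)\<^esub> v \<gamma> = v \<gamma> \<oplus>\<^bsub>stalk S (tgt G \<gamma>)\<^esub> u \<gamma>"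
      using g that us c[of _ \<gamma>] by (simp add: row_ring_simps R.a_comm)
  qed
  show "\<zero>\<^bsub>row_ring\<^esub> \<oplus>\<^bsub>row_ring\<^esub> u = u"
  proof (rule sections_eqI)
    fix \<gamma> assume g: "\<gamma> \<in> arrows G"
    then interpret R: ring "stalk S (tgt G \<gamma>)" by (intro stalk_ring)
    show "(\<zero>\<^bsub>row_ring\<^esub> \<oplus>\<^bsub>row_ring\<^esub> u) \<gamma> = u \<gamma>"
      using g us c[of _ \<gamma>] by (simp add: row_ring_simps)
  qed (use us row_finite_sections zero_sections sections_add in auto)
  define v where "v = (\<lambda>\<gamma> \<in> arrows G. \<ominus>\<^bsub>stalk S (tgt G \<gamma>)\<^esub> u \<gamma>)"
  have vs: "v \<in> sections"
    unfolding v_def by (rule restrict_sections) (simp add: stalk_closed c[OF us])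
  have "row v x \<subseteq> row u x" for x
  proof
    fix \<gamma> assume g: "\<gamma> \<in> row v x"
    then interpret R: ring "stalk S (tgt G \<gamma>)" by (intro stalk_ring) (auto simp: row_def)
    show "\<gamma> \<in> row u x" using g by (auto simp: row_def v_def)
  qed
  then have "v \<in> carrier row_ring"
    unfolding row_ring_simps using vs finite_row[OF us] by (meson row_finiteI)
  moreover have "v \<oplus>\<^bsub>row_ring\<^esub> u = \<zero>\<^bsub>row_ring\<^esub>"
    unfolding row_ring_simps
  proof (rule restrict_ext)
    fix \<gamma> assume g: "\<gamma> \<in> arrows G"
    then interpret R: ring "stalk S (tgt G \<gamma>)" by (intro stalk_ring)
    show "v \<gamma> \<oplus>\<^bsub>stalk S (tgt G \<gamma>)\<^esub> u \<gamma> = \<zero>\<^bsub>stalk S (tgt G \<gamma>)\<^esub>"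
      using g us c[of _ \<gamma>] by (simp add: v_def R.l_neg)
  qed
  ultimately show "\<exists>v\<in>carrier row_ring. v \<oplus>\<^bsub>row_ring\<^esub> u = \<zero>\<^bsub>row_ring\<^esub>" by blast
next
  have "row \<zero>\<^bsub>row_ring\<^esub> x = {}" for x by (auto simp: row_def row_ring_simps)
  then show "\<zero>\<^bsub>row_ring\<^esub> \<in> carrier row_ring"
    using zero_sections by (auto simp: row_ring_simps(1) row_finite_def)
qed

text \<open>The set need not be open, so \<open>diag {x}\<close> is available for a single unit; it
  plays the role of \<open>e\<close>.\<close>

definition diag :: "'g set \<Rightarrow> 'g \<Rightarrow> 'e" where
  "diag X = (\<lambda>\<gamma> \<in> arrows G. if \<gamma> \<in> X then \<one>\<^bsub>stalk S \<gamma>\<^esub> else \<zero>\<^bsub>stalk S (tgt G \<gamma>)\<^esub>)"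

lemma diag_row_finite:
  assumes X: "X \<subseteq> units G" shows "diag X \<in> row_finite"
proof (rule row_finiteI)
  show "diag X \<in> sections"
    unfolding diag_def
  proof (rule restrict_sections)
    fix \<gamma> assume g: "\<gamma> \<in> arrows G"
    have "\<one>\<^bsub>stalk S \<gamma>\<^esub> = \<one>\<^bsub>stalk S (tgt G \<gamma>)\<^esub>" if "\<gamma> \<in> X" using that X tgt_of_unit by auto
    then show "(if \<gamma> \<in> X then \<one>\<^bsub>stalk S \<gamma>\<^esub> else \<zero>\<^bsub>stalk S (tgt G \<gamma>)\<^esub>) \<in> carrier (stalk S (tgt G \<gamma>))"
      using stalk_closed[OF g] by simp
  qed
  show "\<exists>T. finite T \<and> row (diag X) x \<subseteq> T" if "x \<in> units G" for x
    using X by (intro exI[of _ "{x}"]) (auto simp: row_def diag_def tgt_of_unit subset_iff split: if_splits)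
qed

lemma diag_conv:
  assumes X: "X \<subseteq> units G" and v: "v \<in> sections" and \<xi>: "\<xi> \<in> arrows G"
  shows "(diag X \<star> v) \<xi> = (if tgt G \<xi> \<in> X then v \<xi> else \<zero>\<^bsub>stalk S (tgt G \<xi>)\<^esub>)"
proof -
  let ?x = "tgt G \<xi>"
  note d = diag_row_finite[OF X]
  interpret R: ring "stalk S ?x" using \<xi> by (intro stalk_ring)
  have x: "?x \<in> units G" "?x \<in> arrows G" "tgt G ?x = ?x" "src G ?x = ?x"
    using \<xi> by (simp_all add: tgt_unit tgt_closed tgt_tgt src_tgt)
  have l: "ldiv ?x \<xi> = \<xi>" using x \<xi> by (simp add: inv_of_unit unit_mult)
  have vc: "v \<xi> \<in> carrier (stalk S ?x)" using v \<xi> by (rule section_closed)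
  have "(diag X \<star> v) \<xi> = finsum (stalk S ?x) (\<lambda>\<beta>. diag X \<beta> \<otimes>\<^bsub>stalk S ?x\<^esub> act S \<beta> (v (ldiv \<beta> \<xi>))) {?x}"
    using X by (intro conv_value row_finite_sections d v \<xi>) (auto simp: x diag_def subset_iff tgt_of_unit)
  also have "\<dots> = diag X ?x \<otimes>\<^bsub>stalk S ?x\<^esub> act S ?x (v (ldiv ?x \<xi>))"
    using term_closed'[OF row_finite_sections[OF d] v x(2) \<xi> x(3)] by (simp add: R.finsum_insert R.finsum_empty)
  finally show ?thesis using vc x by (simp add: l act_unit' diag_def)
qed

text \<open>Only the factorisation of \<xi> as \<xi> times its source has a unit on the right: if
  \<open>ldiv \<beta> \<xi>\<close> is a unit, it is the source of \<beta>, so \<beta> =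
  \<xi>.\<close>

lemma conv_diag:
  assumes X: "X \<subseteq> units G" and u: "u \<in> sections" and \<xi>: "\<xi> \<in> arrows G"
  shows "(u \<star> diag X) \<xi> = (if src G \<xi> \<in> X then u \<xi> else \<zero>\<^bsub>stalk S (tgt G \<xi>)\<^esub>)"
proof -
  let ?x = "tgt G \<xi>"
  note d = diag_row_finite[OF X]
  interpret R: ring "stalk S ?x" using \<xi> by (intro stalk_ring)
  have l: "ldiv \<xi> \<xi> = src G \<xi>" by (simp add: src_def)
  have uc: "u \<xi> \<in> carrier (stalk S ?x)" using u \<xi> by (rule section_closed)
  have "(u \<star> diag X) \<xi> = finsum (stalk S ?x) (\<lambda>\<beta>. u \<beta> \<otimes>\<^bsub>stalk S ?x\<^esub> act S \<beta> (diag X (ldiv \<beta> \<xi>))) {\<xi>}"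
  proof (rule conv_value[OF u row_finite_sections[OF d] \<xi>])
    fix \<beta> assume b: "\<beta> \<in> arrows G" "tgt G \<beta> = ?x" "\<beta> \<notin> {\<xi>}"
    have "ldiv \<beta> \<xi> \<notin> X"
    proof
      assume "ldiv \<beta> \<xi> \<in> X"
      then have "src G (ldiv \<beta> \<xi>) = ldiv \<beta> \<xi>" "tgt G (ldiv \<beta> \<xi>) = ldiv \<beta> \<xi>"
        using X src_of_unit tgt_of_unit by auto
      then have "src G \<beta> = ldiv \<beta> \<xi>" using b \<xi> by (simp add: ldiv)
      then have "\<beta> = \<xi>" using ldiv(4)[of \<beta> \<xi>] mult_src[of \<beta>] b \<xi> by simp
      then show False using b by simp
    qed
    then show "u \<beta> = \<zero>\<^bsub>stalk S ?x\<^esub> \<or> diag X (ldiv \<beta> \<xi>) = \<zero>\<^bsub>stalk S (src G \<beta>)\<^esub>"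
      using b \<xi> by (simp add: diag_def ldiv)
  qed (use \<xi> in auto)
  also have "\<dots> = u \<xi> \<otimes>\<^bsub>stalk S ?x\<^esub> act S \<xi> (diag X (src G \<xi>))"
    using term_closed'[OF u row_finite_sections[OF d] \<xi> \<xi> refl] by (simp add: R.finsum_insert R.finsum_empty l)
  finally show ?thesis
    using uc \<xi> act_zero[OF \<xi>] act_one[OF \<xi>] by (auto simp: diag_def src_closed tgt_src)
qed

lemma row_ring_one: "\<one>\<^bsub>row_ring\<^esub> = diag (units G)"
  by (simp add: row_ring_simps diag_def)

lemma conv_distrib_right:
  assumes "u \<in> row_finite" "v \<in> row_finite" "w \<in> row_finite"
  shows "(u \<oplus>\<^bsub>row_ring\<^esub> v) \<star> w = (u \<star> w) \<oplus>\<^bsub>row_ring\<^esub> (v \<star> w)"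
proof -
  interpret A: abelian_group row_ring by (rule row_ring_abelian)
  note s = row_finite_sections
  have uv: "u \<oplus>\<^bsub>row_ring\<^esub> v \<in> row_finite" using A.a_closed[of u v] assms by (simp add: row_ring_simps(1))
  show ?thesis
  proof (rule sections_eqI)
    show "(u \<oplus>\<^bsub>row_ring\<^esub> v) \<star> w \<in> sections" "(u \<star> w) \<oplus>\<^bsub>row_ring\<^esub> (v \<star> w) \<in> sections"
      by (intro conv_sections sections_add uv assms s)+
    fix \<xi> assume \<xi>: "\<xi> \<in> arrows G"
    let ?x = "tgt G \<xi>"
    interpret R: ring "stalk S ?x" using \<xi> by (intro stalk_ring)
    define T where "T = row u ?x \<union> row v ?x"
    have T: "finite T" "T \<subseteq> {\<beta> \<in> arrows G. tgt G \<beta> = ?x}"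
      using finite_row assms tgt_unit[OF \<xi>] by (auto simp: T_def row_def)
    have val: "(y \<star> w) \<xi> = finsum (stalk S ?x) (\<lambda>\<beta>. y \<beta> \<otimes>\<^bsub>stalk S ?x\<^esub> act S \<beta> (w (ldiv \<beta> \<xi>))) T"
      if "y \<in> sections" "row y ?x \<subseteq> T" for y
      by (rule conv_value[OF that(1) s[OF assms(3)] \<xi> T]) (use that(2) in \<open>auto simp: row_def\<close>)
    have c: "act S \<beta> (w (ldiv \<beta> \<xi>)) \<in> carrier (stalk S ?x)" "u \<beta> \<in> carrier (stalk S ?x)" "v \<beta> \<in> carrier (stalk S ?x)"
      if "\<beta> \<in> T" for \<beta>
      using that T(2) \<xi> section_closed[OF s[OF assms(1)], of \<beta>] section_closed[OF s[OF assms(2)], of \<beta>]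
        act_closed[of \<beta> "w (ldiv \<beta> \<xi>)"] section_closed[OF s[OF assms(3)], of "ldiv \<beta> \<xi>"]
      by (auto simp: ldiv)
    have "((u \<oplus>\<^bsub>row_ring\<^esub> v) \<star> w) \<xi> =
        finsum (stalk S ?x) (\<lambda>\<beta>. (u \<oplus>\<^bsub>row_ring\<^esub> v) \<beta> \<otimes>\<^bsub>stalk S ?x\<^esub> act S \<beta> (w (ldiv \<beta> \<xi>))) T"
      using row_add[of u v ?x] s assms by (intro val) (auto simp: T_def sections_add)
    also have "\<dots> = finsum (stalk S ?x) (\<lambda>\<beta>. u \<beta> \<otimes>\<^bsub>stalk S ?x\<^esub> act S \<beta> (w (ldiv \<beta> \<xi>)) \<oplus>\<^bsub>stalk S ?x\<^esub>
        v \<beta> \<otimes>\<^bsub>stalk S ?x\<^esub> act S \<beta> (w (ldiv \<beta> \<xi>))) T"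
    proof (rule R.finsum_cong'[OF refl])
      show "(u \<oplus>\<^bsub>row_ring\<^esub> v) \<beta> \<otimes>\<^bsub>stalk S ?x\<^esub> act S \<beta> (w (ldiv \<beta> \<xi>)) = u \<beta> \<otimes>\<^bsub>stalk S ?x\<^esub> act S \<beta> (w (ldiv \<beta> \<xi>)) \<oplus>\<^bsub>stalk S ?x\<^esub>
        v \<beta> \<otimes>\<^bsub>stalk S ?x\<^esub> act S \<beta> (w (ldiv \<beta> \<xi>))" if "\<beta> \<in> T" for \<beta>
        using c[OF that] that T(2) by (auto simp: row_ring_simps R.l_distr)
    qed (use c in auto)
    also have "\<dots> = (u \<star> w) \<xi> \<oplus>\<^bsub>stalk S ?x\<^esub> (v \<star> w) \<xi>"
      using c s assms by (subst R.finsum_addf) (auto simp: val T_def)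
    finally show "((u \<oplus>\<^bsub>row_ring\<^esub> v) \<star> w) \<xi> = ((u \<star> w) \<oplus>\<^bsub>row_ring\<^esub> (v \<star> w)) \<xi>"
      using \<xi> by (simp add: row_ring_simps)
  qed
qed

lemma conv_distrib_left:
  assumes "u \<in> row_finite" "v \<in> row_finite" "w \<in> row_finite"
  shows "w \<star> (u \<oplus>\<^bsub>row_ring\<^esub> v) = (w \<star> u) \<oplus>\<^bsub>row_ring\<^esub> (w \<star> v)"
proof -
  interpret A: abelian_group row_ring by (rule row_ring_abelian)
  note s = row_finite_sections
  have uv: "u \<oplus>\<^bsub>row_ring\<^esub> v \<in> sections" by (intro sections_add s assms)
  show ?thesis
  proof (rule sections_eqI)
    show "w \<star> (u \<oplus>\<^bsub>row_ring\<^esub> v) \<in> sections" "(w \<star> u) \<oplus>\<^bsub>row_ring\<^esub> (w \<star> v) \<in> sections"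
      by (intro conv_sections sections_add uv assms s)+
    fix \<xi> assume \<xi>: "\<xi> \<in> arrows G"
    let ?x = "tgt G \<xi>"
    interpret R: ring "stalk S ?x" using \<xi> by (intro stalk_ring)
    define T where "T = row w ?x"
    have T: "\<beta> \<in> arrows G" "tgt G \<beta> = ?x" if "\<beta> \<in> T" for \<beta>
      using that by (auto simp: T_def row_def)
    have wc: "w \<beta> \<in> carrier (stalk S ?x)" if "\<beta> \<in> T" for \<beta>
      using section_closed[OF s[OF assms(3)], of \<beta>] T[OF that] by simp
    have c: "act S \<beta> (y (ldiv \<beta> \<xi>)) \<in> carrier (stalk S ?x)" if "y \<in> sections" "\<beta> \<in> T" for \<beta> y
      using act_closed[of \<beta> "y (ldiv \<beta> \<xi>)"] section_closed[OF that(1), of "ldiv \<beta> \<xi>"] T[OF that(2)] \<xi>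
      by (auto simp: ldiv)
    have "(w \<star> (u \<oplus>\<^bsub>row_ring\<^esub> v)) \<xi> =
        finsum (stalk S ?x) (\<lambda>\<beta>. w \<beta> \<otimes>\<^bsub>stalk S ?x\<^esub> act S \<beta> ((u \<oplus>\<^bsub>row_ring\<^esub> v) (ldiv \<beta> \<xi>))) T"
      unfolding T_def by (intro conv_row assms uv \<xi>)
    also have "\<dots> = finsum (stalk S ?x) (\<lambda>\<beta>. w \<beta> \<otimes>\<^bsub>stalk S ?x\<^esub> act S \<beta> (u (ldiv \<beta> \<xi>)) \<oplus>\<^bsub>stalk S ?x\<^esub>
        w \<beta> \<otimes>\<^bsub>stalk S ?x\<^esub> act S \<beta> (v (ldiv \<beta> \<xi>))) T"
    proof (rule R.finsum_cong'[OF refl])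
      fix \<beta> assume b: "\<beta> \<in> T"
      have l: "ldiv \<beta> \<xi> \<in> arrows G" "tgt G (ldiv \<beta> \<xi>) = src G \<beta>" using T[OF b] \<xi> by (auto simp: ldiv)
      have "act S \<beta> ((u \<oplus>\<^bsub>row_ring\<^esub> v) (ldiv \<beta> \<xi>)) = act S \<beta> (u (ldiv \<beta> \<xi>)) \<oplus>\<^bsub>stalk S ?x\<^esub> act S \<beta> (v (ldiv \<beta> \<xi>))"
        using ring_hom_add[OF act_ring_hom, of \<beta> "u (ldiv \<beta> \<xi>)" "v (ldiv \<beta> \<xi>)"] T[OF b] l
          section_closed[OF s[OF assms(1)] l(1)] section_closed[OF s[OF assms(2)] l(1)]
        by (simp add: row_ring_simps)
      then show "w \<beta> \<otimes>\<^bsub>stalk S ?x\<^esub> act S \<beta> ((u \<oplus>\<^bsub>row_ring\<^esub> v) (ldiv \<beta> \<xi>)) = w \<beta> \<otimes>\<^bsub>stalk S ?x\<^esub> act S \<beta> (u (ldiv \<beta> \<xi>)) \<oplus>\<^bsub>stalk S ?x\<^esub>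
        w \<beta> \<otimes>\<^bsub>stalk S ?x\<^esub> act S \<beta> (v (ldiv \<beta> \<xi>))"
        using wc[OF b] c[OF s b] assms by (simp add: R.r_distr)
    qed (use wc c s assms in auto)
    also have "\<dots> = (w \<star> u) \<xi> \<oplus>\<^bsub>stalk S ?x\<^esub> (w \<star> v) \<xi>"
      using wc c s assms \<xi> by (subst R.finsum_addf) (auto simp: conv_row T_def)
    finally show "(w \<star> (u \<oplus>\<^bsub>row_ring\<^esub> v)) \<xi> = ((w \<star> u) \<oplus>\<^bsub>row_ring\<^esub> (w \<star> v)) \<xi>"
      using \<xi> by (simp add: row_ring_simps)
  qed
qed

lemma row_ring: "ring row_ring"
proof (rule ringI[OF row_ring_abelian])
  note s = row_finite_sections
  have d: "diag (units G) \<in> row_finite" by (simp add: diag_row_finite)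
  show "monoid row_ring"
  proof (rule monoidI)
    show "\<one>\<^bsub>row_ring\<^esub> \<in> carrier row_ring" unfolding row_ring_one by (simp add: row_ring_simps(1) d)
    fix u assume "u \<in> carrier row_ring"
    then have u: "u \<in> row_finite" by (simp add: row_ring_simps(1))
    show "\<one>\<^bsub>row_ring\<^esub> \<otimes>\<^bsub>row_ring\<^esub> u = u"
      unfolding row_ring_one row_ring_simps(2)
      by (rule sections_eqI[OF conv_sections[OF d s[OF u]] s[OF u]]) (simp add: diag_conv s u tgt_unit)
    show "u \<otimes>\<^bsub>row_ring\<^esub> \<one>\<^bsub>row_ring\<^esub> = u"
      unfolding row_ring_one row_ring_simps(2)
      by (rule sections_eqI[OF conv_sections[OF u s[OF d]] s[OF u]]) (simp add: conv_diag s u src_unit)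
  qed (simp_all add: row_ring_simps(1,2) conv_closed conv_assoc)
qed (simp_all add: row_ring_simps(1,2) conv_distrib_left conv_distrib_right)

section \<open>Extension by zero\<close>

text \<open>Places elements of the isotropy rings and bimodules, which are functions on part of the
  arrows, inside the ring of row-finite sections. The maps \<iota> and \<kappa> of the corner are
  instances.\<close>

definition ext :: "'g set \<Rightarrow> ('g \<Rightarrow> 'e) \<Rightarrow> ('g \<Rightarrow> 'e)" where
  "ext K u = (\<lambda>\<gamma> \<in> arrows G. if \<gamma> \<in> K then u \<gamma> else \<zero>\<^bsub>stalk S (tgt G \<gamma>)\<^esub>)"

lemma ext_sections:
  assumes "\<And>\<gamma>. \<gamma> \<in> K \<Longrightarrow> u \<gamma> \<in> carrier (stalk S (tgt G \<gamma>))"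
  shows "ext K u \<in> sections"
  unfolding ext_def by (rule restrict_sections) (simp add: assms stalk_closed)

lemma ext_arrows: "u \<in> sections \<Longrightarrow> ext (arrows G) u = u"
  by (auto simp: ext_def sections_def PiE_def extensional_def fun_eq_iff)

text \<open>All products and actions are \<open>conv\<close> with different index sets. Extending by
  zero adds only zero terms at arrows in \<open>K\<close>, and an arrow outside \<open>K\<close> has
  no factorisation through \<open>I\<close> and \<open>J\<close>, so each of them becomes the one
  product of \<open>row_ring\<close>.\<close>

lemma ext_conv:
  assumes IJK: "I \<subseteq> arrows G" "J \<subseteq> arrows G" "K \<subseteq> arrows G"
    and K: "\<And>\<beta> \<gamma>. \<lbrakk>\<beta> \<in> I; \<gamma> \<in> J; src G \<beta> = tgt G \<gamma>\<rbrakk> \<Longrightarrow> gmult G \<beta> \<gamma> \<in> K"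
    and u: "\<And>\<beta>. \<beta> \<in> I \<Longrightarrow> u \<beta> \<in> carrier (stalk S (tgt G \<beta>))"
    and v: "\<And>\<gamma>. \<gamma> \<in> J \<Longrightarrow> v \<gamma> \<in> carrier (stalk S (tgt G \<gamma>))"
    and fin: "ext I u \<in> row_finite"
  shows "ext K (conv G S I J K u v) = ext I u \<star> ext J v"
    and "\<xi> \<in> K \<Longrightarrow> conv G S I J K u v \<xi> \<in> carrier (stalk S (tgt G \<xi>))"
proof -
  have eu: "ext I u \<in> sections" and ev: "ext J v \<in> sections" by (intro ext_sections u v; assumption)+
  have val: "ext K (conv G S I J K u v) \<xi> = (ext I u \<star> ext J v) \<xi>" if \<xi>: "\<xi> \<in> arrows G" for \<xi>
  proof -
    interpret R: ring "stalk S (tgt G \<xi>)" using \<xi> by (intro stalk_ring)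
    define T where "T = {\<beta> \<in> row (ext I u) (tgt G \<xi>). ldiv \<beta> \<xi> \<in> J}"
    have "finite T" unfolding T_def using finite_row[OF fin tgt_unit[OF \<xi>]] by simp
    moreover have "T \<subseteq> {\<beta> \<in> I. tgt G \<beta> = tgt G \<xi> \<and> ldiv \<beta> \<xi> \<in> J}"
      by (auto simp: T_def row_def ext_def split: if_splits)
    ultimately have T: "finite T" "T \<subseteq> {\<beta> \<in> I. tgt G \<beta> = tgt G \<xi> \<and> ldiv \<beta> \<xi> \<in> J}" .
    have r: "(ext I u \<star> ext J v) \<xi> = finsum (stalk S (tgt G \<xi>))
        (\<lambda>\<beta>. ext I u \<beta> \<otimes>\<^bsub>stalk S (tgt G \<xi>)\<^esub> act S \<beta> (ext J v (ldiv \<beta> \<xi>))) T"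
    proof (rule conv_value[OF eu ev \<xi> T(1)])
      fix \<beta> assume b: "\<beta> \<in> arrows G" "tgt G \<beta> = tgt G \<xi>" "\<beta> \<notin> T"
      then show "ext I u \<beta> = \<zero>\<^bsub>stalk S (tgt G \<xi>)\<^esub> \<or> ext J v (ldiv \<beta> \<xi>) = \<zero>\<^bsub>stalk S (src G \<beta>)\<^esub>"
        using \<xi> by (auto simp: T_def row_def ext_def ldiv)
    qed (use T IJK in auto)
    show ?thesis
    proof (cases "\<xi> \<in> K")
      case True
      have "conv G S I J K u v \<xi> = finsum (stalk S (tgt G \<xi>))
          (\<lambda>\<beta>. u \<beta> \<otimes>\<^bsub>stalk S (tgt G \<xi>)\<^esub> act S \<beta> (v (ldiv \<beta> \<xi>))) T"
      proof (rule conv_eq[OF True \<xi> IJK(1,2) u v T])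
        fix \<beta> assume "\<beta> \<in> I" "tgt G \<beta> = tgt G \<xi>" "ldiv \<beta> \<xi> \<in> J" "\<beta> \<notin> T"
        then show "u \<beta> = \<zero>\<^bsub>stalk S (tgt G \<xi>)\<^esub> \<or> v (ldiv \<beta> \<xi>) = \<zero>\<^bsub>stalk S (src G \<beta>)\<^esub>"
          using IJK(1) by (auto simp: T_def row_def ext_def)
      qed
      also have "\<dots> = (ext I u \<star> ext J v) \<xi>"
        unfolding r
      proof (rule R.finsum_cong'[OF refl])
        have "ext I u \<beta> = u \<beta>" "ext J v (ldiv \<beta> \<xi>) = v (ldiv \<beta> \<xi>)" if "\<beta> \<in> T" for \<beta>
          using that T(2) IJK \<xi> by (auto simp: ext_def)
        then show "u \<beta> \<otimes>\<^bsub>stalk S (tgt G \<xi>)\<^esub> act S \<beta> (v (ldiv \<beta> \<xi>)) =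
            ext I u \<beta> \<otimes>\<^bsub>stalk S (tgt G \<xi>)\<^esub> act S \<beta> (ext J v (ldiv \<beta> \<xi>))" if "\<beta> \<in> T" for \<beta>
          using that by simp
      qed (use T(2) IJK \<xi> in \<open>auto intro!: term_closed' eu ev\<close>)
      finally show ?thesis using True \<xi> by (simp add: ext_def)
    next
      case False
      have "T = {}" using T(2) K False IJK \<xi> by (force simp: ldiv)
      then show ?thesis unfolding r using False \<xi> by (simp add: ext_def R.finsum_empty)
    qed
  qed
  have c: "(ext I u \<star> ext J v) \<xi> \<in> carrier (stalk S (tgt G \<xi>))" if "\<xi> \<in> arrows G" for \<xi>
    using conv_sections[OF fin ev] that by (rule section_closed)
  show k: "conv G S I J K u v \<xi> \<in> carrier (stalk S (tgt G \<xi>))" if "\<xi> \<in> K" for \<xi>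
    using val[of \<xi>] c[of \<xi>] that IJK(3) by (auto simp: ext_def)
  show "ext K (conv G S I J K u v) = ext I u \<star> ext J v"
    by (rule sections_eqI[OF ext_sections[OF k] conv_sections[OF fin ev] val])
qed

end

section \<open>Local homeomorphisms and compact open bisections\<close>

lemma continuous_map_locally:
  assumes "\<And>x. x \<in> topspace Z \<Longrightarrow> \<exists>W. openin Z W \<and> x \<in> W \<and> continuous_map (subtopology Z W) Y f"
  shows "continuous_map Z Y f"
proof -
  obtain T where T: "\<And>x. x \<in> topspace Z \<Longrightarrow> openin Z (T x) \<and> x \<in> T x \<and> continuous_map (subtopology Z (T x)) Y f"
    using assms by metis
  show ?thesis
    by (rule pasting_lemma[where I = "topspace Z" and T = T and f = "\<lambda>_. f"]) (use T in auto)
qed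

lemma local_homeomorphism_chart:
  assumes f: "local_homeomorphism X Y f" and x: "x \<in> topspace X"
  obtains U where "openin X U" "x \<in> U" "openin Y (f ` U)"
    "homeomorphic_map (subtopology X U) (subtopology Y (f ` U)) f"
  using assms unfolding local_homeomorphism_def by blast

lemma local_homeomorphism_continuous:
  assumes f: "local_homeomorphism X Y f" shows "continuous_map X Y f"
proof (rule continuous_map_locally)
  fix x assume x: "x \<in> topspace X"
  obtain U where U: "openin X U" "x \<in> U" "homeomorphic_map (subtopology X U) (subtopology Y (f ` U)) f"
    using local_homeomorphism_chart[OF f x] by metis
  have "continuous_map (subtopology X U) (subtopology Y (f ` U)) f"
    using U(3) by (rule homeomorphic_imp_continuous_map)
  then show "\<exists>W. openin X W \<and> x \<in> W \<and> continuous_map (subtopology X W) Y f"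
    using U by (meson continuous_map_in_subtopology)
qed

lemma local_homeomorphism_open:
  assumes f: "local_homeomorphism X Y f" shows "open_map X Y f"
  unfolding open_map_def
proof (intro allI impI)
  fix W assume W: "openin X W"
  show "openin Y (f ` W)"
    unfolding openin_subopen[of _ "f ` W"]
  proof
    fix y assume "y \<in> f ` W"
    then obtain x where x: "x \<in> W" "y = f x" by blast
    then have "x \<in> topspace X" using W openin_subset by blast
    from local_homeomorphism_chart[OF f this] obtain U where
      U: "openin X U" "x \<in> U" "openin Y (f ` U)" "homeomorphic_map (subtopology X U) (subtopology Y (f ` U)) f"
      by metis
    have "openin (subtopology X U) (U \<inter> W)" using U(1) W by (simp add: openin_open_subtopology openin_Int)
    then have "openin (subtopology Y (f ` U)) (f ` (U \<inter> W))"
      using homeomorphic_imp_open_map[OF U(4)] by (simp add: open_map_def)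
    then have "openin Y (f ` (U \<inter> W))" using U(3) by (simp add: openin_open_subtopology)
    then show "\<exists>T. openin Y T \<and> y \<in> T \<and> T \<subseteq> f ` W" using x U(2) by blast
  qed
qed

lemma local_homeomorphism_inj:
  assumes f: "local_homeomorphism X Y f" and x: "x \<in> topspace X"
  obtains U where "openin X U" "x \<in> U" "inj_on f U"
proof -
  obtain U where U: "openin X U" "x \<in> U" "homeomorphic_map (subtopology X U) (subtopology Y (f ` U)) f"
    using local_homeomorphism_chart[OF f x] by metis
  have "inj_on f (topspace (subtopology X U))" using homeomorphic_imp_injective_map[OF U(3)] .
  moreover have "topspace (subtopology X U) = U"
    using openin_subset[OF U(1)] by (simp add: Int_absorb1)
  ultimately show thesis using that U by metis
qed

lemma open_injective_homeomorphic:
  assumes "continuous_map X Y f" "open_map X Y f" "openin X U" "inj_on f U"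
  shows "homeomorphic_map (subtopology X U) (subtopology Y (f ` U)) f"
proof (rule bijective_open_imp_homeomorphic_map)
  have U: "U \<subseteq> topspace X" using assms(3) openin_subset by blast
  have fU: "openin Y (f ` U)" using assms(2,3) by (simp add: open_map_def)
  show "continuous_map (subtopology X U) (subtopology Y (f ` U)) f"
    using assms(1) by (simp add: continuous_map_in_subtopology continuous_map_from_subtopology)
  show "open_map (subtopology X U) (subtopology Y (f ` U)) f"
    using assms(2) fU by (auto simp: open_map_def openin_open_subtopology[OF assms(3)] openin_open_subtopology[OF fU])
  show "f ` topspace (subtopology X U) = topspace (subtopology Y (f ` U))"
    using U openin_subset[OF fU] by (simp add: Int_absorb1)
  show "inj_on f (topspace (subtopology X U))" using assms(4) U by (simp add: Int_absorb1)
qed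

lemma local_inverse:
  assumes "continuous_map X Y f" "open_map X Y f" "openin X U" "inj_on f U"
  obtains s where "continuous_map (subtopology Y (f ` U)) X s" "\<And>x. x \<in> U \<Longrightarrow> s (f x) = x"
proof -
  obtain s where s: "homeomorphic_maps (subtopology X U) (subtopology Y (f ` U)) f s"
    using open_injective_homeomorphic[OF assms] homeomorphic_map_maps by blast
  have "continuous_map (subtopology Y (f ` U)) X s"
    using s by (simp add: homeomorphic_maps_def continuous_map_in_subtopology)
  moreover have "s (f x) = x" if "x \<in> U" for x
    using s that openin_subset[OF assms(3)] by (auto simp: homeomorphic_maps_def)
  ultimately show thesis using that by blast
qed

locale ample_sheaf = ample_groupoid G + groupoid_sheaf_of_rings G S
  for G :: "'g groupoid_data" and S :: "('g, 'e) ring_sheaf_data"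

sublocale ample_sheaf \<subseteq> sheaf_groupoid G S ..

section \<open>Topology of units and bisections\<close>

context ample_groupoid
begin

abbreviation "X \<equiv> gtop G"
abbreviation "X0 \<equiv> unit_space G"

lemma units_arrows: "units G \<subseteq> arrows G"
  using unit_arrow by blast

lemma topspace_X0 [simp]: "topspace X0 = units G"
  using units_arrows by (auto simp: unit_space_def)

lemma tgt_continuous: "continuous_map X X0 (tgt G)"
  using tgt_local_homeomorphism by (rule local_homeomorphism_continuous)

lemma tgt_open_map: "open_map X X0 (tgt G)"
  using tgt_local_homeomorphism by (rule local_homeomorphism_open)

lemma tgt_continuous': "continuous_map X X (tgt G)"
  using tgt_continuous by (simp add: unit_space_def continuous_map_in_subtopology)

text \<open>Near a unit the target map is injective on some \<open>U\<close>. If \<gamma> and its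
  target both lie in \<open>U\<close>, they have the same target and so coincide, which makes
  \<gamma> a unit.\<close>

lemma openin_units: "openin X (units G)"
  unfolding openin_subopen[of _ "units G"]
proof
  fix x assume x: "x \<in> units G"
  obtain U where U: "openin X U" "x \<in> U" "inj_on (tgt G) U"
    using local_homeomorphism_inj[OF tgt_local_homeomorphism unit_arrow[OF x]] by blast
  let ?T = "{\<gamma> \<in> U. tgt G \<gamma> \<in> U}"
  have "openin X ?T" using tgt_continuous' U by (intro openin_continuous_map_preimage_gen)
  moreover have "x \<in> ?T" using U x by (simp add: tgt_of_unit)
  moreover have "?T \<subseteq> units G"
  proof
    fix \<gamma> assume g: "\<gamma> \<in> ?T"
    then have "\<gamma> \<in> arrows G" using openin_subset[OF U(1)] by blast
    then have "tgt G \<gamma> = \<gamma>" using tgt_tgt inj_onD[OF U(3), of "tgt G \<gamma>" \<gamma>] g by blast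
    then show "\<gamma> \<in> units G" using tgt_unit[OF \<open>\<gamma> \<in> arrows G\<close>] by simp
  qed
  ultimately show "\<exists>T. openin X T \<and> x \<in> T \<and> T \<subseteq> units G" by blast
qed

lemma openin_X0: "openin X0 V \<longleftrightarrow> openin X V \<and> V \<subseteq> units G"
  unfolding unit_space_def by (rule openin_open_subtopology[OF openin_units])

lemma compactin_X0: "compactin X0 V \<longleftrightarrow> compactin X V \<and> V \<subseteq> units G"
  unfolding unit_space_def by (rule compactin_subtopology)

lemma src_eq_tgt_inv: "\<gamma> \<in> arrows G \<Longrightarrow> src G \<gamma> = tgt G (ginv G \<gamma>)"
  by (simp add: tgt_inv)

lemma src_continuous: "continuous_map X X0 (src G)"
  by (rule continuous_map_eq[OF continuous_map_compose[OF continuous_inv tgt_continuous]])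
    (simp add: src_eq_tgt_inv)

lemma openin_tgt_vimage: "openin X0 V \<Longrightarrow> openin X {\<gamma> \<in> arrows G. tgt G \<gamma> \<in> V}"
  by (rule openin_continuous_map_preimage[OF tgt_continuous])

lemma openin_tgt_image: "openin X U \<Longrightarrow> openin X0 (tgt G ` U)"
  using tgt_open_map by (simp add: open_map_def)

text \<open>The Hausdorff property is automatic: the target map is continuous and injective on
  \<open>U\<close>, with values in the Hausdorff unit space.\<close>

lemma compact_open_bisectionI:
  assumes "openin X U" "compactin X U" "inj_on (src G) U" "inj_on (tgt G) U"
  shows "compact_open_bisection G U"
proof -
  have "Hausdorff_space (subtopology X U)"
    by (rule Hausdorff_space_injective_preimage[OF unit_space_Hausdorff continuous_map_from_subtopology[OF tgt_continuous]])
      (use assms(4) in \<open>auto simp: inj_on_def\<close>)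
  then show ?thesis using assms by (simp add: compact_open_bisection_def)
qed

lemma compact_open_unit_nbhd:
  assumes "openin X0 V" "x \<in> V"
  obtains K where "compactin X0 K" "openin X0 K" "x \<in> K" "K \<subseteq> V"
  using unit_space_compact_open_basis assms unfolding openin_topology_base_unique by metis

lemma unit_bisection:
  assumes "compactin X0 K" "openin X0 K"
  shows "compact_open_bisection G K"
  using assms unfolding openin_X0 compactin_X0
  by (intro compact_open_bisectionI) (auto simp: inj_on_def src_of_unit tgt_of_unit subset_iff)

text \<open>The source map is the target map after inversion, so it is locally injective as well.
  Compactness is obtained by cutting down over a compact open set of units; the result is the image
  of that set under a local inverse of the target map.\<close>

lemma bisection_nbhd:
  assumes W: "openin X W" "\<gamma> \<in> W"
  obtains U where "compact_open_bisection G U" "\<gamma> \<in> U" "U \<subseteq> W"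
proof -
  have gA: "\<gamma> \<in> arrows G" using W openin_subset by blast
  obtain U1 where U1: "openin X U1" "\<gamma> \<in> U1" "inj_on (tgt G) U1"
    using local_homeomorphism_inj[OF tgt_local_homeomorphism gA] by blast
  obtain U2' where U2': "openin X U2'" "ginv G \<gamma> \<in> U2'" "inj_on (tgt G) U2'"
    using local_homeomorphism_inj[OF tgt_local_homeomorphism inv_closed[OF gA]] by blast
  define U2 where "U2 = {\<eta> \<in> arrows G. ginv G \<eta> \<in> U2'}"
  have U2: "openin X U2" "\<gamma> \<in> U2"
    unfolding U2_def using U2' gA openin_continuous_map_preimage[OF continuous_inv] by auto
  have inj2: "inj_on (src G) U2"
  proof (rule inj_onI)
    fix \<eta> \<zeta> assume h: "\<eta> \<in> U2" "\<zeta> \<in> U2" "src G \<eta> = src G \<zeta>"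
    then have "tgt G (ginv G \<eta>) = tgt G (ginv G \<zeta>)" by (auto simp: U2_def tgt_inv)
    then have "ginv G \<eta> = ginv G \<zeta>" using h U2'(3) by (auto simp: U2_def dest: inj_onD)
    then show "\<eta> = \<zeta>" using h inv_inv unfolding U2_def by (metis mem_Collect_eq)
  qed
  define W' where "W' = U1 \<inter> U2 \<inter> W"
  have W': "openin X W'" "\<gamma> \<in> W'" "inj_on (tgt G) W'" "inj_on (src G) W'"
    using U1 U2 W inj2 by (auto simp: W'_def intro: inj_on_subset)
  obtain K where K: "compactin X0 K" "openin X0 K" "tgt G \<gamma> \<in> K" "K \<subseteq> tgt G ` W'"
    using compact_open_unit_nbhd[OF openin_tgt_image[OF W'(1)]] W'(2) by blast
  obtain s where s: "continuous_map (subtopology X0 (tgt G ` W')) X s" "\<And>\<eta>. \<eta> \<in> W' \<Longrightarrow> s (tgt G \<eta>) = \<eta>"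
    using local_inverse[OF tgt_continuous tgt_open_map W'(1,3)] by blast
  define U where "U = {\<eta> \<in> W'. tgt G \<eta> \<in> K}"
  have "U = s ` K"
  proof (intro equalityI subsetI)
    fix \<eta> assume "\<eta> \<in> U" then show "\<eta> \<in> s ` K" using s(2)[of \<eta>] by (auto simp: U_def intro!: image_eqI[of _ _ "tgt G \<eta>"])
  next
    fix \<eta> assume "\<eta> \<in> s ` K"
    then obtain k where k: "k \<in> K" "\<eta> = s k" by blast
    then obtain w where w: "w \<in> W'" "k = tgt G w" using K(4) by blast
    then show "\<eta> \<in> U" using k s(2)[OF w(1)] by (simp add: U_def)
  qed
  moreover have "compactin X (s ` K)"
    using s(1) K by (intro image_compactin[OF _ s(1)]) (simp add: compactin_subtopology)
  moreover have "openin X U"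
    unfolding U_def using W' K by (intro openin_continuous_map_preimage_gen[OF tgt_continuous])
  ultimately have "compact_open_bisection G U"
    using W' by (intro compact_open_bisectionI) (auto simp: U_def intro: inj_on_subset)
  moreover have "\<gamma> \<in> U" "U \<subseteq> W" using W' K by (auto simp: U_def W'_def)
  ultimately show thesis using that by blast
qed

lemma compact_open_tgt_image:
  assumes "compact_open_bisection G U"
  shows "compactin X0 (tgt G ` U)" "openin X0 (tgt G ` U)" "closedin X0 (tgt G ` U)"
proof -
  show c: "compactin X0 (tgt G ` U)"
    using assms by (intro image_compactin[OF _ tgt_continuous]) (simp add: compact_open_bisection_def)
  show "openin X0 (tgt G ` U)" using assms by (intro openin_tgt_image) (simp add: compact_open_bisection_def)
  show "closedin X0 (tgt G ` U)" using c unit_space_Hausdorff compactin_imp_closedin by blast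
qed

text \<open>Finite sets are closed in the Hausdorff unit space. This serves to replace the indicator
  of \<open>{x}\<close> by that of \<open>K\<close> on a fibre that meets only the units in
  \<open>Y\<close>.\<close>

lemma separate_unit:
  assumes x: "x \<in> units G" and Y: "finite Y"
  obtains K where "compactin X0 K" "openin X0 K" "x \<in> K" "K \<inter> Y \<subseteq> {x}"
proof -
  have "closedin X0 ((Y - {x}) \<inter> units G)"
    using unit_space_Hausdorff Y by (intro closedin_Hausdorff_finite) auto
  then have "openin X0 (units G - (Y - {x}) \<inter> units G)" by (metis openin_diff openin_topspace topspace_X0)
  moreover have "x \<in> units G - (Y - {x}) \<inter> units G" using x by blast
  ultimately obtain K where "compactin X0 K" "openin X0 K" "x \<in> K" "K \<subseteq> units G - (Y - {x}) \<inter> units G"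
    by (rule compact_open_unit_nbhd)
  moreover from this have "K \<inter> Y \<subseteq> {x}" by blast
  ultimately show thesis using that by blast
qed

end

section \<open>Continuous sections\<close>

context ample_sheaf
begin

abbreviation "E \<equiv> etop S"

abbreviation cont :: "'g set \<Rightarrow> ('g \<Rightarrow> 'e) \<Rightarrow> bool" where
  "cont W f \<equiv> continuous_map (subtopology X W) E f"

definition over :: "'g set \<Rightarrow> ('g \<Rightarrow> 'e) \<Rightarrow> bool" where
  "over W f \<longleftrightarrow> (\<forall>\<eta> \<in> W. f \<eta> \<in> carrier (stalk S (tgt G \<eta>)))"

lemma over_proj: "\<lbrakk>over W f; \<eta> \<in> W; W \<subseteq> arrows G\<rbrakk> \<Longrightarrow> f \<eta> \<in> topspace E \<and> proj S (f \<eta>) = tgt G \<eta>"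
  using stalk_E[OF tgt_unit, of \<eta> "f \<eta>"] by (auto simp: over_def)

lemma sections_over: "\<lbrakk>f \<in> sections; W \<subseteq> arrows G\<rbrakk> \<Longrightarrow> over W f"
  using section_closed by (auto simp: over_def)

lemma proj_continuous: "continuous_map E X0 (proj S)"
  using proj_local_homeomorphism by (rule local_homeomorphism_continuous)

lemma proj_open_map: "open_map E X0 (proj S)"
  using proj_local_homeomorphism by (rule local_homeomorphism_open)

lemma local_section:
  assumes a: "a \<in> topspace E"
  obtains D \<sigma> where "openin X0 D" "proj S a \<in> D" "continuous_map (subtopology X0 D) E \<sigma>" "\<sigma> (proj S a) = a"
    "\<forall>y \<in> D. \<sigma> y \<in> carrier (stalk S y)"
proof -
  obtain U where U: "openin E U" "a \<in> U" "inj_on (proj S) U"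
    using local_homeomorphism_inj[OF proj_local_homeomorphism a] by blast
  obtain s where s: "continuous_map (subtopology X0 (proj S ` U)) E s" "\<And>b. b \<in> U \<Longrightarrow> s (proj S b) = b"
    using local_inverse[OF proj_continuous proj_open_map U(1,3)] by blast
  have D: "openin X0 (proj S ` U)" using U(1) proj_open_map by (simp add: open_map_def)
  have "s y \<in> carrier (stalk S y)" if y: "y \<in> proj S ` U" for y
  proof -
    obtain b where b: "b \<in> U" "y = proj S b" using y by blast
    have "y \<in> units G" using openin_subset[OF D] y by auto
    then show ?thesis using b s(2)[OF b(1)] openin_subset[OF U(1)] by (auto simp: carrier_stalk)
  qed
  then have "\<forall>y \<in> proj S ` U. s y \<in> carrier (stalk S y)" by blast
  moreover have "proj S a \<in> proj S ` U" "s (proj S a) = a" using U(2) s(2) by auto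
  ultimately show thesis using that[of "proj S ` U" s] D s(1) by simp
qed

text \<open>A local section of the sheaf projection through \<open>a\<close>, pulled back along the
  target map.\<close>

lemma section_through:
  assumes \<gamma>: "\<gamma> \<in> arrows G" and a: "a \<in> carrier (stalk S (tgt G \<gamma>))"
  obtains W f where "openin X W" "\<gamma> \<in> W" "cont W f" "over W f" "f \<gamma> = a"
proof -
  have aE: "a \<in> topspace E" "proj S a = tgt G \<gamma>" using stalk_E[OF tgt_unit[OF \<gamma>] a] by auto
  obtain D \<sigma> where D: "openin X0 D" "proj S a \<in> D" "continuous_map (subtopology X0 D) E \<sigma>" "\<sigma> (proj S a) = a"
    "\<forall>y \<in> D. \<sigma> y \<in> carrier (stalk S y)"
    by (rule local_section[OF aE(1)])
  let ?W = "{\<eta> \<in> arrows G. tgt G \<eta> \<in> D}"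
  have "continuous_map (subtopology X ?W) (subtopology X0 D) (tgt G)"
    using tgt_continuous by (auto simp: continuous_map_in_subtopology continuous_map_from_subtopology)
  then have "cont ?W (\<sigma> \<circ> tgt G)" using D(3) by (rule continuous_map_compose)
  moreover have "openin X ?W" using D(1) by (rule openin_tgt_vimage)
  moreover have "over ?W (\<sigma> \<circ> tgt G)" using D(5) by (simp add: over_def)
  ultimately show thesis using that[of ?W "\<sigma> \<circ> tgt G"] D aE \<gamma> by simp
qed

lemma openin_cont_vimage:
  assumes "openin X W" "cont W f" "openin E U"
  shows "openin X {\<eta> \<in> W. f \<eta> \<in> U}"
proof -
  have "openin (subtopology X W) {\<eta> \<in> topspace (subtopology X W). f \<eta> \<in> U}"
    using assms(2,3) by (rule openin_continuous_map_preimage)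
  moreover have "{\<eta> \<in> topspace (subtopology X W). f \<eta> \<in> U} = {\<eta> \<in> W. f \<eta> \<in> U}"
    using openin_subset[OF assms(1)] by auto
  ultimately show ?thesis using assms(1) by (simp add: openin_open_subtopology)
qed

lemma cont_mono: "\<lbrakk>cont W f; W' \<subseteq> W\<rbrakk> \<Longrightarrow> cont W' f"
  by (rule continuous_map_from_subtopology_mono)

lemma over_mono: "\<lbrakk>over W f; W' \<subseteq> W\<rbrakk> \<Longrightarrow> over W' f"
  by (auto simp: over_def)

text \<open>This holds because \<open>p\<close> is locally injective; \<open>E\<close> itself need not be Hausdorff.\<close>

lemma agree_near:
  assumes W: "openin X W" and f: "cont W f" "over W f" and g: "cont W g" "over W g"
    and \<gamma>: "\<gamma> \<in> W" "f \<gamma> = g \<gamma>"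
  obtains W' where "openin X W'" "\<gamma> \<in> W'" "W' \<subseteq> W" "\<forall>\<eta> \<in> W'. f \<eta> = g \<eta>"
proof -
  have WA: "W \<subseteq> arrows G" using W openin_subset by blast
  have "f \<gamma> \<in> topspace E" using over_proj[OF f(2) \<gamma>(1) WA] by blast
  then obtain U where U: "openin E U" "f \<gamma> \<in> U" "inj_on (proj S) U"
    by (rule local_homeomorphism_inj[OF proj_local_homeomorphism])
  let ?W' = "{\<eta> \<in> W. f \<eta> \<in> U} \<inter> {\<eta> \<in> W. g \<eta> \<in> U}"
  have "openin X ?W'"
    using openin_cont_vimage[OF W f(1) U(1)] openin_cont_vimage[OF W g(1) U(1)] by (rule openin_Int)
  moreover have agree: "f \<eta> = g \<eta>" if "\<eta> \<in> ?W'" for \<eta>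
    using that over_proj[OF f(2) _ WA, of \<eta>] over_proj[OF g(2) _ WA, of \<eta>] inj_onD[OF U(3), of "f \<eta>" "g \<eta>"] by auto
  moreover have "\<gamma> \<in> ?W'" "?W' \<subseteq> W" using \<gamma> U(2) by auto
  ultimately show thesis using that[of ?W'] by blast
qed

lemma cont_locally:
  assumes W: "openin X W" and "\<And>\<gamma>. \<gamma> \<in> W \<Longrightarrow> \<exists>W'. openin X W' \<and> \<gamma> \<in> W' \<and> W' \<subseteq> W \<and> cont W' f"
  shows "cont W f"
proof (rule continuous_map_locally)
  fix \<gamma> assume "\<gamma> \<in> topspace (subtopology X W)"
  then have "\<gamma> \<in> W" by simp
  then obtain W' where W': "openin X W'" "\<gamma> \<in> W'" "W' \<subseteq> W" "cont W' f" using assms(2) by blast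
  have "openin (subtopology X W) W'" using W W' by (simp add: openin_open_subtopology)
  moreover have "subtopology (subtopology X W) W' = subtopology X W'"
    using W'(3) by (simp add: subtopology_subtopology Int_absorb1)
  ultimately show "\<exists>V. openin (subtopology X W) V \<and> \<gamma> \<in> V \<and> continuous_map (subtopology (subtopology X W) V) E f"
    using W'(2,4) by (intro exI[of _ W']) simp
qed

lemma cont_cong: "\<lbrakk>cont W f; \<And>\<eta>. \<eta> \<in> W \<Longrightarrow> f \<eta> = g \<eta>\<rbrakk> \<Longrightarrow> cont W g"
  using continuous_map_eq[of "subtopology X W" E f g] by simp

lemma cont_add:
  assumes W: "W \<subseteq> arrows G" and f: "cont W f" "over W f" and g: "cont W g" "over W g"
  shows "cont W (\<lambda>\<eta>. f \<eta> \<oplus>\<^bsub>stalk S (tgt G \<eta>)\<^esub> g \<eta>)"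
proof -
  have "continuous_map (subtopology X W) (subtopology (prod_topology E E) {(a, b). proj S a = proj S b}) (\<lambda>\<eta>. (f \<eta>, g \<eta>))"
    using f g over_proj[OF f(2) _ W] over_proj[OF g(2) _ W]
    by (auto intro!: continuous_map_into_subtopology continuous_map_pairedI)
  from continuous_map_compose[OF this continuous_add]
  show ?thesis by (rule continuous_map_eq) (use over_proj[OF f(2) _ W] in auto)
qed

lemma cont_mult:
  assumes W: "W \<subseteq> arrows G" and f: "cont W f" "over W f" and g: "cont W g" "over W g"
  shows "cont W (\<lambda>\<eta>. f \<eta> \<otimes>\<^bsub>stalk S (tgt G \<eta>)\<^esub> g \<eta>)"
proof -
  have "continuous_map (subtopology X W) (subtopology (prod_topology E E) {(a, b). proj S a = proj S b}) (\<lambda>\<eta>. (f \<eta>, g \<eta>))"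
    using f g over_proj[OF f(2) _ W] over_proj[OF g(2) _ W]
    by (auto intro!: continuous_map_into_subtopology continuous_map_pairedI)
  from continuous_map_compose[OF this continuous_stalk_mult]
  show ?thesis by (rule continuous_map_eq) (use over_proj[OF f(2) _ W] in auto)
qed

text \<open>
  Continuity of the zero section and of negation is not an axiom. A continuous section \<open>f\<close> with
  \<open>f(\<gamma>) = 0\<close> satisfies \<open>f + f = f\<close> at \<open>\<gamma>\<close>, hence near \<open>\<gamma>\<close>, so it is the zero section there.
\<close>

lemma zero_near:
  assumes W: "openin X W" and f: "cont W f" "over W f" and \<gamma>: "\<gamma> \<in> W" "f \<gamma> = \<zero>\<^bsub>stalk S (tgt G \<gamma>)\<^esub>"
  obtains W' where "openin X W'" "\<gamma> \<in> W'" "W' \<subseteq> W" "\<forall>\<eta> \<in> W'. f \<eta> = \<zero>\<^bsub>stalk S (tgt G \<eta>)\<^esub>"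
proof -
  have WA: "W \<subseteq> arrows G" using W openin_subset by blast
  let ?g = "\<lambda>\<eta>. f \<eta> \<oplus>\<^bsub>stalk S (tgt G \<eta>)\<^esub> f \<eta>"
  have g: "cont W ?g" "over W ?g"
    using cont_add[OF WA f f] f(2) WA by (auto simp: over_def stalk_closed subset_iff)
  have "?g \<gamma> = f \<gamma>"
  proof -
    interpret R: ring "stalk S (tgt G \<gamma>)" using \<gamma> WA by (intro stalk_ring) auto
    show ?thesis using \<gamma>(2) by simp
  qed
  then obtain W' where W': "openin X W'" "\<gamma> \<in> W'" "W' \<subseteq> W" "\<forall>\<eta> \<in> W'. ?g \<eta> = f \<eta>"
    by (rule agree_near[OF W g f \<gamma>(1)])
  have "f \<eta> = \<zero>\<^bsub>stalk S (tgt G \<eta>)\<^esub>" if "\<eta> \<in> W'" for \<eta>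
  proof -
    have \<eta>: "\<eta> \<in> W" "\<eta> \<in> arrows G" using that W'(3) WA by auto
    interpret R: ring "stalk S (tgt G \<eta>)" using \<eta> by (intro stalk_ring)
    show ?thesis using bspec[OF W'(4) that] f(2) \<eta> by (intro R.add_idem_zero) (auto simp: over_def)
  qed
  then show thesis using that[of W'] W'(1-3) by blast
qed

lemma cont_zero:
  assumes W: "openin X W" shows "cont W (\<lambda>\<eta>. \<zero>\<^bsub>stalk S (tgt G \<eta>)\<^esub>)"
proof (rule cont_locally[OF W])
  fix \<gamma> assume \<gamma>: "\<gamma> \<in> W"
  then have \<gamma>A: "\<gamma> \<in> arrows G" using W openin_subset by blast
  obtain V f where V: "openin X V" "\<gamma> \<in> V" "cont V f" "over V f" "f \<gamma> = \<zero>\<^bsub>stalk S (tgt G \<gamma>)\<^esub>"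
    by (rule section_through[OF \<gamma>A stalk_closed(1)[OF \<gamma>A]])
  obtain W' where W': "openin X W'" "\<gamma> \<in> W'" "W' \<subseteq> V" "\<forall>\<eta> \<in> W'. f \<eta> = \<zero>\<^bsub>stalk S (tgt G \<eta>)\<^esub>"
    by (rule zero_near[OF V(1,3,4,2,5)])
  have "cont (W' \<inter> W) f" by (rule cont_mono[OF V(3)]) (use W'(3) in auto)
  then have "cont (W' \<inter> W) (\<lambda>\<eta>. \<zero>\<^bsub>stalk S (tgt G \<eta>)\<^esub>)" by (rule cont_cong) (use W'(4) in auto)
  then show "\<exists>W'. openin X W' \<and> \<gamma> \<in> W' \<and> W' \<subseteq> W \<and> cont W' (\<lambda>\<eta>. \<zero>\<^bsub>stalk S (tgt G \<eta>)\<^esub>)"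
    using W' W \<gamma> by (intro exI[of _ "W' \<inter> W"]) auto
qed

lemma cont_neg:
  assumes W: "openin X W" and f: "cont W f" "over W f"
  shows "cont W (\<lambda>\<eta>. \<ominus>\<^bsub>stalk S (tgt G \<eta>)\<^esub> f \<eta>)"
proof (rule cont_locally[OF W])
  fix \<gamma> assume \<gamma>: "\<gamma> \<in> W"
  have WA: "W \<subseteq> arrows G" using W openin_subset by blast
  then have \<gamma>A: "\<gamma> \<in> arrows G" "f \<gamma> \<in> carrier (stalk S (tgt G \<gamma>))" using f \<gamma> by (auto simp: over_def)
  obtain V g where V: "openin X V" "\<gamma> \<in> V" "cont V g" "over V g" "g \<gamma> = \<ominus>\<^bsub>stalk S (tgt G \<gamma>)\<^esub> f \<gamma>"
    by (rule section_through[OF \<gamma>A(1) stalk_closed(4)[OF \<gamma>A]])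
  let ?V = "V \<inter> W"
  let ?h = "\<lambda>\<eta>. g \<eta> \<oplus>\<^bsub>stalk S (tgt G \<eta>)\<^esub> f \<eta>"
  have Vo: "openin X ?V" "\<gamma> \<in> ?V" "?V \<subseteq> arrows G" using V W \<gamma> WA by auto
  have c: "cont ?V g" "over ?V g" "cont ?V f" "over ?V f"
    by (rule cont_mono[OF V(3)] over_mono[OF V(4)] cont_mono[OF f(1)] over_mono[OF f(2)]; blast)+
  have h: "cont ?V ?h" "over ?V ?h"
    using cont_add[OF Vo(3) c] c Vo(3) by (auto simp: over_def stalk_closed subset_iff)
  have "?h \<gamma> = \<zero>\<^bsub>stalk S (tgt G \<gamma>)\<^esub>"
  proof -
    interpret R: ring "stalk S (tgt G \<gamma>)" using \<gamma>A by (intro stalk_ring)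
    show ?thesis using \<gamma>A V(5) by (simp add: R.l_neg)
  qed
  \<comment> \<open>The sum of \<open>g\<close> and \<open>f\<close> vanishes at \<gamma>, hence
    near \<gamma>, and there \<open>g\<close> is the negative of \<open>f\<close>.\<close>
  then obtain W' where W': "openin X W'" "\<gamma> \<in> W'" "W' \<subseteq> ?V" "\<forall>\<eta> \<in> W'. ?h \<eta> = \<zero>\<^bsub>stalk S (tgt G \<eta>)\<^esub>"
    by (rule zero_near[OF Vo(1) h Vo(2)])
  have "g \<eta> = \<ominus>\<^bsub>stalk S (tgt G \<eta>)\<^esub> f \<eta>" if "\<eta> \<in> W'" for \<eta>
  proof -
    have \<eta>: "\<eta> \<in> ?V" "\<eta> \<in> arrows G" using that W'(3) Vo by auto
    interpret R: ring "stalk S (tgt G \<eta>)" using \<eta> by (intro stalk_ring)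
    have "g \<eta> \<in> carrier (stalk S (tgt G \<eta>))" "f \<eta> \<in> carrier (stalk S (tgt G \<eta>))"
      using c \<eta>(1) unfolding over_def by blast+
    then show ?thesis using bspec[OF W'(4) that] R.minus_equality[of "g \<eta>" "f \<eta>"] by simp
  qed
  then have "cont W' (\<lambda>\<eta>. \<ominus>\<^bsub>stalk S (tgt G \<eta>)\<^esub> f \<eta>)"
    by (rule cont_cong[OF cont_mono[OF c(1) W'(3)]])
  then show "\<exists>W'. openin X W' \<and> \<gamma> \<in> W' \<and> W' \<subseteq> W \<and> cont W' (\<lambda>\<eta>. \<ominus>\<^bsub>stalk S (tgt G \<eta>)\<^esub> f \<eta>)"
    using W' by blast
qed

section \<open>The convolution ring\<close>

definition basic_on :: "'g set \<Rightarrow> ('g \<Rightarrow> 'e) \<Rightarrow> bool" where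
  "basic_on U f \<longleftrightarrow> f \<in> sections \<and> compact_open_bisection G U \<and> cont U f \<and>
     (\<forall>\<gamma> \<in> arrows G - U. f \<gamma> = \<zero>\<^bsub>stalk S (tgt G \<gamma>)\<^esub>)"

lemma basic_sections_iff: "f \<in> basic_sections G S \<longleftrightarrow> (\<exists>U. basic_on U f)"
  by (auto simp: basic_sections_def basic_on_def section_group_def sections_def)

lemma bisectionD:
  assumes "compact_open_bisection G U"
  shows "openin X U" "compactin X U" "inj_on (src G) U" "inj_on (tgt G) U" "U \<subseteq> arrows G"
  using assms openin_subset by (auto simp: compact_open_bisection_def)

lemma basic_onD:
  assumes "basic_on U f"
  shows "f \<in> sections" "compact_open_bisection G U" "cont U f" "over U f"
    "\<And>\<gamma>. \<lbrakk>\<gamma> \<in> arrows G; \<gamma> \<notin> U\<rbrakk> \<Longrightarrow> f \<gamma> = \<zero>\<^bsub>stalk S (tgt G \<gamma>)\<^esub>"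
  using assms sections_over bisectionD(5) by (auto simp: basic_on_def)

lemma basic_onI:
  assumes "compact_open_bisection G U" "cont U f" "over U f"
  shows "basic_on U (ext U f)"
proof -
  note U = bisectionD[OF assms(1)]
  have "ext U f \<in> sections" using assms(3) by (intro ext_sections) (auto simp: over_def)
  moreover have "cont U (ext U f)" using assms(2) by (rule cont_cong) (use U in \<open>auto simp: ext_def\<close>)
  ultimately show ?thesis using assms(1) by (simp add: basic_on_def ext_def)
qed

lemma basic_row:
  assumes f: "basic_on U f" shows "f \<in> row_finite"
proof (rule row_finiteI)
  show "f \<in> sections" using basic_onD[OF f] by blast
  show "\<exists>T. finite T \<and> row f x \<subseteq> T" if "x \<in> units G" for x
  proof -
    have "row f x \<subseteq> {\<gamma> \<in> U. tgt G \<gamma> = x}" using basic_onD(5)[OF f] by (auto simp: row_def)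
    moreover have "finite {\<gamma> \<in> U. tgt G \<gamma> = x}"
    proof (rule finite_imageD)
      show "finite (tgt G ` {\<gamma> \<in> U. tgt G \<gamma> = x})" by (rule finite_subset[of _ "{x}"]) auto
      show "inj_on (tgt G) {\<gamma> \<in> U. tgt G \<gamma> = x}"
        using bisectionD(4)[OF basic_onD(2)[OF f]] by (rule inj_on_subset) auto
    qed
    ultimately show ?thesis by blast
  qed
qed

lemma basic_neg: "basic_on U f \<Longrightarrow> basic_on U (\<lambda>\<gamma> \<in> arrows G. \<ominus>\<^bsub>stalk S (tgt G \<gamma>)\<^esub> f \<gamma>)"
proof -
  assume f: "basic_on U f"
  note U = bisectionD[OF basic_onD(2)[OF f]]
  have "(\<lambda>\<gamma> \<in> arrows G. \<ominus>\<^bsub>stalk S (tgt G \<gamma>)\<^esub> f \<gamma>) \<in> sections"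
    by (rule restrict_sections) (simp add: stalk_closed section_closed[OF basic_onD(1)[OF f]])
  moreover have "cont U (\<lambda>\<gamma> \<in> arrows G. \<ominus>\<^bsub>stalk S (tgt G \<gamma>)\<^esub> f \<gamma>)"
    using cont_neg[OF U(1) basic_onD(3,4)[OF f]] by (rule cont_cong) (use U in auto)
  moreover have "\<ominus>\<^bsub>stalk S (tgt G \<gamma>)\<^esub> f \<gamma> = \<zero>\<^bsub>stalk S (tgt G \<gamma>)\<^esub>" if g: "\<gamma> \<in> arrows G" "\<gamma> \<notin> U" for \<gamma>
  proof -
    interpret R: ring "stalk S (tgt G \<gamma>)" using g by (intro stalk_ring)
    show ?thesis using basic_onD(5)[OF f g] by simp
  qed
  ultimately show ?thesis using basic_onD(2)[OF f] by (simp add: basic_on_def)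
qed

lemma basic_zero: "basic_on {} \<zero>\<^bsub>row_ring\<^esub>"
proof -
  have "compact_open_bisection G {}" by (rule compact_open_bisectionI) auto
  then show ?thesis using zero_sections cont_zero[of "{}"]
    by (auto simp: basic_on_def row_ring_simps intro: cont_cong)
qed

lemma Gamma_simps:
  "a \<oplus>\<^bsub>Gamma_c G S\<^esub> b = a \<oplus>\<^bsub>row_ring\<^esub> b" "a \<otimes>\<^bsub>Gamma_c G S\<^esub> b = a \<star> b"
  "\<zero>\<^bsub>Gamma_c G S\<^esub> = \<zero>\<^bsub>row_ring\<^esub>"
  by (simp_all add: Gamma_c_def section_group_def row_ring_simps)

abbreviation "R \<equiv> carrier (Gamma_c G S)"

lemma R_basic: "basic_on U f \<Longrightarrow> f \<in> R"
  unfolding Gamma_c_def using basic_sections_iff by (auto intro: generate.incl)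

lemma R_add: "\<lbrakk>f \<in> R; g \<in> R\<rbrakk> \<Longrightarrow> f \<oplus>\<^bsub>row_ring\<^esub> g \<in> R"
  using generate.eng[of f "section_group G S" "basic_sections G S" g]
  by (simp add: Gamma_c_def section_group_def row_ring_simps)

text \<open>Inverses need no case of their own: the generating set is closed under negation, by
  \<open>basic_neg\<close>.\<close>

lemma R_induct [consumes 1, case_names basic add]:
  assumes "f \<in> R"
    and basic: "\<And>U f. basic_on U f \<Longrightarrow> P f"
    and add: "\<And>f g. \<lbrakk>f \<in> R; g \<in> R; P f; P g\<rbrakk> \<Longrightarrow> P (f \<oplus>\<^bsub>row_ring\<^esub> g)"
  shows "P f"
proof -
  have "f \<in> generate (section_group G S) (basic_sections G S)" using assms(1) by (simp add: Gamma_c_def)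
  then show ?thesis
  proof (induction rule: generate.induct)
    case one
    have "\<one>\<^bsub>section_group G S\<^esub> = \<zero>\<^bsub>row_ring\<^esub>" by (simp add: section_group_def row_ring_simps)
    then show ?case using basic[OF basic_zero] by simp
  next
    case (incl h) then show ?case using basic basic_sections_iff by blast
  next
    case (inv h)
    then obtain U where h: "basic_on U h" using basic_sections_iff by blast
    have eq: "inv\<^bsub>section_group G S\<^esub> h = (\<lambda>\<gamma> \<in> arrows G. \<ominus>\<^bsub>stalk S (tgt G \<gamma>)\<^esub> h \<gamma>)"
    proof -
      have "group (add_monoid (stalk S (tgt G \<gamma>)))" if "\<gamma> \<in> arrows G" for \<gamma>
        using stalk_ring[OF that] by (intro abelian_group.a_group ring.is_abelian_group)
      then show ?thesis
        using inv_product_group[of h "arrows G" "\<lambda>\<gamma>. add_monoid (stalk S (tgt G \<gamma>))"] basic_onD(1)[OF h]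
        by (simp add: section_group_def a_inv_def sections_def)
    qed
    show ?case unfolding eq by (rule basic[OF basic_neg[OF h]])
  next
    case (eng f g)
    then have "f \<in> R" "g \<in> R" by (simp_all add: Gamma_c_def)
    moreover have eq: "f \<otimes>\<^bsub>section_group G S\<^esub> g = f \<oplus>\<^bsub>row_ring\<^esub> g"
      by (simp add: section_group_def row_ring_simps)
    ultimately show ?case unfolding eq using add eng.IH by blast
  qed
qed

sublocale F: ring row_ring
  by (rule row_ring)

lemma R_row_finite: "f \<in> R \<Longrightarrow> f \<in> row_finite"
proof (induction rule: R_induct)
  case (add f g)
  then show ?case using F.a_closed[of f g] by (simp add: row_ring_simps(1))
qed (rule basic_row)

lemma row_ring_neg:
  assumes "f \<in> row_finite" shows "\<ominus>\<^bsub>row_ring\<^esub> f = (\<lambda>\<gamma> \<in> arrows G. \<ominus>\<^bsub>stalk S (tgt G \<gamma>)\<^esub> f \<gamma>)"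
proof (rule sections_eqI)
  have n: "\<ominus>\<^bsub>row_ring\<^esub> f \<in> row_finite" using F.a_inv_closed[of f] assms by (simp add: row_ring_simps(1))
  then show "\<ominus>\<^bsub>row_ring\<^esub> f \<in> sections" by (rule row_finite_sections)
  note fs = row_finite_sections[OF assms]
  show "(\<lambda>\<gamma> \<in> arrows G. \<ominus>\<^bsub>stalk S (tgt G \<gamma>)\<^esub> f \<gamma>) \<in> sections"
    by (rule restrict_sections) (simp add: stalk_closed section_closed[OF fs])
  fix \<gamma> assume g: "\<gamma> \<in> arrows G"
  interpret R: ring "stalk S (tgt G \<gamma>)" using g by (intro stalk_ring)
  have "(\<ominus>\<^bsub>row_ring\<^esub> f \<oplus>\<^bsub>row_ring\<^esub> f) \<gamma> = \<zero>\<^bsub>row_ring\<^esub> \<gamma>"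
    using assms by (simp add: F.l_neg row_ring_simps(1))
  then have "(\<ominus>\<^bsub>row_ring\<^esub> f) \<gamma> \<oplus>\<^bsub>stalk S (tgt G \<gamma>)\<^esub> f \<gamma> = \<zero>\<^bsub>stalk S (tgt G \<gamma>)\<^esub>"
    using g by (simp add: row_ring_simps)
  then show "(\<ominus>\<^bsub>row_ring\<^esub> f) \<gamma> = (\<lambda>\<gamma> \<in> arrows G. \<ominus>\<^bsub>stalk S (tgt G \<gamma>)\<^esub> f \<gamma>) \<gamma>"
    using g section_closed[OF fs g] section_closed[OF row_finite_sections[OF n] g] R.minus_equality[of "(\<ominus>\<^bsub>row_ring\<^esub> f) \<gamma>" "f \<gamma>"]
    by simp
qed

lemma R_neg: "f \<in> R \<Longrightarrow> \<ominus>\<^bsub>row_ring\<^esub> f \<in> R"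
proof (induction rule: R_induct)
  case (basic U f)
  show ?case unfolding row_ring_neg[OF basic_row[OF basic]] by (rule R_basic[OF basic_neg[OF basic]])
next
  case (add f g)
  then show ?case by (simp add: F.minus_add R_add R_row_finite row_ring_simps(1))
qed

lemma R_subgroup: "subgroup R (add_monoid row_ring)"
  by (rule F.add_subgroupI) (auto simp: row_ring_simps(1) R_row_finite R_add R_neg R_basic[OF basic_zero])

end

context ample_sheaf
begin

lemma diag_basic:
  assumes K: "compactin X0 K" "openin X0 K"
  shows "basic_on K (diag K)"
proof -
  have KU: "K \<subseteq> units G" using K(2) by (simp add: openin_X0)
  have "subtopology X K = subtopology X0 K"
    unfolding unit_space_def subtopology_subtopology using KU by (simp add: Int_absorb1)
  then have "cont K (\<lambda>x. \<one>\<^bsub>stalk S x\<^esub>)"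
    using continuous_map_from_subtopology[OF continuous_one] by simp
  then have "cont K (diag K)" by (rule cont_cong) (use KU units_arrows in \<open>auto simp: diag_def\<close>)
  then show ?thesis
    using unit_bisection[OF K] row_finite_sections[OF diag_row_finite[OF KU]]
    by (simp add: basic_on_def diag_def)
qed

lemma basic_through:
  assumes "\<gamma> \<in> arrows G" "a \<in> carrier (stalk S (tgt G \<gamma>))"
  obtains U f where "basic_on U f" "\<gamma> \<in> U" "f \<gamma> = a"
proof -
  obtain W f where W: "openin X W" "\<gamma> \<in> W" "cont W f" "over W f" "f \<gamma> = a"
    by (rule section_through[OF assms])
  obtain U where U: "compact_open_bisection G U" "\<gamma> \<in> U" "U \<subseteq> W"
    by (rule bisection_nbhd[OF W(1,2)])
  have "basic_on U (ext U f)"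
    by (rule basic_onI[OF U(1) cont_mono[OF W(3) U(3)] over_mono[OF W(4) U(3)]])
  moreover have "ext U f \<gamma> = a" using U(2) W(5) assms(1) by (simp add: ext_def)
  ultimately show thesis using that U(2) by blast
qed

text \<open>The product is carried by the product set \<open>Z\<close> of the two bisections, on
  which every arrow has a unique factorisation, so the convolution has a single term there. The
  factors depend continuously on the arrow, which yields continuity of the product.\<close>

lemma basic_conv:
  assumes f: "basic_on U f" and g: "basic_on V g"
  obtains Z where "basic_on Z (f \<star> g)"
proof -
  note fD = basic_onD[OF f] and gD = basic_onD[OF g]
  note U = bisectionD[OF fD(2)] and V = bisectionD[OF gD(2)]
  obtain s where s: "continuous_map (subtopology X0 (tgt G ` U)) X s" "\<And>\<eta>. \<eta> \<in> U \<Longrightarrow> s (tgt G \<eta>) = \<eta>"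
    using local_inverse[OF tgt_continuous tgt_open_map U(1,4)] by blast
  obtain t where t: "continuous_map (subtopology X0 (tgt G ` V)) X t" "\<And>\<eta>. \<eta> \<in> V \<Longrightarrow> t (tgt G \<eta>) = \<eta>"
    using local_inverse[OF tgt_continuous tgt_open_map V(1,4)] by blast
  define W1 where "W1 = {\<gamma> \<in> arrows G. tgt G \<gamma> \<in> tgt G ` U}"
  \<comment> \<open>\<open>b \<gamma>\<close> is the only arrow of \<open>U\<close> with the target
    of \<gamma>, and \<open>l \<gamma>\<close> is the remaining factor.\<close>
  define b where "b = s \<circ> tgt G"
  define l where "l = (\<lambda>\<gamma>. ldiv (b \<gamma>) \<gamma>)"
  have W1: "openin X W1" "W1 \<subseteq> arrows G"
    unfolding W1_def using openin_tgt_vimage[OF openin_tgt_image[OF U(1)]] by auto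
  have b: "b \<gamma> \<in> U" "tgt G (b \<gamma>) = tgt G \<gamma>" "b \<gamma> \<in> arrows G" if g: "\<gamma> \<in> W1" for \<gamma>
  proof -
    obtain u where u: "u \<in> U" "tgt G \<gamma> = tgt G u" using g by (auto simp: W1_def)
    then have "b \<gamma> = u" using s(2)[of u] by (simp add: b_def)
    then show "b \<gamma> \<in> U" "tgt G (b \<gamma>) = tgt G \<gamma>" "b \<gamma> \<in> arrows G" using u U(5) by auto
  qed
  have b_eq: "b \<gamma> = \<beta>" if "\<beta> \<in> U" "tgt G \<gamma> = tgt G \<beta>" for \<beta> \<gamma>
    using s(2)[OF that(1)] that(2) by (simp add: b_def)
  have l: "l \<gamma> \<in> arrows G" "src G (l \<gamma>) = src G \<gamma>" "tgt G (l \<gamma>) = src G (b \<gamma>)" "gmult G (b \<gamma>) (l \<gamma>) = \<gamma>"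
    if g: "\<gamma> \<in> W1" for \<gamma>
    using ldiv[of "b \<gamma>" \<gamma>] b[OF g] g W1(2) unfolding l_def by auto
  have "continuous_map (subtopology X W1) (subtopology X0 (tgt G ` U)) (tgt G)"
    using continuous_map_from_subtopology[OF tgt_continuous] by (auto simp: continuous_map_in_subtopology W1_def)
  then have b_cont: "continuous_map (subtopology X W1) X b"
    unfolding b_def using s(1) by (rule continuous_map_compose)
  have l_cont: "continuous_map (subtopology X W1) X l"
  proof -
    have "continuous_map (subtopology X W1) (prod_topology X X) (\<lambda>\<gamma>. (ginv G (b \<gamma>), \<gamma>))"
      using continuous_map_compose[OF b_cont continuous_inv]
      by (intro continuous_map_pairedI) (auto simp: o_def intro: continuous_map_from_subtopology)
    then have "continuous_map (subtopology X W1)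
        (subtopology (prod_topology X X) {(\<beta>, \<gamma>). src G \<beta> = tgt G \<gamma>}) (\<lambda>\<gamma>. (ginv G (b \<gamma>), \<gamma>))"
      by (rule continuous_map_into_subtopology) (auto simp: b src_inv)
    from continuous_map_compose[OF this continuous_mult] show ?thesis by (simp add: o_def l_def)
  qed
  define Z where "Z = {\<gamma> \<in> W1. l \<gamma> \<in> V}"
  have ZA: "Z \<subseteq> arrows G" "Z \<subseteq> W1" using W1(2) by (auto simp: Z_def)
  have Z_open: "openin X Z"
  proof -
    have "openin (subtopology X W1) {\<gamma> \<in> topspace (subtopology X W1). l \<gamma> \<in> V}"
      using l_cont V(1) by (rule openin_continuous_map_preimage)
    moreover have "{\<gamma> \<in> topspace (subtopology X W1). l \<gamma> \<in> V} = Z" using W1(2) by (auto simp: Z_def)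
    ultimately show ?thesis using W1(1) by (simp add: openin_open_subtopology)
  qed
  have Z_compact: "compactin X Z"
  proof -
    \<comment> \<open>\<open>Z\<close> is the image of \<open>W\<close> under the continuous map
      \<open>m\<close>. The compact set of targets of \<open>V\<close> is closed in the unit space,
      so \<open>W\<close> is the compact \<open>U\<close> cut with a closed set.\<close>
    define W where "W = U \<inter> {\<beta> \<in> arrows G. src G \<beta> \<in> tgt G ` V}"
    define m where "m = (\<lambda>\<beta>. gmult G \<beta> (t (src G \<beta>)))"
    have W: "compactin X W"
      unfolding W_def using closedin_continuous_map_preimage[OF src_continuous compact_open_tgt_image(3)[OF gD(2)]]
      by (intro compact_Int_closedin[OF U(2)])
    have tW: "t (src G \<beta>) \<in> V \<and> tgt G (t (src G \<beta>)) = src G \<beta>" if w: "\<beta> \<in> W" for \<beta>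
    proof -
      obtain v where "v \<in> V" "src G \<beta> = tgt G v" using w by (auto simp: W_def)
      then show ?thesis using t(2)[of v] by simp
    qed
    have "continuous_map (subtopology X W) (subtopology X0 (tgt G ` V)) (src G)"
      using continuous_map_from_subtopology[OF src_continuous] by (auto simp: continuous_map_in_subtopology W_def)
    from continuous_map_compose[OF this t(1)]
    have "continuous_map (subtopology X W) (prod_topology X X) (\<lambda>\<beta>. (\<beta>, t (src G \<beta>)))"
      by (intro continuous_map_pairedI) (auto simp: o_def intro: continuous_map_from_subtopology)
    then have "continuous_map (subtopology X W)
        (subtopology (prod_topology X X) {(\<beta>, \<gamma>). src G \<beta> = tgt G \<gamma>}) (\<lambda>\<beta>. (\<beta>, t (src G \<beta>)))"
      by (rule continuous_map_into_subtopology) (auto simp: tW)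
    from continuous_map_compose[OF this continuous_mult]
    have "continuous_map (subtopology X W) X m" by (simp add: o_def m_def)
    then have "compactin X (m ` W)" using W by (intro image_compactin) (auto simp: compactin_subtopology)
    moreover have "m ` W = Z"
    proof (intro equalityI subsetI)
      fix \<gamma> assume "\<gamma> \<in> m ` W"
      then obtain \<beta> where bW: "\<beta> \<in> W" "\<gamma> = gmult G \<beta> (t (src G \<beta>))" by (auto simp: m_def)
      let ?\<rho> = "t (src G \<beta>)"
      have r: "?\<rho> \<in> V" "tgt G ?\<rho> = src G \<beta>" "?\<rho> \<in> arrows G" "\<beta> \<in> U" "\<beta> \<in> arrows G"
        using tW[OF bW(1)] bW(1) V(5) by (auto simp: W_def)
      have g1: "\<gamma> \<in> arrows G" "tgt G \<gamma> = tgt G \<beta>" using r bW(2) by (simp_all add: mult_closed tgt_mult)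
      have "b \<gamma> = \<beta>" using r(4) g1(2) by (rule b_eq)
      then have "l \<gamma> = ?\<rho>" using r bW(2) by (simp add: l_def inv_mult_cancel)
      then show "\<gamma> \<in> Z" using g1 r by (auto simp: Z_def W1_def)
    next
      fix \<gamma> assume g: "\<gamma> \<in> Z"
      then have gW: "\<gamma> \<in> W1" "l \<gamma> \<in> V" by (auto simp: Z_def)
      have "b \<gamma> \<in> W" using b[OF gW(1)] l(3)[OF gW(1)] imageI[OF gW(2), of "tgt G"] by (simp add: W_def)
      moreover have "m (b \<gamma>) = \<gamma>" using t(2)[OF gW(2)] l(3,4)[OF gW(1)] by (simp add: m_def)
      ultimately show "\<gamma> \<in> m ` W" by (metis imageI)
    qed
    ultimately show ?thesis by simp
  qed
  have Z_tgt: "inj_on (tgt G) Z"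
  proof (rule inj_onI)
    fix \<gamma> \<gamma>' assume z: "\<gamma> \<in> Z" "\<gamma>' \<in> Z" "tgt G \<gamma> = tgt G \<gamma>'"
    then have W: "\<gamma> \<in> W1" "\<gamma>' \<in> W1" and V': "l \<gamma> \<in> V" "l \<gamma>' \<in> V" by (auto simp: Z_def)
    have bb: "b \<gamma> = b \<gamma>'" using z(3) by (simp add: b_def)
    then have "tgt G (l \<gamma>) = tgt G (l \<gamma>')" unfolding l(3)[OF W(1)] l(3)[OF W(2)] by (simp only:)
    then have "l \<gamma> = l \<gamma>'" by (rule inj_onD[OF V(4) _ V'])
    then have "gmult G (b \<gamma>) (l \<gamma>) = gmult G (b \<gamma>') (l \<gamma>')" using bb by (simp only:)
    then show "\<gamma> = \<gamma>'" unfolding l(4)[OF W(1)] l(4)[OF W(2)] .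
  qed
  have Z_src: "inj_on (src G) Z"
  proof (rule inj_onI)
    fix \<gamma> \<gamma>' assume z: "\<gamma> \<in> Z" "\<gamma>' \<in> Z" "src G \<gamma> = src G \<gamma>'"
    then have W: "\<gamma> \<in> W1" "\<gamma>' \<in> W1" and V': "l \<gamma> \<in> V" "l \<gamma>' \<in> V" by (auto simp: Z_def)
    have "src G (l \<gamma>) = src G (l \<gamma>')" unfolding l(2)[OF W(1)] l(2)[OF W(2)] by (rule z(3))
    then have ll: "l \<gamma> = l \<gamma>'" by (rule inj_onD[OF V(3) _ V'])
    then have "src G (b \<gamma>) = src G (b \<gamma>')" unfolding l(3)[OF W(1), symmetric] l(3)[OF W(2), symmetric] by (simp only:)
    then have "b \<gamma> = b \<gamma>'" by (rule inj_onD[OF U(3) _ b(1)[OF W(1)] b(1)[OF W(2)]])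
    then have "gmult G (b \<gamma>) (l \<gamma>) = gmult G (b \<gamma>') (l \<gamma>')" using ll by (simp only:)
    then show "\<gamma> = \<gamma>'" unfolding l(4)[OF W(1)] l(4)[OF W(2)] .
  qed
  have bis: "compact_open_bisection G Z" by (rule compact_open_bisectionI[OF Z_open Z_compact Z_src Z_tgt])
  have off: "(f \<star> g) \<gamma> = \<zero>\<^bsub>stalk S (tgt G \<gamma>)\<^esub>" if g: "\<gamma> \<in> arrows G" "\<gamma> \<notin> Z" for \<gamma>
  proof -
    interpret Q: ring "stalk S (tgt G \<gamma>)" using g by (intro stalk_ring)
    have "(f \<star> g) \<gamma> = finsum (stalk S (tgt G \<gamma>)) (\<lambda>\<beta>. f \<beta> \<otimes>\<^bsub>stalk S (tgt G \<gamma>)\<^esub> act S \<beta> (g (ldiv \<beta> \<gamma>))) {}"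
    proof (rule conv_value[OF fD(1) gD(1) g(1)])
      fix \<beta> assume be: "\<beta> \<in> arrows G" "tgt G \<beta> = tgt G \<gamma>"
      show "f \<beta> = \<zero>\<^bsub>stalk S (tgt G \<gamma>)\<^esub> \<or> g (ldiv \<beta> \<gamma>) = \<zero>\<^bsub>stalk S (src G \<beta>)\<^esub>"
      proof (cases "\<beta> \<in> U")
        case True
        then have "b \<gamma> = \<beta>" using be(2) by (intro b_eq) auto
        moreover have "\<gamma> \<in> W1" using True be g(1) unfolding W1_def by (metis (mono_tags, lifting) imageI mem_Collect_eq)
        ultimately have "ldiv \<beta> \<gamma> \<notin> V" using g(2) by (auto simp: Z_def l_def)
        then show ?thesis using gD(5)[of "ldiv \<beta> \<gamma>"] ldiv[OF be(1) g(1) be(2)] by simp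
      qed (use fD(5)[of \<beta>] be in auto)
    qed auto
    then show ?thesis by (simp add: Q.finsum_empty)
  qed
  have on: "(f \<star> g) \<gamma> = f (b \<gamma>) \<otimes>\<^bsub>stalk S (tgt G \<gamma>)\<^esub> act S (b \<gamma>) (g (l \<gamma>))" if z: "\<gamma> \<in> Z" for \<gamma>
  proof -
    have gW: "\<gamma> \<in> W1" and gA: "\<gamma> \<in> arrows G" using z ZA by auto
    interpret Q: ring "stalk S (tgt G \<gamma>)" using gA by (intro stalk_ring)
    have "(f \<star> g) \<gamma> = finsum (stalk S (tgt G \<gamma>)) (\<lambda>\<beta>. f \<beta> \<otimes>\<^bsub>stalk S (tgt G \<gamma>)\<^esub> act S \<beta> (g (ldiv \<beta> \<gamma>))) {b \<gamma>}"
    proof (rule conv_value[OF fD(1) gD(1) gA])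
      fix \<beta> assume be: "\<beta> \<in> arrows G" "tgt G \<beta> = tgt G \<gamma>" "\<beta> \<notin> {b \<gamma>}"
      then have "\<beta> \<notin> U" using b_eq[of \<beta> \<gamma>] by auto
      then show "f \<beta> = \<zero>\<^bsub>stalk S (tgt G \<gamma>)\<^esub> \<or> g (ldiv \<beta> \<gamma>) = \<zero>\<^bsub>stalk S (src G \<beta>)\<^esub>"
        using fD(5)[of \<beta>] be by simp
    qed (use b[OF gW] in auto)
    then show ?thesis
      using term_closed'[OF fD(1) gD(1) b(3)[OF gW] gA b(2)[OF gW]]
      by (simp add: Q.finsum_insert Q.finsum_empty l_def)
  qed
  have bZ: "continuous_map (subtopology X Z) X b" and lZ: "continuous_map (subtopology X Z) X l"
    by (rule continuous_map_from_subtopology_mono[OF _ ZA(2)], fact b_cont l_cont)+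
  have "continuous_map (subtopology X Z) (subtopology X U) b" "continuous_map (subtopology X Z) (subtopology X V) l"
    using bZ lZ b(1) ZA by (auto simp: continuous_map_in_subtopology Z_def)
  then have fb: "cont Z (f \<circ> b)" and gl: "cont Z (g \<circ> l)"
    using continuous_map_compose fD(3) gD(3) by blast+
  have fb_over: "over Z (f \<circ> b)"
    unfolding over_def
  proof
    fix \<gamma> assume "\<gamma> \<in> Z"
    then have gW: "\<gamma> \<in> W1" using ZA by auto
    show "(f \<circ> b) \<gamma> \<in> carrier (stalk S (tgt G \<gamma>))"
      using section_closed[OF fD(1) b(3)[OF gW]] b(2)[OF gW] by simp
  qed
  have ac: "act S (b \<gamma>) (g (l \<gamma>)) \<in> carrier (stalk S (tgt G \<gamma>))" if z: "\<gamma> \<in> Z" for \<gamma>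
  proof -
    have gW: "\<gamma> \<in> W1" using z ZA by auto
    have "g (l \<gamma>) \<in> carrier (stalk S (src G (b \<gamma>)))" using section_closed[OF gD(1) l(1)[OF gW]] l(3)[OF gW] by simp
    then show ?thesis using act_closed[OF b(3)[OF gW]] b(2)[OF gW] by simp
  qed
  have "cont Z (\<lambda>\<gamma>. act S (b \<gamma>) (g (l \<gamma>)))"
  proof -
    have "continuous_map (subtopology X Z) (prod_topology X E) (\<lambda>\<gamma>. (b \<gamma>, g (l \<gamma>)))"
      using bZ gl by (intro continuous_map_pairedI) (auto simp: o_def)
    moreover have "src G (b \<gamma>) = proj S (g (l \<gamma>))" if "\<gamma> \<in> Z" for \<gamma>
    proof -
      have gW: "\<gamma> \<in> W1" using that ZA by auto
      show ?thesis
        using stalk_E[OF tgt_unit[OF l(1)[OF gW]] section_closed[OF gD(1) l(1)[OF gW]]] l(3)[OF gW] by simp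
    qed
    ultimately have "continuous_map (subtopology X Z)
        (subtopology (prod_topology X E) {(\<gamma>, e). src G \<gamma> = proj S e}) (\<lambda>\<gamma>. (b \<gamma>, g (l \<gamma>)))"
      by (intro continuous_map_into_subtopology) auto
    from continuous_map_compose[OF this continuous_act] show ?thesis by (simp add: o_def)
  qed
  then have "cont Z (\<lambda>\<gamma>. (f \<circ> b) \<gamma> \<otimes>\<^bsub>stalk S (tgt G \<gamma>)\<^esub> act S (b \<gamma>) (g (l \<gamma>)))"
    using ac by (intro cont_mult ZA fb fb_over) (auto simp: over_def)
  then have "cont Z (f \<star> g)" by (rule cont_cong) (simp add: on)
  then have "basic_on Z (f \<star> g)"
    using bis off conv_sections[OF basic_row[OF f] gD(1)] by (simp add: basic_on_def)
  then show thesis by (rule that)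
qed

lemma R_m_closed:
  assumes "f \<in> R" "g \<in> R" shows "f \<star> g \<in> R"
  using assms(1)
proof (induction rule: R_induct)
  case f: (basic U f)
  show ?case using assms(2)
  proof (induction rule: R_induct)
    case (basic V g)
    obtain Z where "basic_on Z (f \<star> g)" by (rule basic_conv[OF f basic])
    then show ?case by (rule R_basic)
  next
    case (add g h)
    then show ?case by (simp add: conv_distrib_left basic_row[OF f] R_row_finite R_add)
  qed
next
  case (add f h)
  then show ?case by (simp add: conv_distrib_right R_row_finite assms(2) R_add)
qed

lemma diag_R: "\<lbrakk>compactin X0 K; openin X0 K\<rbrakk> \<Longrightarrow> diag K \<in> R"
  using diag_basic by (rule R_basic)

text \<open>The parameter \<open>q\<close> selects between rows and columns.\<close>

lemma realise:
  assumes q: "q = tgt G \<or> q = src G" and T: "finite T" "\<And>\<gamma>. \<gamma> \<in> T \<Longrightarrow> \<gamma> \<in> arrows G \<and> q \<gamma> = x"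
    and a: "\<And>\<gamma>. \<gamma> \<in> T \<Longrightarrow> a \<gamma> \<in> carrier (stalk S (tgt G \<gamma>))"
  shows "\<exists>r \<in> R. \<forall>\<gamma> \<in> arrows G. q \<gamma> = x \<longrightarrow> r \<gamma> = (if \<gamma> \<in> T then a \<gamma> else \<zero>\<^bsub>stalk S (tgt G \<gamma>)\<^esub>)"
  using T a
proof (induction T)
  case empty
  then show ?case using R_basic[OF basic_zero] by (intro bexI[of _ "\<zero>\<^bsub>row_ring\<^esub>"]) (auto simp: row_ring_simps)
next
  case (insert \<delta> T)
  then obtain r where r: "r \<in> R" "\<forall>\<gamma> \<in> arrows G. q \<gamma> = x \<longrightarrow> r \<gamma> = (if \<gamma> \<in> T then a \<gamma> else \<zero>\<^bsub>stalk S (tgt G \<gamma>)\<^esub>)"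
    by auto
  have d: "\<delta> \<in> arrows G" "q \<delta> = x" "a \<delta> \<in> carrier (stalk S (tgt G \<delta>))" using insert by auto
  \<comment> \<open>Within the fibre \<open>q = x\<close>, adding a basic section through \<delta>
    changes only the value at \<delta>, as \<open>q\<close> is injective on the bisection that
    carries it.\<close>
  obtain U h where h: "basic_on U h" "\<delta> \<in> U" "h \<delta> = a \<delta>" by (rule basic_through[OF d(1,3)])
  have inj: "inj_on q U" using q bisectionD(3,4)[OF basic_onD(2)[OF h(1)]] by blast
  have "(r \<oplus>\<^bsub>row_ring\<^esub> h) \<gamma> = (if \<gamma> \<in> insert \<delta> T then a \<gamma> else \<zero>\<^bsub>stalk S (tgt G \<gamma>)\<^esub>)"
    if g: "\<gamma> \<in> arrows G" "q \<gamma> = x" for \<gamma>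
  proof -
    interpret Q: ring "stalk S (tgt G \<gamma>)" using g by (intro stalk_ring)
    have s: "(r \<oplus>\<^bsub>row_ring\<^esub> h) \<gamma> = r \<gamma> \<oplus>\<^bsub>stalk S (tgt G \<gamma>)\<^esub> h \<gamma>" using g by (simp add: row_ring_simps)
    show ?thesis
    proof (cases "\<gamma> = \<delta>")
      case True
      have "r \<gamma> = \<zero>\<^bsub>stalk S (tgt G \<gamma>)\<^esub>" using r(2) g insert.hyps True by auto
      moreover have "a \<gamma> \<in> carrier (stalk S (tgt G \<gamma>))" "h \<gamma> = a \<gamma>" using d h(3) True by auto
      moreover have "\<gamma> \<in> insert \<delta> T" using True by simp
      ultimately show ?thesis unfolding s by simp
    next
      case False
      then have "\<gamma> \<notin> U" using inj_onD[OF inj, of \<gamma> \<delta>] h(2) g(2) d(2) by auto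
      then have "h \<gamma> = \<zero>\<^bsub>stalk S (tgt G \<gamma>)\<^esub>" using basic_onD(5)[OF h(1)] g(1) by blast
      moreover have "r \<gamma> \<in> carrier (stalk S (tgt G \<gamma>))"
        using section_closed[OF row_finite_sections[OF R_row_finite[OF r(1)]] g(1)] .
      ultimately show ?thesis unfolding s using r(2) g False by simp
    qed
  qed
  then show ?case using R_add[OF r(1) R_basic[OF h(1)]] by blast
qed

definition column :: "('g \<Rightarrow> 'e) \<Rightarrow> 'g \<Rightarrow> 'g set" where
  "column u x = {\<gamma> \<in> arrows G. src G \<gamma> = x \<and> u \<gamma> \<noteq> \<zero>\<^bsub>stalk S (tgt G \<gamma>)\<^esub>}"

lemma finite_column: "f \<in> R \<Longrightarrow> finite (column f x)"
proof (induction rule: R_induct)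
  case (basic U f)
  have "finite {\<gamma> \<in> U. src G \<gamma> = x}"
  proof (rule finite_imageD)
    show "finite (src G ` {\<gamma> \<in> U. src G \<gamma> = x})" by (rule finite_subset[of _ "{x}"]) auto
    show "inj_on (src G) {\<gamma> \<in> U. src G \<gamma> = x}"
      using bisectionD(3)[OF basic_onD(2)[OF basic]] by (rule inj_on_subset) auto
  qed
  moreover have "column f x \<subseteq> {\<gamma> \<in> U. src G \<gamma> = x}"
    using basic_onD(5)[OF basic] by (auto simp: column_def)
  ultimately show ?case by (rule finite_subset[rotated])
next
  case (add f g)
  have "column (f \<oplus>\<^bsub>row_ring\<^esub> g) x \<subseteq> column f x \<union> column g x"
  proof
    fix \<gamma> assume g: "\<gamma> \<in> column (f \<oplus>\<^bsub>row_ring\<^esub> g) x"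
    then interpret Q: ring "stalk S (tgt G \<gamma>)" by (intro stalk_ring) (auto simp: column_def)
    show "\<gamma> \<in> column f x \<union> column g x" using g by (auto simp: column_def row_ring_simps)
  qed
  then show ?case using add by (meson finite_UnI finite_subset)
qed

text \<open>For a basic section the targets of its bisection form such a \<open>K\<close>. For a sum
  take the union, because enlarging \<open>K\<close> keeps whatever \<open>diag K\<close>
  fixes.\<close>

lemma local_unit: "f \<in> R \<Longrightarrow> \<exists>K. compactin X0 K \<and> openin X0 K \<and> diag K \<star> f = f"
proof (induction rule: R_induct)
  case (basic U f)
  note K = compact_open_tgt_image[OF basic_onD(2)[OF basic]]
  have KU: "tgt G ` U \<subseteq> units G" using K(2) by (simp add: openin_X0)
  note fs = basic_onD(1)[OF basic]
  have "diag (tgt G ` U) \<star> f = f"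
  proof (rule sections_eqI[OF conv_sections[OF diag_row_finite[OF KU] fs] fs])
    fix \<gamma> assume g: "\<gamma> \<in> arrows G"
    then show "(diag (tgt G ` U) \<star> f) \<gamma> = f \<gamma>"
      using basic_onD(5)[OF basic g] by (cases "\<gamma> \<in> U") (auto simp: diag_conv[OF KU fs g])
  qed
  then show ?case using K by blast
next
  case (add f g)
  then obtain K L where K: "compactin X0 K" "openin X0 K" "diag K \<star> f = f"
    and L: "compactin X0 L" "openin X0 L" "diag L \<star> g = g" by blast
  have KL: "K \<subseteq> units G" "L \<subseteq> units G" "K \<union> L \<subseteq> units G" using K(2) L(2) by (auto simp: openin_X0)
  note s = row_finite_sections[OF R_row_finite]
  have big: "diag (K \<union> L) \<star> h = h" if h: "h \<in> R" "diag M \<star> h = h" "M \<subseteq> K \<union> L" for h M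
  proof (rule sections_eqI[OF conv_sections[OF diag_row_finite[OF KL(3)] s[OF h(1)]] s[OF h(1)]])
    fix \<gamma> assume g: "\<gamma> \<in> arrows G"
    have M: "M \<subseteq> units G" using h(3) KL(3) by blast
    show "(diag (K \<union> L) \<star> h) \<gamma> = h \<gamma>"
    proof (cases "tgt G \<gamma> \<in> K \<union> L")
      case True
      then show ?thesis by (simp add: diag_conv[OF KL(3) s[OF h(1)] g])
    next
      case False
      then have "tgt G \<gamma> \<notin> M" using h(3) by blast
      then have "(diag M \<star> h) \<gamma> = \<zero>\<^bsub>stalk S (tgt G \<gamma>)\<^esub>" by (simp add: diag_conv[OF M s[OF h(1)] g])
      then show ?thesis using False h(2) diag_conv[OF KL(3) s[OF h(1)] g] by simp
    qed
  qed
  have "diag (K \<union> L) \<star> (f \<oplus>\<^bsub>row_ring\<^esub> g) = f \<oplus>\<^bsub>row_ring\<^esub> g"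
    using big[OF add(1) K(3)] big[OF add(2) L(3)] add
    by (simp add: conv_distrib_left diag_row_finite[OF KL(3)] R_row_finite)
  moreover have "compactin X0 (K \<union> L)" "openin X0 (K \<union> L)" using K L by (auto intro: compactin_Un)
  ultimately show ?case by blast
qed

section \<open>Sections vanishing near a unit\<close>

definition vanishing :: "'g \<Rightarrow> ('g \<Rightarrow> 'e) set" where
  "vanishing x = {f \<in> row_finite. \<exists>V. openin X0 V \<and> x \<in> V \<and>
     (\<forall>\<eta> \<in> arrows G. tgt G \<eta> \<in> V \<longrightarrow> f \<eta> = \<zero>\<^bsub>stalk S (tgt G \<eta>)\<^esub>)}"

lemma vanishingD:
  assumes "f \<in> vanishing x"
  obtains V where "openin X0 V" "x \<in> V" "\<forall>\<eta> \<in> arrows G. tgt G \<eta> \<in> V \<longrightarrow> f \<eta> = \<zero>\<^bsub>stalk S (tgt G \<eta>)\<^esub>"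
  using assms unfolding vanishing_def by blast

lemma vanishing_subgroup:
  assumes x: "x \<in> units G" shows "subgroup (vanishing x) (add_monoid row_ring)"
proof (rule F.add_subgroupI)
  show "vanishing x \<subseteq> carrier row_ring" by (auto simp: vanishing_def row_ring_simps(1))
  have "openin X0 (units G)" by (metis openin_topspace topspace_X0)
  then show "\<zero>\<^bsub>row_ring\<^esub> \<in> vanishing x"
    using x R_row_finite[OF R_basic[OF basic_zero]] by (auto simp: vanishing_def row_ring_simps(4))
  fix f assume f: "f \<in> vanishing x"
  obtain V where V: "openin X0 V" "x \<in> V" "\<forall>\<eta> \<in> arrows G. tgt G \<eta> \<in> V \<longrightarrow> f \<eta> = \<zero>\<^bsub>stalk S (tgt G \<eta>)\<^esub>"
    by (rule vanishingD[OF f])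
  have fr: "f \<in> row_finite" using f by (simp add: vanishing_def)
  have "(\<ominus>\<^bsub>row_ring\<^esub> f) \<eta> = \<zero>\<^bsub>stalk S (tgt G \<eta>)\<^esub>" if "\<eta> \<in> arrows G" "tgt G \<eta> \<in> V" for \<eta>
  proof -
    interpret Q: ring "stalk S (tgt G \<eta>)" using that by (intro stalk_ring)
    show ?thesis using V(3) that unfolding row_ring_neg[OF fr] by simp
  qed
  moreover have "\<ominus>\<^bsub>row_ring\<^esub> f \<in> row_finite" using F.a_inv_closed[of f] fr by (simp add: row_ring_simps(1))
  ultimately show "\<ominus>\<^bsub>row_ring\<^esub> f \<in> vanishing x" using V(1,2) unfolding vanishing_def by blast
  fix g assume g: "g \<in> vanishing x"
  obtain W where W: "openin X0 W" "x \<in> W" "\<forall>\<eta> \<in> arrows G. tgt G \<eta> \<in> W \<longrightarrow> g \<eta> = \<zero>\<^bsub>stalk S (tgt G \<eta>)\<^esub>"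
    by (rule vanishingD[OF g])
  have gr: "g \<in> row_finite" using g by (simp add: vanishing_def)
  have "(f \<oplus>\<^bsub>row_ring\<^esub> g) \<eta> = \<zero>\<^bsub>stalk S (tgt G \<eta>)\<^esub>" if "\<eta> \<in> arrows G" "tgt G \<eta> \<in> V \<inter> W" for \<eta>
  proof -
    interpret Q: ring "stalk S (tgt G \<eta>)" using that by (intro stalk_ring)
    show ?thesis using V(3) W(3) that by (simp add: row_ring_simps)
  qed
  moreover have "f \<oplus>\<^bsub>row_ring\<^esub> g \<in> row_finite" using F.a_closed[of f g] fr gr by (simp add: row_ring_simps(1))
  moreover have "openin X0 (V \<inter> W)" "x \<in> V \<inter> W" using V W by auto
  ultimately show "f \<oplus>\<^bsub>row_ring\<^esub> g \<in> vanishing x" unfolding vanishing_def by blast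
qed

text \<open>
  As \<open>G\<close> need not be Hausdorff, elements of \<open>R\<close> can be discontinuous and arrows over the same
  unit \<open>x\<close> need not be separated. Modulo the sections vanishing near \<open>x\<close>, however, every element
  of \<open>R\<close> is the sum of one section per arrow \<open>\<gamma>\<close> over \<open>x\<close>, depending only on the value at \<open>\<gamma>\<close> and
  concentrated, as far as arrows with target near \<open>x\<close> are concerned, on a bisection around \<open>\<gamma>\<close>.
\<close>

definition germ_at :: "'g \<Rightarrow> ('g \<Rightarrow> 'e) \<Rightarrow> bool" where
  "germ_at \<gamma> f \<longleftrightarrow> f \<in> row_finite \<and> (\<exists>U. openin X U \<and> inj_on (tgt G) U \<and> \<gamma> \<in> U \<and> cont U f \<and>
     (\<forall>\<eta> \<in> arrows G. tgt G \<eta> \<in> tgt G ` U \<and> \<eta> \<notin> U \<longrightarrow> f \<eta> = \<zero>\<^bsub>stalk S (tgt G \<eta>)\<^esub>))"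

lemma germ_at_basic: "\<lbrakk>basic_on U f; \<gamma> \<in> U\<rbrakk> \<Longrightarrow> germ_at \<gamma> f"
  unfolding germ_at_def using basic_row[of U f] basic_onD[of U f] bisectionD[of U] by blast

lemma germ_at_mono:
  assumes U: "openin X U" "inj_on (tgt G) U" "U \<subseteq> arrows G"
    and f: "cont U f" "\<forall>\<eta> \<in> arrows G. tgt G \<eta> \<in> tgt G ` U \<and> \<eta> \<notin> U \<longrightarrow> f \<eta> = \<zero>\<^bsub>stalk S (tgt G \<eta>)\<^esub>"
    and V: "V \<subseteq> U"
  shows "cont V f" "\<forall>\<eta> \<in> arrows G. tgt G \<eta> \<in> tgt G ` V \<and> \<eta> \<notin> V \<longrightarrow> f \<eta> = \<zero>\<^bsub>stalk S (tgt G \<eta>)\<^esub>"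
proof -
  show "cont V f" by (rule cont_mono[OF f(1) V])
  show "\<forall>\<eta> \<in> arrows G. tgt G \<eta> \<in> tgt G ` V \<and> \<eta> \<notin> V \<longrightarrow> f \<eta> = \<zero>\<^bsub>stalk S (tgt G \<eta>)\<^esub>"
  proof (intro ballI impI)
    fix \<eta> assume e: "\<eta> \<in> arrows G" "tgt G \<eta> \<in> tgt G ` V \<and> \<eta> \<notin> V"
    then obtain \<zeta> where z: "\<zeta> \<in> V" "tgt G \<eta> = tgt G \<zeta>" by blast
    have "\<eta> \<notin> U" using inj_onD[OF U(2), of \<eta> \<zeta>] z e V by blast
    then show "f \<eta> = \<zero>\<^bsub>stalk S (tgt G \<eta>)\<^esub>" using f(2) e z V by auto
  qed
qed

lemma germ_at_combine:
  assumes f: "germ_at \<gamma> f" and g: "germ_at \<gamma> g"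
  obtains U where "openin X U" "inj_on (tgt G) U" "\<gamma> \<in> U" "cont U f" "cont U g"
    "\<forall>\<eta> \<in> arrows G. tgt G \<eta> \<in> tgt G ` U \<and> \<eta> \<notin> U \<longrightarrow> f \<eta> = \<zero>\<^bsub>stalk S (tgt G \<eta>)\<^esub>"
    "\<forall>\<eta> \<in> arrows G. tgt G \<eta> \<in> tgt G ` U \<and> \<eta> \<notin> U \<longrightarrow> g \<eta> = \<zero>\<^bsub>stalk S (tgt G \<eta>)\<^esub>"
proof -
  obtain U where U: "openin X U" "inj_on (tgt G) U" "\<gamma> \<in> U" "cont U f"
    "\<forall>\<eta> \<in> arrows G. tgt G \<eta> \<in> tgt G ` U \<and> \<eta> \<notin> U \<longrightarrow> f \<eta> = \<zero>\<^bsub>stalk S (tgt G \<eta>)\<^esub>"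
    using f unfolding germ_at_def by blast
  obtain V where V: "openin X V" "inj_on (tgt G) V" "\<gamma> \<in> V" "cont V g"
    "\<forall>\<eta> \<in> arrows G. tgt G \<eta> \<in> tgt G ` V \<and> \<eta> \<notin> V \<longrightarrow> g \<eta> = \<zero>\<^bsub>stalk S (tgt G \<eta>)\<^esub>"
    using g unfolding germ_at_def by blast
  have UA: "U \<subseteq> arrows G" "V \<subseteq> arrows G" using U V openin_subset by blast+
  note m = germ_at_mono[OF U(1,2) UA(1) U(4,5), of "U \<inter> V"] germ_at_mono[OF V(1,2) UA(2) V(4,5), of "U \<inter> V"]
  have "openin X (U \<inter> V)" "inj_on (tgt G) (U \<inter> V)" "\<gamma> \<in> U \<inter> V" using U V by (auto intro: inj_on_subset)
  then show thesis using m by (intro that[of "U \<inter> V"]) auto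
qed

lemma germ_at_add:
  assumes f: "germ_at \<gamma> f" and g: "germ_at \<gamma> g"
  shows "germ_at \<gamma> (f \<oplus>\<^bsub>row_ring\<^esub> g)"
proof -
  obtain U where U: "openin X U" "inj_on (tgt G) U" "\<gamma> \<in> U" "cont U f" "cont U g"
    "\<forall>\<eta> \<in> arrows G. tgt G \<eta> \<in> tgt G ` U \<and> \<eta> \<notin> U \<longrightarrow> f \<eta> = \<zero>\<^bsub>stalk S (tgt G \<eta>)\<^esub>"
    "\<forall>\<eta> \<in> arrows G. tgt G \<eta> \<in> tgt G ` U \<and> \<eta> \<notin> U \<longrightarrow> g \<eta> = \<zero>\<^bsub>stalk S (tgt G \<eta>)\<^esub>"
    by (rule germ_at_combine[OF f g])
  have UA: "U \<subseteq> arrows G" using U(1) openin_subset by blast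
  have rf: "f \<in> row_finite" "g \<in> row_finite" using f g by (auto simp: germ_at_def)
  note s = row_finite_sections[OF rf(1)] row_finite_sections[OF rf(2)]
  have "cont U (f \<oplus>\<^bsub>row_ring\<^esub> g)"
    using cont_add[OF UA U(4) sections_over[OF s(1) UA] U(5) sections_over[OF s(2) UA]]
    by (rule cont_cong) (use UA in \<open>auto simp: row_ring_simps\<close>)
  moreover have "(f \<oplus>\<^bsub>row_ring\<^esub> g) \<eta> = \<zero>\<^bsub>stalk S (tgt G \<eta>)\<^esub>"
    if e: "\<eta> \<in> arrows G" "tgt G \<eta> \<in> tgt G ` U" "\<eta> \<notin> U" for \<eta>
  proof -
    interpret Q: ring "stalk S (tgt G \<eta>)" using e by (intro stalk_ring)
    show ?thesis using U(6,7) e by (simp add: row_ring_simps)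
  qed
  moreover have "f \<oplus>\<^bsub>row_ring\<^esub> g \<in> row_finite" using F.a_closed[of f g] rf by (simp add: row_ring_simps(1))
  ultimately show ?thesis unfolding germ_at_def using U(1-3) by blast
qed

text \<open>By \<open>agree_near\<close> the two sections agree on some \<open>W\<close> around
  \<gamma>. An arrow whose target is a target of \<open>W\<close> either lies in \<open>U\<close>,
  and then in \<open>W\<close> by injectivity, or lies outside \<open>U\<close>, where both sections
  vanish.\<close>

lemma germ_at_eq:
  assumes f: "germ_at \<gamma> f" and g: "germ_at \<gamma> g" and eq: "f \<gamma> = g \<gamma>"
  shows "f \<ominus>\<^bsub>row_ring\<^esub> g \<in> vanishing (tgt G \<gamma>)"
proof -
  obtain U where U: "openin X U" "inj_on (tgt G) U" "\<gamma> \<in> U" "cont U f" "cont U g"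
    "\<forall>\<eta> \<in> arrows G. tgt G \<eta> \<in> tgt G ` U \<and> \<eta> \<notin> U \<longrightarrow> f \<eta> = \<zero>\<^bsub>stalk S (tgt G \<eta>)\<^esub>"
    "\<forall>\<eta> \<in> arrows G. tgt G \<eta> \<in> tgt G ` U \<and> \<eta> \<notin> U \<longrightarrow> g \<eta> = \<zero>\<^bsub>stalk S (tgt G \<eta>)\<^esub>"
    by (rule germ_at_combine[OF f g])
  have UA: "U \<subseteq> arrows G" using U(1) openin_subset by blast
  have rf: "f \<in> row_finite" "g \<in> row_finite" using f g by (auto simp: germ_at_def)
  note s = row_finite_sections[OF rf(1)] row_finite_sections[OF rf(2)]
  obtain W where W: "openin X W" "\<gamma> \<in> W" "W \<subseteq> U" "\<forall>\<eta> \<in> W. f \<eta> = g \<eta>"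
    by (rule agree_near[OF U(1,4) sections_over[OF s(1) UA] U(5) sections_over[OF s(2) UA] U(3) eq])
  have rfd: "f \<ominus>\<^bsub>row_ring\<^esub> g \<in> row_finite" using F.minus_closed[of f g] rf by (simp add: row_ring_simps(1))
  have "(f \<ominus>\<^bsub>row_ring\<^esub> g) \<eta> = \<zero>\<^bsub>stalk S (tgt G \<eta>)\<^esub>" if e: "\<eta> \<in> arrows G" "tgt G \<eta> \<in> tgt G ` W" for \<eta>
  proof -
    interpret Q: ring "stalk S (tgt G \<eta>)" using e by (intro stalk_ring)
    have "f \<eta> = g \<eta>"
    proof (cases "\<eta> \<in> U")
      case True
      obtain \<zeta> where "\<zeta> \<in> W" "tgt G \<eta> = tgt G \<zeta>" using e by blast
      then have "\<eta> \<in> W" using True W(3) inj_onD[OF U(2), of \<eta> \<zeta>] by blast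
      then show ?thesis using W(4) by blast
    next
      case False
      have "tgt G \<eta> \<in> tgt G ` U" using e(2) W(3) by blast
      then show ?thesis using U(6,7) False e(1) by simp
    qed
    then show ?thesis
      using e(1) section_closed[OF s(2) e(1)]
      by (simp add: a_minus_def row_ring_neg[OF rf(2)] row_ring_simps(5) Q.r_neg)
  qed
  then show ?thesis
    unfolding vanishing_def using rfd openin_tgt_image[OF W(1)] W(2) by blast
qed

text \<open>The value zero is sent to the zero section rather than to a chosen one, so that arrows
  off the support add nothing to the sums below.\<close>

definition germ_rep :: "'g \<Rightarrow> 'e \<Rightarrow> ('g \<Rightarrow> 'e)" where
  "germ_rep \<gamma> a = (if a = \<zero>\<^bsub>stalk S (tgt G \<gamma>)\<^esub> then \<zero>\<^bsub>row_ring\<^esub> else SOME f. \<exists>U. basic_on U f \<and> \<gamma> \<in> U \<and> f \<gamma> = a)"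

lemma germ_rep:
  assumes \<gamma>: "\<gamma> \<in> arrows G" and a: "a \<in> carrier (stalk S (tgt G \<gamma>))"
  shows "germ_at \<gamma> (germ_rep \<gamma> a)" "germ_rep \<gamma> a \<gamma> = a"
proof -
  have "germ_at \<gamma> (germ_rep \<gamma> a) \<and> germ_rep \<gamma> a \<gamma> = a"
  proof (cases "a = \<zero>\<^bsub>stalk S (tgt G \<gamma>)\<^esub>")
    case True
    obtain U where U: "compact_open_bisection G U" "\<gamma> \<in> U"
      using bisection_nbhd[of "arrows G" \<gamma>] \<gamma> by blast
    note b = bisectionD[OF U(1)]
    have z: "\<zero>\<^bsub>row_ring\<^esub> \<eta> = \<zero>\<^bsub>stalk S (tgt G \<eta>)\<^esub>" if "\<eta> \<in> arrows G" for \<eta>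
      using that by (simp add: row_ring_simps)
    have "cont U \<zero>\<^bsub>row_ring\<^esub>" using cont_zero[OF b(1)] by (rule cont_cong) (use z b(5) in auto)
    then have "germ_at \<gamma> \<zero>\<^bsub>row_ring\<^esub>"
      unfolding germ_at_def using b U(2) z R_row_finite[OF R_basic[OF basic_zero]] by blast
    then show ?thesis using True z \<gamma> by (simp add: germ_rep_def)
  next
    case False
    obtain U f where "basic_on U f" "\<gamma> \<in> U" "f \<gamma> = a" by (rule basic_through[OF assms])
    then have "\<exists>f U. basic_on U f \<and> \<gamma> \<in> U \<and> f \<gamma> = a" by blast
    from someI_ex[OF this] obtain V where "basic_on V (germ_rep \<gamma> a)" "\<gamma> \<in> V" "germ_rep \<gamma> a \<gamma> = a"
      using False unfolding germ_rep_def by auto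
    then show ?thesis using germ_at_basic by blast
  qed
  then show "germ_at \<gamma> (germ_rep \<gamma> a)" "germ_rep \<gamma> a \<gamma> = a" by auto
qed

lemma germ_rep_zero: "germ_rep \<gamma> \<zero>\<^bsub>stalk S (tgt G \<gamma>)\<^esub> = \<zero>\<^bsub>row_ring\<^esub>"
  by (simp add: germ_rep_def)

lemma germ_rep_closed: "\<lbrakk>\<gamma> \<in> arrows G; a \<in> carrier (stalk S (tgt G \<gamma>))\<rbrakk> \<Longrightarrow> germ_rep \<gamma> a \<in> carrier row_ring"
  using germ_rep(1) by (simp add: germ_at_def row_ring_simps(1))

lemma vanishing_finsum:
  assumes x: "x \<in> units G" and T: "finite T" "\<And>i. i \<in> T \<Longrightarrow> h i \<in> vanishing x"
  shows "finsum row_ring h T \<in> vanishing x"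
  using T
proof (induction T)
  note sub = F.add_subgroupD[OF vanishing_subgroup[OF x]]
  case (insert i T)
  have "h \<in> T \<rightarrow> carrier row_ring" "h i \<in> carrier row_ring" using insert sub(1) by auto
  then show ?case using insert sub(3) by (simp add: F.finsum_insert)
next
  case empty
  then show ?case using F.add_subgroupD(2)[OF vanishing_subgroup[OF x]] by (simp add: F.finsum_empty)
qed

text \<open>Quantifying over all finite \<open>T\<close> above \<open>T0\<close> lets the
  decompositions of two summands use the same index set, which the induction needs. A basic section
  contributes one arrow over \<open>x\<close> or none.\<close>

lemma germ_decomposition:
  assumes x: "x \<in> units G" and f: "f \<in> R"
  shows "\<exists>T0. finite T0 \<and> T0 \<subseteq> {\<gamma> \<in> arrows G. tgt G \<gamma> = x} \<and>
    (\<forall>T. finite T \<longrightarrow> T0 \<subseteq> T \<longrightarrow> T \<subseteq> {\<gamma> \<in> arrows G. tgt G \<gamma> = x} \<longrightarrow>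
      f \<ominus>\<^bsub>row_ring\<^esub> finsum row_ring (\<lambda>\<gamma>. germ_rep \<gamma> (f \<gamma>)) T \<in> vanishing x)"
  using f
proof (induction rule: R_induct)
  note vs = F.add_subgroupD[OF vanishing_subgroup[OF x]]
  case (basic U f)
  note fD = basic_onD[OF basic] and U = bisectionD[OF basic_onD(2)[OF basic]]
  have fF: "f \<in> carrier row_ring" using basic_row[OF basic] by (simp add: row_ring_simps(1))
  have zero: "germ_rep \<gamma> (f \<gamma>) = \<zero>\<^bsub>row_ring\<^esub>" if "\<gamma> \<in> arrows G" "\<gamma> \<notin> U" for \<gamma>
    using fD(5)[OF that] germ_rep_zero by simp
  show ?case
  proof (cases "x \<in> tgt G ` U")
    case False
    have "f \<in> vanishing x"
    proof -
      \<comment> \<open>The targets of a compact open bisection form a closed set, so a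
        neighbourhood of \<open>x\<close> misses them.\<close>
      have "openin X0 (units G - tgt G ` U)"
        using compact_open_tgt_image(3)[OF fD(2)] by (metis openin_diff openin_topspace topspace_X0)
      moreover have "f \<eta> = \<zero>\<^bsub>stalk S (tgt G \<eta>)\<^esub>" if "\<eta> \<in> arrows G" "tgt G \<eta> \<in> units G - tgt G ` U" for \<eta>
        using that fD(5)[of \<eta>] by blast
      moreover have "x \<in> units G - tgt G ` U" using x False by blast
      ultimately show ?thesis using basic_row[OF basic] unfolding vanishing_def by blast
    qed
    moreover have "finsum row_ring (\<lambda>\<gamma>. germ_rep \<gamma> (f \<gamma>)) T = \<zero>\<^bsub>row_ring\<^esub>"
      if "T \<subseteq> {\<gamma> \<in> arrows G. tgt G \<gamma> = x}" for T
    proof (rule F.add.finprod_one_eqI)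
      fix \<gamma> assume "\<gamma> \<in> T"
      then have g: "\<gamma> \<in> arrows G" "tgt G \<gamma> = x" using that by auto
      have "\<gamma> \<notin> U" using False g(2) by blast
      then show "germ_rep \<gamma> (f \<gamma>) = \<zero>\<^bsub>row_ring\<^esub>" by (rule zero[OF g(1)])
    qed
    ultimately show ?thesis using fF by (intro exI[of _ "{}"]) (simp add: a_minus_def)
  next
    case True
    then obtain \<gamma>0 where g0: "\<gamma>0 \<in> U" "tgt G \<gamma>0 = x" by blast
    have g0A: "\<gamma>0 \<in> arrows G" using g0 U(5) by blast
    have fg0: "f \<gamma>0 \<in> carrier (stalk S (tgt G \<gamma>0))" by (rule section_closed[OF fD(1) g0A])
    have "f \<ominus>\<^bsub>row_ring\<^esub> finsum row_ring (\<lambda>\<gamma>. germ_rep \<gamma> (f \<gamma>)) T \<in> vanishing x"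
      if T: "finite T" "{\<gamma>0} \<subseteq> T" "T \<subseteq> {\<gamma> \<in> arrows G. tgt G \<gamma> = x}" for T
    proof -
      have z: "germ_rep \<gamma> (f \<gamma>) = \<zero>\<^bsub>row_ring\<^esub>" if g: "\<gamma> \<in> T - {\<gamma>0}" for \<gamma>
      proof (rule zero)
        show "\<gamma> \<in> arrows G" using g T by blast
        show "\<gamma> \<notin> U" using inj_onD[OF U(4), of \<gamma> \<gamma>0] g T g0 by blast
      qed
      have "finsum row_ring (\<lambda>\<gamma>. germ_rep \<gamma> (f \<gamma>)) T = finsum row_ring (\<lambda>\<gamma>. germ_rep \<gamma> (f \<gamma>)) {\<gamma>0}"
        by (rule F.add.finprod_mono_neutral_cong_right[OF T(1,2)])
          (use z T(3) section_closed[OF fD(1)] germ_rep_closed in auto)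
      also have "\<dots> = germ_rep \<gamma>0 (f \<gamma>0)"
        using germ_rep_closed[OF g0A fg0] by (simp add: F.finsum_insert F.finsum_empty)
      finally show ?thesis
        using germ_at_eq[OF germ_at_basic[OF basic g0(1)] germ_rep(1)[OF g0A fg0]] germ_rep(2)[OF g0A fg0] g0(2)
        by simp
    qed
    then show ?thesis using g0 g0A by (intro exI[of _ "{\<gamma>0}"]) auto
  qed
next
  case (add f g)
  note vs = F.add_subgroupD[OF vanishing_subgroup[OF x]]
  let ?A = "{\<gamma> \<in> arrows G. tgt G \<gamma> = x}"
  obtain Tf where Tf: "finite Tf" "Tf \<subseteq> ?A" "\<forall>T. finite T \<longrightarrow> Tf \<subseteq> T \<longrightarrow> T \<subseteq> ?A \<longrightarrow>
      f \<ominus>\<^bsub>row_ring\<^esub> finsum row_ring (\<lambda>\<gamma>. germ_rep \<gamma> (f \<gamma>)) T \<in> vanishing x" using add(3) by blast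
  obtain Tg where Tg: "finite Tg" "Tg \<subseteq> ?A" "\<forall>T. finite T \<longrightarrow> Tg \<subseteq> T \<longrightarrow> T \<subseteq> ?A \<longrightarrow>
      g \<ominus>\<^bsub>row_ring\<^esub> finsum row_ring (\<lambda>\<gamma>. germ_rep \<gamma> (g \<gamma>)) T \<in> vanishing x" using add(4) by blast
  have rf: "f \<in> row_finite" "g \<in> row_finite" using add(1,2) R_row_finite by auto
  have fgF: "f \<in> carrier row_ring" "g \<in> carrier row_ring" using rf by (simp_all add: row_ring_simps(1))
  note c = section_closed[OF row_finite_sections[OF rf(1)]] section_closed[OF row_finite_sections[OF rf(2)]]
  have "(f \<oplus>\<^bsub>row_ring\<^esub> g) \<ominus>\<^bsub>row_ring\<^esub> finsum row_ring (\<lambda>\<gamma>. germ_rep \<gamma> ((f \<oplus>\<^bsub>row_ring\<^esub> g) \<gamma>)) T \<in> vanishing x"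
    if T: "finite T" "Tf \<union> Tg \<subseteq> T" "T \<subseteq> ?A" for T
  proof -
    define a where "a = (\<lambda>\<gamma>. germ_rep \<gamma> (f \<gamma>))"
    define b where "b = (\<lambda>\<gamma>. germ_rep \<gamma> (g \<gamma>))"
    define d where "d = (\<lambda>\<gamma>. germ_rep \<gamma> ((f \<oplus>\<^bsub>row_ring\<^esub> g) \<gamma>))"
    \<comment> \<open>\<open>germ_rep\<close> is a choice and need not be additive; \<open>h\<close>
      is the defect. Both sides of it have the same value at \<gamma>, so by
      \<open>germ_at_eq\<close> it vanishes near \<open>x\<close>.\<close>
    define h where "h = (\<lambda>\<gamma>. (a \<gamma> \<oplus>\<^bsub>row_ring\<^esub> b \<gamma>) \<ominus>\<^bsub>row_ring\<^esub> d \<gamma>)"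
    have TA: "\<gamma> \<in> arrows G" "tgt G \<gamma> = x" if "\<gamma> \<in> T" for \<gamma> using that T(3) by auto
    have sum: "(f \<oplus>\<^bsub>row_ring\<^esub> g) \<gamma> = f \<gamma> \<oplus>\<^bsub>stalk S (tgt G \<gamma>)\<^esub> g \<gamma>" if "\<gamma> \<in> arrows G" for \<gamma>
      using that by (simp add: row_ring_simps)
    have sc: "(f \<oplus>\<^bsub>row_ring\<^esub> g) \<gamma> \<in> carrier (stalk S (tgt G \<gamma>))" if "\<gamma> \<in> arrows G" for \<gamma>
      unfolding sum[OF that] using c that by (intro stalk_closed)
    have abd: "a \<gamma> \<in> carrier row_ring" "b \<gamma> \<in> carrier row_ring" "d \<gamma> \<in> carrier row_ring" if "\<gamma> \<in> T" for \<gamma>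
      using germ_rep_closed c sc TA[OF that] by (auto simp: a_def b_def d_def)
    have h: "h \<gamma> \<in> vanishing x" if "\<gamma> \<in> T" for \<gamma>
    proof -
      note gA = TA[OF that]
      have "germ_at \<gamma> (a \<gamma> \<oplus>\<^bsub>row_ring\<^esub> b \<gamma>)"
        using germ_rep(1)[OF gA(1) c(1)[OF gA(1)]] germ_rep(1)[OF gA(1) c(2)[OF gA(1)]]
        unfolding a_def b_def by (rule germ_at_add)
      moreover have "germ_at \<gamma> (d \<gamma>)" unfolding d_def by (rule germ_rep(1)[OF gA(1) sc[OF gA(1)]])
      moreover have "(a \<gamma> \<oplus>\<^bsub>row_ring\<^esub> b \<gamma>) \<gamma> = d \<gamma> \<gamma>"
      proof -
        have "(a \<gamma> \<oplus>\<^bsub>row_ring\<^esub> b \<gamma>) \<gamma> = a \<gamma> \<gamma> \<oplus>\<^bsub>stalk S (tgt G \<gamma>)\<^esub> b \<gamma> \<gamma>"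
          using gA(1) by (simp add: row_ring_simps)
        also have "\<dots> = f \<gamma> \<oplus>\<^bsub>stalk S (tgt G \<gamma>)\<^esub> g \<gamma>"
          unfolding a_def b_def germ_rep(2)[OF gA(1) c(1)[OF gA(1)]] germ_rep(2)[OF gA(1) c(2)[OF gA(1)]] ..
        also have "\<dots> = (f \<oplus>\<^bsub>row_ring\<^esub> g) \<gamma>" by (rule sum[OF gA(1), symmetric])
        also have "\<dots> = d \<gamma> \<gamma>" unfolding d_def by (rule germ_rep(2)[OF gA(1) sc[OF gA(1)], symmetric])
        finally show ?thesis .
      qed
      ultimately show ?thesis unfolding h_def using germ_at_eq gA(2) by metis
    qed
    have hF: "h \<gamma> \<in> carrier row_ring" if "\<gamma> \<in> T" for \<gamma> using abd[OF that] by (simp add: h_def)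
    let ?s = "\<lambda>h. finsum row_ring h T"
    have sF: "?s a \<in> carrier row_ring" "?s b \<in> carrier row_ring" "?s d \<in> carrier row_ring" "?s h \<in> carrier row_ring"
      using abd hF by (auto intro!: F.finsum_closed)
    have "?s a \<oplus>\<^bsub>row_ring\<^esub> ?s b = finsum row_ring (\<lambda>\<gamma>. a \<gamma> \<oplus>\<^bsub>row_ring\<^esub> b \<gamma>) T"
      by (rule F.finsum_addf[symmetric]) (use abd in auto)
    also have "\<dots> = finsum row_ring (\<lambda>\<gamma>. h \<gamma> \<oplus>\<^bsub>row_ring\<^esub> d \<gamma>) T"
      by (rule F.finsum_cong'[OF refl]) (use abd hF in \<open>auto simp: h_def F.diff_add_cancel\<close>)
    also have "\<dots> = ?s h \<oplus>\<^bsub>row_ring\<^esub> ?s d"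
      by (rule F.finsum_addf) (use abd hF in auto)
    finally have s: "?s a \<oplus>\<^bsub>row_ring\<^esub> ?s b = ?s h \<oplus>\<^bsub>row_ring\<^esub> ?s d" .
    let ?v = "(f \<ominus>\<^bsub>row_ring\<^esub> ?s a) \<oplus>\<^bsub>row_ring\<^esub> (g \<ominus>\<^bsub>row_ring\<^esub> ?s b) \<oplus>\<^bsub>row_ring\<^esub> ?s h"
    have "?v \<in> vanishing x"
      using Tf(3) Tg(3) T vanishing_finsum[OF x T(1) h] unfolding a_def b_def by (intro vs(3)) auto
    moreover have "(f \<oplus>\<^bsub>row_ring\<^esub> g) \<ominus>\<^bsub>row_ring\<^esub> ?s d = ?v"
    proof -
      have "?v \<oplus>\<^bsub>row_ring\<^esub> ?s d = (f \<ominus>\<^bsub>row_ring\<^esub> ?s a) \<oplus>\<^bsub>row_ring\<^esub> (g \<ominus>\<^bsub>row_ring\<^esub> ?s b) \<oplus>\<^bsub>row_ring\<^esub> (?s a \<oplus>\<^bsub>row_ring\<^esub> ?s b)"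
        unfolding s using fgF sF by (simp add: F.a_assoc)
      also have "\<dots> = ((f \<ominus>\<^bsub>row_ring\<^esub> ?s a) \<oplus>\<^bsub>row_ring\<^esub> ?s a) \<oplus>\<^bsub>row_ring\<^esub> ((g \<ominus>\<^bsub>row_ring\<^esub> ?s b) \<oplus>\<^bsub>row_ring\<^esub> ?s b)"
        using fgF sF by (simp add: F.a_ac)
      also have "\<dots> = f \<oplus>\<^bsub>row_ring\<^esub> g" using fgF sF by (simp add: F.diff_add_cancel)
      finally have e: "?v \<oplus>\<^bsub>row_ring\<^esub> ?s d = f \<oplus>\<^bsub>row_ring\<^esub> g" .
      have vF: "?v \<in> carrier row_ring" using fgF sF by simp
      have "(?v \<oplus>\<^bsub>row_ring\<^esub> ?s d) \<ominus>\<^bsub>row_ring\<^esub> ?s d = ?v"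
        using vF sF(3) by (simp only: a_minus_def F.a_assoc F.r_neg F.a_inv_closed F.r_zero)
      then show ?thesis unfolding e .
    qed
    ultimately show ?thesis unfolding d_def by simp
  qed
  then show ?case using Tf Tg by (intro exI[of _ "Tf \<union> Tg"]) auto
qed

text \<open>All values over \<open>x\<close> are zero, so all terms in
  \<open>germ_decomposition\<close> are the zero section. Continuity alone would not give this: the
  basic summands of \<open>f\<close> live on different bisections, and their values may
  cancel.\<close>

lemma vanishing_near:
  assumes x: "x \<in> units G" and f: "f \<in> R"
    and z: "\<And>\<gamma>. \<lbrakk>\<gamma> \<in> arrows G; tgt G \<gamma> = x\<rbrakk> \<Longrightarrow> f \<gamma> = \<zero>\<^bsub>stalk S x\<^esub>"
  shows "f \<in> vanishing x"
proof -
  obtain T where T: "finite T" "T \<subseteq> {\<gamma> \<in> arrows G. tgt G \<gamma> = x}"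
    "f \<ominus>\<^bsub>row_ring\<^esub> finsum row_ring (\<lambda>\<gamma>. germ_rep \<gamma> (f \<gamma>)) T \<in> vanishing x"
    using germ_decomposition[OF x f] by blast
  have "finsum row_ring (\<lambda>\<gamma>. germ_rep \<gamma> (f \<gamma>)) T = \<zero>\<^bsub>row_ring\<^esub>"
  proof (rule F.add.finprod_one_eqI)
    fix \<gamma> assume "\<gamma> \<in> T"
    then have "\<gamma> \<in> arrows G" "tgt G \<gamma> = x" using T(2) by auto
    then show "germ_rep \<gamma> (f \<gamma>) = \<zero>\<^bsub>row_ring\<^esub>" using z[of \<gamma>] germ_rep_zero[of \<gamma>] by simp
  qed
  then show ?thesis using T(3) R_row_finite[OF f] by (simp add: a_minus_def row_ring_simps(1)[symmetric])
qed

end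

context ample_sheaf
begin

section \<open>The corner at a unit\<close>

lemma diag_diag:
  assumes V: "V \<subseteq> units G" and W: "W \<subseteq> units G"
  shows "diag V \<star> diag W = diag (V \<inter> W)"
proof -
  note d = diag_row_finite[OF V] diag_row_finite[OF W]
  have VW: "V \<inter> W \<subseteq> units G" using V by blast
  note s = row_finite_sections[OF d(2)] row_finite_sections[OF diag_row_finite[OF VW]]
  show ?thesis
  proof (rule sections_eqI[OF conv_sections[OF d(1) s(1)] s(2)])
    fix \<gamma> assume g: "\<gamma> \<in> arrows G"
    have "\<gamma> \<in> W \<Longrightarrow> tgt G \<gamma> = \<gamma>" using W tgt_of_unit by blast
    moreover have "\<gamma> \<in> V \<Longrightarrow> tgt G \<gamma> = \<gamma>" using V tgt_of_unit by blast
    ultimately show "(diag V \<star> diag W) \<gamma> = diag (V \<inter> W) \<gamma>"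
      unfolding diag_conv[OF V s(1) g] using g by (auto simp: diag_def)
  qed
qed

lemma diag_disjoint_Un:
  assumes V: "V \<subseteq> units G" and W: "W \<subseteq> units G" and "V \<inter> W = {}"
  shows "diag (V \<union> W) = diag V \<oplus>\<^bsub>row_ring\<^esub> diag W"
proof (rule sections_eqI)
  have VW: "V \<union> W \<subseteq> units G" using V W by blast
  show "diag (V \<union> W) \<in> sections" using diag_row_finite[OF VW] row_finite_sections by blast
  show "diag V \<oplus>\<^bsub>row_ring\<^esub> diag W \<in> sections"
    using diag_row_finite[OF V] diag_row_finite[OF W] row_finite_sections by (intro sections_add) auto
  fix \<gamma> assume g: "\<gamma> \<in> arrows G"
  interpret Q: ring "stalk S (tgt G \<gamma>)" using g by (intro stalk_ring)
  have "\<gamma> \<in> V \<union> W \<Longrightarrow> tgt G \<gamma> = \<gamma>" using VW tgt_of_unit by blast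
  then have "\<gamma> \<in> V \<union> W \<Longrightarrow> \<one>\<^bsub>stalk S \<gamma>\<^esub> = \<one>\<^bsub>stalk S (tgt G \<gamma>)\<^esub>" by simp
  then show "diag (V \<union> W) \<gamma> = (diag V \<oplus>\<^bsub>row_ring\<^esub> diag W) \<gamma>"
    using g assms(3) by (auto simp: diag_def row_ring_simps(5))
qed

lemma diag_empty: "diag {} = \<zero>\<^bsub>row_ring\<^esub>"
  by (simp add: diag_def row_ring_simps)

definition single :: "'g \<Rightarrow> ('g \<Rightarrow> 'e)" where
  "single \<delta> = ext {\<delta>} (\<lambda>\<gamma>. \<one>\<^bsub>stalk S (tgt G \<gamma>)\<^esub>)"

lemma single_row_finite:
  assumes d: "\<delta> \<in> arrows G" shows "single \<delta> \<in> row_finite"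
proof (rule row_finiteI)
  show "single \<delta> \<in> sections" unfolding single_def using d stalk_closed by (intro ext_sections) auto
  show "\<exists>T. finite T \<and> row (single \<delta>) x \<subseteq> T" for x
    by (intro exI[of _ "{\<delta>}"]) (auto simp: row_def single_def ext_def)
qed

lemma single_apply: "\<gamma> \<in> arrows G \<Longrightarrow>
    single \<delta> \<gamma> = (if \<gamma> = \<delta> then \<one>\<^bsub>stalk S (tgt G \<gamma>)\<^esub> else \<zero>\<^bsub>stalk S (tgt G \<gamma>)\<^esub>)"
  by (simp add: single_def ext_def)

lemma single_single_inv:
  assumes d: "\<delta> \<in> arrows G"
  shows "single \<delta> \<star> single (ginv G \<delta>) = diag {tgt G \<delta>}"
proof -
  let ?y = "tgt G \<delta>"
  have i: "ginv G \<delta> \<in> arrows G" "tgt G (ginv G \<delta>) = src G \<delta>" using d by (auto simp: inv_closed tgt_inv)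
  have y: "{?y} \<subseteq> units G" using d tgt_unit by blast
  interpret D: ring "stalk S ?y" using d by (intro stalk_ring)
  note rf = single_row_finite[OF d] single_row_finite[OF i(1)]
  note s = row_finite_sections[OF rf(1)] row_finite_sections[OF rf(2)]
  show ?thesis
  proof (rule sections_eqI[OF conv_sections[OF rf(1) s(2)] row_finite_sections[OF diag_row_finite[OF y]]])
    fix \<xi> assume \<xi>: "\<xi> \<in> arrows G"
    interpret Q: ring "stalk S (tgt G \<xi>)" using \<xi> by (intro stalk_ring)
    show "(single \<delta> \<star> single (ginv G \<delta>)) \<xi> = diag {?y} \<xi>"
    proof (cases "tgt G \<xi> = ?y")
      case True
      have l: "ldiv \<delta> \<xi> \<in> arrows G" "tgt G (ldiv \<delta> \<xi>) = src G \<delta>" using ldiv[OF d \<xi>] True by auto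
      have iff: "ldiv \<delta> \<xi> = ginv G \<delta> \<longleftrightarrow> \<xi> = ?y"
        using ldiv_eq_iff[OF d \<xi> True[symmetric] i(1)] i(2) by (auto simp: tgt_def)
      have "(single \<delta> \<star> single (ginv G \<delta>)) \<xi> = finsum (stalk S (tgt G \<xi>))
          (\<lambda>\<beta>. single \<delta> \<beta> \<otimes>\<^bsub>stalk S (tgt G \<xi>)\<^esub> act S \<beta> (single (ginv G \<delta>) (ldiv \<beta> \<xi>))) {\<delta>}"
        by (rule conv_value[OF s \<xi>]) (use d True single_apply in auto)
      also have "\<dots> = single \<delta> \<delta> \<otimes>\<^bsub>stalk S (tgt G \<xi>)\<^esub> act S \<delta> (single (ginv G \<delta>) (ldiv \<delta> \<xi>))"
        using term_closed'[OF s d \<xi> True[symmetric]] by (simp add: Q.finsum_insert Q.finsum_empty)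
      also have "\<dots> = diag {?y} \<xi>"
      proof (cases "\<xi> = ?y")
        case eq: True
        have "act S \<delta> (single (ginv G \<delta>) (ldiv \<delta> \<xi>)) = \<one>\<^bsub>stalk S (tgt G \<xi>)\<^esub>"
          using iff eq l act_one[OF d] i True by (simp add: single_apply)
        then show ?thesis using eq True d \<xi> by (simp add: single_apply diag_def)
      next
        case neq: False
        have "act S \<delta> (single (ginv G \<delta>) (ldiv \<delta> \<xi>)) = \<zero>\<^bsub>stalk S (tgt G \<xi>)\<^esub>"
          using iff neq l act_zero[OF d] True by (simp add: single_apply)
        then show ?thesis using neq True d \<xi> by (simp add: single_apply diag_def)
      qed
      finally show ?thesis .
    next
      case False
      have "(single \<delta> \<star> single (ginv G \<delta>)) \<xi> = finsum (stalk S (tgt G \<xi>))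
          (\<lambda>\<beta>. single \<delta> \<beta> \<otimes>\<^bsub>stalk S (tgt G \<xi>)\<^esub> act S \<beta> (single (ginv G \<delta>) (ldiv \<beta> \<xi>))) {}"
        by (rule conv_value[OF s \<xi>]) (use False single_apply in auto)
      moreover have "\<xi> \<noteq> ?y" using False tgt_tgt[OF d] by auto
      ultimately show ?thesis using \<xi> by (simp add: Q.finsum_empty diag_def)
    qed
  qed
qed

text \<open>This is \<open>e R = e F\<close>: only the finite row at \<open>x\<close> matters, and
  \<open>realise\<close> builds an element of \<open>R\<close> with any prescribed finite
  row.\<close>

lemma realise_row:
  assumes x: "x \<in> units G" and f: "f \<in> row_finite"
  shows "\<exists>r \<in> R. diag {x} \<star> r = diag {x} \<star> f"
proof -
  have X: "{x} \<subseteq> units G" using x by blast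
  have "\<exists>r \<in> R. \<forall>\<gamma> \<in> arrows G. tgt G \<gamma> = x \<longrightarrow> r \<gamma> = (if \<gamma> \<in> row f x then f \<gamma> else \<zero>\<^bsub>stalk S (tgt G \<gamma>)\<^esub>)"
    by (rule realise) (use finite_row[OF f x] section_closed[OF row_finite_sections[OF f]] in \<open>auto simp: row_def\<close>)
  then obtain r where r: "r \<in> R" "\<And>\<gamma>. \<lbrakk>\<gamma> \<in> arrows G; tgt G \<gamma> = x\<rbrakk> \<Longrightarrow> r \<gamma> = f \<gamma>"
    unfolding row_def by auto
  have "diag {x} \<star> r = diag {x} \<star> f"
  proof (rule sections_eqI)
    show "diag {x} \<star> r \<in> sections" by (rule conv_sections[OF diag_row_finite[OF X] row_finite_sections[OF R_row_finite[OF r(1)]]])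
    show "diag {x} \<star> f \<in> sections" by (rule conv_sections[OF diag_row_finite[OF X] row_finite_sections[OF f]])
  qed (simp add: diag_conv[OF X row_finite_sections[OF R_row_finite[OF r(1)]]] diag_conv[OF X row_finite_sections[OF f]] r(2))
  then show ?thesis using r(1) by blast
qed

lemma realise_column:
  assumes x: "x \<in> units G" and f: "f \<in> row_finite" "finite (column f x)"
  shows "\<exists>r \<in> R. r \<star> diag {x} = f \<star> diag {x}"
proof -
  have X: "{x} \<subseteq> units G" using x by blast
  have "\<exists>r \<in> R. \<forall>\<gamma> \<in> arrows G. src G \<gamma> = x \<longrightarrow> r \<gamma> = (if \<gamma> \<in> column f x then f \<gamma> else \<zero>\<^bsub>stalk S (tgt G \<gamma>)\<^esub>)"
    by (rule realise) (use f(2) section_closed[OF row_finite_sections[OF f(1)]] in \<open>auto simp: column_def\<close>)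
  then obtain r where r: "r \<in> R" "\<And>\<gamma>. \<lbrakk>\<gamma> \<in> arrows G; src G \<gamma> = x\<rbrakk> \<Longrightarrow> r \<gamma> = f \<gamma>"
    unfolding column_def by auto
  have "r \<star> diag {x} = f \<star> diag {x}"
  proof (rule sections_eqI)
    show "r \<star> diag {x} \<in> sections" by (rule conv_sections[OF R_row_finite[OF r(1)] row_finite_sections[OF diag_row_finite[OF X]]])
    show "f \<star> diag {x} \<in> sections" by (rule conv_sections[OF f(1) row_finite_sections[OF diag_row_finite[OF X]]])
  qed (simp add: conv_diag[OF X row_finite_sections[OF R_row_finite[OF r(1)]]] conv_diag[OF X row_finite_sections[OF f(1)]] r(2))
  then show ?thesis using r(1) by blast
qed

text \<open>For \<open>\<delta> : x \<rightarrow> y\<close>, the unit at \<open>y\<close> is \<open>1\<^sub>\<delta> * 1\<^sub>\<delta>\<^sub>-\<^sub>1\<close> and factors through the unit at \<open>x\<close>.\<close>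

lemma unit_factor:
  assumes d: "\<delta> \<in> arrows G"
  shows "\<exists>v \<in> R. \<exists>w \<in> R. diag {tgt G \<delta>} = v \<star> diag {src G \<delta>} \<star> w"
proof -
  let ?x = "src G \<delta>"
  have x: "?x \<in> units G" "{?x} \<subseteq> units G" using d src_unit by auto
  have i: "ginv G \<delta> \<in> arrows G" "tgt G (ginv G \<delta>) = ?x" using d by (auto simp: inv_closed tgt_inv)
  note rf = single_row_finite[OF d] single_row_finite[OF i(1)] diag_row_finite[OF x(2)]
  note s = rf[THEN row_finite_sections]
  have "column (single \<delta>) ?x \<subseteq> {\<delta>}" by (auto simp: column_def single_apply split: if_splits)
  then obtain v where v: "v \<in> R" "v \<star> diag {?x} = single \<delta> \<star> diag {?x}"
    using realise_column[OF x(1) rf(1)] finite_subset by blast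
  obtain w where w: "w \<in> R" "diag {?x} \<star> w = diag {?x} \<star> single (ginv G \<delta>)"
    using realise_row[OF x(1) rf(2)] by blast
  have 1: "single \<delta> \<star> diag {?x} = single \<delta>"
    by (rule sections_eqI[OF conv_sections[OF rf(1) s(3)] s(1)])
      (auto simp: conv_diag[OF x(2) s(1)] single_apply)
  have 2: "diag {?x} \<star> single (ginv G \<delta>) = single (ginv G \<delta>)"
    by (rule sections_eqI[OF conv_sections[OF rf(3) s(2)] s(2)])
      (auto simp: diag_conv[OF x(2) s(2)] single_apply i)
  have "v \<star> diag {?x} \<star> w = single \<delta> \<star> w" using v(2) 1 by simp
  also have "\<dots> = single \<delta> \<star> diag {?x} \<star> w" using 1 by simp
  also have "\<dots> = single \<delta> \<star> (diag {?x} \<star> w)" using rf R_row_finite[OF w(1)] by (intro conv_assoc)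
  also have "\<dots> = diag {tgt G \<delta>}" using w(2) 2 single_single_inv[OF d] by simp
  finally show ?thesis using v(1) w(1) by metis
qed

context
  fixes x assumes x: "x \<in> units G"
begin

abbreviation "ex \<equiv> diag {x}"
abbreviation "isox \<equiv> isotropy G x"
abbreviation "fibx \<equiv> src_fibre G x"
abbreviation "Bx \<equiv> isotropy_ring G S x"
abbreviation "Lx \<equiv> bimodule_group G S x"

lemma x_units: "{x} \<subseteq> units G"
  using x by blast

lemma ex_row_finite: "ex \<in> row_finite"
  by (rule diag_row_finite[OF x_units])

lemma iso_arrows: "isox \<subseteq> arrows G" and fib_arrows: "fibx \<subseteq> arrows G"
  by (auto simp: isotropy_def src_fibre_def)

text \<open>The left factor \<open>ex\<close> keeps the arrows with target \<open>x\<close> and the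
  right one those with source \<open>x\<close>; together they leave the isotropy group.\<close>

lemma ext_iso:
  assumes f: "f \<in> row_finite" shows "ex \<star> f \<star> ex = ext isox f"
proof (rule sections_eqI)
  note s = row_finite_sections[OF f]
  have ef: "ex \<star> f \<in> row_finite" by (rule conv_closed[OF ex_row_finite f])
  show "ex \<star> f \<star> ex \<in> sections" by (rule conv_sections[OF ef row_finite_sections[OF ex_row_finite]])
  show "ext isox f \<in> sections" using section_closed[OF s] iso_arrows by (intro ext_sections) auto
  fix \<gamma> assume "\<gamma> \<in> arrows G"
  then show "(ex \<star> f \<star> ex) \<gamma> = ext isox f \<gamma>"
    by (auto simp: conv_diag[OF x_units row_finite_sections[OF ef]] diag_conv[OF x_units s] ext_def isotropy_def)
qed

lemma ext_fib:
  assumes f: "f \<in> row_finite" shows "f \<star> ex = ext fibx f"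
proof (rule sections_eqI)
  note s = row_finite_sections[OF f]
  show "f \<star> ex \<in> sections" by (rule conv_sections[OF f row_finite_sections[OF ex_row_finite]])
  show "ext fibx f \<in> sections" using section_closed[OF s] fib_arrows by (intro ext_sections) auto
  fix \<gamma> assume "\<gamma> \<in> arrows G"
  then show "(f \<star> ex) \<gamma> = ext fibx f \<gamma>"
    by (auto simp: conv_diag[OF x_units s] ext_def src_fibre_def)
qed

lemma ext_row_finite:
  assumes "K \<subseteq> arrows G" "\<And>\<gamma>. \<gamma> \<in> K \<Longrightarrow> u \<gamma> \<in> carrier (stalk S (tgt G \<gamma>))"
    "finite {\<gamma> \<in> K. u \<gamma> \<noteq> \<zero>\<^bsub>stalk S (tgt G \<gamma>)\<^esub>}"
  shows "ext K u \<in> row_finite"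
proof (rule row_finiteI)
  show "ext K u \<in> sections" using assms(2) by (rule ext_sections)
  show "\<exists>T. finite T \<and> row (ext K u) y \<subseteq> T" for y
    using assms(1,3) by (intro exI[of _ "{\<gamma> \<in> K. u \<gamma> \<noteq> \<zero>\<^bsub>stalk S (tgt G \<gamma>)\<^esub>}"])
      (auto simp: row_def ext_def split: if_splits)
qed

lemma stalk_group: "y \<in> units G \<Longrightarrow> group (add_monoid (stalk S y))"
  using ring_stalk[of y] by (intro abelian_group.a_group ring.is_abelian_group)

lemma carrier_B: "b \<in> carrier Bx \<longleftrightarrow> b \<in> extensional isox \<and>
    (\<forall>\<delta> \<in> isox. b \<delta> \<in> carrier (stalk S x)) \<and> finite {\<delta> \<in> isox. b \<delta> \<noteq> \<zero>\<^bsub>stalk S x\<^esub>}"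
  using carrier_sum_group[of isox "\<lambda>_. add_monoid (stalk S x)"] stalk_group[OF x]
  by (auto simp: isotropy_ring_def Let_def PiE_iff)

lemma carrier_L: "l \<in> carrier Lx \<longleftrightarrow> l \<in> extensional fibx \<and>
    (\<forall>\<gamma> \<in> fibx. l \<gamma> \<in> carrier (stalk S (tgt G \<gamma>))) \<and> finite {\<gamma> \<in> fibx. l \<gamma> \<noteq> \<zero>\<^bsub>stalk S (tgt G \<gamma>)\<^esub>}"
  using carrier_sum_group[of fibx "\<lambda>\<gamma>. add_monoid (stalk S (tgt G \<gamma>))"] stalk_group[OF tgt_unit] fib_arrows
  by (auto simp: bimodule_group_def PiE_iff subset_iff)

lemma B_values: "\<lbrakk>b \<in> carrier Bx; \<delta> \<in> isox\<rbrakk> \<Longrightarrow> b \<delta> \<in> carrier (stalk S (tgt G \<delta>))"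
  by (auto simp: carrier_B isotropy_def)

lemma L_values: "\<lbrakk>l \<in> carrier Lx; \<delta> \<in> fibx\<rbrakk> \<Longrightarrow> l \<delta> \<in> carrier (stalk S (tgt G \<delta>))"
  by (auto simp: carrier_L)

lemma iso_support: "{\<delta> \<in> isox. b \<delta> \<noteq> \<zero>\<^bsub>stalk S (tgt G \<delta>)\<^esub>} = {\<delta> \<in> isox. b \<delta> \<noteq> \<zero>\<^bsub>stalk S x\<^esub>}"
  by (auto simp: isotropy_def)

lemma ext_B: "b \<in> carrier Bx \<Longrightarrow> ext isox b \<in> row_finite"
  using iso_arrows B_values by (intro ext_row_finite) (auto simp: carrier_B iso_support)

lemma ext_L: "l \<in> carrier Lx \<Longrightarrow> ext fibx l \<in> row_finite"
  using fib_arrows L_values by (intro ext_row_finite) (auto simp: carrier_L)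

lemma B_memberI:
  assumes b: "b \<in> extensional isox" "\<And>\<delta>. \<delta> \<in> isox \<Longrightarrow> b \<delta> \<in> carrier (stalk S (tgt G \<delta>))" and f: "ext isox b \<in> row_finite"
  shows "b \<in> carrier Bx"
proof -
  have "{\<delta> \<in> isox. b \<delta> \<noteq> \<zero>\<^bsub>stalk S x\<^esub>} = row (ext isox b) x"
    using iso_arrows by (auto simp: row_def ext_def isotropy_def split: if_splits)
  then have "finite {\<delta> \<in> isox. b \<delta> \<noteq> \<zero>\<^bsub>stalk S x\<^esub>}" using finite_row[OF f x] by simp
  then show ?thesis using b by (auto simp: carrier_B isotropy_def)
qed

text \<open>Finite support on a source fibre is a column condition, which row-finiteness does not
  give. It is inherited from \<open>r\<close>, since elements of \<open>R\<close> have finite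
  columns.\<close>

lemma L_memberI:
  assumes l: "l \<in> extensional fibx" "\<And>\<gamma>. \<gamma> \<in> fibx \<Longrightarrow> l \<gamma> \<in> carrier (stalk S (tgt G \<gamma>))"
    and r: "r \<in> R" "ext fibx l = r \<star> ex"
  shows "l \<in> carrier Lx"
proof -
  have "l \<gamma> = r \<gamma>" if g: "\<gamma> \<in> fibx" for \<gamma>
  proof -
    have "ext fibx l \<gamma> = ext fibx r \<gamma>" using r(2) ext_fib[OF R_row_finite[OF r(1)]] by simp
    then show ?thesis using g fib_arrows by (auto simp: ext_def)
  qed
  then have "{\<gamma> \<in> fibx. l \<gamma> \<noteq> \<zero>\<^bsub>stalk S (tgt G \<gamma>)\<^esub>} \<subseteq> column r x"
    by (auto simp: column_def src_fibre_def)
  then have "finite {\<gamma> \<in> fibx. l \<gamma> \<noteq> \<zero>\<^bsub>stalk S (tgt G \<gamma>)\<^esub>}" using finite_column[OF r(1)] finite_subset by blast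
  then show ?thesis using l by (auto simp: carrier_L)
qed

lemma ext_B_corner: "b \<in> carrier Bx \<Longrightarrow> ex \<star> ext isox b \<star> ex = ext isox b"
  unfolding ext_iso[OF ext_B] by (auto simp: ext_def)

lemma ext_inj: "\<lbrakk>u \<in> extensional K; v \<in> extensional K; K \<subseteq> arrows G; ext K u = ext K v\<rbrakk> \<Longrightarrow> u = v"
proof (rule extensionalityI)
  fix \<gamma> assume g: "K \<subseteq> arrows G" "ext K u = ext K v" "\<gamma> \<in> K"
  then have "ext K u \<gamma> = ext K v \<gamma>" "\<gamma> \<in> arrows G" by auto
  then show "u \<gamma> = v \<gamma>" using g(3) by (simp add: ext_def)
qed

lemma ext_restrict: "K \<subseteq> arrows G \<Longrightarrow> ext K (restrict f K) = ext K f"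
  by (auto simp: ext_def)

lemma ext_iso_bij: "bij_betw (ext isox) (carrier Bx) {ex \<star> f \<star> ex | f. f \<in> row_finite}"
  unfolding bij_betw_def
proof
  show "inj_on (ext isox) (carrier Bx)"
    by (rule inj_onI) (use ext_inj iso_arrows in \<open>auto simp: carrier_B\<close>)
  show "ext isox ` carrier Bx = {ex \<star> f \<star> ex | f. f \<in> row_finite}"
  proof (intro equalityI subsetI)
    fix h assume "h \<in> ext isox ` carrier Bx"
    then obtain b where b: "b \<in> carrier Bx" "h = ext isox b" by blast
    then have "h = ex \<star> ext isox b \<star> ex" using ext_B_corner by simp
    then show "h \<in> {ex \<star> f \<star> ex | f. f \<in> row_finite}" using ext_B[OF b(1)] by blast
  next
    fix h assume "h \<in> {ex \<star> f \<star> ex | f. f \<in> row_finite}"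
    then obtain f where f: "f \<in> row_finite" "h = ex \<star> f \<star> ex" by blast
    have h: "h = ext isox (restrict f isox)" using f ext_iso ext_restrict[OF iso_arrows] by simp
    have hF: "h \<in> row_finite" using f ex_row_finite by (auto intro: conv_closed)
    have "restrict f isox \<in> carrier Bx"
      using section_closed[OF row_finite_sections[OF f(1)]] iso_arrows h hF by (intro B_memberI) auto
    then show "h \<in> ext isox ` carrier Bx" using h by blast
  qed
qed

lemma L_image: "l \<in> carrier Lx \<Longrightarrow> \<exists>r \<in> R. ext fibx l = r \<star> ex"
proof -
  assume l: "l \<in> carrier Lx"
  have "column (ext fibx l) x \<subseteq> {\<gamma> \<in> fibx. l \<gamma> \<noteq> \<zero>\<^bsub>stalk S (tgt G \<gamma>)\<^esub>}"
    by (auto simp: column_def ext_def split: if_splits)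
  then have "finite (column (ext fibx l) x)" using l finite_subset by (auto simp: carrier_L)
  then obtain r where r: "r \<in> R" "r \<star> ex = ext fibx l \<star> ex" using realise_column[OF x ext_L[OF l]] by blast
  have "ext fibx l \<star> ex = ext fibx l" unfolding ext_fib[OF ext_L[OF l]] by (auto simp: ext_def)
  then have "ext fibx l = r \<star> ex" using r(2) by simp
  then show ?thesis using r(1) by blast
qed

lemma ext_fib_bij: "bij_betw (ext fibx) (carrier Lx) {r \<star> ex | r. r \<in> R}"
  unfolding bij_betw_def
proof
  show "inj_on (ext fibx) (carrier Lx)"
    by (rule inj_onI) (use ext_inj fib_arrows in \<open>auto simp: carrier_L\<close>)
  show "ext fibx ` carrier Lx = {r \<star> ex | r. r \<in> R}"
  proof (intro equalityI subsetI)
    fix h assume "h \<in> ext fibx ` carrier Lx"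
    then show "h \<in> {r \<star> ex | r. r \<in> R}" using L_image by blast
  next
    fix h assume "h \<in> {r \<star> ex | r. r \<in> R}"
    then obtain r where r: "r \<in> R" "h = r \<star> ex" by blast
    have h: "h = ext fibx (restrict r fibx)"
      using r ext_fib[OF R_row_finite[OF r(1)]] ext_restrict[OF fib_arrows] by simp
    have "restrict r fibx \<in> carrier Lx"
      using section_closed[OF row_finite_sections[OF R_row_finite[OF r(1)]]] fib_arrows h r
      by (intro L_memberI[OF _ _ r(1)]) auto
    then show "h \<in> ext fibx ` carrier Lx" using h by blast
  qed
qed

lemma ext_add: "K \<subseteq> arrows G \<Longrightarrow>
    (\<And>\<gamma>. \<gamma> \<in> K \<Longrightarrow> w \<gamma> = u \<gamma> \<oplus>\<^bsub>stalk S (tgt G \<gamma>)\<^esub> v \<gamma>) \<Longrightarrow>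
    ext K w = ext K u \<oplus>\<^bsub>row_ring\<^esub> ext K v"
proof -
  assume a: "K \<subseteq> arrows G" "\<And>\<gamma>. \<gamma> \<in> K \<Longrightarrow> w \<gamma> = u \<gamma> \<oplus>\<^bsub>stalk S (tgt G \<gamma>)\<^esub> v \<gamma>"
  show ?thesis
    unfolding row_ring_simps ext_def[of K w]
  proof (rule restrict_ext)
    fix \<gamma> assume g: "\<gamma> \<in> arrows G"
    interpret Q: ring "stalk S (tgt G \<gamma>)" using g by (intro stalk_ring)
    show "(if \<gamma> \<in> K then w \<gamma> else \<zero>\<^bsub>stalk S (tgt G \<gamma>)\<^esub>) = ext K u \<gamma> \<oplus>\<^bsub>stalk S (tgt G \<gamma>)\<^esub> ext K v \<gamma>"
      using g a(2) by (simp add: ext_def)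
  qed
qed

lemma B_add:
  assumes "a \<in> carrier Bx" "b \<in> carrier Bx"
  shows "a \<oplus>\<^bsub>Bx\<^esub> b \<in> carrier Bx \<and> ext isox (a \<oplus>\<^bsub>Bx\<^esub> b) = ext isox a \<oplus>\<^bsub>row_ring\<^esub> ext isox b"
proof -
  have v: "(a \<oplus>\<^bsub>Bx\<^esub> b) = (\<lambda>\<delta> \<in> isox. a \<delta> \<oplus>\<^bsub>stalk S x\<^esub> b \<delta>)"
    by (simp add: isotropy_ring_def Let_def)
  have e: "ext isox (a \<oplus>\<^bsub>Bx\<^esub> b) = ext isox a \<oplus>\<^bsub>row_ring\<^esub> ext isox b"
    by (rule ext_add[OF iso_arrows]) (auto simp: v isotropy_def)
  have "ext isox a \<oplus>\<^bsub>row_ring\<^esub> ext isox b \<in> row_finite"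
    using F.a_closed[of "ext isox a" "ext isox b"] ext_B assms by (simp add: row_ring_simps(1))
  moreover have "(a \<oplus>\<^bsub>Bx\<^esub> b) \<delta> \<in> carrier (stalk S (tgt G \<delta>))" if d: "\<delta> \<in> isox" for \<delta>
    using stalk_closed(3)[of \<delta> "a \<delta>" "b \<delta>"] B_values[OF assms(1) d] B_values[OF assms(2) d] d iso_arrows
    by (auto simp: v isotropy_def)
  ultimately show ?thesis using e by (auto intro!: B_memberI simp: v)
qed

lemma B_mult:
  assumes "a \<in> carrier Bx" "b \<in> carrier Bx"
  shows "a \<otimes>\<^bsub>Bx\<^esub> b \<in> carrier Bx \<and> ext isox (a \<otimes>\<^bsub>Bx\<^esub> b) = ext isox a \<star> ext isox b"
proof -
  have v: "a \<otimes>\<^bsub>Bx\<^esub> b = conv G S isox isox isox a b" by (simp add: isotropy_ring_def Let_def)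
  have cl: "gmult G \<beta> \<gamma> \<in> isox" if "\<beta> \<in> isox" "\<gamma> \<in> isox" for \<beta> \<gamma>
    using that by (auto simp: isotropy_def mult_closed src_mult tgt_mult)
  note c = ext_conv[where u = a and v = b, OF iso_arrows iso_arrows iso_arrows cl B_values[OF assms(1)] B_values[OF assms(2)] ext_B[OF assms(1)]]
  have e: "ext isox (a \<otimes>\<^bsub>Bx\<^esub> b) = ext isox a \<star> ext isox b" unfolding v by (rule c(1))
  have "ext isox a \<star> ext isox b \<in> row_finite" using ext_B assms by (intro conv_closed)
  moreover have "a \<otimes>\<^bsub>Bx\<^esub> b \<in> extensional isox" unfolding v conv_def by simp
  ultimately have "a \<otimes>\<^bsub>Bx\<^esub> b \<in> carrier Bx" using c(2) e by (intro B_memberI) (auto simp: v)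
  then show ?thesis using e by blast
qed

lemma B_one: "\<one>\<^bsub>Bx\<^esub> \<in> carrier Bx \<and> ext isox \<one>\<^bsub>Bx\<^esub> = ex"
proof -
  have v: "\<one>\<^bsub>Bx\<^esub> = (\<lambda>\<delta> \<in> isox. if \<delta> = x then \<one>\<^bsub>stalk S x\<^esub> else \<zero>\<^bsub>stalk S x\<^esub>)"
    by (simp add: isotropy_ring_def Let_def)
  have xi: "x \<in> isox" using x by (simp add: isotropy_def unit_arrow src_of_unit tgt_of_unit)
  have e: "ext isox \<one>\<^bsub>Bx\<^esub> = ex"
    unfolding ext_def diag_def v using xi by (intro restrict_ext) (auto simp: isotropy_def)
  have "\<one>\<^bsub>Bx\<^esub> \<delta> \<in> carrier (stalk S (tgt G \<delta>))" if "\<delta> \<in> isox" for \<delta>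
    using that stalk_closed(1,2)[of \<delta>] by (auto simp: v isotropy_def)
  then show ?thesis using e ex_row_finite by (auto intro!: B_memberI simp: v)
qed

lemma L_mult:
  assumes "k \<in> carrier Lx" "l \<in> carrier Lx"
  shows "k \<otimes>\<^bsub>Lx\<^esub> l \<in> carrier Lx \<and> ext fibx (k \<otimes>\<^bsub>Lx\<^esub> l) = ext fibx k \<oplus>\<^bsub>row_ring\<^esub> ext fibx l"
proof
  have "group Lx" unfolding bimodule_group_def
    using stalk_group[OF tgt_unit] fib_arrows by (auto intro!: sum_group)
  then show "k \<otimes>\<^bsub>Lx\<^esub> l \<in> carrier Lx"
    using assms by (meson group.is_monoid monoid.m_closed)
  show "ext fibx (k \<otimes>\<^bsub>Lx\<^esub> l) = ext fibx k \<oplus>\<^bsub>row_ring\<^esub> ext fibx l"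
    by (rule ext_add[OF fib_arrows]) (simp add: bimodule_group_def)
qed

lemma L_lact:
  assumes r: "r \<in> R" and l: "l \<in> carrier Lx"
  shows "bimodule_left G S x r l \<in> carrier Lx \<and> ext fibx (bimodule_left G S x r l) = r \<star> ext fibx l"
proof -
  note rr = R_row_finite[OF r]
  note rs = row_finite_sections[OF rr]
  have cl: "gmult G \<beta> \<gamma> \<in> fibx" if "\<beta> \<in> arrows G" "\<gamma> \<in> fibx" "src G \<beta> = tgt G \<gamma>" for \<beta> \<gamma>
    using that by (auto simp: src_fibre_def mult_closed src_mult)
  have re: "ext (arrows G) r \<in> row_finite" using rr ext_arrows[OF rs] by simp
  note c = ext_conv[where u = r and v = l, OF subset_refl fib_arrows fib_arrows cl section_closed[OF rs] L_values[OF l] re, folded bimodule_left_def]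
  have e: "ext fibx (bimodule_left G S x r l) = r \<star> ext fibx l" by (rule c(1)[unfolded ext_arrows[OF rs]])
  obtain s where s: "s \<in> R" "ext fibx l = s \<star> ex" using L_image[OF l] by blast
  have e2: "ext fibx (bimodule_left G S x r l) = (r \<star> s) \<star> ex"
    unfolding e s(2) by (rule conv_assoc[OF rr R_row_finite[OF s(1)] ex_row_finite, symmetric])
  have "bimodule_left G S x r l \<in> extensional fibx" unfolding bimodule_left_def conv_def by simp
  then have "bimodule_left G S x r l \<in> carrier Lx"
    by (rule L_memberI[OF _ c(2) R_m_closed[OF r s(1)] e2])
  then show ?thesis using e by blast
qed

text \<open>After compression only arrows of the isotropy group survive. They lie in the finite row
  at \<open>x\<close>, so the column is finite as well and \<open>realise_column\<close>
  applies.\<close>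

lemma corner_column:
  assumes f: "f \<in> row_finite" shows "\<exists>r \<in> R. r \<star> ex = ex \<star> f \<star> ex"
proof -
  have F: "ex \<star> f \<star> ex \<in> row_finite" using f ex_row_finite by (auto intro: conv_closed)
  have "column (ex \<star> f \<star> ex) x \<subseteq> row f x"
    unfolding ext_iso[OF f] by (auto simp: column_def row_def ext_def isotropy_def split: if_splits)
  then have "finite (column (ex \<star> f \<star> ex) x)" using finite_row[OF f x] finite_subset by blast
  then obtain r where r: "r \<in> R" "r \<star> ex = (ex \<star> f \<star> ex) \<star> ex" using realise_column[OF x F] by blast
  have "(ex \<star> f \<star> ex) \<star> ex = ex \<star> f \<star> (ex \<star> ex)"
    using f ex_row_finite by (intro conv_assoc conv_closed)
  then have "r \<star> ex = ex \<star> f \<star> ex" unfolding r(2) using diag_diag[OF x_units x_units] by simp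
  then show ?thesis using r(1) by blast
qed

lemma L_ract:
  assumes l: "l \<in> carrier Lx" and b: "b \<in> carrier Bx"
  shows "bimodule_right G S x l b \<in> carrier Lx \<and> ext fibx (bimodule_right G S x l b) = ext fibx l \<star> ext isox b"
proof -
  have cl: "gmult G \<beta> \<gamma> \<in> fibx" if "\<beta> \<in> fibx" "\<gamma> \<in> isox" "src G \<beta> = tgt G \<gamma>" for \<beta> \<gamma>
    using that by (auto simp: src_fibre_def isotropy_def mult_closed src_mult)
  note c = ext_conv[where u = l and v = b, OF fib_arrows iso_arrows fib_arrows cl L_values[OF l] B_values[OF b] ext_L[OF l], folded bimodule_right_def]
  have e: "ext fibx (bimodule_right G S x l b) = ext fibx l \<star> ext isox b" by (rule c(1))
  obtain s where s: "s \<in> R" "ext fibx l = s \<star> ex" using L_image[OF l] by blast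
  obtain a where a: "a \<in> R" "a \<star> ex = ext isox b"
    using corner_column[OF ext_B[OF b]] unfolding ext_B_corner[OF b] by blast
  \<comment> \<open>This brings \<open>l b\<close> into the form \<open>R e\<close>: with
    \<open>l = s e\<close> and \<open>b = a e\<close> the product is \<open>s (e a e)\<close>, and
    \<open>a'\<close> realises the inner compression.\<close>
  obtain a' where a': "a' \<in> R" "a' \<star> ex = ex \<star> a \<star> ex" using corner_column[OF R_row_finite[OF a(1)]] by blast
  note rf = R_row_finite[OF s(1)] R_row_finite[OF a(1)] R_row_finite[OF a'(1)] ex_row_finite
  have "ext fibx l \<star> ext isox b = s \<star> ex \<star> (a \<star> ex)" using s a by simp
  also have "\<dots> = s \<star> (ex \<star> a \<star> ex)" using rf by (simp add: conv_assoc conv_closed)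
  also have "\<dots> = (s \<star> a') \<star> ex" using rf a'(2) by (simp add: conv_assoc)
  finally have e2: "ext fibx (bimodule_right G S x l b) = (s \<star> a') \<star> ex" using e by simp
  have "bimodule_right G S x l b \<in> extensional fibx" unfolding bimodule_right_def conv_def by simp
  then have "bimodule_right G S x l b \<in> carrier Lx"
    by (rule L_memberI[OF _ c(2) R_m_closed[OF s(1) a'(1)] e2])
  then show ?thesis using e by blast
qed

text \<open>The row of \<open>r\<close> at \<open>x\<close> meets finitely many sources. The
  indicator of a compact open \<open>K\<close> that contains \<open>x\<close> and none of the others
  lies in \<open>R\<close> and cuts this row exactly as \<open>ex\<close> does.\<close>

lemma right_cut:
  assumes r: "r \<in> R" shows "\<exists>s \<in> R. ex \<star> r \<star> s = ex \<star> r \<star> ex"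
proof -
  have fin: "finite (src G ` row r x)" using finite_row[OF R_row_finite[OF r] x] by simp
  obtain K where K: "compactin X0 K" "openin X0 K" "x \<in> K" "K \<inter> src G ` row r x \<subseteq> {x}"
    by (rule separate_unit[OF x fin])
  have KU: "K \<subseteq> units G" using K(2) by (simp add: openin_X0)
  note rs = row_finite_sections[OF R_row_finite[OF r]]
  have er: "ex \<star> r \<in> row_finite" using conv_closed[OF ex_row_finite R_row_finite[OF r]] .
  note ers = row_finite_sections[OF er]
  have "ex \<star> r \<star> diag K = ex \<star> r \<star> ex"
  proof (rule sections_eqI)
    show "ex \<star> r \<star> diag K \<in> sections" "ex \<star> r \<star> ex \<in> sections"
      by (intro conv_sections er row_finite_sections diag_row_finite KU ex_row_finite)+
    fix \<gamma> assume g: "\<gamma> \<in> arrows G"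
    show "(ex \<star> r \<star> diag K) \<gamma> = (ex \<star> r \<star> ex) \<gamma>"
      unfolding conv_diag[OF KU ers g] conv_diag[OF x_units ers g] diag_conv[OF x_units rs g]
      using K(3,4) g by (auto simp: row_def)
  qed
  then show ?thesis using diag_R[OF K(1,2)] by blast
qed

text \<open>The mirror image, with the finitely many targets in the column of \<open>r\<close> at
  \<open>x\<close>.\<close>

lemma left_cut:
  assumes r: "r \<in> R" shows "\<exists>s \<in> R. s \<star> r \<star> ex = ex \<star> r \<star> ex"
proof -
  have fin: "finite (tgt G ` column r x)" using finite_column[OF r] by simp
  obtain K where K: "compactin X0 K" "openin X0 K" "x \<in> K" "K \<inter> tgt G ` column r x \<subseteq> {x}"
    by (rule separate_unit[OF x fin])
  have KU: "K \<subseteq> units G" using K(2) by (simp add: openin_X0)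
  note rs = row_finite_sections[OF R_row_finite[OF r]]
  have kr: "diag K \<star> r \<in> row_finite" using conv_closed[OF diag_row_finite[OF KU] R_row_finite[OF r]] .
  have er: "ex \<star> r \<in> row_finite" using conv_closed[OF ex_row_finite R_row_finite[OF r]] .
  note s = row_finite_sections[OF kr] row_finite_sections[OF er]
  have "diag K \<star> r \<star> ex = ex \<star> r \<star> ex"
  proof (rule sections_eqI)
    show "diag K \<star> r \<star> ex \<in> sections" "ex \<star> r \<star> ex \<in> sections"
      by (intro conv_sections er kr row_finite_sections ex_row_finite)+
    fix \<gamma> assume g: "\<gamma> \<in> arrows G"
    show "(diag K \<star> r \<star> ex) \<gamma> = (ex \<star> r \<star> ex) \<gamma>"
      unfolding conv_diag[OF x_units s(1) g] conv_diag[OF x_units s(2) g] diag_conv[OF x_units rs g] diag_conv[OF KU rs g]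
      using K(3,4) g by (auto simp: column_def)
  qed
  then show ?thesis using diag_R[OF K(1,2)] by blast
qed

text \<open>Multiplying \<open>ex r\<close> on the right by the indicator of its finitely many
  sources changes nothing. That indicator is the sum of those of the single sources
  \<open>y\<close>, and each factors through \<open>ex\<close> along an arrow between
  \<open>x\<close> and \<open>y\<close>.\<close>

lemma row_factor:
  assumes r: "r \<in> R"
  shows "ex \<star> r \<in> generate (add_monoid row_ring) {ex \<star> r \<star> v \<star> ex \<star> w | v w. v \<in> R \<and> w \<in> R}"
    (is "_ \<in> ?H")
proof -
  note rr = R_row_finite[OF r]
  have er: "ex \<star> r \<in> row_finite" using conv_closed[OF ex_row_finite rr] .
  have S: "{ex \<star> r \<star> v \<star> ex \<star> w | v w. v \<in> R \<and> w \<in> R} \<subseteq> carrier (add_monoid row_ring)"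
    using er ex_row_finite R_row_finite by (auto simp: row_ring_simps(1) intro!: conv_closed)
  note H = F.add_subgroupD[OF group.generate_is_subgroup[OF F.a_group S]]
  have "ex \<star> r \<star> diag Y \<in> ?H" if "finite Y" "Y \<subseteq> src G ` row r x" for Y
    using that
  proof (induction Y)
    case empty
    have "ex \<star> r \<star> diag {} = \<zero>\<^bsub>row_ring\<^esub>"
      unfolding diag_empty using F.r_null[of "ex \<star> r"] er by (simp add: row_ring_simps(1,2))
    then show ?case using H(2) by simp
  next
    case (insert y Y)
    then obtain \<gamma> where g: "\<gamma> \<in> arrows G" "tgt G \<gamma> = x" "src G \<gamma> = y" by (auto simp: row_def)
    have yU: "{y} \<subseteq> units G" using g src_unit by blast
    have YU: "Y \<subseteq> units G" using insert.prems src_unit by (auto simp: row_def)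
    obtain v w where vw: "v \<in> R" "w \<in> R" "diag {y} = v \<star> ex \<star> w"
      using unit_factor[OF inv_closed[OF g(1)]] g by (auto simp: src_inv tgt_inv)
    have "ex \<star> r \<star> diag {y} = ex \<star> r \<star> v \<star> ex \<star> w"
      unfolding vw(3) using er R_row_finite[OF vw(1)] R_row_finite[OF vw(2)] ex_row_finite
      by (simp add: conv_assoc conv_closed)
    then have 1: "ex \<star> r \<star> diag {y} \<in> ?H" using vw(1,2) by (auto intro!: generate.incl)
    have "diag (insert y Y) = diag {y} \<oplus>\<^bsub>row_ring\<^esub> diag Y"
      using diag_disjoint_Un[OF yU YU] insert.hyps by simp
    then have "ex \<star> r \<star> diag (insert y Y) = (ex \<star> r \<star> diag {y}) \<oplus>\<^bsub>row_ring\<^esub> (ex \<star> r \<star> diag Y)"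
      using conv_distrib_left[OF diag_row_finite[OF yU] diag_row_finite[OF YU] er] by simp
    then show ?case using H(3)[OF 1] insert by simp
  qed
  moreover have "ex \<star> r \<star> diag (src G ` row r x) = ex \<star> r"
  proof (rule sections_eqI)
    have Y: "src G ` row r x \<subseteq> units G" using src_unit by (auto simp: row_def)
    show "ex \<star> r \<star> diag (src G ` row r x) \<in> sections"
      by (rule conv_sections[OF er row_finite_sections[OF diag_row_finite[OF Y]]])
    show "ex \<star> r \<in> sections" by (rule row_finite_sections[OF er])
    fix \<gamma> assume g: "\<gamma> \<in> arrows G"
    show "(ex \<star> r \<star> diag (src G ` row r x)) \<gamma> = (ex \<star> r) \<gamma>"
      unfolding conv_diag[OF Y row_finite_sections[OF er] g] diag_conv[OF x_units row_finite_sections[OF rr] g]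
      using g by (auto simp: row_def)
  qed
  moreover have "finite (src G ` row r x)" using finite_row[OF rr x] by simp
  ultimately show ?thesis by force
qed

text \<open>As for rows, with the indicator of the finitely many targets multiplied from the
  left.\<close>

lemma column_factor:
  assumes r: "r \<in> R"
  shows "r \<star> ex \<in> generate (add_monoid row_ring) {w \<star> ex \<star> v \<star> r \<star> ex | v w. v \<in> R \<and> w \<in> R}"
    (is "_ \<in> ?H")
proof -
  note rr = R_row_finite[OF r]
  have re: "r \<star> ex \<in> row_finite" using conv_closed[OF rr ex_row_finite] .
  have S: "{w \<star> ex \<star> v \<star> r \<star> ex | v w. v \<in> R \<and> w \<in> R} \<subseteq> carrier (add_monoid row_ring)"
    using rr ex_row_finite R_row_finite by (auto simp: row_ring_simps(1) intro!: conv_closed)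
  note H = F.add_subgroupD[OF group.generate_is_subgroup[OF F.a_group S]]
  have "diag Y \<star> (r \<star> ex) \<in> ?H" if "finite Y" "Y \<subseteq> tgt G ` column r x" for Y
    using that
  proof (induction Y)
    case empty
    have "diag {} \<star> (r \<star> ex) = \<zero>\<^bsub>row_ring\<^esub>"
      unfolding diag_empty using F.l_null[of "r \<star> ex"] re by (simp add: row_ring_simps(1,2))
    then show ?case using H(2) by simp
  next
    case (insert y Y)
    then obtain \<gamma> where g: "\<gamma> \<in> arrows G" "src G \<gamma> = x" "tgt G \<gamma> = y" by (auto simp: column_def)
    have yU: "{y} \<subseteq> units G" using g tgt_unit by blast
    have YU: "Y \<subseteq> units G" using insert.prems tgt_unit by (auto simp: column_def)
    obtain w v where vw: "w \<in> R" "v \<in> R" "diag {y} = w \<star> ex \<star> v"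
      using unit_factor[OF g(1)] g by auto
    have "diag {y} \<star> (r \<star> ex) = w \<star> ex \<star> v \<star> r \<star> ex"
      unfolding vw(3) using rr R_row_finite[OF vw(1)] R_row_finite[OF vw(2)] ex_row_finite
      by (simp add: conv_assoc conv_closed)
    then have 1: "diag {y} \<star> (r \<star> ex) \<in> ?H" using vw(1,2) by (auto intro!: generate.incl)
    have "diag (insert y Y) = diag {y} \<oplus>\<^bsub>row_ring\<^esub> diag Y"
      using diag_disjoint_Un[OF yU YU] insert.hyps by simp
    then have "diag (insert y Y) \<star> (r \<star> ex) = (diag {y} \<star> (r \<star> ex)) \<oplus>\<^bsub>row_ring\<^esub> (diag Y \<star> (r \<star> ex))"
      using conv_distrib_right[OF diag_row_finite[OF yU] diag_row_finite[OF YU] re] by simp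
    then show ?case using H(3)[OF 1] insert by simp
  qed
  moreover have "diag (tgt G ` column r x) \<star> (r \<star> ex) = r \<star> ex"
  proof (rule sections_eqI)
    have Y: "tgt G ` column r x \<subseteq> units G" using tgt_unit by (auto simp: column_def)
    show "diag (tgt G ` column r x) \<star> (r \<star> ex) \<in> sections"
      by (rule conv_sections[OF diag_row_finite[OF Y] row_finite_sections[OF re]])
    show "r \<star> ex \<in> sections" by (rule row_finite_sections[OF re])
    fix \<gamma> assume g: "\<gamma> \<in> arrows G"
    show "(diag (tgt G ` column r x) \<star> (r \<star> ex)) \<gamma> = (r \<star> ex) \<gamma>"
      unfolding diag_conv[OF Y row_finite_sections[OF re] g] conv_diag[OF x_units row_finite_sections[OF rr] g]
      using g by (auto simp: column_def)
  qed
  moreover have "finite (tgt G ` column r x)" using finite_column[OF r] by simp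
  ultimately show ?thesis by force
qed

lemma corner_at_unit:
  "corner row_ring (Gamma_c G S) Bx Lx ex (ext isox) (ext fibx) (bimodule_left G S x) (bimodule_right G S x)"
proof (intro corner.intro corner_axioms.intro)
  show "ring row_ring" by (rule row_ring)
  show "subgroup R (add_monoid row_ring)" by (rule R_subgroup)
  show "\<exists>r\<in>R. ex \<otimes>\<^bsub>row_ring\<^esub> r = ex \<otimes>\<^bsub>row_ring\<^esub> f" if "f \<in> carrier row_ring" for f
    using that realise_row[OF x] by (simp add: row_ring_simps(1,2))
  show "\<exists>r\<in>R. r \<otimes>\<^bsub>row_ring\<^esub> ex = ex \<otimes>\<^bsub>row_ring\<^esub> f \<otimes>\<^bsub>row_ring\<^esub> ex" if "f \<in> carrier row_ring" for f
    using that corner_column by (simp add: row_ring_simps(1,2))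
  show "ex \<otimes>\<^bsub>row_ring\<^esub> r \<in> generate (add_monoid row_ring)
      {ex \<otimes>\<^bsub>row_ring\<^esub> r \<otimes>\<^bsub>row_ring\<^esub> v \<otimes>\<^bsub>row_ring\<^esub> ex \<otimes>\<^bsub>row_ring\<^esub> w | v w. v \<in> R \<and> w \<in> R}"
    and "r \<otimes>\<^bsub>row_ring\<^esub> ex \<in> generate (add_monoid row_ring)
      {w \<otimes>\<^bsub>row_ring\<^esub> ex \<otimes>\<^bsub>row_ring\<^esub> v \<otimes>\<^bsub>row_ring\<^esub> r \<otimes>\<^bsub>row_ring\<^esub> ex | v w. v \<in> R \<and> w \<in> R}" if "r \<in> R" for r
    unfolding row_ring_simps(2) using row_factor[OF that] column_factor[OF that] .
qed (simp_all only: row_ring_simps(1,2) Gamma_simps R_m_closed ex_row_finite diag_diag[OF x_units x_units] Int_absorb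
    right_cut left_cut ext_iso_bij B_add B_mult B_one ext_fib_bij L_mult L_lact L_ract simp_thms)

end

text \<open>
  An element that vanishes in every stalk is killed by the characteristic sections of a cover of
  its support, hence is zero by compactness.
\<close>

lemma nonzero_stalk:
  assumes N: "left_module (Gamma_c G S) N"
    and fn: "f \<in> R" "n \<in> carrier N" "f \<odot>\<^bsub>N\<^esub> n \<noteq> \<zero>\<^bsub>N\<^esub>"
  shows "\<exists>x \<in> units G. generate (add_monoid N)
    {g \<odot>\<^bsub>N\<^esub> m | g m. g \<in> R \<and> m \<in> carrier N \<and> diag {x} \<star> g = \<zero>\<^bsub>row_ring\<^esub>} \<noteq> carrier N"
proof (rule ccontr)
  assume "\<not> ?thesis"
  then have gen: "carrier N = generate (add_monoid N)
      {g \<odot>\<^bsub>N\<^esub> m | g m. g \<in> R \<and> m \<in> carrier N \<and> diag {x} \<star> g = \<zero>\<^bsub>row_ring\<^esub>}" if "x \<in> units G" for x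
    using that by blast
  interpret N: left_module "Gamma_c G S" N by (rule N)
  have act_mult: "(a \<star> b) \<odot>\<^bsub>N\<^esub> m = a \<odot>\<^bsub>N\<^esub> (b \<odot>\<^bsub>N\<^esub> m)" if "a \<in> R" "b \<in> R" "m \<in> carrier N" for a b m
    using N.lsmult_assoc[OF that] by (simp add: Gamma_simps)
  have act_add: "(a \<oplus>\<^bsub>row_ring\<^esub> b) \<odot>\<^bsub>N\<^esub> m = a \<odot>\<^bsub>N\<^esub> m \<oplus>\<^bsub>N\<^esub> b \<odot>\<^bsub>N\<^esub> m" if "a \<in> R" "b \<in> R" "m \<in> carrier N" for a b m
    using N.lsmult_l_distr[OF that] by (simp add: Gamma_simps)
  have zR: "\<zero>\<^bsub>row_ring\<^esub> \<in> R" by (rule R_basic[OF basic_zero])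
  have act_0: "\<zero>\<^bsub>row_ring\<^esub> \<odot>\<^bsub>N\<^esub> m = \<zero>\<^bsub>N\<^esub>" if m: "m \<in> carrier N" for m
  proof (rule N.add_idem_zero)
    show "\<zero>\<^bsub>row_ring\<^esub> \<odot>\<^bsub>N\<^esub> m \<in> carrier N" using zR m by (rule N.lsmult_closed)
    show "\<zero>\<^bsub>row_ring\<^esub> \<odot>\<^bsub>N\<^esub> m \<oplus>\<^bsub>N\<^esub> \<zero>\<^bsub>row_ring\<^esub> \<odot>\<^bsub>N\<^esub> m = \<zero>\<^bsub>row_ring\<^esub> \<odot>\<^bsub>N\<^esub> m"
      using act_add[OF zR zR m] by simp
  qed
  have act_right_0: "a \<odot>\<^bsub>N\<^esub> \<zero>\<^bsub>N\<^esub> = \<zero>\<^bsub>N\<^esub>" if a: "a \<in> R" for a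
  proof (rule N.add_idem_zero)
    show "a \<odot>\<^bsub>N\<^esub> \<zero>\<^bsub>N\<^esub> \<in> carrier N" using a by (simp add: N.lsmult_closed)
    show "a \<odot>\<^bsub>N\<^esub> \<zero>\<^bsub>N\<^esub> \<oplus>\<^bsub>N\<^esub> a \<odot>\<^bsub>N\<^esub> \<zero>\<^bsub>N\<^esub> = a \<odot>\<^bsub>N\<^esub> \<zero>\<^bsub>N\<^esub>"
      using N.lsmult_r_distr[OF a N.zero_closed N.zero_closed] by simp
  qed
  have act_right_neg: "a \<odot>\<^bsub>N\<^esub> (\<ominus>\<^bsub>N\<^esub> m) = \<ominus>\<^bsub>N\<^esub> (a \<odot>\<^bsub>N\<^esub> m)" if a: "a \<in> R" and m: "m \<in> carrier N" for a m
  proof (rule N.minus_equality[symmetric])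
    show "a \<odot>\<^bsub>N\<^esub> (\<ominus>\<^bsub>N\<^esub> m) \<oplus>\<^bsub>N\<^esub> a \<odot>\<^bsub>N\<^esub> m = \<zero>\<^bsub>N\<^esub>"
      using N.lsmult_r_distr[OF a N.a_inv_closed[OF m] m] m act_right_0[OF a] by (simp add: N.l_neg)
  qed (use a m in \<open>auto simp: N.lsmult_closed\<close>)
  let ?co = "\<lambda>V. compactin X0 V \<and> openin X0 V"
  have co_R: "diag V \<in> R" if "?co V" for V using that diag_R by blast
  have co_units: "V \<subseteq> units G" if "?co V" for V using that by (simp add: openin_X0)
  have co_closed: "closedin X0 V" if "?co V" for V
    using that unit_space_Hausdorff compactin_imp_closedin by blast
  have shrink: "diag W \<odot>\<^bsub>N\<^esub> m = \<zero>\<^bsub>N\<^esub>" if "?co V" "?co W" "W \<subseteq> V" "m \<in> carrier N" "diag V \<odot>\<^bsub>N\<^esub> m = \<zero>\<^bsub>N\<^esub>" for V W m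
  proof -
    have "diag W \<star> diag V = diag W" using diag_diag[OF co_units[OF that(2)] co_units[OF that(1)]] that(3) by (simp add: Int_absorb2)
    then have "diag W \<odot>\<^bsub>N\<^esub> m = diag W \<odot>\<^bsub>N\<^esub> (diag V \<odot>\<^bsub>N\<^esub> m)"
      using act_mult[OF co_R[OF that(2)] co_R[OF that(1)] that(4)] by simp
    then show ?thesis using that(5) act_right_0[OF co_R[OF that(2)]] by simp
  qed
  define m where "m = f \<odot>\<^bsub>N\<^esub> n"
  have mN: "m \<in> carrier N" using fn by (simp add: m_def N.lsmult_closed)
  define P where "P = (\<lambda>V. ?co V \<and> diag V \<odot>\<^bsub>N\<^esub> m = \<zero>\<^bsub>N\<^esub>)"
  have local: "\<exists>V. P V \<and> x \<in> V" if x: "x \<in> units G" for x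
  proof -
    \<comment> \<open>The elements killed by the indicator of some compact open neighbourhood of
      \<open>x\<close>. By \<open>vanishing_near\<close> they include the generators in
      \<open>gen\<close>, which by the assumption to be refuted generate \<open>N\<close>.\<close>
    define H where "H = {k \<in> carrier N. \<exists>V. ?co V \<and> x \<in> V \<and> diag V \<odot>\<^bsub>N\<^esub> k = \<zero>\<^bsub>N\<^esub>}"
    have openU: "openin X0 (units G)" by (metis openin_topspace topspace_X0)
    obtain V0 where V0: "?co V0" "x \<in> V0" using compact_open_unit_nbhd[OF openU x] by blast
    have "subgroup H (add_monoid N)"
    proof (rule N.add_subgroupI)
      show "\<zero>\<^bsub>N\<^esub> \<in> H" using V0 act_right_0[OF co_R] by (auto simp: H_def)
      fix k assume k: "k \<in> H"
      obtain V where V: "?co V" "x \<in> V" "diag V \<odot>\<^bsub>N\<^esub> k = \<zero>\<^bsub>N\<^esub>" using k unfolding H_def by blast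
      have kN: "k \<in> carrier N" using k by (simp add: H_def)
      have "diag V \<odot>\<^bsub>N\<^esub> (\<ominus>\<^bsub>N\<^esub> k) = \<zero>\<^bsub>N\<^esub>" using act_right_neg[OF co_R[OF V(1)] kN] V(3) by simp
      then show "\<ominus>\<^bsub>N\<^esub> k \<in> H" using V(1,2) kN unfolding H_def by blast
      fix l assume l: "l \<in> H"
      obtain W where W: "?co W" "x \<in> W" "diag W \<odot>\<^bsub>N\<^esub> l = \<zero>\<^bsub>N\<^esub>" using l unfolding H_def by blast
      have lN: "l \<in> carrier N" using l by (simp add: H_def)
      have VW: "?co (V \<inter> W)" using V(1) W(1) co_closed[OF W(1)] by (auto intro: compact_Int_closedin)
      have "diag (V \<inter> W) \<odot>\<^bsub>N\<^esub> (k \<oplus>\<^bsub>N\<^esub> l) = \<zero>\<^bsub>N\<^esub>"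
        using N.lsmult_r_distr[OF co_R[OF VW] kN lN] shrink[OF V(1) VW _ kN V(3)] shrink[OF W(1) VW _ lN W(3)] by simp
      then show "k \<oplus>\<^bsub>N\<^esub> l \<in> H" using VW V(2) W(2) kN lN unfolding H_def by blast
    qed (auto simp: H_def)
    moreover have "{g \<odot>\<^bsub>N\<^esub> k | g k. g \<in> R \<and> k \<in> carrier N \<and> diag {x} \<star> g = \<zero>\<^bsub>row_ring\<^esub>} \<subseteq> H"
    proof clarify
      fix g k assume g: "g \<in> R" "diag {x} \<star> g = \<zero>\<^bsub>row_ring\<^esub>" and k: "k \<in> carrier N"
      note gs = row_finite_sections[OF R_row_finite[OF g(1)]]
      have "g \<gamma> = \<zero>\<^bsub>stalk S x\<^esub>" if "\<gamma> \<in> arrows G" "tgt G \<gamma> = x" for \<gamma>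
      proof -
        have "(diag {x} \<star> g) \<gamma> = g \<gamma>" using diag_conv[OF _ gs that(1), of "{x}"] x that(2) by simp
        then show ?thesis using g(2) that by (simp add: row_ring_simps(4))
      qed
      then have "g \<in> vanishing x" by (rule vanishing_near[OF x g(1)])
      then obtain V where V: "openin X0 V" "x \<in> V" "\<forall>\<eta> \<in> arrows G. tgt G \<eta> \<in> V \<longrightarrow> g \<eta> = \<zero>\<^bsub>stalk S (tgt G \<eta>)\<^esub>"
        by (rule vanishingD)
      obtain W where W: "?co W" "x \<in> W" "W \<subseteq> V" using compact_open_unit_nbhd[OF V(1,2)] by blast
      have "diag W \<star> g = \<zero>\<^bsub>row_ring\<^esub>"
      proof (rule sections_eqI[OF conv_sections[OF diag_row_finite[OF co_units[OF W(1)]] gs] zero_sections])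
        fix \<gamma> assume \<gamma>: "\<gamma> \<in> arrows G"
        show "(diag W \<star> g) \<gamma> = \<zero>\<^bsub>row_ring\<^esub> \<gamma>"
          unfolding diag_conv[OF co_units[OF W(1)] gs \<gamma>] using V(3) W(3) \<gamma> by (auto simp: row_ring_simps(4))
      qed
      then have "diag W \<odot>\<^bsub>N\<^esub> (g \<odot>\<^bsub>N\<^esub> k) = \<zero>\<^bsub>N\<^esub>"
        using act_mult[OF co_R[OF W(1)] g(1) k] act_0[OF k] by simp
      then show "g \<odot>\<^bsub>N\<^esub> k \<in> H" using W(1,2) N.lsmult_closed[OF g(1) k] unfolding H_def by blast
    qed
    ultimately have "generate (add_monoid N)
        {g \<odot>\<^bsub>N\<^esub> k | g k. g \<in> R \<and> k \<in> carrier N \<and> diag {x} \<star> g = \<zero>\<^bsub>row_ring\<^esub>} \<subseteq> H"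
      by (intro group.generate_subgroup_incl[OF N.a_group])
    then have "carrier N \<subseteq> H" by (rule subset_trans[OF equalityD1[OF gen[OF x]]])
    then show ?thesis using mN by (auto simp: H_def P_def)
  qed
  have P_Un: "P (V \<union> W)" if "P V" "P W" for V W
  proof -
    have V: "?co V" "diag V \<odot>\<^bsub>N\<^esub> m = \<zero>\<^bsub>N\<^esub>" and W: "?co W" "diag W \<odot>\<^bsub>N\<^esub> m = \<zero>\<^bsub>N\<^esub>"
      using that by (auto simp: P_def)
    \<comment> \<open>Splitting the union into the disjoint sets \<open>V\<close> and
      \<open>W - V\<close> makes the indicator additive.\<close>
    have co: "?co (W - V)"
    proof
      have "closedin X0 (units G - V)" using V(1) by (metis closedin_diff closedin_topspace topspace_X0)
      then have "compactin X0 (W \<inter> (units G - V))" using W(1) by (auto intro: compact_Int_closedin)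
      moreover have "W \<inter> (units G - V) = W - V" using co_units[OF W(1)] by blast
      ultimately show "compactin X0 (W - V)" by simp
      show "openin X0 (W - V)" using W(1) co_closed[OF V(1)] by (auto intro: openin_diff)
    qed
    have "diag (V \<union> (W - V)) = diag V \<oplus>\<^bsub>row_ring\<^esub> diag (W - V)"
      by (rule diag_disjoint_Un[OF co_units[OF V(1)] co_units[OF co]]) blast
    then have "diag (V \<union> W) \<odot>\<^bsub>N\<^esub> m = \<zero>\<^bsub>N\<^esub>"
      using act_add[OF co_R[OF V(1)] co_R[OF co] mN] V(2) shrink[OF W(1) co _ mN W(2)] by simp
    then show ?thesis using V(1) W(1) by (auto simp: P_def intro: compactin_Un)
  qed
  have P_empty: "P {}"
    using act_0[OF mN] by (simp add: P_def diag_empty)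
  have P_Union: "P (\<Union>\<F>)" if "finite \<F>" "\<And>V. V \<in> \<F> \<Longrightarrow> P V" for \<F>
    using that by (induction \<F>) (auto simp: P_empty P_Un)
  \<comment> \<open>As \<open>m = f n\<close>, the section \<open>diag K\<close> fixes
    \<open>m\<close>. Finitely many sets with property \<open>P\<close> cover \<open>K\<close>, so
    it also kills \<open>m\<close>.\<close>
  obtain K where K: "?co K" "diag K \<star> f = f" using local_unit[OF fn(1)] by blast
  have "\<exists>\<F>. finite \<F> \<and> \<F> \<subseteq> Collect P \<and> K \<subseteq> \<Union>\<F>"
  proof -
    have "\<And>V. V \<in> Collect P \<Longrightarrow> openin X0 V" "K \<subseteq> \<Union>(Collect P)"
      using local co_units[OF K(1)] by (auto simp: P_def)
    then show ?thesis using K(1) unfolding compactin_def by meson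
  qed
  then obtain \<F> where F: "finite \<F>" "\<F> \<subseteq> Collect P" "K \<subseteq> \<Union>\<F>" by blast
  have PF: "P (\<Union>\<F>)" using F by (intro P_Union) auto
  have "diag K \<odot>\<^bsub>N\<^esub> m = \<zero>\<^bsub>N\<^esub>"
    using shrink[OF _ K(1) F(3) mN] PF by (simp add: P_def)
  moreover have "diag K \<odot>\<^bsub>N\<^esub> m = m"
    using act_mult[OF co_R[OF K(1)] fn(1,2)] K(2) by (simp add: m_def)
  ultimately show False using fn(3) by (simp add: m_def)
qed

section \<open>The two inclusions\<close>

lemma induced_primitive:
  fixes M :: "('g \<Rightarrow> 'e, 'm, 'd) module_scheme"
  assumes x: "x \<in> units G" and M: "simple_left_module (isotropy_ring G S x) M"
  shows "primitive_ideal TYPE('u) (Gamma_c G S) (annihilator (Gamma_c G S) (tensor_module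
    (bimodule_group G S x) (bimodule_left G S x) (bimodule_right G S x) (isotropy_ring G S x) M))"
proof -
  interpret C: corner row_ring "Gamma_c G S" "isotropy_ring G S x" "bimodule_group G S x" "diag {x}"
    "ext (isotropy G x)" "ext (src_fibre G x)" "bimodule_left G S x" "bimodule_right G S x"
    by (rule corner_at_unit[OF x])
  show ?thesis
    unfolding C.corner_ann_primitive(1)[OF M] by (rule C.corner_ann_primitive(2)[OF M])
qed

lemma primitive_induced:
  fixes N :: "('g \<Rightarrow> 'e, ('g \<Rightarrow> 'e) + 'u) module"
  assumes N: "simple_left_module (Gamma_c G S) N"
    and max: "\<And>x. x \<in> units G \<Longrightarrow> left_max_ring TYPE('u) (isotropy_ring G S x)"
  shows "\<exists>x \<in> units G. \<exists>M :: ('g \<Rightarrow> 'e, ('g \<Rightarrow> 'e) + 'u) module.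
    simple_left_module (isotropy_ring G S x) M \<and>
    annihilator (Gamma_c G S) N = annihilator (Gamma_c G S) (tensor_module
      (bimodule_group G S x) (bimodule_left G S x) (bimodule_right G S x) (isotropy_ring G S x) M)"
proof -
  have NL: "left_module (Gamma_c G S) N" using N by (simp add: simple_left_module_def)
  interpret N: left_module "Gamma_c G S" N by (rule NL)
  obtain f n where fn: "f \<in> R" "n \<in> carrier N" "f \<odot>\<^bsub>N\<^esub> n \<noteq> \<zero>\<^bsub>N\<^esub>"
    using N unfolding simple_left_module_def by blast
  obtain x where x: "x \<in> units G" and gx: "generate (add_monoid N)
      {g \<odot>\<^bsub>N\<^esub> m | g m. g \<in> R \<and> m \<in> carrier N \<and> diag {x} \<star> g = \<zero>\<^bsub>row_ring\<^esub>} \<noteq> carrier N"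
    using nonzero_stalk[OF NL fn] by blast
  let ?S = "{r \<odot>\<^bsub>N\<^esub> n | r n. r \<in> R \<and> n \<in> carrier N}"
  have S: "?S \<subseteq> carrier (add_monoid N)" by (auto simp: N.lsmult_closed)
  have sub: "subgroup (generate (add_monoid N) ?S) (add_monoid N)"
    by (rule group.generate_is_subgroup[OF N.a_group S])
  have incl: "r \<odot>\<^bsub>N\<^esub> k \<in> generate (add_monoid N) ?S" if "r \<in> R" "k \<in> carrier N" for r k
    by (rule generate.incl) (use that in blast)
  \<comment> \<open>\<open>R N\<close> is a non-zero submodule of the simple \<open>N\<close>, hence
    all of it; this is the extra assumption of \<open>corner_ring_module\<close>.\<close>
  have "submodule (generate (add_monoid N) ?S) (Gamma_c G S) N"
    using sub incl N.add_subgroupD(1)[OF sub] by (auto simp: submodule_def submodule_axioms_def)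
  moreover have "generate (add_monoid N) ?S \<noteq> {\<zero>\<^bsub>N\<^esub>}" using incl[OF fn(1,2)] fn(3) by blast
  ultimately have generated: "generate (add_monoid N) ?S = carrier N"
    using N unfolding simple_left_module_def by blast
  interpret C: corner_ring_module row_ring "Gamma_c G S" "isotropy_ring G S x" "bimodule_group G S x" "diag {x}"
    "ext (isotropy G x)" "ext (src_fibre G x)" "bimodule_left G S x" "bimodule_right G S x" N
    by (intro corner_ring_module.intro corner_ring_module_axioms.intro corner_at_unit[OF x] NL generated)
  have ker: "C.germ_kernel \<noteq> carrier N"
    unfolding C.germ_kernel_def row_ring_simps(2) by (rule gx)
  \<comment> \<open>The quotient has the type of \<open>N\<close>, which is exactly the one covered
    by the left max hypothesis.\<close>
  have "\<exists>H. maximal_submodule H (isotropy_ring G S x) (C.quot C.germ_kernel)"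
    using max[OF x] C.quot_module[OF C.stable_germ_kernel] C.quot_germ_kernel_nonzero[OF ker]
    unfolding left_max_ring_def by blast
  from C.annihilator_induced[OF N ker this] show ?thesis using x by blast
qed

end

theorem theorem4p3:
  fixes G :: "'g groupoid_data" and S :: "('g, 'e) ring_sheaf_data"
  assumes "ample_groupoid G"
    and "groupoid_sheaf_of_rings G S"
    and "\<And>x. x \<in> units G \<Longrightarrow> left_max_ring TYPE('u) (isotropy_ring G S x)"
  shows "{I. primitive_ideal TYPE('u) (Gamma_c G S) I} =
    {annihilator (Gamma_c G S) (Ind G S x M) | x (M :: ('g \<Rightarrow> 'e, ('g \<Rightarrow> 'e) + 'u) module).
      x \<in> units G \<and> simple_left_module (isotropy_ring G S x) M}"
proof -
  interpret ample_sheaf G S by (intro ample_sheaf.intro assms)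
  show ?thesis
  proof (intro equalityI subsetI)
    fix I assume "I \<in> {I. primitive_ideal TYPE('u) (Gamma_c G S) I}"
    then obtain N :: "('g \<Rightarrow> 'e, ('g \<Rightarrow> 'e) + 'u) module" where
      "simple_left_module (Gamma_c G S) N" "I = annihilator (Gamma_c G S) N"
      by (auto simp: primitive_ideal_def)
    then show "I \<in> {annihilator (Gamma_c G S) (Ind G S x M) | x (M :: ('g \<Rightarrow> 'e, ('g \<Rightarrow> 'e) + 'u) module).
        x \<in> units G \<and> simple_left_module (isotropy_ring G S x) M}"
      using primitive_induced[OF _ assms(3)] unfolding Ind_def by blast
  next
    fix I assume "I \<in> {annihilator (Gamma_c G S) (Ind G S x M) | x (M :: ('g \<Rightarrow> 'e, ('g \<Rightarrow> 'e) + 'u) module).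
        x \<in> units G \<and> simple_left_module (isotropy_ring G S x) M}"
    then show "I \<in> {I. primitive_ideal TYPE('u) (Gamma_c G S) I}"
      using induced_primitive unfolding Ind_def by blast
  qed
qed

end
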